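(* Let $0<R\le 1$, let $u$ be a weak solution of $\operatorname{div}\mathcal A(x,u,u_x)=\mathcal B(x,u,u_x)$ in $D$, where $\mathcal A,\mathcal B$ satisfy the structure conditions (S) and the coefficients satisfy the integrability conditions (I) of the context, and let $k$ be as in the context. Suppose $\overline{B_{2R}}\subset D$, where $B_R$ and $B_{2R}$ denote the balls of radius $R$ and $2R$ with a common fixed center $z\in D$. Then $$\|u\|_{L^\infty(B_R)}\le C\left(\|u\|_{E_{nr},B_{2R}}+k\right),\qquad \|u_x\|_{L^n(B_R)}\le C\left(\|u\|_{E_{nr},B_{2R}}+k\right).$$ Here $C$ is a constant not depending on $u$; it may depend on $n,r,a,R$ and, in a non-decreasing way, on the norms $\|\cdot\|_{(N_r),D}$ of $b^{n/(n-1)},c^n,d,e^{n/(n-1)},f,g$.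
   Context: Let $n\ge 2$, let $D\subset\mathbb R^n$ be bounded, connected and open, and let $r$ satisfy $\frac{n-1}{n}<r<1$. $u_x$ denotes the gradient of $u$. $\mathcal A(x,u,p)\in\mathbb R^n$ and $\mathcal B(x,u,p)\in\mathbb R$ are defined for $x\in D$, $u\in\mathbb R$, $p\in\mathbb R^n$. (S) For all $x,u,p$: $|\mathcal A|\le a|p|^{n-1}+b|u|^{n-1}+e$, $\ |\mathcal B|\le c|p|^{n-1}+d|u|^{n-1}+f$, $\ p\cdot\mathcal A\ge |p|^n-d|u|^n-g$, where $a>0$ is a constant and $b,c,d,e,f,g$ are nonnegative functions of $x\in D$. (I) $b^{n/(n-1)},\,c^n,\,d,\,e^{n/(n-1)},\,f,\,g\in L\log^{(n-1)/r}L(D)$, the space of $V$ with $\int_D|V|\log^{(n-1)/r}(|V|+1)\,dx<\infty$. Weak solution: $u\in W^{1,n}(D)$ and $\int_D \phi_x\cdot\mathcal A(x,u,u_x)+\phi\,\mathcal B(x,u,u_x)\,dx=0$ for all $\phi\in C_0^\infty(D)$ (it is part of the hypothesis that $\mathcal A(x,u,u_x),\mathcal B(x,u,u_x)$ are measurable and these integrals make sense). Norms: for $s>0$ let $N_s(t)=\int_0^t\log^{(n-1)/s}(\tau+1)\,d\tau$, and for a measurable set $\Omega$ let $\|V\|_{(N_s),\Omega}=\inf\{\lambda>0:\int_\Omega N_s(|V|/\lambda)\,dx\le 1\}$ and $\|v\|_{E_s,\Omega}=\inf\{\lambda>0:\int_\Omega \left(\exp(|v/\lambda|^{s/(n-1)})-1\right)dx\le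 1\}$. $k=\left(\|e^{n/(n-1)}\|_{(N_r),D}^{(n-1)/n}+\|f\|_{(N_r),D}\right)^{1/(n-1)}+\|g\|_{(N_r),D}^{1/n}$. *)

theory Defs
  imports "HOL-Analysis.Analysis" "HOL-Probability.Essential_Supremum"
begin

text \<open>
  Throughout, the dimension \<open>n\<close> is \<open>CARD('n)\<close> for functions on \<open>real ^ 'n\<close>.
  Norms that can be infinite take values in \<open>ennreal\<close>.
\<close>

definition partial_deriv :: "'n::finite \<Rightarrow> (real ^ 'n \<Rightarrow> real) \<Rightarrow> real ^ 'n \<Rightarrow> real"
  where "partial_deriv i \<phi> x = frechet_derivative \<phi> (at x) (axis i 1)"

definition gradient :: "(real ^ 'n::finite \<Rightarrow> real) \<Rightarrow> real ^ 'n \<Rightarrow> real ^ 'n"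
  where "gradient \<phi> x = (\<chi> i. partial_deriv i \<phi> x)"

primrec C_k :: "nat \<Rightarrow> (real ^ 'n::finite \<Rightarrow> real) \<Rightarrow> bool"
  where
    "C_k 0 \<phi> \<longleftrightarrow> continuous_on UNIV \<phi>"
  | "C_k (Suc k) \<phi> \<longleftrightarrow> \<phi> differentiable_on UNIV \<and> (\<forall>i. C_k k (partial_deriv i \<phi>))"

text \<open>
  Elements of \<open>C\<^sub>0\<^sup>\<infinity>(D)\<close> are represented by their extensions by zero, which are smooth
  on the whole space because the support is a compact subset of the open set \<open>D\<close>.
\<close>

definition test_function :: "(real ^ 'n::finite) set \<Rightarrow> (real ^ 'n \<Rightarrow> real) \<Rightarrow> bool"
  where "test_function D \<phi> \<longleftrightarrow>
    (\<forall>k. C_k k \<phi>) \<and> compact (closure (support_on UNIV \<phi>)) \<and> closure (support_on UNIV \<phi>) \<subseteq> D"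

definition Ln :: "(real ^ 'n::finite) set \<Rightarrow> (real ^ 'n \<Rightarrow> 'b::euclidean_space) \<Rightarrow> bool"
  where "Ln D f \<longleftrightarrow> f \<in> borel_measurable (lebesgue_on D) \<and>
    integrable (lebesgue_on D) (\<lambda>x. norm (f x) ^ CARD('n))"

text \<open>Meaningful only for \<open>f\<close> with \<open>Ln D f\<close>, where the integral is finite.\<close>

definition Ln_norm :: "(real ^ 'n::finite) set \<Rightarrow> (real ^ 'n \<Rightarrow> 'b::euclidean_space) \<Rightarrow> real"
  where "Ln_norm D f = (\<integral>x. norm (f x) ^ CARD('n) \<partial>lebesgue_on D) powr (1 / CARD('n))"

definition Linf_norm :: "(real ^ 'n::finite) set \<Rightarrow> (real ^ 'n \<Rightarrow> real) \<Rightarrow> ennreal"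
  where "Linf_norm D f = esssup (lebesgue_on D) (\<lambda>x. ennreal \<bar>f x\<bar>)"

text \<open>\<open>W1n D u ux\<close>: \<open>u\<close> is in \<open>W\<^sup>1\<^sup>,\<^sup>n(D)\<close> and \<open>ux\<close> is (a representative of) its weak gradient.\<close>

definition W1n :: "(real ^ 'n::finite) set \<Rightarrow> (real ^ 'n \<Rightarrow> real) \<Rightarrow> (real ^ 'n \<Rightarrow> real ^ 'n) \<Rightarrow> bool"
  where "W1n D u ux \<longleftrightarrow> Ln D u \<and> Ln D ux \<and>
    (\<forall>\<phi>. test_function D \<phi> \<longrightarrow> (\<forall>i.
      (\<integral>x. u x * partial_deriv i \<phi> x \<partial>lebesgue_on D) = - (\<integral>x. ux x $ i * \<phi> x \<partial>lebesgue_on D)))"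

definition weak_solution ::
    "(real ^ 'n::finite) set \<Rightarrow> (real ^ 'n \<Rightarrow> real \<Rightarrow> real ^ 'n \<Rightarrow> real ^ 'n) \<Rightarrow>
     (real ^ 'n \<Rightarrow> real \<Rightarrow> real ^ 'n \<Rightarrow> real) \<Rightarrow> (real ^ 'n \<Rightarrow> real) \<Rightarrow> (real ^ 'n \<Rightarrow> real ^ 'n) \<Rightarrow> bool"
  where "weak_solution D A B u ux \<longleftrightarrow> W1n D u ux \<and>
    (\<lambda>x. A x (u x) (ux x)) \<in> borel_measurable (lebesgue_on D) \<and>
    (\<lambda>x. B x (u x) (ux x)) \<in> borel_measurable (lebesgue_on D) \<and>
    (\<forall>\<phi>. test_function D \<phi> \<longrightarrow>
      integrable (lebesgue_on D)
        (\<lambda>x. gradient \<phi> x \<bullet> A x (u x) (ux x) + \<phi> x * B x (u x) (ux x)) \<and>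
      (\<integral>x. gradient \<phi> x \<bullet> A x (u x) (ux x) + \<phi> x * B x (u x) (ux x) \<partial>lebesgue_on D) = 0)"

definition structure_conditions ::
    "(real ^ 'n::finite) set \<Rightarrow> (real ^ 'n \<Rightarrow> real \<Rightarrow> real ^ 'n \<Rightarrow> real ^ 'n) \<Rightarrow>
     (real ^ 'n \<Rightarrow> real \<Rightarrow> real ^ 'n \<Rightarrow> real) \<Rightarrow> real \<Rightarrow> (real ^ 'n \<Rightarrow> real) \<Rightarrow> (real ^ 'n \<Rightarrow> real) \<Rightarrow>
     (real ^ 'n \<Rightarrow> real) \<Rightarrow> (real ^ 'n \<Rightarrow> real) \<Rightarrow> (real ^ 'n \<Rightarrow> real) \<Rightarrow> (real ^ 'n \<Rightarrow> real) \<Rightarrow> bool"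
  where "structure_conditions D A B a b c d e f g \<longleftrightarrow> a > 0 \<and>
    (\<forall>x\<in>D. 0 \<le> b x \<and> 0 \<le> c x \<and> 0 \<le> d x \<and> 0 \<le> e x \<and> 0 \<le> f x \<and> 0 \<le> g x) \<and>
    (\<forall>x\<in>D. \<forall>u p.
      norm (A x u p) \<le> a * norm p ^ (CARD('n) - 1) + b x * \<bar>u\<bar> ^ (CARD('n) - 1) + e x \<and>
      \<bar>B x u p\<bar> \<le> c x * norm p ^ (CARD('n) - 1) + d x * \<bar>u\<bar> ^ (CARD('n) - 1) + f x \<and>
      p \<bullet> A x u p \<ge> norm p ^ CARD('n) - d x * \<bar>u\<bar> ^ CARD('n) - g x)"

definition LlogL :: "real \<Rightarrow> (real ^ 'n::finite) set \<Rightarrow> (real ^ 'n \<Rightarrow> real) \<Rightarrow> bool"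
  where "LlogL s D V \<longleftrightarrow> V \<in> borel_measurable (lebesgue_on D) \<and>
    integrable (lebesgue_on D) (\<lambda>x. \<bar>V x\<bar> * ln (\<bar>V x\<bar> + 1) powr s)"

definition integrability_conditions ::
    "(real ^ 'n::finite) set \<Rightarrow> real \<Rightarrow> (real ^ 'n \<Rightarrow> real) \<Rightarrow> (real ^ 'n \<Rightarrow> real) \<Rightarrow>
     (real ^ 'n \<Rightarrow> real) \<Rightarrow> (real ^ 'n \<Rightarrow> real) \<Rightarrow> (real ^ 'n \<Rightarrow> real) \<Rightarrow> (real ^ 'n \<Rightarrow> real) \<Rightarrow> bool"
  where "integrability_conditions D r b c d e f g \<longleftrightarrow>
    (let n = real CARD('n); s = (n - 1) / r in
      LlogL s D (\<lambda>x. b x powr (n / (n - 1))) \<and> LlogL s D (\<lambda>x. c x ^ CARD('n)) \<and>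
      LlogL s D d \<and> LlogL s D (\<lambda>x. e x powr (n / (n - 1))) \<and> LlogL s D f \<and> LlogL s D g)"

definition luxemburg_norm ::
    "(real \<Rightarrow> real) \<Rightarrow> (real ^ 'n::finite) set \<Rightarrow> (real ^ 'n \<Rightarrow> real) \<Rightarrow> ennreal"
  where "luxemburg_norm \<Phi> \<Omega> V =
    Inf {ennreal l | l. l > 0 \<and> (\<integral>\<^sup>+x. ennreal (\<Phi> (\<bar>V x\<bar> / l)) \<partial>lebesgue_on \<Omega>) \<le> 1}"

definition N_norm :: "real \<Rightarrow> (real ^ 'n::finite) set \<Rightarrow> (real ^ 'n \<Rightarrow> real) \<Rightarrow> ennreal"
  where "N_norm s = luxemburg_norm (\<lambda>t. integral {0..t} (\<lambda>\<tau>. ln (\<tau> + 1) powr ((real CARD('n) - 1) / s)))"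

definition E_norm :: "real \<Rightarrow> (real ^ 'n::finite) set \<Rightarrow> (real ^ 'n \<Rightarrow> real) \<Rightarrow> ennreal"
  where "E_norm s = luxemburg_norm (\<lambda>t. exp (t powr (s / (real CARD('n) - 1))) - 1)"

text \<open>
  Under \<open>integrability_conditions\<close> the norms \<open>N_norm r D\<close> of the coefficients are finite, so
  that \<open>enn2real\<close> loses nothing.
\<close>

definition N_real :: "real \<Rightarrow> (real ^ 'n::finite) set \<Rightarrow> (real ^ 'n \<Rightarrow> real) \<Rightarrow> real"
  where "N_real r D V = enn2real (N_norm r D V)"

definition k_const ::
    "(real ^ 'n::finite) set \<Rightarrow> real \<Rightarrow> (real ^ 'n \<Rightarrow> real) \<Rightarrow> (real ^ 'n \<Rightarrow> real) \<Rightarrow> (real ^ 'n \<Rightarrow> real) \<Rightarrow> real"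
  where "k_const D r e f g =
    (let n = real CARD('n) in
      (N_real r D (\<lambda>x. e x powr (n / (n - 1))) powr ((n - 1) / n) + N_real r D f) powr (1 / (n - 1))
      + N_real r D g powr (1 / n))"

text \<open>Monotone in each of six nonnegative real arguments.\<close>

definition nondecreasing6 :: "(real \<Rightarrow> real \<Rightarrow> real \<Rightarrow> real \<Rightarrow> real \<Rightarrow> real \<Rightarrow> real) \<Rightarrow> bool"
  where "nondecreasing6 F \<longleftrightarrow>
    (\<forall>p1 p2 p3 p4 p5 p6 q1 q2 q3 q4 q5 q6.
      0 \<le> p1 \<and> p1 \<le> q1 \<and> 0 \<le> p2 \<and> p2 \<le> q2 \<and> 0 \<le> p3 \<and> p3 \<le> q3 \<and>
      0 \<le> p4 \<and> p4 \<le> q4 \<and> 0 \<le> p5 \<and> p5 \<le> q5 \<and> 0 \<le> p6 \<and> p6 \<le> q6 \<longrightarrow>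
      F p1 p2 p3 p4 p5 p6 \<le> F q1 q2 q3 q4 q5 q6)"

end

theory Submission
  imports Defs "HOL-Computational_Algebra.Polynomial"
begin

text \<open>
  Dividing \<open>u\<close> by any \<open>lam\<close> above \<open>\<parallel>u\<parallel> + k\<close> turns the structure conditions into conditions with
  a single coefficient: \<open>\<sigma>\<^sup>n\<close> is the sum of \<open>b\<^sup>n\<^sup>'\<close>, \<open>c\<^sup>n\<close>, \<open>d\<close>, \<open>e\<^sup>n\<^sup>'\<close>, \<open>f\<close>, \<open>g\<close> with the last three divided by
  the appropriate powers of \<open>lam\<close>, so that its Orlicz norm is controlled. It then suffices to
  bound \<open>u\<close> and its gradient by a constant. The Orlicz condition enters only through
  \<open>\<integral>\<^sub>E \<sigma>\<^sup>n \<le> \<Gamma> L powr (-s)\<close> for all sets \<open>E\<close> of measure at most \<open>exp (-L)\<close>, where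
  \<open>s = (n - 1) / r > n - 1\<close>, and the exponential norm of \<open>u\<close> only through its norm in \<open>L\<^sup>2\<^sup>n\<close>.

  Let \<open>v\<close> be \<open>u - h\<close>, truncated and cut off, with support of measure at most \<open>exp (-L)\<close>. Trudinger's
  inequality shows that \<open>\<integral> \<sigma>\<^sup>n v\<^sup>n\<close> is at most \<open>\<Gamma> L powr (n - 1 - s)\<close> times the energy of \<open>v\<close>, up to
  losses in the exponent, so for large \<open>L\<close> this term is absorbed in Caccioppoli's inequality. A second
  application of Trudinger's inequality to the resulting energy bound makes the next level set have
  measure at most \<open>exp (-\<kappa> L)\<close>. Iterating along levels increasing to \<open>2 H\<close> bounds \<open>u\<close> from above,
  the same applies to \<open>-u\<close>, and Caccioppoli's inequality then bounds the gradient.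
\<close>

subsection \<open>Smooth functions, mollifiers and cutoffs\<close>

text \<open>Where the support has measure at most \<open>exp (-L)\<close>, the energy has order
  \<open>L powr (-s)\<close>. To gain \<open>exp (-m)\<close>, Trudinger's inequality wants
  \<open>J m^(n-1)\<close> small against \<open>t^n\<close>; for \<open>m = \<kappa> L\<close> the
  product has order \<open>L powr (n - 1 - s)\<close>, and \<open>r < 1\<close> means
  \<open>s > n - 1\<close>. As \<open>L\<close> grows geometrically, this surplus also pays for the
  geometric losses from shrinking balls and level gaps. The bound \<open>r > (n - 1) / n\<close>
  makes the exponent in the exponential norm exceed 1, which controls all powers of
  \<open>u\<close>. The power \<open>2 n\<close> instead of \<open>n\<close> turns the integral of
  \<open>|u|^n\<close> over a set of measure \<open>exp (-L)\<close> into a multiple of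
  \<open>exp (-L/2)\<close>, below any power of \<open>L\<close>. The obstacle: test functions built
  from \<open>u\<close> are admissible only when bounded, and a term can be absorbed only when
  finite. Hence a Sobolev class closed under composition, products and truncation, and a qualitative
  bound of weighted integrals before the quantitative one. \<open>lam\<close> is a strict upper
  bound because a Luxemburg infimum need not be attained and may vanish; its limit is taken at the
  end.\<close>

lemma partial_deriv_eq:
  "(\<phi> has_derivative D) (at x) \<Longrightarrow> partial_deriv i \<phi> x = D (axis i 1)"
  unfolding partial_deriv_def using frechet_derivative_at by metis

lemma C_k_continuous: "C_k k \<phi> \<Longrightarrow> continuous_on UNIV \<phi>"
  by (cases k) (auto intro: differentiable_imp_continuous_on)

lemma C_k_SucD: "C_k (Suc k) \<phi> \<Longrightarrow> C_k k \<phi>"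
  by (induction k arbitrary: \<phi>) (auto intro: differentiable_imp_continuous_on)

lemma partial_deriv_add:
  assumes "\<phi> differentiable_on UNIV" "\<psi> differentiable_on UNIV"
  shows "partial_deriv i (\<lambda>x. \<phi> x + \<psi> x) = (\<lambda>x. partial_deriv i \<phi> x + partial_deriv i \<psi> x)"
proof
  fix x
  have "(\<phi> has_derivative frechet_derivative \<phi> (at x)) (at x)"
       "(\<psi> has_derivative frechet_derivative \<psi> (at x)) (at x)"
    using assms by (auto simp: differentiable_on_def frechet_derivative_works)
  from has_derivative_add[OF this] show
    "partial_deriv i (\<lambda>x. \<phi> x + \<psi> x) x = partial_deriv i \<phi> x + partial_deriv i \<psi> x"
    by (simp add: partial_deriv_eq) (simp add: partial_deriv_def)
qed

lemma partial_deriv_mult: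
  assumes "\<phi> differentiable_on UNIV" "\<psi> differentiable_on UNIV"
  shows "partial_deriv i (\<lambda>x. \<phi> x * \<psi> x) = (\<lambda>x. \<phi> x * partial_deriv i \<psi> x + partial_deriv i \<phi> x * \<psi> x)"
proof
  fix x
  have "(\<phi> has_derivative frechet_derivative \<phi> (at x)) (at x)"
       "(\<psi> has_derivative frechet_derivative \<psi> (at x)) (at x)"
    using assms by (auto simp: differentiable_on_def frechet_derivative_works)
  from has_derivative_mult[OF this] show
    "partial_deriv i (\<lambda>x. \<phi> x * \<psi> x) x = \<phi> x * partial_deriv i \<psi> x + partial_deriv i \<phi> x * \<psi> x"
    by (simp add: partial_deriv_eq) (simp add: partial_deriv_def)
qed

lemma C_k_add: "C_k k \<phi> \<Longrightarrow> C_k k \<psi> \<Longrightarrow> C_k k (\<lambda>x. \<phi> x + \<psi> x)"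
proof (induction k arbitrary: \<phi> \<psi>)
  case 0 then show ?case by (auto intro: continuous_intros)
next
  case (Suc k) then show ?case
    by (auto simp: partial_deriv_add intro: differentiable_on_add)
qed

lemma C_k_mult: "C_k k \<phi> \<Longrightarrow> C_k k \<psi> \<Longrightarrow> C_k k (\<lambda>x. \<phi> x * \<psi> x)"
proof (induction k arbitrary: \<phi> \<psi>)
  case 0 then show ?case by (auto intro: continuous_intros)
next
  case (Suc k) then show ?case using C_k_SucD[OF Suc.prems(1)] C_k_SucD[OF Suc.prems(2)]
    by (auto simp: partial_deriv_mult intro!: differentiable_on_mult C_k_add)
qed

lemma C_k_const: "C_k k (\<lambda>x::real^'n::finite. c)"
proof (induction k arbitrary: c)
  case (Suc k)
  have "partial_deriv i (\<lambda>x::real^'n. c) = (\<lambda>x. 0)" for i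
    by (auto intro!: ext partial_deriv_eq[THEN trans] derivative_eq_intros)
  then show ?case using Suc by auto
qed auto

lemma C_k_prod: "finite I \<Longrightarrow> (\<And>i. i \<in> I \<Longrightarrow> C_k k (\<phi> i)) \<Longrightarrow> C_k k (\<lambda>x. \<Prod>i\<in>I. \<phi> i x)"
  by (induction I rule: finite_induct) (auto intro: C_k_const C_k_mult)

text \<open>\<open>F\<close> lists a smooth function of one variable together with all its
  derivatives, so differentiating \<open>F m (w \<bullet> x + c)\<close> only raises
  \<open>m\<close> and adds a constant factor. Keeping \<open>m\<close> arbitrary closes the
  induction.\<close>

lemma C_k_affine:
  fixes F :: "nat \<Rightarrow> real \<Rightarrow> real"
  assumes F: "\<And>m t. (F m has_real_derivative F (Suc m) t) (at t)"
  shows "C_k k (\<lambda>x. F m (w \<bullet> x + c))"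
proof (induction k arbitrary: m)
  case 0
  have "continuous_on UNIV (F m)"
    using F DERIV_isCont continuous_at_imp_continuous_on by blast
  then show ?case unfolding C_k.simps by (rule continuous_on_compose2) (auto intro!: continuous_intros)
next
  case (Suc k)
  have d: "((\<lambda>x. F m (w \<bullet> x + c)) has_derivative (\<lambda>h. F (Suc m) (w \<bullet> x + c) * (w \<bullet> h))) (at x)" for x
  proof -
    have "((\<lambda>x. w \<bullet> x + c) has_derivative (\<lambda>h. w \<bullet> h)) (at x)"
      by (auto intro!: derivative_eq_intros)
    from has_derivative_compose[OF this F[of m "w \<bullet> x + c", unfolded has_field_derivative_def]]
    show ?thesis .
  qed
  have "partial_deriv i (\<lambda>x. F m (w \<bullet> x + c)) = (\<lambda>x. F (Suc m) (w \<bullet> x + c) * (w \<bullet> axis i 1))" for i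
    by (auto simp: partial_deriv_eq[OF d])
  with d show ?case by (auto simp: differentiable_on_def intro!: C_k_mult C_k_const Suc
        intro: differentiableI)
qed

text \<open>Needed because a mollifying kernel \<open>\<rho> (x - y)\<close>, read as a function of
  \<open>y\<close>, later enters a test function.\<close>

lemma C_k_reflect:
  "C_k k \<rho> \<Longrightarrow> C_k k (\<lambda>y. \<rho> (x - y))"
proof (induction k arbitrary: \<rho>)
  case 0
  then have "continuous_on UNIV \<rho>" by simp
  then show ?case unfolding C_k.simps by (rule continuous_on_compose2) (auto intro!: continuous_intros)
next
  case (Suc k)
  have d: "((\<lambda>y. \<rho> (x - y)) has_derivative (\<lambda>h. frechet_derivative \<rho> (at (x - y)) (- h))) (at y)" for y
  proof -
    have "(\<rho> has_derivative frechet_derivative \<rho> (at (x - y))) (at (x - y))"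
      using Suc.prems by (auto simp: differentiable_on_def frechet_derivative_works)
    then show ?thesis
      by (auto intro!: derivative_eq_intros has_derivative_compose[of "\<lambda>y. x - y" _ y UNIV \<rho>])
  qed
  have "linear (frechet_derivative \<rho> (at y))" for y
    using Suc.prems by (auto simp: differentiable_on_def intro: linear_frechet_derivative)
  then have "partial_deriv i (\<lambda>y. \<rho> (x - y)) = (\<lambda>y. -1 * partial_deriv i \<rho> (x - y))" for i
    by (auto simp: partial_deriv_eq[OF d] partial_deriv_def linear_neg)
  moreover have "C_k k (\<lambda>y. -1 * partial_deriv i \<rho> (x - y))" for i
    by (rule C_k_mult[OF C_k_const]) (use Suc in auto)
  ultimately show ?case using d by (auto simp: differentiable_on_def intro: differentiableI)
qed

text \<open>The functions \<open>p(1/t) exp(-1/t)\<close>, continued by 0, form a family closed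
  under differentiation. Smoothness of the member with \<open>p = 1\<close> then needs only a
  recursion on polynomials.\<close>

definition flat_exp :: "real poly \<Rightarrow> real \<Rightarrow> real"
  where "flat_exp p t = (if t > 0 then poly p (1/t) * exp (- (1/t)) else 0)"

lemma poly_times_exp_minus_tendsto_0:
  fixes p :: "real poly"
  shows "((\<lambda>y. poly p y * exp (- y)) \<longlongrightarrow> 0) at_top"
proof -
  have "((\<lambda>y. \<Sum>i\<le>degree p. coeff p i * (y ^ i / exp y)) \<longlongrightarrow> (\<Sum>i\<le>degree p. coeff p i * 0)) at_top"
    by (intro tendsto_sum tendsto_mult tendsto_const tendsto_power_div_exp_0)
  then show ?thesis
    by (simp add: poly_altdef sum_distrib_right exp_minus divide_inverse mult.assoc)
qed

text \<open>With \<open>y = 1/t\<close> the chain rule gives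
  \<open>y^2 (p(y) - p'(y)) exp(-y)\<close>; the monomial \<open>y^2\<close> is
  \<open>[:0,0,1:]\<close>. Only the point \<open>t = 0\<close> calls for a limit.\<close>

lemma flat_exp_deriv:
  "(flat_exp p has_real_derivative flat_exp ([:0,0,1:] * (p - pderiv p)) t) (at t)"
proof -
  consider "t > 0" | "t < 0" | "t = 0" by linarith
  then show ?thesis
  proof cases
    case 1
    have "((\<lambda>t. poly p (1/t) * exp (- (1/t))) has_real_derivative
        flat_exp ([:0,0,1:] * (p - pderiv p)) t) (at t)"
      using 1 by (auto intro!: derivative_eq_intros DERIV_chain2[OF poly_DERIV]
          simp: flat_exp_def field_simps power2_eq_square)
    then show ?thesis
      by (rule has_field_derivative_transform_within_open[where S="{0<..}"])
         (use 1 in \<open>auto simp: flat_exp_def\<close>)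
  next
    case 2
    have "((\<lambda>t. 0) has_real_derivative 0) (at t)" by simp
    then have "(flat_exp p has_real_derivative 0) (at t)"
      by (rule has_field_derivative_transform_within_open[where S="{..<0}"])
         (use 2 in \<open>auto simp: flat_exp_def\<close>)
    then show ?thesis using 2 by (simp add: flat_exp_def)
  next
    case 3
    \<comment> \<open>The difference quotient at 0 equals \<open>y p(y) exp(-y)\<close> with
      \<open>y = 1/h\<close>, and \<open>pCons 0 p\<close> is the polynomial
      \<open>y p(y)\<close>.\<close>
    have r: "((\<lambda>t. poly (pCons 0 p) (inverse t) * exp (- inverse t)) \<longlongrightarrow> 0) (at_right 0)"
      using filterlim_compose[OF poly_times_exp_minus_tendsto_0[of "pCons 0 p"] filterlim_inverse_at_top_right]
      by simp
    have "((\<lambda>h. flat_exp p h / h) \<longlongrightarrow> 0) (at_right 0)"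
      by (rule Lim_transform_eventually[OF r])
         (auto simp: eventually_at_right_less flat_exp_def field_simps intro!: eventually_at_rightI[of 0 1])
    moreover have "((\<lambda>h. flat_exp p h / h) \<longlongrightarrow> 0) (at_left 0)"
      by (rule Lim_transform_eventually[OF tendsto_const])
         (auto simp: flat_exp_def intro!: eventually_at_leftI[of "-1" 0])
    ultimately have "((\<lambda>h. flat_exp p h / h) \<longlongrightarrow> 0) (at 0)"
      by (simp add: filterlim_at_split)
    then show ?thesis using 3 by (simp add: DERIV_def flat_exp_def)
  qed
qed

lemma ex_smooth_flat:
  "\<exists>F :: nat \<Rightarrow> real \<Rightarrow> real. (\<forall>m t. (F m has_real_derivative F (Suc m) t) (at t)) \<and>
     (\<forall>t. F 0 t \<ge> 0) \<and> (\<forall>t. F 0 t > 0 \<longleftrightarrow> t > 0)"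
proof -
  define P where "P = rec_nat (1::real poly) (\<lambda>_ p. [:0,0,1:] * (p - pderiv p))"
  show ?thesis
  proof (intro exI[of _ "\<lambda>m. flat_exp (P m)"] conjI allI)
    show "(flat_exp (P m) has_real_derivative flat_exp (P (Suc m)) t) (at t)" for m t
      using flat_exp_deriv[of "P m" t] by (simp add: P_def)
  qed (auto simp: P_def flat_exp_def)
qed

text \<open>A function is carried together with its gradient field, so that both can be approximated
  and combined as a pair without computing derivatives again.\<close>

definition C1_grad :: "(real ^ 'n::finite \<Rightarrow> real) \<Rightarrow> (real ^ 'n \<Rightarrow> real ^ 'n) \<Rightarrow> bool"
  where "C1_grad \<phi> g \<longleftrightarrow> (\<forall>x. (\<phi> has_derivative (\<lambda>h. g x \<bullet> h)) (at x)) \<and> continuous_on UNIV g"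

definition smooth_bump :: "(real ^ 'n::finite \<Rightarrow> real) \<Rightarrow> bool"
  where "smooth_bump \<psi> \<longleftrightarrow> (\<forall>k. C_k k \<psi>) \<and> (\<exists>r. \<forall>x. norm x \<ge> r \<longrightarrow> \<psi> x = 0)"

lemma C1_grad_partial_deriv: "C1_grad \<phi> g \<Longrightarrow> partial_deriv i \<phi> x = g x $ i"
  unfolding C1_grad_def using partial_deriv_eq[of \<phi> "\<lambda>h. g x \<bullet> h" x i] by (simp add: inner_axis)

lemma C1_grad_gradient: "C1_grad \<phi> g \<Longrightarrow> gradient \<phi> = g"
  by (auto simp: gradient_def vec_eq_iff C1_grad_partial_deriv)

lemma C1_grad_cont: "C1_grad \<phi> g \<Longrightarrow> continuous_on UNIV \<phi>" "C1_grad \<phi> g \<Longrightarrow> continuous_on UNIV g"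
  unfolding C1_grad_def
  by (meson differentiable_def differentiable_imp_continuous_on differentiable_on_def differentiable_at_imp_differentiable_on)+

lemma C1_grad_borel [measurable_dest]:
  "C1_grad \<phi> g \<Longrightarrow> \<phi> \<in> borel_measurable borel" "C1_grad \<phi> g \<Longrightarrow> g \<in> borel_measurable borel"
  using C1_grad_cont borel_measurable_continuous_onI by blast+

lemma C_k_1_C1_grad:
  assumes "C_k (Suc 0) \<phi>" shows "C1_grad \<phi> (gradient \<phi>)"
proof -
  have d: "(\<phi> has_derivative frechet_derivative \<phi> (at x)) (at x)" for x
    using assms by (auto simp: differentiable_on_def frechet_derivative_works)
  have "frechet_derivative \<phi> (at x) h = gradient \<phi> x \<bullet> h" for x h
  proof -
    interpret linear "frechet_derivative \<phi> (at x)" using d has_derivative_linear by blast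
    have "frechet_derivative \<phi> (at x) h = frechet_derivative \<phi> (at x) (\<Sum>i\<in>UNIV. h $ i *s axis i 1)"
      by (simp add: basis_expansion)
    also have "\<dots> = (\<Sum>i\<in>UNIV. h $ i * frechet_derivative \<phi> (at x) (axis i 1))"
      by (simp add: sum scale scalar_mult_eq_scaleR)
    finally show ?thesis by (simp add: gradient_def inner_vec_def partial_deriv_def mult.commute)
  qed
  moreover have "continuous_on UNIV (gradient \<phi>)"
    using assms unfolding gradient_def by (intro continuous_on_vec_lambda) auto
  moreover have "(\<phi> has_derivative (\<lambda>h. gradient \<phi> x \<bullet> h)) (at x)" for x
    using d[of x] calculation(1)[of x] by (subst (asm) (2) ext[of _ "\<lambda>h. gradient \<phi> x \<bullet> h"]) auto
  ultimately show ?thesis by (simp add: C1_grad_def)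
qed

lemma smooth_bump_C1_grad: "smooth_bump \<psi> \<Longrightarrow> C1_grad \<psi> (gradient \<psi>)"
  unfolding smooth_bump_def using C_k_1_C1_grad by blast

lemma gradient_zero_outside:
  assumes "C1_grad \<phi> g" "closed K" "\<And>x. x \<notin> K \<Longrightarrow> \<phi> x = 0" "x \<notin> K"
  shows "g x = 0"
proof -
  have "(\<phi> has_derivative (\<lambda>h. g x \<bullet> h)) (at x)" using assms by (auto simp: C1_grad_def)
  moreover have "((\<lambda>_. 0) has_derivative (\<lambda>h. 0)) (at x)" by simp
  then have "(\<phi> has_derivative (\<lambda>h. 0)) (at x)"
    by (rule has_derivative_transform_within_open[where s="-K"]) (use assms in auto)
  ultimately have "(\<lambda>h. g x \<bullet> h) = (\<lambda>h. 0)" by (rule has_derivative_unique)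
  then have "g x \<bullet> g x = 0" by meson
  then show ?thesis by simp
qed

text \<open>The modulus comes from compactness of the ball enlarged by 1. If one of two points at
  distance below 1 lies outside that ball, both lie outside the support.\<close>

lemma bounded_support_uniformly_continuous:
  fixes g :: "'a::euclidean_space \<Rightarrow> 'b::real_normed_vector"
  assumes "continuous_on UNIV g" "\<And>x. norm x \<ge> r \<Longrightarrow> g x = 0"
  shows "uniformly_continuous_on UNIV g" "\<exists>M. \<forall>x. norm (g x) \<le> M"
proof -
  have u: "uniformly_continuous_on (cball 0 (r+1)) g"
    using assms by (intro compact_uniformly_continuous) (auto intro: continuous_on_subset)
  show "uniformly_continuous_on UNIV g"
    unfolding uniformly_continuous_on_def
  proof (intro allI impI)
    fix e :: real assume e: "e > 0"
    then obtain d where d: "d > 0" "\<And>x y. x \<in> cball 0 (r+1) \<Longrightarrow> y \<in> cball 0 (r+1) \<Longrightarrow> dist y x < d \<Longrightarrow> dist (g y) (g x) < e"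
      using u unfolding uniformly_continuous_on_def by blast
    have "dist (g y) (g x) < e" if "dist y x < min d 1" for x y
    proof (cases "norm x \<le> r + 1 \<and> norm y \<le> r + 1")
      case True then show ?thesis using d(2)[of x y] that by auto
    next
      case False
      have "norm x \<le> norm y + dist y x" "norm y \<le> norm x + dist y x"
        by (auto simp: dist_norm norm_triangle_sub norm_minus_commute)
           (metis norm_minus_commute norm_triangle_sub)
      then have "norm x \<ge> r" "norm y \<ge> r" using False that by auto
      then show ?thesis using assms(2) e by simp
    qed
    then show "\<exists>d>0. \<forall>x\<in>UNIV. \<forall>x'\<in>UNIV. dist x' x < d \<longrightarrow> dist (g x') (g x) < e"
      using d(1) by (intro exI[of _ "min d 1"]) auto
  qed
  have "compact (g ` cball 0 r)" using assms
    by (intro compact_continuous_image) (auto intro: continuous_on_subset)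
  then obtain M where M: "\<And>y. y \<in> g ` cball 0 r \<Longrightarrow> norm y \<le> M"
    using compact_imp_bounded bounded_iff by metis
  have "norm (g x) \<le> max M 0" for x
    using M[of "g x"] assms(2)[of x] by (cases "norm x \<le> r") auto
  then show "\<exists>M. \<forall>x. norm (g x) \<le> M" by blast
qed

section \<open>Translation and reflection invariance of Lebesgue integrals, and convolution\<close>

lemma distr_lborel_reflect: "distr lborel borel (\<lambda>y. x - y) = (lborel :: 'a::euclidean_space measure)"
proof -
  have "(lborel :: 'a measure) = density (distr lborel borel (\<lambda>y. x - y)) (\<lambda>_. (\<Prod>j\<in>(Basis::'a set). \<bar>-1::real\<bar>))"
    using lborel_affine_euclidean[where t=x and c="\<lambda>_::'a. -1::real"]
    by (simp add: sum_negf euclidean_representation)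
  then show ?thesis by (simp add: density_1)
qed

lemma nn_integral_lborel_shift:
  fixes f :: "'a::euclidean_space \<Rightarrow> ennreal"
  assumes "f \<in> borel_measurable borel"
  shows "(\<integral>\<^sup>+y. f (x + y) \<partial>lborel) = (\<integral>\<^sup>+y. f y \<partial>lborel)"
  by (subst (2) lborel_distr_plus[of x, symmetric]) (use assms in \<open>simp add: nn_integral_distr\<close>)

lemma integral_lborel_reflect:
  fixes f :: "'a::euclidean_space \<Rightarrow> 'b::{banach,second_countable_topology}"
  assumes "f \<in> borel_measurable borel"
  shows "(\<integral>y. f (x - y) \<partial>lborel) = (\<integral>y. f y \<partial>lborel)"
  by (subst (2) distr_lborel_reflect[of x, symmetric]) (use assms in \<open>simp add: integral_distr\<close>)

lemma integrable_lborel_reflect: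
  fixes f :: "'a::euclidean_space \<Rightarrow> 'b::{banach,second_countable_topology}"
  assumes "integrable lborel f"
  shows "integrable lborel (\<lambda>y. f (x - y))"
proof -
  have "integrable (distr lborel borel (\<lambda>y. x - y)) f" using assms by (simp add: distr_lborel_reflect)
  then show ?thesis by (subst (asm) integrable_distr_eq) (use assms in auto)
qed

lemma integrable_bounded_support:
  fixes f :: "'a::euclidean_space \<Rightarrow> 'b::{banach,second_countable_topology}"
  assumes "continuous_on UNIV f" "\<And>x. norm x \<ge> r \<Longrightarrow> f x = 0"
  shows "integrable lborel f"
proof -
  have "integrable lborel (\<lambda>x. indicator (cball 0 r) x *\<^sub>R f x)"
    using assms by (intro borel_integrable_compact) (auto intro: continuous_on_subset)
  moreover have "(\<lambda>x. indicator (cball 0 r) x *\<^sub>R f x) = f"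
    using assms(2) by (auto simp: indicator_def)
  ultimately show ?thesis by simp
qed

lemma ex_mollifier:
  assumes "\<epsilon> > 0"
  shows "\<exists>\<rho> :: real ^ 'n::finite \<Rightarrow> real. (\<forall>k. C_k k \<rho>) \<and> (\<forall>x. \<rho> x \<ge> 0) \<and> (\<forall>x. norm x \<ge> \<epsilon> \<longrightarrow> \<rho> x = 0)
    \<and> integrable lborel \<rho> \<and> (\<integral>x. \<rho> x \<partial>lborel) = 1"
proof -
  obtain F :: "nat \<Rightarrow> real \<Rightarrow> real" where F: "\<And>m t. (F m has_real_derivative F (Suc m) t) (at t)"
    "\<And>t. F 0 t \<ge> 0" "\<And>t. F 0 t > 0 \<longleftrightarrow> t > 0"
    using ex_smooth_flat by blast
  \<comment> \<open>The product below lives on the cube of half-width \<open>\<delta>\<close>. Since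
    the norm is at most the sum of the absolute coordinates, the cube lies in the ball of radius
    \<open>\<epsilon>\<close>.\<close>
  define \<delta> where "\<delta> = \<epsilon> / real CARD('n)"
  have \<delta>: "\<delta> > 0" using assms by (simp add: \<delta>_def)
  define \<rho> :: "real ^ 'n \<Rightarrow> real" where "\<rho> = (\<lambda>x. \<Prod>i\<in>UNIV. F 0 (axis i 1 \<bullet> x + \<delta>) * F 0 ((- axis i 1) \<bullet> x + \<delta>))"
  have C: "C_k k \<rho>" for k unfolding \<rho>_def by (intro C_k_prod C_k_mult C_k_affine F) auto
  have nn: "\<rho> x \<ge> 0" for x unfolding \<rho>_def by (intro prod_nonneg mult_nonneg_nonneg) (auto simp: F)
  have pos: "\<rho> 0 > 0" unfolding \<rho>_def by (intro prod_pos) (auto simp: F \<delta>)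
  have z: "\<rho> x = 0" if "norm x \<ge> \<epsilon>" for x
  proof (rule ccontr)
    assume "\<rho> x \<noteq> 0"
    then have "F 0 (x $ i + \<delta>) \<noteq> 0 \<and> F 0 (- (x $ i) + \<delta>) \<noteq> 0" for i
      unfolding \<rho>_def by (auto simp: inner_axis' )
    then have "F 0 (x $ i + \<delta>) > 0 \<and> F 0 (- (x $ i) + \<delta>) > 0" for i
      using F(2) by (metis less_eq_real_def)
    then have "\<bar>x $ i\<bar> < \<delta>" for i using F(3) by (metis abs_less_iff add.commute diff_gt_0_iff_gt minus_less_iff
        diff_conv_add_uminus neg_less_iff_less less_iff_diff_less_0 diff_minus_eq_add)
    then have "(\<Sum>i\<in>UNIV. \<bar>x $ i\<bar>) < (\<Sum>i\<in>(UNIV::'n set). \<delta>)" by (intro sum_strict_mono) auto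
    then have "norm x < \<epsilon>" using norm_le_l1_cart[of x] by (simp add: \<delta>_def)
    then show False using that by simp
  qed
  have cont: "continuous_on UNIV \<rho>" using C[of 0] by simp
  have int: "integrable lborel \<rho>" by (rule integrable_bounded_support[OF cont z])
  \<comment> \<open>A nonnegative function of integral 0 vanishes almost everywhere, but the set
    where \<open>\<rho>\<close> is nonzero is open and contains 0.\<close>
  have "(\<integral>x. \<rho> x \<partial>lborel) \<noteq> 0"
  proof
    assume "(\<integral>x. \<rho> x \<partial>lborel) = 0"
    then have "AE x in lborel. \<rho> x = 0" using integral_nonneg_eq_0_iff_AE[OF int] nn by simp
    then have "{x. \<rho> x \<noteq> 0} \<in> null_sets lborel"
      by (subst (asm) AE_iff_null) (use int in auto)
    then have "negligible {x. \<rho> x \<noteq> 0}" by (simp add: negligible_iff_null_sets null_sets_completionI)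
    moreover have "open {x. \<rho> x \<noteq> 0}" using cont by (intro open_Collect_neq) auto
    ultimately show False using open_not_negligible[of "{x. \<rho> x \<noteq> 0}"] pos
      by (metis (mono_tags, lifting) empty_iff less_irrefl mem_Collect_eq)
  qed
  moreover have "(\<integral>x. \<rho> x \<partial>lborel) \<ge> 0" using nn by simp
  ultimately have I: "(\<integral>x. \<rho> x \<partial>lborel) > 0" by simp
  show ?thesis
  proof (intro exI[of _ "\<lambda>x. (1 / (\<integral>x. \<rho> x \<partial>lborel)) * \<rho> x"] conjI allI)
    show "C_k k (\<lambda>x. (1 / (\<integral>x. \<rho> x \<partial>lborel)) * \<rho> x)" for k by (intro C_k_mult C_k_const C)
  qed (use nn z int I in auto)
qed

lemma integrable_scaleR_bounded:
  fixes f :: "'a \<Rightarrow> real" and g :: "'a \<Rightarrow> 'b::{banach,second_countable_topology}"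
  assumes "integrable M f" "g \<in> borel_measurable M" "\<And>y. norm (g y) \<le> B"
  shows "integrable M (\<lambda>y. f y *\<^sub>R g y)"
proof (rule Bochner_Integration.integrable_bound)
  show "integrable M (\<lambda>y. f y * B)" using assms by simp
  have "norm (f y *\<^sub>R g y) \<le> norm (f y * B)" for y
    using assms(3)[of y] by (auto simp: abs_mult intro!: mult_left_mono intro: order_trans[OF _ abs_ge_self])
  then show "AE y in M. norm (f y *\<^sub>R g y) \<le> norm (f y * B)" by blast
  have "f \<in> borel_measurable M" using assms by blast
  then show "(\<lambda>y. f y *\<^sub>R g y) \<in> borel_measurable M" using assms(2) by measurable
qed

text \<open>The kernel is real while the function may be vector valued, so that \<open>u\<close> and
  its gradient field are mollified by one and the same operation.\<close>

definition conv :: "('a::euclidean_space \<Rightarrow> 'b::{banach,second_countable_topology}) \<Rightarrow> ('a \<Rightarrow> real) \<Rightarrow> 'a \<Rightarrow> 'b"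
  where "conv f \<psi> x = (\<integral>y. \<psi> (x - y) *\<^sub>R f y \<partial>lborel)"

lemma conv_integrable:
  fixes f :: "'a::euclidean_space \<Rightarrow> 'b::{banach,second_countable_topology}"
  assumes "integrable lborel f" "continuous_on UNIV \<psi>" "\<And>x. norm (\<psi> x) \<le> M"
  shows "integrable lborel (\<lambda>y. \<psi> (x - y) *\<^sub>R f y)"
proof -
  have [measurable]: "\<psi> \<in> borel_measurable borel"
    using assms(2) borel_measurable_continuous_onI by blast
  have [measurable]: "f \<in> borel_measurable borel" using assms(1) by auto
  show ?thesis
    by (rule Bochner_Integration.integrable_bound[where f="\<lambda>y. M * norm (f y)"])
       (use assms(1,3) in \<open>auto intro!: AE_I2 mult_right_mono order_trans[OF _ abs_ge_self]\<close>)
qed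

text \<open>Uniform continuity of the gradient of the kernel makes the linearisation error of
  \<open>\<psi>\<close> small uniformly in the base point. It can therefore be integrated against
  \<open>|f|\<close>, where \<open>f\<close> is merely integrable.\<close>

lemma conv_C1_grad:
  fixes f :: "real ^ 'n::finite \<Rightarrow> real"
  assumes f: "integrable lborel f" and C: "C1_grad \<psi> g" and s: "\<And>x. norm x \<ge> r \<Longrightarrow> \<psi> x = 0"
  shows "C1_grad (conv f \<psi>) (\<lambda>x. \<integral>y. f y *\<^sub>R g (x - y) \<partial>lborel)"
proof -
  have c\<psi>: "continuous_on UNIV \<psi>" and cg: "continuous_on UNIV g" using C1_grad_cont[OF C] by auto
  have sg: "g x = 0" if "norm x \<ge> r + 1" for x
    by (rule gradient_zero_outside[OF C, of "cball 0 r"]) (use s that in auto)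
  obtain M where M: "\<And>x. norm (\<psi> x) \<le> M" using bounded_support_uniformly_continuous(2)[OF c\<psi> s] by blast
  obtain Mg where Mg: "\<And>x. norm (g x) \<le> Mg" using bounded_support_uniformly_continuous(2)[OF cg sg] by blast
  have ug: "uniformly_continuous_on UNIV g" by (rule bounded_support_uniformly_continuous(1)[OF cg sg])
  have [measurable]: "\<psi> \<in> borel_measurable borel" "g \<in> borel_measurable borel"
    using c\<psi> cg borel_measurable_continuous_onI by blast+
  have [measurable]: "f \<in> borel_measurable borel" using f by auto
  have ig: "integrable lborel (\<lambda>y. f y *\<^sub>R g (x - y))" for x
    by (rule integrable_scaleR_bounded[OF f _ Mg]) measurable
  have i\<psi>: "integrable lborel (\<lambda>y. \<psi> (x - y) *\<^sub>R f y)" for x by (rule conv_integrable[OF f c\<psi> M])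
  \<comment> \<open>The summand 1 keeps the divisor in \<open>e / I\<close> positive when
    \<open>f\<close> vanishes.\<close>
  define I where "I = (\<integral>y. norm (f y) \<partial>lborel) + 1"
  have I: "I > 0" "(\<integral>y. norm (f y) \<partial>lborel) \<le> I" unfolding I_def
    by (auto intro: add_nonneg_pos)
  have key: "\<exists>d>0. \<forall>a b. norm (b - a) < d \<longrightarrow> norm (g b - g a) \<le> e / I" if "e > 0" for e
    using ug[unfolded uniformly_continuous_on_def, rule_format, of "e / I"] that I
    by (auto simp: dist_norm) (metis less_imp_le norm_minus_commute)
  have "(conv f \<psi> has_derivative (\<lambda>h. (\<integral>y. f y *\<^sub>R g (x - y) \<partial>lborel) \<bullet> h)) (at x)" for x
    unfolding has_derivative_at_alt
  proof (intro conjI allI impI)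
    show "bounded_linear ((\<bullet>) (\<integral>y. f y *\<^sub>R g (x - y) \<partial>lborel))" by (rule bounded_linear_inner_right)
    fix e :: real assume e: "e > 0"
    obtain d where d: "d > 0" "\<And>a b. norm (b - a) < d \<Longrightarrow> norm (g b - g a) \<le> e / I"
      using key[OF e] by blast
    have pt: "norm (\<psi> b - \<psi> a - g a \<bullet> (b - a)) \<le> norm (b - a) * (e / I)" if "norm (b - a) < d" for a b
    proof (rule differentiable_bound_linearization[where S="ball a d" and f=\<psi> and f'="\<lambda>x h. g x \<bullet> h"])
      show "a + t *\<^sub>R (b - a) \<in> ball a d" if "t \<in> {0..1}" for t
      proof -
        have "\<bar>t\<bar> * norm (b - a) \<le> 1 * norm (b - a)" using that by (intro mult_right_mono) auto
        then show ?thesis using \<open>norm (b - a) < d\<close> by (simp add: dist_norm)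
      qed
      show "(\<psi> has_derivative (\<bullet>) (g x)) (at x within ball a d)" for x
        using C by (auto simp: C1_grad_def intro: has_derivative_at_withinI)
      show "onorm ((\<bullet>) (g x) - (\<bullet>) (g a)) \<le> e / I" if "x \<in> ball a d" for x
        unfolding fun_diff_def
      proof (rule onorm_bound)
        show "0 \<le> e / I" using e I by simp
        fix h
        have "norm (g x \<bullet> h - g a \<bullet> h) \<le> norm (g x - g a) * norm h"
          by (metis Cauchy_Schwarz_ineq2 inner_diff_left real_norm_def)
        also have "\<dots> \<le> e / I * norm h"
          using d(2)[of x a] that by (intro mult_right_mono) (auto simp: dist_norm norm_minus_commute)
        finally show "norm (g x \<bullet> h - g a \<bullet> h) \<le> e / I * norm h" .
      qed
      show "a \<in> ball a d" using d by simp
    qed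
    show "\<exists>d>0. \<forall>y. norm (y - x) < d \<longrightarrow> norm (conv f \<psi> y - conv f \<psi> x - (\<integral>y. f y *\<^sub>R g (x - y) \<partial>lborel) \<bullet> (y - x)) \<le> e * norm (y - x)"
    proof (intro exI[of _ d] conjI allI impI)
      fix x' assume x': "norm (x' - x) < d"
      have "conv f \<psi> x' - conv f \<psi> x - (\<integral>y. f y *\<^sub>R g (x - y) \<partial>lborel) \<bullet> (x' - x)
        = (\<integral>y. f y * (\<psi> (x' - y) - \<psi> (x - y) - g (x - y) \<bullet> (x' - x)) \<partial>lborel)"
      proof -
        have "(\<integral>y. f y * (\<psi> (x' - y) - \<psi> (x - y) - g (x - y) \<bullet> (x' - x)) \<partial>lborel)
          = (\<integral>y. (\<psi> (x' - y) *\<^sub>R f y - \<psi> (x - y) *\<^sub>R f y) - (f y *\<^sub>R g (x - y)) \<bullet> (x' - x) \<partial>lborel)"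
          by (intro Bochner_Integration.integral_cong) (auto simp: algebra_simps)
        also have "\<dots> = (\<integral>y. \<psi> (x' - y) *\<^sub>R f y - \<psi> (x - y) *\<^sub>R f y \<partial>lborel)
            - (\<integral>y. (f y *\<^sub>R g (x - y)) \<bullet> (x' - x) \<partial>lborel)"
          by (intro Bochner_Integration.integral_diff Bochner_Integration.integrable_diff i\<psi> integrable_inner_left ig)
        finally show ?thesis
          by (simp add: conv_def Bochner_Integration.integral_diff[OF i\<psi> i\<psi>, simplified] integral_inner_left[OF ig, symmetric])
      qed
      also have "norm \<dots> \<le> (\<integral>y. norm (f y) * (norm (x' - x) * (e / I)) \<partial>lborel)"
      proof (rule Bochner_Integration.integral_norm_bound_integral)
        show "integrable lborel (\<lambda>y. norm (f y) * (norm (x' - x) * (e / I)))" using f by auto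
        show "norm (f y * (\<psi> (x' - y) - \<psi> (x - y) - g (x - y) \<bullet> (x' - x))) \<le> norm (f y) * (norm (x' - x) * (e / I))" for y
          unfolding real_norm_def abs_mult using pt[of "x' - y" "x - y"] x' by (intro mult_left_mono) auto
        have "integrable lborel (\<lambda>y. \<psi> (x' - y) *\<^sub>R f y - \<psi> (x - y) *\<^sub>R f y - (f y *\<^sub>R g (x - y)) \<bullet> (x' - x))"
          by (intro Bochner_Integration.integrable_diff i\<psi> integrable_inner_left ig)
        then show "integrable lborel (\<lambda>y. f y * (\<psi> (x' - y) - \<psi> (x - y) - g (x - y) \<bullet> (x' - x)))"
          by (simp add: algebra_simps)
      qed
      also have "\<dots> = (\<integral>y. norm (f y) \<partial>lborel) * (norm (x' - x) * (e / I))" by simp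
      also have "\<dots> \<le> I * (norm (x' - x) * (e / I))" using I e by (intro mult_right_mono) auto
      also have "\<dots> = e * norm (x' - x)" using I by (simp add: field_simps)
      finally show "norm (conv f \<psi> x' - conv f \<psi> x - (\<integral>y. f y *\<^sub>R g (x - y) \<partial>lborel) \<bullet> (x' - x)) \<le> e * norm (x' - x)" .
    qed (use d in auto)
  qed
  moreover have "continuous_on UNIV (\<lambda>x. \<integral>y. f y *\<^sub>R g (x - y) \<partial>lborel)"
    unfolding continuous_on_iff
  proof (intro ballI allI impI)
    fix x e :: real and x0 :: "real ^ 'n" assume e: "e > 0"
    obtain d where d: "d > 0" "\<And>a b. norm (b - a) < d \<Longrightarrow> norm (g b - g a) \<le> (e/2) / I"
      using key[of "e/2"] e by auto
    have "dist (\<integral>y. f y *\<^sub>R g (x - y) \<partial>lborel) (\<integral>y. f y *\<^sub>R g (x0 - y) \<partial>lborel) < e" if "dist x x0 < d" for x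
    proof -
      have "dist (\<integral>y. f y *\<^sub>R g (x - y) \<partial>lborel) (\<integral>y. f y *\<^sub>R g (x0 - y) \<partial>lborel)
        = norm (\<integral>y. f y *\<^sub>R (g (x - y) - g (x0 - y)) \<partial>lborel)"
        unfolding dist_norm by (subst Bochner_Integration.integral_diff[symmetric]) (auto intro!: ig simp: algebra_simps)
      also have "\<dots> \<le> (\<integral>y. norm (f y) * ((e/2) / I) \<partial>lborel)"
      proof (rule Bochner_Integration.integral_norm_bound_integral)
        show "integrable lborel (\<lambda>y. norm (f y) * ((e/2) / I))" using f by auto
        show "norm (f y *\<^sub>R (g (x - y) - g (x0 - y))) \<le> norm (f y) * ((e/2) / I)" for y
          unfolding norm_scaleR real_norm_def using d(2)[of "x - y" "x0 - y"] that
          by (intro mult_left_mono) (auto simp: dist_norm)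
        have "integrable lborel (\<lambda>y. f y *\<^sub>R g (x - y) - f y *\<^sub>R g (x0 - y))"
          by (intro Bochner_Integration.integrable_diff ig)
        then show "integrable lborel (\<lambda>y. f y *\<^sub>R (g (x - y) - g (x0 - y)))"
          by (simp add: algebra_simps)
      qed
      also have "\<dots> = (\<integral>y. norm (f y) \<partial>lborel) * ((e/2) / I)" by simp
      also have "\<dots> \<le> I * ((e/2) / I)" using I e by (intro mult_right_mono) auto
      also have "\<dots> < e" using I e by (simp add: field_simps)
      finally show ?thesis .
    qed
    then show "\<exists>d>0. \<forall>x'\<in>UNIV. dist x' x0 < d \<longrightarrow> dist (\<integral>y. f y *\<^sub>R g (x' - y) \<partial>lborel) (\<integral>y. f y *\<^sub>R g (x0 - y) \<partial>lborel) < e"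
      using d(1) by auto
  qed
  ultimately show ?thesis by (auto simp: C1_grad_def)
qed

lemma smooth_bump_partial_deriv:
  assumes "smooth_bump \<psi>" shows "smooth_bump (partial_deriv i \<psi>)"
proof -
  obtain r where r: "\<And>x. norm x \<ge> r \<Longrightarrow> \<psi> x = 0" using assms by (auto simp: smooth_bump_def)
  have C: "C1_grad \<psi> (gradient \<psi>)" using assms by (blast intro: smooth_bump_C1_grad)
  have "C_k k (partial_deriv i \<psi>)" for k
    using assms by (metis smooth_bump_def C_k.simps(2))
  moreover have "gradient \<psi> x = 0" if "norm x \<ge> r + 1" for x
    by (rule gradient_zero_outside[OF C, of "cball 0 r"]) (use that r in auto)
  then have "\<forall>x. norm x \<ge> r + 1 \<longrightarrow> partial_deriv i \<psi> x = 0"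
    using C1_grad_partial_deriv[OF C] by auto
  ultimately show ?thesis unfolding smooth_bump_def by blast
qed

text \<open>Every derivative falls on the kernel, and partial derivatives of a bump are bumps again;
  hence the induction runs with the kernel arbitrary and \<open>f\<close> fixed.\<close>

lemma C_k_conv:
  fixes f :: "real ^ 'n::finite \<Rightarrow> real"
  assumes f: "integrable lborel f"
  shows "smooth_bump \<psi> \<Longrightarrow> C_k k (conv f \<psi>)"
proof (induction k arbitrary: \<psi>)
  case 0
  then obtain r where r: "\<And>x. norm x \<ge> r \<Longrightarrow> \<psi> x = 0" by (auto simp: smooth_bump_def)
  have C: "C1_grad \<psi> (gradient \<psi>)" using 0 by (blast intro: smooth_bump_C1_grad)
  show ?case using C1_grad_cont(1)[OF conv_C1_grad[OF f C r]] by simp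
next
  case (Suc k)
  then obtain r where r: "\<And>x. norm x \<ge> r \<Longrightarrow> \<psi> x = 0" by (auto simp: smooth_bump_def)
  have C: "C1_grad \<psi> (gradient \<psi>)" using Suc by (blast intro: smooth_bump_C1_grad)
  have sg: "gradient \<psi> x = 0" if "norm x \<ge> r + 1" for x
    by (rule gradient_zero_outside[OF C, of "cball 0 r"]) (use that r in auto)
  obtain M where M: "\<And>x. norm (gradient \<psi> x) \<le> M"
    using bounded_support_uniformly_continuous(2)[OF C1_grad_cont(2)[OF C] sg] by blast
  note D = conv_C1_grad[OF f C r]
  have "partial_deriv i (conv f \<psi>) = conv f (partial_deriv i \<psi>)" for i
  proof
    fix x
    have [measurable]: "gradient \<psi> \<in> borel_measurable borel" using C1_grad_borel[OF C] by simp
    have [measurable]: "f \<in> borel_measurable borel" using f by auto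
    have ig: "integrable lborel (\<lambda>y. f y *\<^sub>R gradient \<psi> (x - y))"
      by (rule integrable_scaleR_bounded[OF f _ M]) measurable
    have "partial_deriv i (conv f \<psi>) x = (\<integral>y. f y *\<^sub>R gradient \<psi> (x - y) \<partial>lborel) \<bullet> axis i 1"
      by (simp add: C1_grad_partial_deriv[OF D] inner_axis)
    also have "\<dots> = (\<integral>y. (f y *\<^sub>R gradient \<psi> (x - y)) \<bullet> axis i 1 \<partial>lborel)"
      by (simp only: integral_inner_left[OF ig])
    finally show "partial_deriv i (conv f \<psi>) x = conv f (partial_deriv i \<psi>) x"
      by (simp add: conv_def inner_axis gradient_def mult.commute)
  qed
  moreover have "conv f \<psi> differentiable_on UNIV"
    using D by (auto simp: C1_grad_def differentiable_on_def differentiable_def)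
  ultimately show ?case using Suc smooth_bump_partial_deriv by auto
qed

text \<open>The indicator of the ball halfway between the two radii is mollified at half their
  distance. The result is smooth to all orders but comes without a gradient bound.\<close>

lemma ex_smooth_cutoff:
  fixes z :: "real ^ 'n::finite"
  assumes "r < r'"
  shows "\<exists>\<zeta>. (\<forall>k. C_k k \<zeta>) \<and> (\<forall>x\<in>cball z r. \<zeta> x = 1) \<and> (\<forall>x. x \<notin> cball z r' \<longrightarrow> \<zeta> x = 0)"
proof -
  define \<epsilon> where "\<epsilon> = (r' - r) / 2"
  have \<epsilon>: "\<epsilon> > 0" using assms by (simp add: \<epsilon>_def)
  obtain \<rho> :: "real ^ 'n \<Rightarrow> real" where \<rho>: "\<And>k. C_k k \<rho>" "\<And>x. norm x \<ge> \<epsilon> \<Longrightarrow> \<rho> x = 0"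
    "integrable lborel \<rho>" "(\<integral>x. \<rho> x \<partial>lborel) = 1" using ex_mollifier[OF \<epsilon>] by blast
  let ?f = "indicator (ball z (r + \<epsilon>)) :: real ^ 'n \<Rightarrow> real"
  have f: "integrable lborel ?f"
    using emeasure_lborel_ball_finite by (intro integrable_real_indicator) auto
  have "smooth_bump \<rho>" using \<rho> by (auto simp: smooth_bump_def)
  then have "C_k k (conv ?f \<rho>)" for k by (rule C_k_conv[OF f])
  moreover have "conv ?f \<rho> x = 1" if "x \<in> cball z r" for x
  proof -
    have "\<rho> (x - y) *\<^sub>R ?f y = \<rho> (x - y)" for y
    proof (cases "norm (x - y) \<ge> \<epsilon>")
      case False
      then have "dist z y < r + \<epsilon>" using that dist_triangle[of z y x] by (auto simp: dist_norm)
      then show ?thesis by simp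
    qed (simp add: \<rho>)
    then have "conv ?f \<rho> x = (\<integral>y. \<rho> (x - y) \<partial>lborel)" by (simp only: conv_def)
    also have "\<dots> = 1" using \<rho> by (subst integral_lborel_reflect) auto
    finally show ?thesis .
  qed
  moreover have "conv ?f \<rho> x = 0" if "x \<notin> cball z r'" for x
  proof -
    have "\<rho> (x - y) *\<^sub>R ?f y = 0" for y
    proof (cases "norm (x - y) \<ge> \<epsilon>")
      case False
      then have "dist z y \<ge> r + \<epsilon>" using that dist_triangle[of z x y]
        by (auto simp: dist_norm norm_minus_commute \<epsilon>_def field_simps)
      then show ?thesis by simp
    qed (simp add: \<rho>)
    then show ?thesis by (simp only: conv_def Bochner_Integration.integral_zero)
  qed
  ultimately show ?thesis by blast
qed

lemma test_functionI:
  assumes "\<And>k. C_k k \<phi>" "compact K" "K \<subseteq> D" "\<And>x. x \<notin> K \<Longrightarrow> \<phi> x = 0"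
  shows "test_function D \<phi>"
proof -
  have "support_on UNIV \<phi> \<subseteq> K" using assms(4) by (auto simp: support_on_def)
  then have "closure (support_on UNIV \<phi>) \<subseteq> K" using assms(2) by (simp add: closure_minimal compact_imp_closed)
  moreover then have "compact (closure (support_on UNIV \<phi>))"
    using assms(2) by (metis bounded_subset closed_closure compact_eq_bounded_closed)
  ultimately show ?thesis using assms by (auto simp: test_function_def)
qed

subsection \<open>Mollification in the spaces of p-integrable functions\<close>

lemma bounded_support_modulus:
  fixes g :: "'a::euclidean_space \<Rightarrow> 'b::real_normed_vector"
  assumes "continuous_on UNIV g" "\<And>x. norm x \<ge> r \<Longrightarrow> g x = 0" "e > 0"
  obtains d where "d > 0" "\<And>x y. dist y x < d \<Longrightarrow> dist (g y) (g x) < e"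
proof -
  have "uniformly_continuous_on UNIV g"
    by (rule bounded_support_uniformly_continuous(1)[OF assms(1), of r]) (rule assms(2))
  then obtain d where "d > 0" "\<forall>x\<in>UNIV. \<forall>x'\<in>UNIV. dist x' x < d \<longrightarrow> dist (g x') (g x) < e"
    using assms(3) unfolding uniformly_continuous_on_def by meson
  then show ?thesis using that by simp
qed

text \<open>The p-th power of the norm, without the root and with values in \<open>ennreal\<close>.
  Integrability becomes a condition only where it is used, and a triangle inequality with the factor
  \<open>2 ^ p\<close> takes the place of Minkowski's.\<close>

definition lpint :: "nat \<Rightarrow> ('a::euclidean_space \<Rightarrow> 'b::euclidean_space) \<Rightarrow> ennreal"
  where "lpint p f = (\<integral>\<^sup>+x. ennreal (norm (f x) ^ p) \<partial>lborel)"

lemma norm_add_power_le: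
  fixes a b :: "'a::real_normed_vector"
  shows "norm (a + b) ^ p \<le> 2 ^ p * (norm a ^ p + norm b ^ p)"
proof -
  have "norm (a + b) \<le> 2 * max (norm a) (norm b)"
    using norm_triangle_ineq[of a b] by linarith
  then have "norm (a + b) ^ p \<le> (2 * max (norm a) (norm b)) ^ p" by (intro power_mono) auto
  also have "\<dots> = 2 ^ p * (max (norm a) (norm b)) ^ p" by (simp add: power_mult_distrib)
  also have "(max (norm a) (norm b)) ^ p \<le> norm a ^ p + norm b ^ p" by (auto simp: max_def)
  finally show ?thesis by simp
qed

lemma ennreal_2_power_mult_add:
  assumes "a \<ge> 0" "b \<ge> 0" shows "ennreal (2 ^ p * (a + b)) = 2 ^ p * (ennreal a + ennreal b)"
proof -
  have "ennreal (2 ^ p) = 2 ^ p" using ennreal_power[of 2 p] by simp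
  then show ?thesis using assms by (simp add: ennreal_mult)
qed

lemma ennreal_ex_real_less:
  assumes "e > (0::ennreal)" shows "\<exists>r>0. ennreal r < e"
proof (cases e)
  case (real r)
  then show ?thesis using assms by (intro exI[of _ "r/2"]) (auto simp: ennreal_less_iff)
qed (auto intro!: exI[of _ 1])

text \<open>The error budget for one application of the triangle inequality with factor
  \<open>2 ^ p\<close>.\<close>

lemma ennreal_small_split:
  assumes "e > (0::ennreal)"
  shows "\<exists>d>0. d < \<infinity> \<and> 2 ^ p * (d + d) < e"
proof -
  obtain r where r: "r > 0" "ennreal r < e" using ennreal_ex_real_less[OF assms] by blast
  have "2 ^ p * (ennreal (r / (2 * 2 ^ p)) + ennreal (r / (2 * 2 ^ p))) = ennreal r"
    using r by (subst ennreal_2_power_mult_add[symmetric]) auto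
  then show ?thesis using r by (intro exI[of _ "ennreal (r / (2 * 2 ^ p))"]) auto
qed

lemma lpint_add_le:
  fixes f g :: "'a::euclidean_space \<Rightarrow> 'b::euclidean_space"
  assumes [measurable]: "f \<in> borel_measurable borel" "g \<in> borel_measurable borel"
  shows "lpint p (\<lambda>x. f x + g x) \<le> 2 ^ p * (lpint p f + lpint p g)"
proof -
  have "lpint p (\<lambda>x. f x + g x) \<le> (\<integral>\<^sup>+x. 2 ^ p * (ennreal (norm (f x) ^ p) + ennreal (norm (g x) ^ p)) \<partial>lborel)"
    unfolding lpint_def
    by (intro nn_integral_mono) (simp add: ennreal_2_power_mult_add[symmetric] norm_add_power_le ennreal_leI)
  then show ?thesis by (simp add: lpint_def nn_integral_cmult nn_integral_add)
qed

lemma lpint_minus: "lpint p (\<lambda>x. - f x) = lpint p f"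
  by (simp add: lpint_def)

lemma lpint_diff_commute: "lpint p (\<lambda>x. f x - g x) = lpint p (\<lambda>x. g x - f x)"
  by (simp add: lpint_def norm_minus_commute)

lemma lpint_diff_le:
  fixes f g :: "'a::euclidean_space \<Rightarrow> 'b::euclidean_space"
  assumes [measurable]: "f \<in> borel_measurable borel" "g \<in> borel_measurable borel"
  shows "lpint p (\<lambda>x. f x - g x) \<le> 2 ^ p * (lpint p f + lpint p g)"
  using lpint_add_le[of f "\<lambda>x. - g x" p] by (simp add: lpint_minus)

lemma lpint_triangle:
  fixes f g h :: "'a::euclidean_space \<Rightarrow> 'b::euclidean_space"
  assumes [measurable]: "f \<in> borel_measurable borel" "g \<in> borel_measurable borel" "h \<in> borel_measurable borel"
  shows "lpint p (\<lambda>x. f x - h x) \<le> 2 ^ p * (lpint p (\<lambda>x. f x - g x) + lpint p (\<lambda>x. g x - h x))"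
  using lpint_add_le[of "\<lambda>x. f x - g x" "\<lambda>x. g x - h x" p] by simp

lemma lpint_shift:
  fixes f :: "'a::euclidean_space \<Rightarrow> 'b::euclidean_space"
  assumes [measurable]: "f \<in> borel_measurable borel"
  shows "lpint p (\<lambda>x. f (x - y)) = lpint p f"
  unfolding lpint_def using nn_integral_lborel_shift[of "\<lambda>x. ennreal (norm (f x) ^ p)" "- y"] by simp

text \<open>Radial retraction onto the ball of radius \<open>M\<close>. It bounds the members of an
  approximating sequence and fixes the values of a limit bounded by \<open>M\<close>, so pointwise
  convergence survives.\<close>

definition ball_proj :: "real \<Rightarrow> 'b::real_normed_vector \<Rightarrow> 'b"
  where "ball_proj M v = (1 / max 1 (norm v / M)) *\<^sub>R v"

lemma ball_proj:
  assumes "M > 0"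
  shows "norm (ball_proj M v) \<le> M" "norm v \<le> M \<Longrightarrow> ball_proj M v = v" "continuous_on UNIV (ball_proj M)"
proof -
  have M: "M \<noteq> 0" using assms by simp
  show "norm (ball_proj M v) \<le> M"
    using assms M by (cases "norm v \<le> M") (auto simp: ball_proj_def max_def divide_simps)
  show "norm v \<le> M \<Longrightarrow> ball_proj M v = v"
    using assms M by (auto simp: ball_proj_def max_def divide_simps)
  have "max 1 (norm v / M) \<noteq> 0" for v :: 'b by (metis max.cobounded1 not_one_le_zero)
  then show "continuous_on UNIV (ball_proj M :: 'b \<Rightarrow> 'b)"
    unfolding ball_proj_def[abs_def] using M by (intro continuous_intros) auto
qed

lemma ennreal_tendsto_0_ex_less:
  fixes X :: "nat \<Rightarrow> ennreal"
  assumes "X \<longlonglongrightarrow> 0" "e > 0" shows "\<exists>k. X k < e"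
  using order_tendstoD(2)[OF assms] by (auto simp: eventually_sequentially)

text \<open>A measurable function is an almost everywhere limit of continuous functions. Retracting
  their values and cutting them off in space gives a common majorant, after which dominated
  convergence applies.\<close>

lemma Lp_bounded_approx:
  fixes h :: "'a::euclidean_space \<Rightarrow> 'b::euclidean_space"
  assumes p: "p > 0" and h[measurable]: "h \<in> borel_measurable borel" and M: "M > 0" "\<And>x. norm (h x) \<le> M"
    and s: "\<And>x. norm x > m \<Longrightarrow> h x = 0" and e: "e > (0::ennreal)"
  shows "\<exists>c. continuous_on UNIV c \<and> (\<forall>x. norm x \<ge> m + 1 \<longrightarrow> c x = 0) \<and> lpint p (\<lambda>x. h x - c x) < e"
proof -
  have "h measurable_on UNIV" using h by (intro lebesgue_measurable_imp_measurable_on) (auto simp: measurable_completion)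
  then obtain Nn g where Nn: "negligible Nn" and g: "\<And>k. continuous_on UNIV (g k)"
    "\<And>x. x \<notin> Nn \<Longrightarrow> (\<lambda>k. g k x) \<longlonglongrightarrow> h x"
    unfolding measurable_on_def by auto
  define P :: "'b \<Rightarrow> 'b" where "P = ball_proj M"
  have P: "norm (P v) \<le> M" "norm v \<le> M \<Longrightarrow> P v = v" "continuous_on UNIV P" for v
    using ball_proj[OF M(1)] by (auto simp: P_def)
  define cu where "cu x = max 0 (min 1 (m + 1 - norm x))" for x :: 'a
  define c where "c k x = cu x *\<^sub>R P (g k x)" for k x
  have c: "continuous_on UNIV (c k)" for k
  proof -
    have "continuous_on UNIV (\<lambda>x. P (g k x))" by (rule continuous_on_compose2[OF P(3) g(1)]) auto
    then show ?thesis unfolding c_def cu_def by (intro continuous_intros) auto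
  qed
  have [measurable]: "c k \<in> borel_measurable borel" for k using c borel_measurable_continuous_onI by blast
  have cu: "0 \<le> cu x" "cu x \<le> 1" for x by (auto simp: cu_def)
  have Ph: "cu x *\<^sub>R P (h x) = h x" for x
    using P(2)[OF M(2)[of x]] s[of x] by (cases "norm x > m") (auto simp: cu_def P_def ball_proj_def)
  have nc: "norm (c k x) \<le> M" for k x
    using mult_mono[OF cu(2)[of x] P(1)[of "g k x"]] cu(1) by (auto simp: c_def)
  have "(\<lambda>k. \<integral>\<^sup>+x. ennreal (norm (h x - c k x) ^ p) \<partial>lborel) \<longlonglongrightarrow> (\<integral>\<^sup>+x. 0 \<partial>(lborel :: 'a measure))"
  proof (rule nn_integral_dominated_convergence[where w="\<lambda>x. ennreal ((2 * M) ^ p) * indicator (cball 0 (m+1)) x"])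
    show "AE x in lborel. ennreal (norm (h x - c j x) ^ p) \<le> ennreal ((2 * M) ^ p) * indicator (cball 0 (m+1)) x" for j
    proof (intro AE_I2)
      fix x
      show "ennreal (norm (h x - c j x) ^ p) \<le> ennreal ((2 * M) ^ p) * indicator (cball 0 (m+1)) x"
      proof (cases "norm x \<le> m + 1")
        case True
        have "norm (h x - c j x) \<le> 2 * M" using norm_triangle_ineq4[of "h x" "c j x"] nc[of j x] M(2)[of x] by linarith
        then have "norm (h x - c j x) ^ p \<le> (2 * M) ^ p" by (intro power_mono) auto
        then show ?thesis using True by (simp add: ennreal_leI)
      next
        case False
        then have "h x = 0" "c j x = 0" using s[of x] by (auto simp: c_def cu_def)
        then show ?thesis using p by (simp add: power_0_left)
      qed
    qed
    show "(\<integral>\<^sup>+x. ennreal ((2 * M) ^ p) * indicator (cball 0 (m+1)) x \<partial>(lborel :: 'a measure)) < \<infinity>"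
      using emeasure_lborel_cball_finite[of "0::'a" "m+1"]
      by (simp add: nn_integral_cmult_indicator ennreal_mult_less_top)
    show "(\<lambda>x. ennreal ((2 * M) ^ p) * indicator (cball 0 (m+1)) x) \<in> borel_measurable (lborel :: 'a measure)"
      by (intro borel_measurable_times_ennreal borel_measurable_indicator borel_measurable_const) simp_all
    have "AE x in lebesgue. x \<notin> Nn" using Nn by (simp add: negligible_iff_null_sets AE_not_in)
    then have "AE x in lborel. x \<notin> Nn" by (simp add: AE_completion_iff)
    then show "AE x in lborel. (\<lambda>k. ennreal (norm (h x - c k x) ^ p)) \<longlonglongrightarrow> 0"
    proof eventually_elim
      case (elim x)
      have "(\<lambda>k. P (g k x)) \<longlonglongrightarrow> P (h x)"
        using P(3) g(2)[OF elim] by (metis continuous_on_tendsto_compose UNIV_I eventually_sequentially)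
      then have "(\<lambda>k. c k x) \<longlonglongrightarrow> cu x *\<^sub>R P (h x)" unfolding c_def by (intro tendsto_intros)
      then have "(\<lambda>k. norm (h x - c k x) ^ p) \<longlonglongrightarrow> norm (h x - h x) ^ p"
        unfolding Ph by (intro tendsto_intros)
      moreover have "norm (h x - h x) ^ p = 0" using p by (simp add: power_0_left)
      ultimately have "(\<lambda>k. norm (h x - c k x) ^ p) \<longlonglongrightarrow> 0" by (simp only:)
      then show ?case using tendsto_ennrealI by fastforce
    qed
  qed measurable
  then have "(\<lambda>k. lpint p (\<lambda>x. h x - c k x)) \<longlonglongrightarrow> 0" by (simp add: lpint_def)
  then obtain k where "lpint p (\<lambda>x. h x - c k x) < e" using ennreal_tendsto_0_ex_less e by blast
  moreover have "c k x = 0" if "norm x \<ge> m + 1" for x using that by (simp add: c_def cu_def)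
  ultimately show ?thesis using c by blast
qed

text \<open>Truncation in domain and range at once reduces to bounded functions of bounded support;
  the truncated functions are dominated by \<open>f\<close> itself.\<close>

lemma Lp_approx:
  fixes f :: "'a::euclidean_space \<Rightarrow> 'b::euclidean_space"
  assumes p: "p > 0" and f[measurable]: "f \<in> borel_measurable borel" and fin: "lpint p f < \<infinity>" and e: "e > (0::ennreal)"
  shows "\<exists>c r. continuous_on UNIV c \<and> (\<forall>x. norm x \<ge> r \<longrightarrow> c x = 0) \<and> lpint p (\<lambda>x. f x - c x) < e"
proof -
  define F where "F m x = (if norm x \<le> real m \<and> norm (f x) \<le> real m then f x else 0)" for m :: nat and x
  have [measurable]: "F m \<in> borel_measurable borel" for m unfolding F_def by measurable
  have "(\<lambda>m. \<integral>\<^sup>+x. ennreal (norm (f x - F m x) ^ p) \<partial>lborel) \<longlonglongrightarrow> (\<integral>\<^sup>+x. 0 \<partial>(lborel :: 'a measure))"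
  proof (rule nn_integral_dominated_convergence[where w="\<lambda>x. ennreal (norm (f x) ^ p)"])
    show "AE x in lborel. ennreal (norm (f x - F j x) ^ p) \<le> ennreal (norm (f x) ^ p)" for j
      using p by (intro AE_I2) (auto simp: F_def intro!: ennreal_leI)
    show "AE x in lborel. (\<lambda>m. ennreal (norm (f x - F m x) ^ p)) \<longlonglongrightarrow> 0"
    proof (intro AE_I2 tendsto_eventually)
      fix x
      obtain m0 :: nat where "norm x \<le> real m0" "norm (f x) \<le> real m0"
        by (meson le_cases order_trans real_arch_simple max.cobounded1 max.cobounded2)
      then show "\<forall>\<^sub>F m in sequentially. ennreal (norm (f x - F m x) ^ p) = 0"
        using p by (intro eventually_sequentiallyI[of m0]) (auto simp: F_def)
    qed
    show "(\<integral>\<^sup>+ x. ennreal (norm (f x) ^ p) \<partial>lborel) < \<infinity>" using fin by (simp add: lpint_def)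
  qed measurable
  then have lim: "(\<lambda>m. lpint p (\<lambda>x. f x - F m x)) \<longlonglongrightarrow> 0" by (simp add: lpint_def)
  obtain d where d: "d > 0" "d < \<infinity>" "2 ^ p * (d + d) < e" using ennreal_small_split[OF e] by blast
  then obtain m where m: "lpint p (\<lambda>x. f x - F m x) < d" using ennreal_tendsto_0_ex_less[OF lim] by blast
  obtain c where c: "continuous_on UNIV c" "\<And>x. norm x \<ge> real m + 1 \<Longrightarrow> c x = 0" "lpint p (\<lambda>x. F m x - c x) < d"
    using Lp_bounded_approx[OF p, of "F m" "real m + 1" "real m" d] d(1)
    by (force simp: F_def)
  have [measurable]: "c \<in> borel_measurable borel" using c borel_measurable_continuous_onI by blast
  have "lpint p (\<lambda>x. f x - c x) \<le> 2 ^ p * (lpint p (\<lambda>x. f x - F m x) + lpint p (\<lambda>x. F m x - c x))"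
    by (rule lpint_triangle) measurable
  also have "\<dots> \<le> 2 ^ p * (d + d)" using m c(3) by (intro mult_left_mono add_mono) auto
  also have "\<dots> < e" by (rule d)
  finally show ?thesis using c by blast
qed

text \<open>A continuous \<open>c\<close> of bounded support is compared with its translate by
  uniform continuity on a ball of finite measure. The distance of \<open>f\<close> to
  \<open>c\<close> is unchanged when both are translated.\<close>

lemma Lp_translation_continuous:
  fixes f :: "'a::euclidean_space \<Rightarrow> 'b::euclidean_space"
  assumes p: "p > 0" and f[measurable]: "f \<in> borel_measurable borel" and fin: "lpint p f < \<infinity>" and e: "e > (0::ennreal)"
  shows "\<exists>d>0. \<forall>y. norm y < d \<longrightarrow> lpint p (\<lambda>x. f (x - y) - f x) < e"
proof -
  obtain e1 where e1: "e1 > 0" "e1 < \<infinity>" "2 ^ p * (e1 + e1) < e" using ennreal_small_split[OF e, of p] by blast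
  obtain e2 where e2: "e2 > 0" "e2 < \<infinity>" "2 ^ p * (e2 + e2) < e1" using ennreal_small_split[OF e1(1), of p] by blast
  have "min e1 e2 > 0" using e1 e2 by simp
  obtain c r where c: "continuous_on UNIV c" "\<And>x. norm x \<ge> r \<Longrightarrow> c x = 0" "lpint p (\<lambda>x. f x - c x) < min e1 e2"
    using Lp_approx[OF p f fin \<open>min e1 e2 > 0\<close>] by blast
  have [measurable]: "c \<in> borel_measurable borel" using c borel_measurable_continuous_onI by blast
  define w where "w = measure lborel (cball (0::'a) (r + 1)) + 1"
  have w: "w > 0" by (simp add: w_def add_nonneg_pos)
  obtain s where s: "s > 0" "ennreal s < e2" using ennreal_ex_real_less[OF e2(1)] by blast
  \<comment> \<open>A deviation \<open>\<eta>\<close> on a set of measure at most \<open>w\<close>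
    costs \<open>\<eta> ^ p w\<close>. The bound by 1 gives \<open>\<eta> ^ p \<le> \<eta>\<close>,
    so the cost is at most \<open>s\<close>.\<close>
  define \<eta> where "\<eta> = min 1 (s / w)"
  have \<eta>: "\<eta> > 0" "\<eta> ^ p * w \<le> s"
  proof -
    show \<eta>0: "\<eta> > 0" using s w by (simp add: \<eta>_def)
    have "\<eta> ^ p \<le> \<eta> ^ 1" using p \<eta>0 by (intro power_decreasing) (auto simp: \<eta>_def)
    then have "\<eta> ^ p * w \<le> \<eta> * w" using w by simp
    also have "\<dots> \<le> s / w * w" using w by (intro mult_right_mono) (auto simp: \<eta>_def)
    finally show "\<eta> ^ p * w \<le> s" using w by simp
  qed
  obtain d where d: "d > 0" "\<And>x y. dist y x < d \<Longrightarrow> dist (c y) (c x) < \<eta>"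
    using bounded_support_modulus[OF c(1,2) \<eta>(1)] by blast
  have "lpint p (\<lambda>x. f (x - y) - f x) < e" if y: "norm y < min d 1" for y
  proof -
    have "lpint p (\<lambda>x. c (x - y) - c x) \<le> (\<integral>\<^sup>+x. ennreal (\<eta> ^ p) * indicator (cball 0 (r+1)) x \<partial>(lborel :: 'a measure))"
      unfolding lpint_def
    proof (intro nn_integral_mono)
      fix x
      show "ennreal (norm (c (x - y) - c x) ^ p) \<le> ennreal (\<eta> ^ p) * indicator (cball 0 (r+1)) x"
      proof (cases "norm x \<le> r + 1")
        case True
        have "norm (c (x - y) - c x) \<le> \<eta>" using d(2)[of "x - y" x] y by (simp add: dist_norm)
        then have "norm (c (x - y) - c x) ^ p \<le> \<eta> ^ p" by (intro power_mono) auto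
        then show ?thesis using True by (simp add: ennreal_leI)
      next
        case False
        have "norm x \<le> norm (x - y) + norm y" using norm_triangle_sub[of x "x - y"] by simp
        then have "norm (x - y) \<ge> r" using False y by auto
        then show ?thesis using False c(2) p by (simp add: power_0_left)
      qed
    qed
    also have "\<dots> = ennreal (\<eta> ^ p) * emeasure lborel (cball (0::'a) (r+1))" by (simp add: nn_integral_cmult_indicator)
    also have "\<dots> \<le> ennreal (\<eta> ^ p) * ennreal w"
    proof (intro mult_left_mono)
      have "emeasure lborel (cball (0::'a) (r+1)) = ennreal (measure lborel (cball (0::'a) (r+1)))"
        using emeasure_lborel_cball_finite[of "0::'a" "r+1"] by (intro emeasure_eq_ennreal_measure) auto
      then show "emeasure lborel (cball (0::'a) (r+1)) \<le> ennreal w" by (simp add: w_def ennreal_leI)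
    qed simp
    also have "\<dots> \<le> ennreal s" using \<eta> w by (simp add: ennreal_mult'[symmetric] ennreal_leI)
    finally have 1: "lpint p (\<lambda>x. c (x - y) - c x) \<le> e2" using s by simp
    have 2: "lpint p (\<lambda>x. f (x - y) - c (x - y)) \<le> e1"
      using lpint_shift[of "\<lambda>x. f x - c x" p y] c(3) by (auto intro: less_imp_le)
    have 3: "lpint p (\<lambda>x. c x - f x) \<le> e2" using c(3) by (subst lpint_diff_commute) (auto intro: less_imp_le)
    have "lpint p (\<lambda>x. c (x - y) - f x) \<le> 2 ^ p * (lpint p (\<lambda>x. c (x - y) - c x) + lpint p (\<lambda>x. c x - f x))"
      by (rule lpint_triangle) measurable
    also have "\<dots> \<le> 2 ^ p * (e2 + e2)" using 1 3 by (intro mult_left_mono add_mono) auto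
    finally have 4: "lpint p (\<lambda>x. c (x - y) - f x) \<le> e1" using e2 by simp
    have "lpint p (\<lambda>x. f (x - y) - f x) \<le> 2 ^ p * (lpint p (\<lambda>x. f (x - y) - c (x - y)) + lpint p (\<lambda>x. c (x - y) - f x))"
      by (rule lpint_triangle) measurable
    also have "\<dots> \<le> 2 ^ p * (e1 + e1)" using 2 4 by (intro mult_left_mono add_mono) auto
    also have "\<dots> < e" by (rule e1)
    finally show ?thesis .
  qed
  then show ?thesis using d(1) by (intro exI[of _ "min d 1"]) auto
qed

definition mollifier :: "real \<Rightarrow> ('a::euclidean_space \<Rightarrow> real) \<Rightarrow> bool"
  where "mollifier \<epsilon> \<rho> \<longleftrightarrow> continuous_on UNIV \<rho> \<and> (\<forall>x. \<rho> x \<ge> 0) \<and> (\<forall>x. norm x \<ge> \<epsilon> \<longrightarrow> \<rho> x = 0)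
     \<and> integrable lborel \<rho> \<and> (\<integral>x. \<rho> x \<partial>lborel) = 1"

text \<open>Convexity: the graph of the power lies above its tangent at \<open>m\<close>. For
  \<open>m > 0\<close> this is Bernoulli's inequality for \<open>t / m\<close>.\<close>

lemma tangent_power_le:
  fixes m t :: real
  assumes "m \<ge> 0" "t \<ge> 0" "p > 0"
  shows "m ^ p + real p * m ^ (p - 1) * (t - m) \<le> t ^ p"
proof -
  have "real p * m ^ (p - 1) * (t - m) \<le> t ^ p - m ^ p"
  proof (cases "m = 0")
    case True then show ?thesis using assms by (cases p) (auto simp: power_0_left)
  next
    case False
    then have m: "m > 0" using assms by simp
    have "1 + real p * (t / m - 1) \<le> (1 + (t / m - 1)) ^ p"
      using assms m by (intro Bernoulli_inequality) auto
    then have "m ^ p * (1 + real p * (t / m - 1)) \<le> m ^ p * (t / m) ^ p" using m by simp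
    also have "m ^ p * (t / m) ^ p = t ^ p" using m by (simp add: power_divide)
    also have "m ^ p * (1 + real p * (t / m - 1)) = m ^ p + real p * m ^ (p - 1) * (t - m)"
      using m assms by (cases p) (auto simp: field_simps)
    finally show ?thesis by simp
  qed
  then show ?thesis by simp
qed

text \<open>Jensen's inequality for the probability density \<open>\<rho>\<close>. The tangent
  inequality at the mean \<open>m\<close> of \<open>norm (h y)\<close> is integrated, and the linear
  term cancels there.\<close>

lemma weighted_jensen_power:
  fixes h :: "'a::euclidean_space \<Rightarrow> 'b::euclidean_space"
  assumes p: "p > 0" and \<rho>: "\<And>x. \<rho> x \<ge> (0::real)" "integrable lborel \<rho>" "(\<integral>x. \<rho> x \<partial>lborel) = 1"
    and h[measurable]: "h \<in> borel_measurable borel" and i: "integrable lborel (\<lambda>y. \<rho> y *\<^sub>R h y)"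
  shows "ennreal (norm (\<integral>y. \<rho> y *\<^sub>R h y \<partial>lborel) ^ p) \<le> (\<integral>\<^sup>+y. ennreal (\<rho> y * norm (h y) ^ p) \<partial>lborel)"
proof (cases "(\<integral>\<^sup>+y. ennreal (\<rho> y * norm (h y) ^ p) \<partial>lborel) = \<infinity>")
  case False
  have [measurable]: "\<rho> \<in> borel_measurable borel" using \<rho>(2) by auto
  have ip: "integrable lborel (\<lambda>y. \<rho> y * norm (h y) ^ p)"
    using False \<rho>(1) by (intro integrableI_nonneg) (auto simp: less_top)
  have i1: "integrable lborel (\<lambda>y. \<rho> y * norm (h y))"
    using integrable_norm[OF i] \<rho>(1) by (simp add: abs_of_nonneg)
  define m where "m = (\<integral>y. \<rho> y * norm (h y) \<partial>lborel)"
  have m: "m \<ge> 0" unfolding m_def using \<rho>(1) by (intro Bochner_Integration.integral_nonneg) auto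
  have nm: "norm (\<integral>y. \<rho> y *\<^sub>R h y \<partial>lborel) \<le> m"
    using integral_norm_bound[of lborel "\<lambda>y. \<rho> y *\<^sub>R h y"] \<rho>(1) by (simp add: m_def abs_of_nonneg)
  have "m ^ p = (\<integral>y. (m ^ p - real p * m ^ (p - 1) * m) * \<rho> y + real p * m ^ (p - 1) * (\<rho> y * norm (h y)) \<partial>lborel)"
    using i1 \<rho> by (subst Bochner_Integration.integral_add) (auto simp: m_def[symmetric] simp del: mult_minus_left)
  also have "\<dots> \<le> (\<integral>y. \<rho> y * norm (h y) ^ p \<partial>lborel)"
  proof (rule integral_mono[OF _ ip])
    show "integrable lborel (\<lambda>y. (m ^ p - real p * m ^ (p - 1) * m) * \<rho> y + real p * m ^ (p - 1) * (\<rho> y * norm (h y)))"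
      using i1 \<rho> by auto
    fix y
    have "\<rho> y * (m ^ p + real p * m ^ (p - 1) * (norm (h y) - m)) \<le> \<rho> y * norm (h y) ^ p"
      using tangent_power_le[OF m _ p, of "norm (h y)"] \<rho>(1) by (intro mult_left_mono) auto
    then show "(m ^ p - real p * m ^ (p - 1) * m) * \<rho> y + real p * m ^ (p - 1) * (\<rho> y * norm (h y)) \<le> \<rho> y * norm (h y) ^ p"
      by (simp add: algebra_simps)
  qed
  finally have "norm (\<integral>y. \<rho> y *\<^sub>R h y \<partial>lborel) ^ p \<le> (\<integral>y. \<rho> y * norm (h y) ^ p \<partial>lborel)"
    using power_mono[OF nm norm_ge_zero, of p] by simp
  then show ?thesis using \<rho>(1) by (subst nn_integral_eq_integral[OF ip]) (auto intro: ennreal_leI)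
qed simp

lemma conv_commute:
  fixes f :: "'a::euclidean_space \<Rightarrow> 'b::euclidean_space"
  assumes [measurable]: "f \<in> borel_measurable borel" "\<rho> \<in> borel_measurable borel"
  shows "conv f \<rho> x = (\<integral>y. \<rho> y *\<^sub>R f (x - y) \<partial>lborel)"
  using integral_lborel_reflect[of "\<lambda>y. \<rho> y *\<^sub>R f (x - y)" x] by (simp add: conv_def)

text \<open>The error \<open>conv f \<rho> - f\<close> is the average of
  \<open>f (x - y) - f x\<close> with weight \<open>\<rho> y\<close>. Jensen's inequality and Fubini
  turn its norm into an average of translation errors over
  \<open>norm y < \<epsilon>\<close>.\<close>

lemma lpint_conv_diff_le:
  fixes f :: "'a::euclidean_space \<Rightarrow> 'b::euclidean_space"
  assumes p: "p > 0" and f: "integrable lborel f" and \<rho>: "mollifier \<epsilon> \<rho>"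
    and d: "\<And>y. norm y < \<epsilon> \<Longrightarrow> lpint p (\<lambda>x. f (x - y) - f x) \<le> e"
  shows "lpint p (\<lambda>x. conv f \<rho> x - f x) \<le> e"
proof -
  note \<rho> = \<rho>[unfolded mollifier_def]
  have [measurable]: "f \<in> borel_measurable borel" using f by auto
  have [measurable]: "\<rho> \<in> borel_measurable borel" using \<rho> by auto
  have \<rho>0: "\<rho> x \<ge> 0" for x using \<rho> by auto
  have "\<exists>M. \<forall>x. norm (\<rho> x) \<le> M" using \<rho> by (intro bounded_support_uniformly_continuous(2)[of _ \<epsilon>]) auto
  then obtain M where M: "\<And>x. norm (\<rho> x) \<le> M" by blast
  have i: "integrable lborel (\<lambda>y. \<rho> y *\<^sub>R f (x - y))" for x
  proof -
    have "integrable lborel (\<lambda>y. \<rho> (x - y) *\<^sub>R f y)"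
      using \<rho> by (intro conv_integrable[OF f _ M]) auto
    from integrable_lborel_reflect[OF this, where x=x] show ?thesis by simp
  qed
  have eq: "conv f \<rho> x - f x = (\<integral>y. \<rho> y *\<^sub>R (f (x - y) - f x) \<partial>lborel)" for x
  proof -
    have "(\<integral>y. \<rho> y *\<^sub>R (f (x - y) - f x) \<partial>lborel) = (\<integral>y. \<rho> y *\<^sub>R f (x - y) - \<rho> y *\<^sub>R f x \<partial>lborel)"
      by (simp add: scaleR_diff_right)
    also have "\<dots> = (\<integral>y. \<rho> y *\<^sub>R f (x - y) \<partial>lborel) - (\<integral>y. \<rho> y *\<^sub>R f x \<partial>lborel)"
      using i \<rho> by (intro Bochner_Integration.integral_diff) auto
    also have "(\<integral>y. \<rho> y *\<^sub>R f x \<partial>lborel) = f x" using \<rho> by simp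
    finally show ?thesis by (simp add: conv_commute)
  qed
  have "lpint p (\<lambda>x. conv f \<rho> x - f x) \<le> (\<integral>\<^sup>+x. \<integral>\<^sup>+y. ennreal (\<rho> y * norm (f (x - y) - f x) ^ p) \<partial>lborel \<partial>lborel)"
    unfolding lpint_def eq
  proof (intro nn_integral_mono weighted_jensen_power p)
    fix x
    have "integrable lborel (\<lambda>y. \<rho> y *\<^sub>R f (x - y) - \<rho> y *\<^sub>R f x)"
      using i \<rho> by (intro Bochner_Integration.integrable_diff) auto
    then show "integrable lborel (\<lambda>y. \<rho> y *\<^sub>R (f (x - y) - f x))" by (simp add: scaleR_diff_right)
  qed (use \<rho> in auto)
  also have "\<dots> = (\<integral>\<^sup>+y. \<integral>\<^sup>+x. ennreal (\<rho> y * norm (f (x - y) - f x) ^ p) \<partial>lborel \<partial>lborel)"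
    by (rule lborel_pair.Fubini') measurable
  also have "\<dots> = (\<integral>\<^sup>+y. ennreal (\<rho> y) * lpint p (\<lambda>x. f (x - y) - f x) \<partial>lborel)"
    unfolding lpint_def using \<rho>0 by (subst nn_integral_cmult[symmetric]) (auto simp: ennreal_mult)
  also have "\<dots> \<le> (\<integral>\<^sup>+y. ennreal (\<rho> y) * e \<partial>lborel)"
  proof (intro nn_integral_mono)
    fix y show "ennreal (\<rho> y) * lpint p (\<lambda>x. f (x - y) - f x) \<le> ennreal (\<rho> y) * e"
      using d[of y] \<rho> by (cases "norm y < \<epsilon>") (auto intro!: mult_left_mono)
  qed
  also have "\<dots> = (\<integral>\<^sup>+y. ennreal (\<rho> y) \<partial>lborel) * e" by (simp add: nn_integral_multc)
  also have "(\<integral>\<^sup>+y. ennreal (\<rho> y) \<partial>lborel) = 1" using \<rho> by (subst nn_integral_eq_integral) auto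
  finally show ?thesis by simp
qed

lemma Lp_mollify:
  fixes f :: "'a::euclidean_space \<Rightarrow> 'b::euclidean_space"
  assumes p: "p > 0" and f: "integrable lborel f" and fin: "lpint p f < \<infinity>" and e: "e > (0::ennreal)"
  shows "\<exists>d>0. \<forall>\<rho> \<epsilon>. \<epsilon> \<le> d \<longrightarrow> mollifier \<epsilon> \<rho> \<longrightarrow> lpint p (\<lambda>x. conv f \<rho> x - f x) \<le> e"
proof -
  obtain d where "d > 0" "\<And>y. norm y < d \<Longrightarrow> lpint p (\<lambda>x. f (x - y) - f x) < e"
    using Lp_translation_continuous[OF p _ fin e] f by auto
  then show ?thesis
    by (intro exI[of _ d] conjI allI impI lpint_conv_diff_le[OF p f]) (auto intro: less_imp_le)
qed

lemma ex_smooth_mollifier: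
  assumes "\<epsilon> > 0"
  shows "\<exists>\<rho> :: real ^ 'n::finite \<Rightarrow> real. mollifier \<epsilon> \<rho> \<and> smooth_bump \<rho>"
proof -
  obtain \<rho> :: "real ^ 'n \<Rightarrow> real" where \<rho>: "(\<forall>k. C_k k \<rho>) \<and> (\<forall>x. \<rho> x \<ge> 0) \<and> (\<forall>x. norm x \<ge> \<epsilon> \<longrightarrow> \<rho> x = 0)
    \<and> integrable lborel \<rho> \<and> (\<integral>x. \<rho> x \<partial>lborel) = 1" using ex_mollifier[OF assms] by blast
  then have "continuous_on UNIV \<rho>" using C_k_continuous by blast
  then show ?thesis using \<rho> unfolding mollifier_def smooth_bump_def by blast
qed

lemma conv_outside_support:
  assumes "\<And>x. x \<notin> cball z r \<Longrightarrow> f x = 0" "\<And>x. norm x \<ge> \<epsilon> \<Longrightarrow> \<rho> x = 0" "x \<notin> cball z (r + \<epsilon>)"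
  shows "conv f \<rho> x = 0"
proof -
  have "\<rho> (x - y) *\<^sub>R f y = 0" for y
  proof (cases "y \<in> cball z r")
    case True
    then have "norm (x - y) \<ge> \<epsilon>" using assms(3) dist_triangle[of z x y]
      by (auto simp: dist_norm norm_minus_commute)
    then show ?thesis using assms(2) by simp
  qed (simp add: assms)
  then show ?thesis by (simp only: conv_def Bochner_Integration.integral_zero)
qed

lemma weighted_average_close:
  fixes f :: "'a::euclidean_space \<Rightarrow> 'b::euclidean_space"
  assumes \<rho>: "mollifier \<epsilon> \<rho>" and f: "continuous_on UNIV f" "\<And>x. norm (f x) \<le> M"
    and d: "\<And>y. norm y < \<epsilon> \<Longrightarrow> norm (f (x - y) - f x) \<le> e"
  shows "norm ((\<integral>y. \<rho> y *\<^sub>R f (x - y) \<partial>lborel) - f x) \<le> e"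
proof -
  note \<rho> = \<rho>[unfolded mollifier_def]
  have [measurable]: "f \<in> borel_measurable borel" using f borel_measurable_continuous_onI by blast
  have i: "integrable lborel (\<lambda>y. \<rho> y *\<^sub>R f (x - y))"
    by (rule integrable_scaleR_bounded[of _ _ _ M]) (use \<rho> f in auto)
  have i': "integrable lborel (\<lambda>y. \<rho> y *\<^sub>R f (x - y) - \<rho> y *\<^sub>R f x)"
    using i \<rho> by (intro Bochner_Integration.integrable_diff) auto
  have "(\<integral>y. \<rho> y *\<^sub>R f (x - y) \<partial>lborel) - f x = (\<integral>y. \<rho> y *\<^sub>R f (x - y) - \<rho> y *\<^sub>R f x \<partial>lborel)"
    using i \<rho> by (subst Bochner_Integration.integral_diff) auto
  also have "norm \<dots> \<le> (\<integral>y. \<rho> y * e \<partial>lborel)"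
  proof (rule Bochner_Integration.integral_norm_bound_integral[OF i'])
    fix y
    have "norm (\<rho> y *\<^sub>R f (x - y) - \<rho> y *\<^sub>R f x) = \<rho> y * norm (f (x - y) - f x)"
      using \<rho> by (simp flip: scaleR_diff_right)
    also have "\<dots> \<le> \<rho> y * e" using d[of y] \<rho> by (cases "norm y < \<epsilon>") (auto intro!: mult_left_mono)
    finally show "norm (\<rho> y *\<^sub>R f (x - y) - \<rho> y *\<^sub>R f x) \<le> \<rho> y * e" .
  qed (use \<rho> in auto)
  also have "\<dots> = e" using \<rho> by simp
  finally show ?thesis .
qed

text \<open>Bridges the C1 functions that generate the Sobolev class and the smooth functions with
  which the equation may be tested. The support grows from radius \<open>r\<close> to
  \<open>r'\<close>.\<close>

lemma C1_uniform_smooth_approx: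
  fixes \<phi> :: "real ^ 'n::finite \<Rightarrow> real"
  assumes C: "C1_grad \<phi> g" and s: "\<And>x. x \<notin> cball z r \<Longrightarrow> \<phi> x = 0" and r': "r < r'" and e: "e > 0"
  shows "\<exists>\<psi>. (\<forall>k. C_k k \<psi>) \<and> (\<forall>x. x \<notin> cball z r' \<longrightarrow> \<psi> x = 0) \<and>
    (\<forall>x. norm (\<psi> x - \<phi> x) \<le> e) \<and> (\<forall>x. norm (gradient \<psi> x - g x) \<le> e)"
proof -
  have far: "x \<notin> cball z r" if "norm x \<ge> norm z + r + 1" for x
    using that norm_triangle_sub[of x z] by (auto simp: dist_norm norm_minus_commute)
  have s\<phi>: "\<phi> x = 0" if "norm x \<ge> norm z + r + 1" for x using s far[OF that] by simp
  have sg: "g x = 0" if "norm x \<ge> norm z + r + 1" for x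
    using gradient_zero_outside[OF C closed_cball s far[OF that]] by blast
  note c = C1_grad_cont[OF C]
  have [measurable]: "\<phi> \<in> borel_measurable borel" "g \<in> borel_measurable borel" using C1_grad_borel[OF C] by auto
  obtain d1 where d1: "d1 > 0" "\<And>x y. dist y x < d1 \<Longrightarrow> dist (\<phi> y) (\<phi> x) < e"
    using bounded_support_modulus[OF c(1) s\<phi> e] by blast
  obtain d2 where d2: "d2 > 0" "\<And>x y. dist y x < d2 \<Longrightarrow> dist (g y) (g x) < e"
    using bounded_support_modulus[OF c(2) sg e] by blast
  obtain M1 where M1: "\<And>x. norm (\<phi> x) \<le> M1" using bounded_support_uniformly_continuous(2)[OF c(1) s\<phi>] by blast
  obtain M2 where M2: "\<And>x. norm (g x) \<le> M2" using bounded_support_uniformly_continuous(2)[OF c(2) sg] by blast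
  define \<epsilon> where "\<epsilon> = min (r' - r) (min d1 d2)"
  have "\<epsilon> > 0" using r' d1 d2 by (simp add: \<epsilon>_def)
  then obtain \<rho> :: "real ^ 'n \<Rightarrow> real" where \<rho>: "mollifier \<epsilon> \<rho>" "smooth_bump \<rho>" using ex_smooth_mollifier by blast
  have [measurable]: "\<rho> \<in> borel_measurable borel" using \<rho>(1) by (auto simp: mollifier_def)
  have i\<phi>: "integrable lborel \<phi>" by (rule integrable_bounded_support[OF c(1) s\<phi>])
  have Ck: "C_k k (conv \<phi> \<rho>)" for k by (rule C_k_conv[OF i\<phi> \<rho>(2)])
  \<comment> \<open>With function and kernel exchanged the derivative falls on
    \<open>\<phi>\<close>, so the gradient of the mollified function is an average of
    \<open>g\<close> and uniformly close to it.\<close>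
  have sym: "conv \<phi> \<rho> = conv \<rho> \<phi>"
    by (rule ext) (subst conv_commute; simp add: conv_def mult.commute)
  have "integrable lborel \<rho>" using \<rho>(1) by (auto simp: mollifier_def)
  from conv_C1_grad[OF this C s\<phi>, folded sym]
  have gr: "gradient (conv \<phi> \<rho>) = (\<lambda>x. \<integral>y. \<rho> y *\<^sub>R g (x - y) \<partial>lborel)" by (rule C1_grad_gradient)
  have "norm (conv \<phi> \<rho> x - \<phi> x) \<le> e" for x
    unfolding conv_commute[of \<phi> \<rho>, simplified]
  proof (rule weighted_average_close[OF \<rho>(1) c(1) M1, unfolded real_scaleR_def])
    show "norm (\<phi> (x - y) - \<phi> x) \<le> e" if "norm y < \<epsilon>" for y
      using d1(2)[of "x - y" x] that by (auto simp: dist_norm \<epsilon>_def)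
  qed
  moreover have "norm (gradient (conv \<phi> \<rho>) x - g x) \<le> e" for x
    unfolding gr
  proof (rule weighted_average_close[OF \<rho>(1) c(2) M2])
    show "norm (g (x - y) - g x) \<le> e" if "norm y < \<epsilon>" for y
      using d2(2)[of "x - y" x] that by (auto simp: dist_norm \<epsilon>_def)
  qed
  moreover have "conv \<phi> \<rho> x = 0" if "x \<notin> cball z r'" for x
    by (rule conv_outside_support[where z=z and r=r and \<epsilon>=\<epsilon>]) (use s \<rho>(1) that in \<open>auto simp: mollifier_def \<epsilon>_def\<close>)
  ultimately show ?thesis using Ck by blast
qed

subsection \<open>Compactly supported Sobolev functions\<close>

text \<open>
  \<open>v\<close> belongs to the Sobolev space \<open>W\<^sub>0\<^sup>1\<^sup>,\<^sup>n\<close> of the ball of radius \<open>r\<close> around \<open>z\<close> and \<open>g\<close> is its gradient;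
  both are everywhere defined Borel functions on the whole space, zero outside the ball.
\<close>

definition H0 :: "real ^ 'n::finite \<Rightarrow> real \<Rightarrow> (real ^ 'n \<Rightarrow> real) \<Rightarrow> (real ^ 'n \<Rightarrow> real ^ 'n) \<Rightarrow> bool"
  where "H0 z r v g \<longleftrightarrow> v \<in> borel_measurable borel \<and> g \<in> borel_measurable borel \<and>
    (\<forall>x. x \<notin> cball z r \<longrightarrow> v x = 0 \<and> g x = 0) \<and> lpint CARD('n) v < \<infinity> \<and> lpint CARD('n) g < \<infinity> \<and>
    (\<forall>e>0. \<exists>\<phi> \<psi>. C1_grad \<phi> \<psi> \<and> (\<forall>x. x \<notin> cball z r \<longrightarrow> \<phi> x = 0) \<and>
      lpint CARD('n) (\<lambda>x. \<phi> x - v x) < e \<and> lpint CARD('n) (\<lambda>x. \<psi> x - g x) < e)"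

lemma H0_borel [measurable_dest]:
  "H0 z r v g \<Longrightarrow> v \<in> borel_measurable borel" "H0 z r v g \<Longrightarrow> g \<in> borel_measurable borel"
  by (auto simp: H0_def)

lemma H0_outside: "H0 z r v g \<Longrightarrow> x \<notin> cball z r \<Longrightarrow> v x = 0" "H0 z r v g \<Longrightarrow> x \<notin> cball z r \<Longrightarrow> g x = 0"
  by (auto simp: H0_def)

lemma H0_finite: "H0 z r v g \<Longrightarrow> lpint CARD('n) v < \<infinity>" "H0 z r v g \<Longrightarrow> lpint CARD('n) g < \<infinity>"
  for v :: "real ^ 'n::finite \<Rightarrow> real"
  by (auto simp: H0_def)

text \<open>Approximation of approximants: membership for compositions, sums, products and positive
  parts is obtained by exhibiting them as limits and concluding here. Finiteness of the limit is
  inherited from a single approximant at distance below 1.\<close>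

lemma H0_closed:
  fixes v :: "real ^ 'n::finite \<Rightarrow> real"
  assumes [measurable]: "v \<in> borel_measurable borel" "g \<in> borel_measurable borel"
    and out: "\<And>x. x \<notin> cball z r \<Longrightarrow> v x = 0" "\<And>x. x \<notin> cball z r \<Longrightarrow> g x = 0"
    and lim: "\<And>e. e > 0 \<Longrightarrow> \<exists>v' g'. H0 z r v' g' \<and> lpint CARD('n) (\<lambda>x. v' x - v x) < e \<and> lpint CARD('n) (\<lambda>x. g' x - g x) < e"
  shows "H0 z r v g"
proof -
  obtain v1 g1 where 1: "H0 z r v1 g1" "lpint CARD('n) (\<lambda>x. v1 x - v x) < 1" "lpint CARD('n) (\<lambda>x. g1 x - g x) < 1"
    using lim[of 1] by auto
  note [measurable] = H0_borel[OF 1(1)]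
  have t: "2 ^ p * (a + b) < (top::ennreal)" if "a < top" "b < 1" for a b p
    using that order.strict_trans[OF that(2) ennreal_one_less_top]
    by (auto simp: ennreal_mult_less_top power_less_top_ennreal)
  have "lpint CARD('n) v \<le> 2 ^ CARD('n) * (lpint CARD('n) v1 + lpint CARD('n) (\<lambda>x. v1 x - v x))"
    using lpint_diff_le[of v1 "\<lambda>x. v1 x - v x" "CARD('n)"] by simp
  also have "\<dots> < top" using 1 H0_finite[OF 1(1)] by (intro t) auto
  finally have fv: "lpint CARD('n) v < \<infinity>" by simp
  have "lpint CARD('n) g \<le> 2 ^ CARD('n) * (lpint CARD('n) g1 + lpint CARD('n) (\<lambda>x. g1 x - g x))"
    using lpint_diff_le[of g1 "\<lambda>x. g1 x - g x" "CARD('n)"] by simp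
  also have "\<dots> < top" using 1 H0_finite[OF 1(1)] by (intro t) auto
  finally have fg: "lpint CARD('n) g < \<infinity>" by simp
  have "\<exists>\<phi> \<psi>. C1_grad \<phi> \<psi> \<and> (\<forall>x. x \<notin> cball z r \<longrightarrow> \<phi> x = 0) \<and>
      lpint CARD('n) (\<lambda>x. \<phi> x - v x) < e \<and> lpint CARD('n) (\<lambda>x. \<psi> x - g x) < e" if "e > 0" for e
  proof -
    obtain d where d: "d > 0" "2 ^ CARD('n) * (d + d) < e" using ennreal_small_split[OF \<open>e > 0\<close>, of "CARD('n)"] by blast
    obtain v1 g1 where 1: "H0 z r v1 g1" "lpint CARD('n) (\<lambda>x. v1 x - v x) < d" "lpint CARD('n) (\<lambda>x. g1 x - g x) < d"
      using lim[OF d(1)] by blast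
    note [measurable] = H0_borel[OF 1(1)]
    obtain \<phi> \<psi> where 2: "C1_grad \<phi> \<psi>" "\<forall>x. x \<notin> cball z r \<longrightarrow> \<phi> x = 0"
      "lpint CARD('n) (\<lambda>x. \<phi> x - v1 x) < d" "lpint CARD('n) (\<lambda>x. \<psi> x - g1 x) < d"
      using 1(1) d(1) unfolding H0_def by meson
    note [measurable] = C1_grad_borel[OF 2(1)]
    have "lpint CARD('n) (\<lambda>x. \<phi> x - v x) \<le> 2 ^ CARD('n) * (lpint CARD('n) (\<lambda>x. \<phi> x - v1 x) + lpint CARD('n) (\<lambda>x. v1 x - v x))"
      by (rule lpint_triangle) measurable
    also have "\<dots> \<le> 2 ^ CARD('n) * (d + d)" using 1 2 by (intro mult_left_mono add_mono) auto
    finally have a: "lpint CARD('n) (\<lambda>x. \<phi> x - v x) < e" using d(2) by simp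
    have "lpint CARD('n) (\<lambda>x. \<psi> x - g x) \<le> 2 ^ CARD('n) * (lpint CARD('n) (\<lambda>x. \<psi> x - g1 x) + lpint CARD('n) (\<lambda>x. g1 x - g x))"
      by (rule lpint_triangle) measurable
    also have "\<dots> \<le> 2 ^ CARD('n) * (d + d)" using 1 2 by (intro mult_left_mono add_mono) auto
    finally have "lpint CARD('n) (\<lambda>x. \<psi> x - g x) < e" using d(2) by simp
    with a 2 show ?thesis by blast
  qed
  then show ?thesis using fv fg out unfolding H0_def by auto
qed

lemma H0_closed_seq:
  fixes v :: "real ^ 'n::finite \<Rightarrow> real"
  assumes "v \<in> borel_measurable borel" "g \<in> borel_measurable borel"
    and "\<And>x. x \<notin> cball z r \<Longrightarrow> v x = 0" "\<And>x. x \<notin> cball z r \<Longrightarrow> g x = 0"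
    and H: "\<And>k::nat. H0 z r (V k) (G k)"
    and lim: "(\<lambda>k. lpint CARD('n) (\<lambda>x. V k x - v x)) \<longlonglongrightarrow> 0" "(\<lambda>k. lpint CARD('n) (\<lambda>x. G k x - g x)) \<longlonglongrightarrow> 0"
  shows "H0 z r v g"
proof (rule H0_closed[OF assms(1-4)])
  fix e :: ennreal assume "e > 0"
  then have "\<forall>\<^sub>F k in sequentially. lpint CARD('n) (\<lambda>x. V k x - v x) < e \<and> lpint CARD('n) (\<lambda>x. G k x - g x) < e"
    using order_tendstoD(2)[OF lim(1)] order_tendstoD(2)[OF lim(2)] by (intro eventually_conj) auto
  then show "\<exists>v' g'. H0 z r v' g' \<and> lpint CARD('n) (\<lambda>x. v' x - v x) < e \<and> lpint CARD('n) (\<lambda>x. g' x - g x) < e"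
    using H unfolding eventually_sequentially by blast
qed

lemma C1_grad_H0:
  fixes \<phi> :: "real ^ 'n::finite \<Rightarrow> real"
  assumes C: "C1_grad \<phi> \<psi>" and s: "\<And>x. x \<notin> cball z r \<Longrightarrow> \<phi> x = 0"
  shows "H0 z r \<phi> \<psi>"
proof -
  have s': "\<psi> x = 0" if "x \<notin> cball z r" for x by (rule gradient_zero_outside[OF C closed_cball s that])
  have fin: "lpint CARD('n) f < \<infinity>" if "continuous_on UNIV f" "\<And>x. x \<notin> cball z r \<Longrightarrow> f x = 0" for f :: "real ^ 'n \<Rightarrow> 'b::euclidean_space"
  proof -
    have "integrable lborel (\<lambda>x. indicator (cball z r) x *\<^sub>R (norm (f x) ^ CARD('n)))"
      using that(1) by (intro borel_integrable_compact continuous_intros) (auto intro: continuous_on_subset)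
    also have "(\<lambda>x. indicator (cball z r) x *\<^sub>R (norm (f x) ^ CARD('n))) = (\<lambda>x. norm (f x) ^ CARD('n))"
      using that(2) by (auto simp: fun_eq_iff power_0_left indicator_def)
    finally show ?thesis unfolding lpint_def using nn_integral_eq_integral[of lborel "\<lambda>x. norm (f x) ^ CARD('n)"] by simp
  qed
  show ?thesis unfolding H0_def
    using C1_grad_borel[OF C] s s' fin[OF C1_grad_cont(1)[OF C]] fin[OF C1_grad_cont(2)[OF C]] C
    by (auto intro!: exI[of _ \<phi>] exI[of _ \<psi>] simp: lpint_def power_0_left)
qed

lemma tendsto_0_le_ennreal:
  fixes X Y :: "nat \<Rightarrow> ennreal"
  assumes "Y \<longlonglongrightarrow> 0" "\<And>k. X k \<le> Y k" shows "X \<longlonglongrightarrow> 0"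
  by (rule tendsto_sandwich[OF _ _ tendsto_const assms(1)]) (use assms(2) in auto)

lemma lpint_tendsto_0_AE_subseq:
  fixes f :: "nat \<Rightarrow> 'a::euclidean_space \<Rightarrow> 'b::euclidean_space"
  assumes p: "p > 0" and [measurable]: "\<And>k. f k \<in> borel_measurable borel" and lim: "(\<lambda>k. lpint p (f k)) \<longlonglongrightarrow> 0" and fin: "\<And>k. lpint p (f k) < \<infinity>"
  shows "\<exists>s. strict_mono s \<and> (AE x in lborel. (\<lambda>k. f (s k) x) \<longlonglongrightarrow> 0)"
proof -
  have i: "integrable lborel (\<lambda>x. norm (f k x) ^ p)" for k
    using fin[of k] by (intro integrableI_nonneg) (auto simp: lpint_def)
  have eq: "(\<integral>x. norm (norm (f k x) ^ p) \<partial>lborel) = enn2real (lpint p (f k))" for k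
    unfolding lpint_def by (subst integral_eq_nn_integral) auto
  have "(\<lambda>k. enn2real (lpint p (f k))) \<longlonglongrightarrow> enn2real 0"
    by (rule tendsto_enn2real) (use lim in auto)
  then have "(\<lambda>k. \<integral>x. norm (norm (f k x) ^ p) \<partial>lborel) \<longlonglongrightarrow> 0" by (simp only: eq) simp
  from tendsto_L1_AE_subseq[OF i this]
  obtain s where s: "strict_mono s" "AE x in lborel. (\<lambda>k. norm (f (s k) x) ^ p) \<longlonglongrightarrow> 0" by blast
  have "AE x in lborel. (\<lambda>k. f (s k) x) \<longlonglongrightarrow> 0" using s(2)
  proof eventually_elim
    case (elim x)
    then have "(\<lambda>k. root p (norm (f (s k) x) ^ p)) \<longlonglongrightarrow> root p 0" by (rule tendsto_real_root)
    then show ?case using p by (simp add: real_root_power_cancel tendsto_norm_zero_iff)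
  qed
  with s(1) show ?thesis by blast
qed

text \<open>Besides convergence in norm, a subsequence converges almost everywhere. Nonlinear
  functions of the approximants need this to pass to the limit.\<close>

lemma H0_seq:
  fixes v :: "real ^ 'n::finite \<Rightarrow> real"
  assumes H: "H0 z r v g"
  obtains \<phi> \<psi> where "\<And>k::nat. C1_grad (\<phi> k) (\<psi> k)" "\<And>k x. x \<notin> cball z r \<Longrightarrow> \<phi> k x = 0"
    "(\<lambda>k. lpint CARD('n) (\<lambda>x. \<phi> k x - v x)) \<longlonglongrightarrow> 0" "(\<lambda>k. lpint CARD('n) (\<lambda>x. \<psi> k x - g x)) \<longlonglongrightarrow> 0"
    "AE x in lborel. (\<lambda>k. \<phi> k x) \<longlonglongrightarrow> v x"
proof -
  have "\<forall>k::nat. \<exists>p. C1_grad (fst p) (snd p) \<and> (\<forall>x. x \<notin> cball z r \<longrightarrow> fst p x = 0) \<and>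
      lpint CARD('n) (\<lambda>x. fst p x - v x) < ennreal (1 / Suc k) \<and> lpint CARD('n) (\<lambda>x. snd p x - g x) < ennreal (1 / Suc k)"
  proof
    fix k :: nat
    have "ennreal (1 / Suc k) > 0" by simp
    then obtain \<phi> \<psi> where "C1_grad \<phi> \<psi> \<and> (\<forall>x. x \<notin> cball z r \<longrightarrow> \<phi> x = 0) \<and>
      lpint CARD('n) (\<lambda>x. \<phi> x - v x) < ennreal (1 / Suc k) \<and> lpint CARD('n) (\<lambda>x. \<psi> x - g x) < ennreal (1 / Suc k)"
      using H unfolding H0_def by blast
    then show "\<exists>p. C1_grad (fst p) (snd p) \<and> (\<forall>x. x \<notin> cball z r \<longrightarrow> fst p x = 0) \<and>
      lpint CARD('n) (\<lambda>x. fst p x - v x) < ennreal (1 / Suc k) \<and> lpint CARD('n) (\<lambda>x. snd p x - g x) < ennreal (1 / Suc k)"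
      by (intro exI[of _ "(\<phi>, \<psi>)"]) simp
  qed
  then obtain P where P: "\<And>k::nat. C1_grad (fst (P k)) (snd (P k))" "\<And>k x. x \<notin> cball z r \<Longrightarrow> fst (P k) x = 0"
      "\<And>k. lpint CARD('n) (\<lambda>x. fst (P k) x - v x) < ennreal (1 / Suc k)"
      "\<And>k. lpint CARD('n) (\<lambda>x. snd (P k) x - g x) < ennreal (1 / Suc k)"
    using choice[of "\<lambda>k p. C1_grad (fst p) (snd p) \<and> (\<forall>x. x \<notin> cball z r \<longrightarrow> fst p x = 0) \<and>
      lpint CARD('n) (\<lambda>x. fst p x - v x) < ennreal (1 / Suc k) \<and> lpint CARD('n) (\<lambda>x. snd p x - g x) < ennreal (1 / Suc k)"] by blast
  have z: "(\<lambda>k. ennreal (1 / Suc k)) \<longlonglongrightarrow> 0"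
    using tendsto_ennrealI[OF LIMSEQ_inverse_real_of_nat] by (simp add: inverse_eq_divide)
  have l1: "(\<lambda>k. lpint CARD('n) (\<lambda>x. fst (P k) x - v x)) \<longlonglongrightarrow> 0"
    by (rule tendsto_0_le_ennreal[OF z less_imp_le[OF P(3)]])
  have l2: "(\<lambda>k. lpint CARD('n) (\<lambda>x. snd (P k) x - g x)) \<longlonglongrightarrow> 0"
    by (rule tendsto_0_le_ennreal[OF z less_imp_le[OF P(4)]])
  note [measurable] = H0_borel[OF H] C1_grad_borel[OF P(1)]
  have "lpint CARD('n) (\<lambda>x. fst (P k) x - v x) < \<infinity>" for k
    using P(3)[of k] by (metis ennreal_less_top infinity_ennreal_def order.strict_trans)
  then obtain s where s: "strict_mono s" "AE x in lborel. (\<lambda>k. fst (P (s k)) x - v x) \<longlonglongrightarrow> 0"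
    using lpint_tendsto_0_AE_subseq[OF _ _ l1] by auto
  show ?thesis
  proof (rule that[of "\<lambda>k. fst (P (s k))" "\<lambda>k. snd (P (s k))"])
    show "(\<lambda>k. lpint CARD('n) (\<lambda>x. fst (P (s k)) x - v x)) \<longlonglongrightarrow> 0"
      using LIMSEQ_subseq_LIMSEQ[OF l1 s(1)] by (simp add: comp_def)
    show "(\<lambda>k. lpint CARD('n) (\<lambda>x. snd (P (s k)) x - g x)) \<longlonglongrightarrow> 0"
      using LIMSEQ_subseq_LIMSEQ[OF l2 s(1)] by (simp add: comp_def)
    show "AE x in lborel. (\<lambda>k. fst (P (s k)) x) \<longlonglongrightarrow> v x"
      using s(2) by eventually_elim (simp add: LIM_zero_iff)
  qed (use P in auto)
qed

lemma lpint_mult_le: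
  fixes f :: "'a::euclidean_space \<Rightarrow> 'b::euclidean_space" and h :: "'a \<Rightarrow> 'c::euclidean_space"
  assumes [measurable]: "f \<in> borel_measurable borel" and "B \<ge> 0" "\<And>x. norm (h x) \<le> B * norm (f x)"
  shows "lpint p h \<le> ennreal (B ^ p) * lpint p f"
proof -
  have "lpint p h \<le> (\<integral>\<^sup>+x. ennreal (B ^ p) * ennreal (norm (f x) ^ p) \<partial>lborel)"
    unfolding lpint_def
  proof (intro nn_integral_mono)
    fix x
    have "norm (h x) ^ p \<le> (B * norm (f x)) ^ p" using assms by (intro power_mono) auto
    then show "ennreal (norm (h x) ^ p) \<le> ennreal (B ^ p) * ennreal (norm (f x) ^ p)"
      using assms(2) by (simp add: power_mult_distrib ennreal_leI flip: ennreal_mult)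
  qed
  then show ?thesis by (simp add: lpint_def nn_integral_cmult)
qed

lemma tendsto_mult_0_ennreal:
  fixes X :: "nat \<Rightarrow> ennreal"
  assumes "X \<longlonglongrightarrow> 0" "c < \<infinity>" shows "(\<lambda>k. c * X k) \<longlonglongrightarrow> 0"
  using ennreal_tendsto_cmult[of c X 0 sequentially] assms by auto

lemma lpint_tendsto_0_dominated:
  fixes f :: "nat \<Rightarrow> 'a::euclidean_space \<Rightarrow> 'b::euclidean_space" and w :: "'a \<Rightarrow> 'c::euclidean_space"
  assumes p: "p > 0" and [measurable]: "\<And>k. f k \<in> borel_measurable borel" "w \<in> borel_measurable borel"
    and w: "lpint p w < \<infinity>" and le: "\<And>k x. norm (f k x) \<le> B * norm (w x)" and B: "B \<ge> 0"
    and lim: "AE x in lborel. (\<lambda>k. f k x) \<longlonglongrightarrow> 0"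
  shows "(\<lambda>k. lpint p (f k)) \<longlonglongrightarrow> 0"
proof -
  have "(\<lambda>k. \<integral>\<^sup>+x. ennreal (norm (f k x) ^ p) \<partial>lborel) \<longlonglongrightarrow> (\<integral>\<^sup>+x. 0 \<partial>(lborel :: 'a measure))"
  proof (rule nn_integral_dominated_convergence[where w="\<lambda>x. ennreal (B ^ p) * ennreal (norm (w x) ^ p)"])
    show "AE x in lborel. ennreal (norm (f k x) ^ p) \<le> ennreal (B ^ p) * ennreal (norm (w x) ^ p)" for k
    proof (intro AE_I2)
      fix x
      have "norm (f k x) ^ p \<le> (B * norm (w x)) ^ p" using le by (intro power_mono) auto
      then show "ennreal (norm (f k x) ^ p) \<le> ennreal (B ^ p) * ennreal (norm (w x) ^ p)"
        using B by (simp add: power_mult_distrib ennreal_leI flip: ennreal_mult)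
    qed
    show "(\<integral>\<^sup>+x. ennreal (B ^ p) * ennreal (norm (w x) ^ p) \<partial>lborel) < \<infinity>"
      using w by (simp add: nn_integral_cmult lpint_def ennreal_mult_less_top)
    show "AE x in lborel. (\<lambda>k. ennreal (norm (f k x) ^ p)) \<longlonglongrightarrow> 0" using lim
    proof eventually_elim
      case (elim x)
      then have "(\<lambda>k. norm (f k x) ^ p) \<longlonglongrightarrow> norm (0::'b) ^ p" by (intro tendsto_intros)
      then show ?case using p tendsto_ennrealI by (fastforce simp: power_0_left)
    qed
  qed measurable
  then show ?thesis by (simp add: lpint_def)
qed

lemma C1_grad_compose:
  assumes C: "C1_grad \<phi> \<psi>" and T: "\<And>t. (T has_real_derivative \<tau> t) (at t)" and \<tau>: "continuous_on UNIV \<tau>"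
  shows "C1_grad (\<lambda>x. T (\<phi> x)) (\<lambda>x. \<tau> (\<phi> x) *\<^sub>R \<psi> x)"
  unfolding C1_grad_def
proof (intro conjI allI)
  fix x
  have "(\<phi> has_derivative (\<lambda>h. \<psi> x \<bullet> h)) (at x)" using C by (auto simp: C1_grad_def)
  note D = has_derivative_compose[OF this T[of "\<phi> x", unfolded has_field_derivative_def]]
  show "((\<lambda>x. T (\<phi> x)) has_derivative (\<bullet>) (\<tau> (\<phi> x) *\<^sub>R \<psi> x)) (at x)"
    by (rule has_derivative_eq_rhs[OF D]) auto
  have "continuous_on UNIV (\<lambda>x. \<tau> (\<phi> x))"
    by (rule continuous_on_compose2[OF \<tau> C1_grad_cont(1)[OF C]]) auto
  then show "continuous_on UNIV (\<lambda>x. \<tau> (\<phi> x) *\<^sub>R \<psi> x)" using C1_grad_cont(2)[OF C] by (intro continuous_intros)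
qed

lemma real_derivative_bounded_lipschitz:
  fixes T :: "real \<Rightarrow> real"
  assumes T: "\<And>t. (T has_real_derivative \<tau> t) (at t)" and B: "\<And>t. \<bar>\<tau> t\<bar> \<le> B"
  shows "\<bar>T a - T b\<bar> \<le> B * \<bar>a - b\<bar>"
  using field_differentiable_bound[of UNIV T \<tau> B a b] T B by auto

text \<open>Chain rule. The gradient error splits into \<open>\<tau> (\<phi> k x)\<close> times the
  error of \<open>\<psi> k\<close>, small since \<open>\<tau>\<close> is bounded, and
  \<open>\<tau> (\<phi> k x) - \<tau> (v x)\<close> times the fixed \<open>g x\<close>, small by
  dominated convergence. The sequence is exported because the equation has to be tested with such
  approximants.\<close>

lemma H0_compose_seq:
  fixes v :: "real ^ 'n::finite \<Rightarrow> real"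
  assumes H: "H0 z r v g" and T: "\<And>t. (T has_real_derivative \<tau> t) (at t)" and \<tau>: "continuous_on UNIV \<tau>"
    and B: "\<And>t. \<bar>\<tau> t\<bar> \<le> B" and T0: "T 0 = 0"
  obtains \<phi> \<psi> where "\<And>k::nat. C1_grad (\<lambda>x. T (\<phi> k x)) (\<psi> k)" "\<And>k x. x \<notin> cball z r \<Longrightarrow> T (\<phi> k x) = 0"
    "(\<lambda>k. lpint CARD('n) (\<lambda>x. T (\<phi> k x) - T (v x))) \<longlonglongrightarrow> 0"
    "(\<lambda>k. lpint CARD('n) (\<lambda>x. \<psi> k x - \<tau> (v x) *\<^sub>R g x)) \<longlonglongrightarrow> 0"
    "AE x in lborel. (\<lambda>k. T (\<phi> k x)) \<longlonglongrightarrow> T (v x)"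
proof -
  obtain \<phi> \<psi> where 1: "\<And>k::nat. C1_grad (\<phi> k) (\<psi> k)" "\<And>k x. x \<notin> cball z r \<Longrightarrow> \<phi> k x = 0"
    "(\<lambda>k. lpint CARD('n) (\<lambda>x. \<phi> k x - v x)) \<longlonglongrightarrow> 0" "(\<lambda>k. lpint CARD('n) (\<lambda>x. \<psi> k x - g x)) \<longlonglongrightarrow> 0"
    "AE x in lborel. (\<lambda>k. \<phi> k x) \<longlonglongrightarrow> v x" by (rule H0_seq[OF H]) (rule that, assumption+)
  note [measurable] = H0_borel[OF H] C1_grad_borel[OF 1(1)]
  have [measurable]: "\<tau> \<in> borel_measurable borel" using \<tau> borel_measurable_continuous_onI by blast
  have B0: "B \<ge> 0" using B[of 0] by simp
  have cT: "isCont T t" for t using T DERIV_isCont by blast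
  have c\<tau>: "isCont \<tau> t" for t using \<tau> by (simp add: continuous_on_eq_continuous_at)
  show ?thesis
  proof (rule that[of \<phi> "\<lambda>k x. \<tau> (\<phi> k x) *\<^sub>R \<psi> k x"])
    show "C1_grad (\<lambda>x. T (\<phi> k x)) (\<lambda>x. \<tau> (\<phi> k x) *\<^sub>R \<psi> k x)" for k by (rule C1_grad_compose[OF 1(1) T \<tau>])
    show "T (\<phi> k x) = 0" if "x \<notin> cball z r" for k x using 1(2)[OF that] T0 by simp
    show "AE x in lborel. (\<lambda>k. T (\<phi> k x)) \<longlonglongrightarrow> T (v x)"
      using 1(5) by eventually_elim (rule isCont_tendsto_compose[OF cT])
    show "(\<lambda>k. lpint CARD('n) (\<lambda>x. T (\<phi> k x) - T (v x))) \<longlonglongrightarrow> 0"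
    proof (rule tendsto_0_le_ennreal)
      show "(\<lambda>k. ennreal (B ^ CARD('n)) * lpint CARD('n) (\<lambda>x. \<phi> k x - v x)) \<longlonglongrightarrow> 0"
        by (rule tendsto_mult_0_ennreal[OF 1(3)]) simp
      show "lpint CARD('n) (\<lambda>x. T (\<phi> k x) - T (v x)) \<le> ennreal (B ^ CARD('n)) * lpint CARD('n) (\<lambda>x. \<phi> k x - v x)" for k
        by (rule lpint_mult_le[OF _ B0]) (use real_derivative_bounded_lipschitz[OF T B] in auto)
    qed
    show "(\<lambda>k. lpint CARD('n) (\<lambda>x. \<tau> (\<phi> k x) *\<^sub>R \<psi> k x - \<tau> (v x) *\<^sub>R g x)) \<longlonglongrightarrow> 0"
    proof (rule tendsto_0_le_ennreal)
      have a: "(\<lambda>k. lpint CARD('n) (\<lambda>x. (\<tau> (\<phi> k x) - \<tau> (v x)) *\<^sub>R g x)) \<longlonglongrightarrow> 0"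
      proof (rule lpint_tendsto_0_dominated[where B="2 * B" and w=g])
        show "norm ((\<tau> (\<phi> k x) - \<tau> (v x)) *\<^sub>R g x) \<le> 2 * B * norm (g x)" for k x
          using B[of "\<phi> k x"] B[of "v x"] by (auto intro!: mult_right_mono)
        show "AE x in lborel. (\<lambda>k. (\<tau> (\<phi> k x) - \<tau> (v x)) *\<^sub>R g x) \<longlonglongrightarrow> 0" using 1(5)
        proof eventually_elim
          case (elim x)
          have "(\<lambda>k. (\<tau> (\<phi> k x) - \<tau> (v x)) *\<^sub>R g x) \<longlonglongrightarrow> (\<tau> (v x) - \<tau> (v x)) *\<^sub>R g x"
            by (intro tendsto_intros isCont_tendsto_compose[OF c\<tau>] elim)
          then show ?case by simp
        qed
      qed (use B0 H0_finite[OF H] in auto)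
      have b: "(\<lambda>k. ennreal (B ^ CARD('n)) * lpint CARD('n) (\<lambda>x. \<psi> k x - g x)) \<longlonglongrightarrow> 0"
        by (rule tendsto_mult_0_ennreal[OF 1(4)]) simp
      have "(\<lambda>k. ennreal (B ^ CARD('n)) * lpint CARD('n) (\<lambda>x. \<psi> k x - g x)
          + lpint CARD('n) (\<lambda>x. (\<tau> (\<phi> k x) - \<tau> (v x)) *\<^sub>R g x)) \<longlonglongrightarrow> 0"
        using tendsto_add[OF b a] by simp
      then show "(\<lambda>k. 2 ^ CARD('n) * (ennreal (B ^ CARD('n)) * lpint CARD('n) (\<lambda>x. \<psi> k x - g x)
          + lpint CARD('n) (\<lambda>x. (\<tau> (\<phi> k x) - \<tau> (v x)) *\<^sub>R g x))) \<longlonglongrightarrow> 0"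
        by (rule tendsto_mult_0_ennreal) (simp add: power_less_top_ennreal)
      fix k
      have "lpint CARD('n) (\<lambda>x. \<tau> (\<phi> k x) *\<^sub>R \<psi> k x - \<tau> (v x) *\<^sub>R g x)
        = lpint CARD('n) (\<lambda>x. \<tau> (\<phi> k x) *\<^sub>R (\<psi> k x - g x) + (\<tau> (\<phi> k x) - \<tau> (v x)) *\<^sub>R g x)"
        by (simp add: algebra_simps)
      also have "\<dots> \<le> 2 ^ CARD('n) * (lpint CARD('n) (\<lambda>x. \<tau> (\<phi> k x) *\<^sub>R (\<psi> k x - g x))
          + lpint CARD('n) (\<lambda>x. (\<tau> (\<phi> k x) - \<tau> (v x)) *\<^sub>R g x))"
        by (rule lpint_add_le) measurable
      also have "lpint CARD('n) (\<lambda>x. \<tau> (\<phi> k x) *\<^sub>R (\<psi> k x - g x)) \<le> ennreal (B ^ CARD('n)) * lpint CARD('n) (\<lambda>x. \<psi> k x - g x)"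
        by (rule lpint_mult_le[OF _ B0]) (use B in \<open>auto intro!: mult_right_mono\<close>)
      finally show "lpint CARD('n) (\<lambda>x. \<tau> (\<phi> k x) *\<^sub>R \<psi> k x - \<tau> (v x) *\<^sub>R g x)
        \<le> 2 ^ CARD('n) * (ennreal (B ^ CARD('n)) * lpint CARD('n) (\<lambda>x. \<psi> k x - g x)
          + lpint CARD('n) (\<lambda>x. (\<tau> (\<phi> k x) - \<tau> (v x)) *\<^sub>R g x))"
        by (simp add: mult_left_mono add_right_mono)
    qed
  qed
qed

lemma H0_compose:
  fixes v :: "real ^ 'n::finite \<Rightarrow> real"
  assumes H: "H0 z r v g" and T: "\<And>t. (T has_real_derivative \<tau> t) (at t)" and \<tau>: "continuous_on UNIV \<tau>"
    and B: "\<And>t. \<bar>\<tau> t\<bar> \<le> B" and T0: "T 0 = 0"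
  shows "H0 z r (\<lambda>x. T (v x)) (\<lambda>x. \<tau> (v x) *\<^sub>R g x)"
proof -
  obtain \<phi> \<psi> where 1: "\<And>k::nat. C1_grad (\<lambda>x. T (\<phi> k x)) (\<psi> k)" "\<And>k x. x \<notin> cball z r \<Longrightarrow> T (\<phi> k x) = 0"
    "(\<lambda>k. lpint CARD('n) (\<lambda>x. T (\<phi> k x) - T (v x))) \<longlonglongrightarrow> 0"
    "(\<lambda>k. lpint CARD('n) (\<lambda>x. \<psi> k x - \<tau> (v x) *\<^sub>R g x)) \<longlonglongrightarrow> 0"
    "AE x in lborel. (\<lambda>k. T (\<phi> k x)) \<longlonglongrightarrow> T (v x)"
    by (rule H0_compose_seq[OF assms]) (rule that, assumption+)
  note [measurable] = H0_borel[OF H]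
  have [measurable]: "\<tau> \<in> borel_measurable borel" using \<tau> borel_measurable_continuous_onI by blast
  have "continuous_on UNIV T" using T DERIV_isCont continuous_at_imp_continuous_on by blast
  then have [measurable]: "T \<in> borel_measurable borel" using borel_measurable_continuous_onI by blast
  show ?thesis
  proof (rule H0_closed_seq[OF _ _ _ _ _ 1(3,4)])
    show "H0 z r (\<lambda>x. T (\<phi> k x)) (\<psi> k)" for k by (rule C1_grad_H0[OF 1(1,2)])
  qed (use H0_outside[OF H] T0 in auto)
qed

lemma H0_add:
  fixes v :: "real ^ 'n::finite \<Rightarrow> real"
  assumes 1: "H0 z r v g" and 2: "H0 z r v' g'"
  shows "H0 z r (\<lambda>x. v x + v' x) (\<lambda>x. g x + g' x)"
proof -
  obtain \<phi> \<psi> where a: "\<And>k::nat. C1_grad (\<phi> k) (\<psi> k)" "\<And>k x. x \<notin> cball z r \<Longrightarrow> \<phi> k x = 0"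
    "(\<lambda>k. lpint CARD('n) (\<lambda>x. \<phi> k x - v x)) \<longlonglongrightarrow> 0" "(\<lambda>k. lpint CARD('n) (\<lambda>x. \<psi> k x - g x)) \<longlonglongrightarrow> 0"
    "AE x in lborel. (\<lambda>k. \<phi> k x) \<longlonglongrightarrow> v x" by (rule H0_seq[OF 1]) (rule that, assumption+)
  obtain \<phi>' \<psi>' where b: "\<And>k::nat. C1_grad (\<phi>' k) (\<psi>' k)" "\<And>k x. x \<notin> cball z r \<Longrightarrow> \<phi>' k x = 0"
    "(\<lambda>k. lpint CARD('n) (\<lambda>x. \<phi>' k x - v' x)) \<longlonglongrightarrow> 0" "(\<lambda>k. lpint CARD('n) (\<lambda>x. \<psi>' k x - g' x)) \<longlonglongrightarrow> 0"
    "AE x in lborel. (\<lambda>k. \<phi>' k x) \<longlonglongrightarrow> v' x" by (rule H0_seq[OF 2]) (rule that, assumption+)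
  note [measurable] = H0_borel[OF 1] H0_borel[OF 2] C1_grad_borel[OF a(1)] C1_grad_borel[OF b(1)]
  have lim: "(\<lambda>k. lpint p (\<lambda>x. f k x + f' k x - (h x + h' x))) \<longlonglongrightarrow> 0"
    if "(\<lambda>k. lpint p (\<lambda>x. f k x - h x)) \<longlonglongrightarrow> 0" "(\<lambda>k. lpint p (\<lambda>x. f' k x - h' x)) \<longlonglongrightarrow> 0"
     and [measurable]: "\<And>k. f k \<in> borel_measurable borel" "\<And>k. f' k \<in> borel_measurable borel" "h \<in> borel_measurable borel" "h' \<in> borel_measurable borel"
    for p and f f' :: "nat \<Rightarrow> real ^ 'n \<Rightarrow> 'b::euclidean_space" and h h'
  proof (rule tendsto_0_le_ennreal)
    have "(\<lambda>k. lpint p (\<lambda>x. f k x - h x) + lpint p (\<lambda>x. f' k x - h' x)) \<longlonglongrightarrow> 0"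
      using tendsto_add[OF that(1,2)] by simp
    then show "(\<lambda>k. 2 ^ p * (lpint p (\<lambda>x. f k x - h x) + lpint p (\<lambda>x. f' k x - h' x))) \<longlonglongrightarrow> 0"
      by (rule tendsto_mult_0_ennreal) (simp add: power_less_top_ennreal)
    show "lpint p (\<lambda>x. f k x + f' k x - (h x + h' x)) \<le> 2 ^ p * (lpint p (\<lambda>x. f k x - h x) + lpint p (\<lambda>x. f' k x - h' x))" for k
      using lpint_add_le[of "\<lambda>x. f k x - h x" "\<lambda>x. f' k x - h' x" p] by (simp add: algebra_simps)
  qed
  show ?thesis
  proof (rule H0_closed_seq)
    show "H0 z r (\<lambda>x. \<phi> k x + \<phi>' k x) (\<lambda>x. \<psi> k x + \<psi>' k x)" for k
    proof (rule C1_grad_H0)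
      show "C1_grad (\<lambda>x. \<phi> k x + \<phi>' k x) (\<lambda>x. \<psi> k x + \<psi>' k x)"
        using a(1)[of k] b(1)[of k] unfolding C1_grad_def
        by (auto intro!: continuous_intros has_derivative_add[THEN has_derivative_eq_rhs] simp: inner_add_left)
    qed (use a(2) b(2) in auto)
  qed (use lim[OF a(3) b(3)] lim[OF a(4) b(4)] H0_outside[OF 1] H0_outside[OF 2] in auto)
qed

lemma H0_uminus: "H0 z r v g \<Longrightarrow> H0 z r (\<lambda>x. - v x) (\<lambda>x. - g x)"
  using H0_compose[of z r v g "\<lambda>t. - t" "\<lambda>_. -1" 1, OF _ DERIV_minus[OF DERIV_ident]] by simp

lemma H0_diff:
  assumes "H0 z r v g" "H0 z r v' g'"
  shows "H0 z r (\<lambda>x. v x - v' x) (\<lambda>x. g x - g' x)"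
  using H0_add[OF assms(1) H0_uminus[OF assms(2)]] by simp

text \<open>The new radius \<open>r'\<close> is that of the factor \<open>\<eta>\<close> and is
  unrelated to \<open>r\<close>: multiplying by a cutoff also localises to a smaller ball.\<close>

lemma H0_mult:
  fixes v :: "real ^ 'n::finite \<Rightarrow> real"
  assumes H: "H0 z r v g" and C: "C1_grad \<eta> \<eta>'" and B: "\<And>x. \<bar>\<eta> x\<bar> \<le> B" "\<And>x. norm (\<eta>' x) \<le> B"
    and s: "\<And>x. x \<notin> cball z r' \<Longrightarrow> \<eta> x = 0"
  shows "H0 z r' (\<lambda>x. \<eta> x * v x) (\<lambda>x. \<eta> x *\<^sub>R g x + v x *\<^sub>R \<eta>' x)"
proof -
  have s': "\<eta>' x = 0" if "x \<notin> cball z r'" for x by (rule gradient_zero_outside[OF C closed_cball s that])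
  obtain \<phi> \<psi> where a: "\<And>k::nat. C1_grad (\<phi> k) (\<psi> k)" "\<And>k x. x \<notin> cball z r \<Longrightarrow> \<phi> k x = 0"
    "(\<lambda>k. lpint CARD('n) (\<lambda>x. \<phi> k x - v x)) \<longlonglongrightarrow> 0" "(\<lambda>k. lpint CARD('n) (\<lambda>x. \<psi> k x - g x)) \<longlonglongrightarrow> 0"
    "AE x in lborel. (\<lambda>k. \<phi> k x) \<longlonglongrightarrow> v x" by (rule H0_seq[OF H]) (rule that, assumption+)
  note [measurable] = H0_borel[OF H] C1_grad_borel[OF a(1)] C1_grad_borel[OF C]
  have B0: "B \<ge> 0" using B(1)[of 0] by simp
  let ?N = "CARD('n)"
  show ?thesis
  proof (rule H0_closed_seq)
    show "H0 z r' (\<lambda>x. \<eta> x * \<phi> k x) (\<lambda>x. \<eta> x *\<^sub>R \<psi> k x + \<phi> k x *\<^sub>R \<eta>' x)" for k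
    proof (rule C1_grad_H0)
      show "C1_grad (\<lambda>x. \<eta> x * \<phi> k x) (\<lambda>x. \<eta> x *\<^sub>R \<psi> k x + \<phi> k x *\<^sub>R \<eta>' x)"
        using a(1)[of k] C C1_grad_cont[OF C] C1_grad_cont[OF a(1)] unfolding C1_grad_def
        by (auto intro!: continuous_intros has_derivative_mult[THEN has_derivative_eq_rhs] simp: inner_add_left algebra_simps)
    qed (use s in auto)
    show "(\<lambda>k. lpint ?N (\<lambda>x. \<eta> x * \<phi> k x - \<eta> x * v x)) \<longlonglongrightarrow> 0"
    proof (rule tendsto_0_le_ennreal)
      show "(\<lambda>k. ennreal (B ^ ?N) * lpint ?N (\<lambda>x. \<phi> k x - v x)) \<longlonglongrightarrow> 0"
        by (rule tendsto_mult_0_ennreal[OF a(3)]) simp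
      show "lpint ?N (\<lambda>x. \<eta> x * \<phi> k x - \<eta> x * v x) \<le> ennreal (B ^ ?N) * lpint ?N (\<lambda>x. \<phi> k x - v x)" for k
        by (rule lpint_mult_le[OF _ B0])
           (use B in \<open>auto simp: abs_mult right_diff_distrib[symmetric] intro!: mult_right_mono\<close>)
    qed
    show "(\<lambda>k. lpint ?N (\<lambda>x. \<eta> x *\<^sub>R \<psi> k x + \<phi> k x *\<^sub>R \<eta>' x - (\<eta> x *\<^sub>R g x + v x *\<^sub>R \<eta>' x))) \<longlonglongrightarrow> 0"
    proof (rule tendsto_0_le_ennreal)
      have "(\<lambda>k. ennreal (B ^ ?N) * lpint ?N (\<lambda>x. \<psi> k x - g x)) \<longlonglongrightarrow> 0"
        by (rule tendsto_mult_0_ennreal[OF a(4)]) simp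
      moreover have "(\<lambda>k. ennreal (B ^ ?N) * lpint ?N (\<lambda>x. \<phi> k x - v x)) \<longlonglongrightarrow> 0"
        by (rule tendsto_mult_0_ennreal[OF a(3)]) simp
      ultimately have "(\<lambda>k. ennreal (B ^ ?N) * lpint ?N (\<lambda>x. \<psi> k x - g x) + ennreal (B ^ ?N) * lpint ?N (\<lambda>x. \<phi> k x - v x)) \<longlonglongrightarrow> 0"
        using tendsto_add by fastforce
      then show "(\<lambda>k. 2 ^ ?N * (ennreal (B ^ ?N) * lpint ?N (\<lambda>x. \<psi> k x - g x) + ennreal (B ^ ?N) * lpint ?N (\<lambda>x. \<phi> k x - v x))) \<longlonglongrightarrow> 0"
        by (rule tendsto_mult_0_ennreal) (simp add: power_less_top_ennreal)
      fix k
      have "lpint ?N (\<lambda>x. \<eta> x *\<^sub>R \<psi> k x + \<phi> k x *\<^sub>R \<eta>' x - (\<eta> x *\<^sub>R g x + v x *\<^sub>R \<eta>' x))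
         = lpint ?N (\<lambda>x. \<eta> x *\<^sub>R (\<psi> k x - g x) + (\<phi> k x - v x) *\<^sub>R \<eta>' x)"
        by (simp add: algebra_simps)
      also have "\<dots> \<le> 2 ^ ?N * (lpint ?N (\<lambda>x. \<eta> x *\<^sub>R (\<psi> k x - g x)) + lpint ?N (\<lambda>x. (\<phi> k x - v x) *\<^sub>R \<eta>' x))"
        by (rule lpint_add_le) measurable
      also have "\<dots> \<le> 2 ^ ?N * (ennreal (B ^ ?N) * lpint ?N (\<lambda>x. \<psi> k x - g x) + ennreal (B ^ ?N) * lpint ?N (\<lambda>x. \<phi> k x - v x))"
      proof (intro mult_left_mono add_mono)
        show "lpint ?N (\<lambda>x. \<eta> x *\<^sub>R (\<psi> k x - g x)) \<le> ennreal (B ^ ?N) * lpint ?N (\<lambda>x. \<psi> k x - g x)"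
          by (rule lpint_mult_le[OF _ B0]) (use B in \<open>auto intro!: mult_right_mono\<close>)
        have "norm ((\<phi> k x - v x) *\<^sub>R \<eta>' x) \<le> B * norm (\<phi> k x - v x)" for x
          using mult_left_mono[OF B(2)[of x], of "\<bar>\<phi> k x - v x\<bar>"] by (simp add: mult.commute)
        then show "lpint ?N (\<lambda>x. (\<phi> k x - v x) *\<^sub>R \<eta>' x) \<le> ennreal (B ^ ?N) * lpint ?N (\<lambda>x. \<phi> k x - v x)"
          by (intro lpint_mult_le[OF _ B0]) auto
      qed simp
      finally show "lpint ?N (\<lambda>x. \<eta> x *\<^sub>R \<psi> k x + \<phi> k x *\<^sub>R \<eta>' x - (\<eta> x *\<^sub>R g x + v x *\<^sub>R \<eta>' x))
         \<le> 2 ^ ?N * (ennreal (B ^ ?N) * lpint ?N (\<lambda>x. \<psi> k x - g x) + ennreal (B ^ ?N) * lpint ?N (\<lambda>x. \<phi> k x - v x))" .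
    qed
  qed (use s s' in auto)
qed

text \<open>A C1 version of the positive part, namely the primitive of the ramp
  \<open>soft_step\<close>, which rises from 0 to 1 between 0 and \<open>\<delta>\<close>. Written
  as a difference of squares it inherits differentiability from the square of the positive
  part.\<close>

definition soft_pos :: "real \<Rightarrow> real \<Rightarrow> real"
  where "soft_pos \<delta> t = ((max 0 t)\<^sup>2 - (max 0 (t - \<delta>))\<^sup>2) / (2 * \<delta>)"

definition soft_step :: "real \<Rightarrow> real \<Rightarrow> real"
  where "soft_step \<delta> t = (max 0 t - max 0 (t - \<delta>)) / \<delta>"

lemma DERIV_max_0_sq: "((\<lambda>t. (max 0 t)\<^sup>2) has_real_derivative 2 * max 0 t) (at t)"
proof -
  consider "t > 0" | "t < 0" | "t = 0" by linarith
  then show ?thesis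
  proof cases
    case 1
    have "((\<lambda>t. t\<^sup>2) has_real_derivative 2 * max 0 t) (at t)" using 1 by (auto intro!: derivative_eq_intros)
    then show ?thesis
      by (rule has_field_derivative_transform_within_open[where S="{0<..}"]) (use 1 in auto)
  next
    case 2
    have "((\<lambda>t. 0) has_real_derivative 2 * max 0 t) (at t)" using 2 by simp
    then show ?thesis
      by (rule has_field_derivative_transform_within_open[where S="{..<0}"]) (use 2 in auto)
  next
    case 3
    have "((\<lambda>h. (max 0 h)\<^sup>2 / h) \<longlongrightarrow> 0) (at (0::real))"
    proof (rule Lim_null_comparison)
      show "\<forall>\<^sub>F h in at (0::real). norm ((max 0 h)\<^sup>2 / h) \<le> \<bar>h\<bar>"
        by (auto simp: max_def power2_eq_square intro!: always_eventually)
      show "((\<lambda>h. \<bar>h\<bar>) \<longlongrightarrow> 0) (at (0::real))" by (auto intro!: tendsto_eq_intros)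
    qed
    then show ?thesis using 3 by (simp add: DERIV_def)
  qed
qed

lemma soft_pos_deriv:
  assumes "\<delta> > 0" shows "(soft_pos \<delta> has_real_derivative soft_step \<delta> t) (at t)"
proof -
  have "((\<lambda>t. (max 0 (t - \<delta>))\<^sup>2) has_real_derivative 2 * max 0 (t - \<delta>)) (at t)"
    using DERIV_shift[of "\<lambda>t. (max 0 t)\<^sup>2" "2 * max 0 (t - \<delta>)" t "- \<delta>"] DERIV_max_0_sq[of "t - \<delta>"] by simp
  from DERIV_cdivide[OF DERIV_diff[OF DERIV_max_0_sq[of t] this], of "2 * \<delta>"]
  have D: "(soft_pos \<delta> has_real_derivative (2 * max 0 t - 2 * max 0 (t - \<delta>)) / (2 * \<delta>)) (at t)"
    unfolding soft_pos_def[abs_def] .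
  have "(2 * max 0 t - 2 * max 0 (t - \<delta>)) / (2 * \<delta>) = soft_step \<delta> t"
    using assms by (simp add: soft_step_def divide_simps)
  with D show ?thesis by (simp only:)
qed

lemma soft_step:
  assumes "\<delta> > 0"
  shows "0 \<le> soft_step \<delta> t" "soft_step \<delta> t \<le> 1" "t \<le> 0 \<Longrightarrow> soft_step \<delta> t = 0" "t \<ge> \<delta> \<Longrightarrow> soft_step \<delta> t = 1"
    "continuous_on UNIV (soft_step \<delta>)"
proof -
  show "continuous_on UNIV (soft_step \<delta>)"
    unfolding soft_step_def[abs_def] using assms by (intro continuous_intros) auto
qed (use assms in \<open>auto simp: soft_step_def max_def divide_simps\<close>)

lemma soft_pos:
  assumes "\<delta> > 0"
  shows "t \<le> 0 \<Longrightarrow> soft_pos \<delta> t = 0" "t \<ge> \<delta> \<Longrightarrow> soft_pos \<delta> t = t - \<delta> / 2"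
    "\<bar>soft_pos \<delta> t - max 0 t\<bar> \<le> \<delta>"
proof -
  show 1: "t \<le> 0 \<Longrightarrow> soft_pos \<delta> t = 0" for t using assms by (simp add: soft_pos_def)
  show 2: "t \<ge> \<delta> \<Longrightarrow> soft_pos \<delta> t = t - \<delta> / 2" for t
    using assms by (simp add: soft_pos_def power2_eq_square field_simps)
  show "\<bar>soft_pos \<delta> t - max 0 t\<bar> \<le> \<delta>"
  proof -
    consider "t \<le> 0" | "t \<ge> \<delta>" | "0 < t" "t < \<delta>" by linarith
    then show ?thesis
    proof cases
      case 3
      have "t * t \<le> t * \<delta>" using 3 by (intro mult_left_mono) auto
      then have "0 \<le> soft_pos \<delta> t \<and> soft_pos \<delta> t \<le> \<delta>"
        using 3 mult_strict_mono[of t \<delta> t \<delta>] assms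
        by (auto simp: soft_pos_def power2_eq_square divide_simps mult.left_commute[of _ 2])
          (smt (verit) mult_pos_pos)
      then show ?thesis using 3 by auto
    qed (use 1 2 assms in auto)
  qed
qed

text \<open>Compositions with \<open>soft_pos\<close> converge as the ramp steepens. The ramp is 0
  at 0, so in the limit the gradient survives exactly where \<open>v x > h\<close>;
  \<open>h \<ge> 0\<close> keeps the function zero outside the ball.\<close>

lemma H0_pos_part:
  fixes v :: "real ^ 'n::finite \<Rightarrow> real"
  assumes H: "H0 z r v g" and h: "h \<ge> 0"
  shows "H0 z r (\<lambda>x. max 0 (v x - h)) (\<lambda>x. if v x > h then g x else 0)"
proof -
  note [measurable] = H0_borel[OF H]
  define \<delta> where "\<delta> k = 1 / real (Suc k)" for k
  have \<delta>: "\<delta> k > 0" for k by (simp add: \<delta>_def)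
  have \<delta>0: "\<delta> \<longlonglongrightarrow> 0" unfolding \<delta>_def using LIMSEQ_inverse_real_of_nat by (simp add: inverse_eq_divide)
  have [measurable]: "soft_step d \<in> borel_measurable borel" "soft_pos d \<in> borel_measurable borel" for d
    unfolding soft_step_def[abs_def] soft_pos_def[abs_def] by measurable
  show ?thesis
  proof (rule H0_closed_seq)
    show "H0 z r (\<lambda>x. soft_pos (\<delta> k) (v x - h)) (\<lambda>x. soft_step (\<delta> k) (v x - h) *\<^sub>R g x)" for k
    proof (rule H0_compose[OF H, where T="\<lambda>t. soft_pos (\<delta> k) (t - h)" and \<tau>="\<lambda>t. soft_step (\<delta> k) (t - h)" and B=1])
      show "((\<lambda>t. soft_pos (\<delta> k) (t - h)) has_real_derivative soft_step (\<delta> k) (t - h)) (at t)" for t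
        using DERIV_shift[of "soft_pos (\<delta> k)" "soft_step (\<delta> k) (t - h)" t "- h"] soft_pos_deriv[OF \<delta>, of k "t - h"] by simp
      show "continuous_on UNIV (\<lambda>t. soft_step (\<delta> k) (t - h))"
        by (rule continuous_on_compose2[OF soft_step(5)[OF \<delta>]]) (auto intro!: continuous_intros)
      show "\<bar>soft_step (\<delta> k) (t - h)\<bar> \<le> 1" for t using soft_step(1,2)[OF \<delta>, of k "t - h"] by auto
    qed (use soft_pos(1)[OF \<delta>] h in auto)
    show "(\<lambda>k. lpint CARD('n) (\<lambda>x. soft_step (\<delta> k) (v x - h) *\<^sub>R g x - (if h < v x then g x else 0))) \<longlonglongrightarrow> 0"
    proof (rule lpint_tendsto_0_dominated[where w=g and B=1])
      show "norm (soft_step (\<delta> k) (v x - h) *\<^sub>R g x - (if h < v x then g x else 0)) \<le> 1 * norm (g x)" for k x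
      proof (cases "h < v x")
        case True
        have "soft_step (\<delta> k) (v x - h) *\<^sub>R g x - (if h < v x then g x else 0) = (soft_step (\<delta> k) (v x - h) - 1) *\<^sub>R g x"
          using True by (simp add: algebra_simps)
        then show ?thesis using soft_step(1,2)[OF \<delta>, of k "v x - h"]
          by (auto intro!: mult_left_le_one_le)
      qed (use soft_step(3)[OF \<delta>, of "v x - h" k] in auto)
      show "AE x in lborel. (\<lambda>k. soft_step (\<delta> k) (v x - h) *\<^sub>R g x - (if h < v x then g x else 0)) \<longlonglongrightarrow> 0"
      proof (intro AE_I2 tendsto_eventually)
        fix x
        show "\<forall>\<^sub>F k in sequentially. soft_step (\<delta> k) (v x - h) *\<^sub>R g x - (if h < v x then g x else 0) = 0"
        proof (cases "h < v x")
          case True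
          then have "\<forall>\<^sub>F k in sequentially. \<delta> k < v x - h" using order_tendstoD(2)[OF \<delta>0] by simp
          then show ?thesis by eventually_elim (use soft_step(4)[OF \<delta>] True in auto)
        qed (use soft_step(3)[OF \<delta>] in auto)
      qed
    qed (use H0_finite[OF H] in auto)
    have out: "v x = 0" if "x \<notin> cball z r" for x using H0_outside[OF H that] by simp
    show "(\<lambda>k. lpint CARD('n) (\<lambda>x. soft_pos (\<delta> k) (v x - h) - max 0 (v x - h))) \<longlonglongrightarrow> 0"
    proof (rule lpint_tendsto_0_dominated[where w="indicator (cball z r) :: _ \<Rightarrow> real" and B=1])
      show "norm (soft_pos (\<delta> k) (v x - h) - max 0 (v x - h)) \<le> 1 * norm (indicator (cball z r) x :: real)" for k x
      proof (cases "x \<in> cball z r")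
        case True
        have "\<delta> k \<le> 1" by (simp add: \<delta>_def)
        then show ?thesis using True soft_pos(3)[OF \<delta>, of k "v x - h"] by simp
      qed (use out soft_pos(1)[OF \<delta>] h in auto)
      have "lpint CARD('n) (indicator (cball z r) :: real ^ 'n \<Rightarrow> real) = (\<integral>\<^sup>+x. indicator (cball z r) x \<partial>lborel)"
        unfolding lpint_def by (intro nn_integral_cong) (auto simp: indicator_def power_0_left)
      then show "lpint CARD('n) (indicator (cball z r) :: real ^ 'n \<Rightarrow> real) < \<infinity>"
        using emeasure_lborel_cball_finite[of z r] by simp
      show "AE x in lborel. (\<lambda>k. soft_pos (\<delta> k) (v x - h) - max 0 (v x - h)) \<longlonglongrightarrow> 0"
        by (intro AE_I2 Lim_null_comparison[OF _ \<delta>0] always_eventually allI) (use soft_pos(3)[OF \<delta>] in auto)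
      show "indicator (cball z r) \<in> borel_measurable (borel :: (real ^ 'n) measure)"
        by (intro borel_measurable_indicator) simp
    qed auto
  qed (use H0_outside[OF H] h in auto)
qed

text \<open>The slice between two levels is the difference of the positive parts at these levels;
  the gradient is kept on the half-open range of values.\<close>

lemma H0_truncate:
  fixes v :: "real ^ 'n::finite \<Rightarrow> real"
  assumes H: "H0 z r v g" and h: "h \<ge> 0" "M \<ge> 0"
  shows "H0 z r (\<lambda>x. min M (max 0 (v x - h))) (\<lambda>x. if h < v x \<and> v x \<le> h + M then g x else 0)"
proof -
  have "H0 z r (\<lambda>x. max 0 (v x - h) - max 0 (v x - (h + M)))
      (\<lambda>x. (if v x > h then g x else 0) - (if v x > h + M then g x else 0))"
    using h by (intro H0_diff H0_pos_part[OF H]) auto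
  moreover have "(\<lambda>x. max 0 (v x - h) - max 0 (v x - (h + M))) = (\<lambda>x. min M (max 0 (v x - h)))"
    using h by (auto simp: fun_eq_iff max_def min_def)
  moreover have "(\<lambda>x. (if v x > h then g x else 0) - (if v x > h + M then g x else 0))
      = (\<lambda>x. if h < v x \<and> v x \<le> h + M then g x else 0)"
    using h by (auto simp: fun_eq_iff)
  ultimately show ?thesis by simp
qed

text \<open>Either \<open>a\<close> is below \<open>\<delta>\<close>, or \<open>a / \<delta>\<close>
  exceeds 1 and so do its powers. With \<open>\<delta>\<close> chosen afterwards, such inequalities
  do the work of Hoelder's.\<close>

lemma young_light:
  fixes a \<delta> :: real
  assumes "a \<ge> 0" "\<delta> > 0" "p > 0"
  shows "a \<le> \<delta> + (1 / \<delta>) ^ (p - 1) * a ^ p"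
proof (cases "a \<le> \<delta>")
  case False
  then have "1 ^ (p - 1) \<le> (a / \<delta>) ^ (p - 1)" using assms by (intro power_mono) auto
  then have "a * 1 \<le> a * (a / \<delta>) ^ (p - 1)" using assms by (intro mult_left_mono) auto
  also have "\<dots> = (1 / \<delta>) ^ (p - 1) * a ^ p" using assms(3) by (cases p) (auto simp: power_divide)
  finally show ?thesis using assms by simp
qed (use assms in \<open>simp add: add_increasing2\<close>)

text \<open>The parameter stays free so that it can later be adapted to the measure of
  \<open>S\<close>, which restores the scaling of Hoelder's inequality.\<close>

lemma L1_le_Lp_bounded_support:
  fixes f :: "'a::euclidean_space \<Rightarrow> 'b::euclidean_space"
  assumes p: "p > 0" and [measurable]: "f \<in> borel_measurable borel" and S[measurable]: "S \<in> sets borel"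
    and out: "\<And>x. x \<notin> S \<Longrightarrow> f x = 0" and \<delta>: "\<delta> > 0"
  shows "(\<integral>\<^sup>+x. ennreal (norm (f x)) \<partial>lborel) \<le> ennreal \<delta> * emeasure lborel S + ennreal ((1 / \<delta>) ^ (p - 1)) * lpint p f"
proof -
  have "(\<integral>\<^sup>+x. ennreal (norm (f x)) \<partial>lborel)
    \<le> (\<integral>\<^sup>+x. ennreal \<delta> * indicator S x + ennreal ((1 / \<delta>) ^ (p - 1)) * ennreal (norm (f x) ^ p) \<partial>lborel)"
  proof (intro nn_integral_mono)
    fix x
    have "ennreal (norm (f x)) \<le> ennreal (\<delta> + (1 / \<delta>) ^ (p - 1) * norm (f x) ^ p)"
      using young_light[OF norm_ge_zero \<delta> p] by (intro ennreal_leI) auto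
    also have "\<dots> = ennreal \<delta> + ennreal ((1 / \<delta>) ^ (p - 1)) * ennreal (norm (f x) ^ p)"
      using \<delta> by (simp add: ennreal_mult[symmetric])
    finally show "ennreal (norm (f x)) \<le> ennreal \<delta> * indicator S x + ennreal ((1 / \<delta>) ^ (p - 1)) * ennreal (norm (f x) ^ p)"
      using out[of x] by (cases "x \<in> S") auto
  qed
  also have "\<dots> = ennreal \<delta> * emeasure lborel S + ennreal ((1 / \<delta>) ^ (p - 1)) * lpint p f"
    by (simp add: nn_integral_add nn_integral_cmult lpint_def nn_integral_cmult_indicator)
  finally show ?thesis .
qed

lemma L1_tendsto_0_of_Lp:
  fixes f :: "nat \<Rightarrow> 'a::euclidean_space \<Rightarrow> 'b::euclidean_space"
  assumes p: "p > 0" and f: "\<And>k. f k \<in> borel_measurable borel"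
    and out: "\<And>k x. x \<notin> cball z r \<Longrightarrow> f k x = 0" and lim: "(\<lambda>k. lpint p (f k)) \<longlonglongrightarrow> 0"
  shows "(\<lambda>k. \<integral>\<^sup>+x. ennreal (norm (f k x)) \<partial>lborel) \<longlonglongrightarrow> 0"
proof (rule order_tendstoI)
  fix e :: ennreal assume "0 < e"
  then obtain e0 where e0: "e0 > 0" "ennreal e0 < e" using ennreal_ex_real_less by blast
  define w where "w = measure lborel (cball z r) + 1"
  have w: "w > 0" by (simp add: w_def add_nonneg_pos)
  have ew: "emeasure lborel (cball z r) \<le> ennreal w"
    using emeasure_lborel_cball_finite[of z r] by (simp add: emeasure_eq_ennreal_measure w_def)
  define \<delta> where "\<delta> = e0 / 2 / w"
  have \<delta>: "\<delta> > 0" using e0 w by (simp add: \<delta>_def)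
  have "(\<lambda>k. ennreal ((1 / \<delta>) ^ (p - 1)) * lpint p (f k)) \<longlonglongrightarrow> 0"
    by (rule tendsto_mult_0_ennreal[OF lim]) simp
  moreover have "ennreal (e0 / 2) > 0" using e0 by simp
  ultimately have "\<forall>\<^sub>F k in sequentially. ennreal ((1 / \<delta>) ^ (p - 1)) * lpint p (f k) < ennreal (e0 / 2)"
    using order_tendstoD(2) by blast
  then show "\<forall>\<^sub>F k in sequentially. (\<integral>\<^sup>+x. ennreal (norm (f k x)) \<partial>lborel) < e"
  proof eventually_elim
    case (elim k)
    have "(\<integral>\<^sup>+x. ennreal (norm (f k x)) \<partial>lborel) \<le> ennreal \<delta> * emeasure lborel (cball z r) + ennreal ((1 / \<delta>) ^ (p - 1)) * lpint p (f k)"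
      by (rule L1_le_Lp_bounded_support[OF p f _ out \<delta>]) auto
    also have "\<dots> \<le> ennreal \<delta> * ennreal w + ennreal (e0 / 2)"
      using ew elim by (intro add_mono mult_left_mono) auto
    also have "\<dots> = ennreal e0" using \<delta> w e0 by (simp add: ennreal_mult[symmetric] \<delta>_def flip: ennreal_plus)
    finally show ?case using e0 by simp
  qed
qed simp

text \<open>The difference is the integral of the derivative along the segment from \<open>x\<close>
  to \<open>x + y\<close>. Fubini and translation invariance remove the position on the
  segment.\<close>

lemma C1_translation_le:
  fixes \<phi> :: "real ^ 'n::finite \<Rightarrow> real"
  assumes C: "C1_grad \<phi> \<psi>"
  shows "(\<integral>\<^sup>+x. ennreal \<bar>\<phi> (x + y) - \<phi> x\<bar> \<partial>lborel) \<le> ennreal (norm y) * (\<integral>\<^sup>+x. ennreal (norm (\<psi> x)) \<partial>lborel)"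
proof -
  note [measurable] = C1_grad_borel[OF C]
  have pt: "ennreal \<bar>\<phi> (x + y) - \<phi> x\<bar> \<le> (\<integral>\<^sup>+t. indicator {0..1} t * (ennreal (norm y) * ennreal (norm (\<psi> (x + t *\<^sub>R y)))) \<partial>lborel)" for x
  proof -
    have d: "((\<lambda>t. \<phi> (x + t *\<^sub>R y)) has_vector_derivative (\<psi> (x + t *\<^sub>R y) \<bullet> y)) (at t within {0..1})" for t
    proof -
      have "(\<phi> has_derivative (\<lambda>h. \<psi> (x + t *\<^sub>R y) \<bullet> h)) (at (x + t *\<^sub>R y))" using C by (auto simp: C1_grad_def)
      moreover have "((\<lambda>t. x + t *\<^sub>R y) has_derivative (\<lambda>h. h *\<^sub>R y)) (at t within {0..1})"
        by (auto intro!: derivative_eq_intros)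
      ultimately have "((\<lambda>t. \<phi> (x + t *\<^sub>R y)) has_derivative (\<lambda>h. \<psi> (x + t *\<^sub>R y) \<bullet> (h *\<^sub>R y))) (at t within {0..1})"
        by (rule has_derivative_compose[rotated])
      then show ?thesis by (simp add: has_vector_derivative_def)
    qed
    have c: "continuous_on {0..1} (\<lambda>t. \<psi> (x + t *\<^sub>R y) \<bullet> y)"
      by (intro continuous_intros continuous_on_compose2[OF C1_grad_cont(2)[OF C]]) auto
    have hb: "has_bochner_integral lborel (\<lambda>t. indicator {0..1} t *\<^sub>R (\<psi> (x + t *\<^sub>R y) \<bullet> y)) (\<phi> (x + 1 *\<^sub>R y) - \<phi> (x + 0 *\<^sub>R y))"
      by (rule has_bochner_integral_FTC_Icc[OF _ d c]) simp
    then have i: "integrable lborel (\<lambda>t. indicator {0..1} t *\<^sub>R (\<psi> (x + t *\<^sub>R y) \<bullet> y))"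
      and e: "(\<integral>t. indicator {0..1} t *\<^sub>R (\<psi> (x + t *\<^sub>R y) \<bullet> y) \<partial>lborel) = \<phi> (x + y) - \<phi> x"
      by (auto simp: has_bochner_integral_iff)
    have "ennreal \<bar>\<phi> (x + y) - \<phi> x\<bar> \<le> (\<integral>\<^sup>+t. norm (indicator {0..1} t *\<^sub>R (\<psi> (x + t *\<^sub>R y) \<bullet> y)) \<partial>lborel)"
      using integral_norm_bound_ennreal[OF i] unfolding e by simp
    also have "\<dots> \<le> (\<integral>\<^sup>+t. indicator {0..1} t * (ennreal (norm y) * ennreal (norm (\<psi> (x + t *\<^sub>R y)))) \<partial>lborel)"
    proof (intro nn_integral_mono)
      fix t :: real
      have "norm (\<psi> (x + t *\<^sub>R y) \<bullet> y) \<le> norm y * norm (\<psi> (x + t *\<^sub>R y))"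
        using Cauchy_Schwarz_ineq2[of "\<psi> (x + t *\<^sub>R y)" y] by (simp add: mult.commute)
      then show "ennreal (norm (indicator {0..1} t *\<^sub>R (\<psi> (x + t *\<^sub>R y) \<bullet> y))) \<le> indicator {0..1} t * (ennreal (norm y) * ennreal (norm (\<psi> (x + t *\<^sub>R y))))"
        by (auto simp: indicator_def ennreal_leI simp flip: ennreal_mult)
    qed
    finally show ?thesis .
  qed
  have "(\<integral>\<^sup>+x. ennreal \<bar>\<phi> (x + y) - \<phi> x\<bar> \<partial>lborel)
    \<le> (\<integral>\<^sup>+x. \<integral>\<^sup>+t. indicator {0..1} t * (ennreal (norm y) * ennreal (norm (\<psi> (x + t *\<^sub>R y)))) \<partial>lborel \<partial>lborel)"
    by (intro nn_integral_mono pt)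
  also have "\<dots> = (\<integral>\<^sup>+t. \<integral>\<^sup>+x. indicator {0..1::real} t * (ennreal (norm y) * ennreal (norm (\<psi> (x + t *\<^sub>R y)))) \<partial>lborel \<partial>lborel)"
    by (rule lborel_pair.Fubini') measurable
  also have "\<dots> = (\<integral>\<^sup>+t. indicator {0..1::real} t * (ennreal (norm y) * (\<integral>\<^sup>+x. ennreal (norm (\<psi> x)) \<partial>lborel)) \<partial>lborel)"
  proof (intro nn_integral_cong)
    fix t :: real
    have "(\<integral>\<^sup>+x. ennreal (norm (\<psi> (x + t *\<^sub>R y))) \<partial>lborel) = (\<integral>\<^sup>+x. ennreal (norm (\<psi> x)) \<partial>lborel)"
      using nn_integral_lborel_shift[of "\<lambda>x. ennreal (norm (\<psi> x))" "t *\<^sub>R y"] by (simp add: add.commute)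
    then show "(\<integral>\<^sup>+x. indicator {0..1} t * (ennreal (norm y) * ennreal (norm (\<psi> (x + t *\<^sub>R y)))) \<partial>lborel)
       = indicator {0..1} t * (ennreal (norm y) * (\<integral>\<^sup>+x. ennreal (norm (\<psi> x)) \<partial>lborel))"
      by (simp add: nn_integral_cmult)
  qed
  also have "\<dots> = ennreal (norm y) * (\<integral>\<^sup>+x. ennreal (norm (\<psi> x)) \<partial>lborel)"
    by (simp add: nn_integral_multc)
  finally show ?thesis .
qed

text \<open>Both sides are continuous in the L1 norm, and on functions with support in one ball
  convergence in the n-th power implies convergence in L1.\<close>

lemma H0_translation_le:
  fixes v :: "real ^ 'n::finite \<Rightarrow> real"
  assumes H: "H0 z r v g"
  shows "(\<integral>\<^sup>+x. ennreal \<bar>v (x + y) - v x\<bar> \<partial>lborel) \<le> ennreal (norm y) * (\<integral>\<^sup>+x. ennreal (norm (g x)) \<partial>lborel)"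
proof -
  obtain \<phi> \<psi> where a: "\<And>k::nat. C1_grad (\<phi> k) (\<psi> k)" "\<And>k x. x \<notin> cball z r \<Longrightarrow> \<phi> k x = 0"
    "(\<lambda>k. lpint CARD('n) (\<lambda>x. \<phi> k x - v x)) \<longlonglongrightarrow> 0" "(\<lambda>k. lpint CARD('n) (\<lambda>x. \<psi> k x - g x)) \<longlonglongrightarrow> 0"
    "AE x in lborel. (\<lambda>k. \<phi> k x) \<longlonglongrightarrow> v x" by (rule H0_seq[OF H]) (rule that, assumption+)
  note [measurable] = H0_borel[OF H] C1_grad_borel[OF a(1)]
  have out: "\<psi> k x = 0" if "x \<notin> cball z r" for k x
    by (rule gradient_zero_outside[OF a(1) closed_cball a(2) that])
  let ?A = "\<lambda>k. \<integral>\<^sup>+x. ennreal (norm (\<phi> k x - v x)) \<partial>lborel"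
  let ?B = "\<lambda>k. \<integral>\<^sup>+x. ennreal (norm (\<psi> k x - g x)) \<partial>lborel"
  let ?I = "\<integral>\<^sup>+x. ennreal (norm (g x)) \<partial>lborel"
  have A: "?A \<longlonglongrightarrow> 0"
    by (rule L1_tendsto_0_of_Lp[OF _ _ _ a(3), of z r]) (use a(2) H0_outside[OF H] in auto)
  have B: "?B \<longlonglongrightarrow> 0"
    by (rule L1_tendsto_0_of_Lp[OF _ _ _ a(4), of z r]) (use out H0_outside[OF H] in auto)
  have "(\<integral>\<^sup>+x. ennreal \<bar>v (x + y) - v x\<bar> \<partial>lborel) \<le> ennreal (norm y) * ?I + (ennreal (norm y) * ?B k + 2 * ?A k)" for k
  proof -
    have "(\<integral>\<^sup>+x. ennreal \<bar>v (x + y) - v x\<bar> \<partial>lborel)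
      \<le> (\<integral>\<^sup>+x. (ennreal \<bar>\<phi> k (x + y) - \<phi> k x\<bar> + ennreal (norm (\<phi> k (x + y) - v (x + y)))) + ennreal (norm (\<phi> k x - v x)) \<partial>lborel)"
      by (intro nn_integral_mono) (auto intro!: ennreal_leI simp flip: ennreal_plus)
    also have "\<dots> = (\<integral>\<^sup>+x. ennreal \<bar>\<phi> k (x + y) - \<phi> k x\<bar> \<partial>lborel)
       + (\<integral>\<^sup>+x. ennreal (norm (\<phi> k (x + y) - v (x + y))) \<partial>lborel) + ?A k"
      by (simp add: nn_integral_add)
    also have "(\<integral>\<^sup>+x. ennreal (norm (\<phi> k (x + y) - v (x + y))) \<partial>lborel) = ?A k"
      using nn_integral_lborel_shift[of "\<lambda>x. ennreal (norm (\<phi> k x - v x))" y] by (simp add: add.commute)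
    also have "(\<integral>\<^sup>+x. ennreal \<bar>\<phi> k (x + y) - \<phi> k x\<bar> \<partial>lborel) \<le> ennreal (norm y) * (\<integral>\<^sup>+x. ennreal (norm (\<psi> k x)) \<partial>lborel)"
      by (rule C1_translation_le[OF a(1)])
    also have "(\<integral>\<^sup>+x. ennreal (norm (\<psi> k x)) \<partial>lborel) \<le> (\<integral>\<^sup>+x. ennreal (norm (g x)) + ennreal (norm (\<psi> k x - g x)) \<partial>lborel)"
      by (intro nn_integral_mono) (auto intro!: ennreal_leI norm_triangle_sub simp flip: ennreal_plus)
    also have "\<dots> = ?I + ?B k" by (simp add: nn_integral_add)
    finally show ?thesis by (simp add: distrib_left mult_2 add.assoc mult_left_mono add_right_mono)
  qed
  moreover have "(\<lambda>k. ennreal (norm y) * ?I + (ennreal (norm y) * ?B k + 2 * ?A k)) \<longlonglongrightarrow> ennreal (norm y) * ?I + (0 + 0)"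
    by (intro tendsto_add tendsto_const tendsto_mult_0_ennreal A B) auto
  ultimately show ?thesis using LIMSEQ_le_const by fastforce
qed

subsection \<open>Localised solutions as test functions\<close>

lemma borel_ball_cball [measurable]:
  fixes z :: "'a::euclidean_space" shows "ball z r \<in> sets borel" "cball z r \<in> sets borel"
  by auto

lemma C1_grad_reflect:
  assumes C: "C1_grad \<rho> g"
  shows "C1_grad (\<lambda>y. \<rho> (x - y)) (\<lambda>y. - g (x - y))"
  unfolding C1_grad_def
proof (intro conjI allI)
  fix y
  have "(\<rho> has_derivative (\<lambda>h. g (x - y) \<bullet> h)) (at (x - y))" using C by (auto simp: C1_grad_def)
  moreover have "((\<lambda>y. x - y) has_derivative (\<lambda>h. - h)) (at y)" by (auto intro!: derivative_eq_intros)
  ultimately have D: "((\<lambda>y. \<rho> (x - y)) has_derivative (\<lambda>h. g (x - y) \<bullet> (- h))) (at y)"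
    by (rule has_derivative_compose[rotated])
  show "((\<lambda>y. \<rho> (x - y)) has_derivative (\<bullet>) (- g (x - y))) (at y)"
    by (rule has_derivative_eq_rhs[OF D]) auto
  show "continuous_on UNIV (\<lambda>y. - g (x - y))"
    by (intro continuous_intros continuous_on_compose2[OF C1_grad_cont(2)[OF C]]) auto
qed

lemma C1_grad_mult:
  assumes "C1_grad \<phi> \<phi>'" "C1_grad \<psi> \<psi>'"
  shows "C1_grad (\<lambda>x. \<phi> x * \<psi> x) (\<lambda>x. \<phi> x *\<^sub>R \<psi>' x + \<psi> x *\<^sub>R \<phi>' x)"
  using assms C1_grad_cont[OF assms(1)] C1_grad_cont[OF assms(2)] unfolding C1_grad_def
  by (auto intro!: continuous_intros has_derivative_mult[THEN has_derivative_eq_rhs] simp: inner_add_left algebra_simps)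

lemma integrable_Lp_bounded_support:
  fixes f :: "'a::euclidean_space \<Rightarrow> 'b::euclidean_space"
  assumes p: "p > 0" and f[measurable]: "f \<in> borel_measurable borel"
    and out: "\<And>x. x \<notin> cball z r \<Longrightarrow> f x = 0" and fin: "lpint p f < \<infinity>"
  shows "integrable lborel f"
proof (rule integrableI_bounded)
  have "(\<integral>\<^sup>+x. ennreal (norm (f x)) \<partial>lborel) \<le> ennreal 1 * emeasure lborel (cball z r) + ennreal ((1 / 1) ^ (p - 1)) * lpint p f"
    by (rule L1_le_Lp_bounded_support[OF p f _ out]) auto
  also have "\<dots> < \<infinity>" using fin emeasure_lborel_cball_finite[of z r] by (auto simp: ennreal_mult_less_top)
  finally show "(\<integral>\<^sup>+x. ennreal (norm (f x)) \<partial>lborel) < \<infinity>" .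
qed simp

lemma bounded_support_bound:
  fixes f :: "'a::euclidean_space \<Rightarrow> 'b::real_normed_vector"
  assumes "continuous_on UNIV f" "\<And>x. x \<notin> cball z r \<Longrightarrow> f x = 0"
  obtains B where "B \<ge> 0" "\<And>x. norm (f x) \<le> B"
proof -
  have "compact (f ` cball z r)" using assms
    by (intro compact_continuous_image) (auto intro: continuous_on_subset)
  then obtain M where M: "\<And>y. y \<in> f ` cball z r \<Longrightarrow> norm y \<le> M"
    using compact_imp_bounded bounded_iff by metis
  have "norm (f x) \<le> max M 0" for x
    using M[of "f x"] assms(2)[of x] by (cases "x \<in> cball z r") auto
  then show ?thesis using that[of "max M 0"] by auto
qed

lemma lpint_indicator: "p > 0 \<Longrightarrow> lpint p (\<lambda>x. indicator S x *\<^sub>R f x) = (\<integral>\<^sup>+x\<in>S. ennreal (norm (f x) ^ p) \<partial>lborel)"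
  unfolding lpint_def by (intro nn_integral_cong) (auto simp: indicator_def power_0_left)

text \<open>Meyers--Serrin: mollification commutes with the weak gradient.\<close>

lemma weak_gradient_cutoff_H0:
  fixes u :: "real ^ 'n::finite \<Rightarrow> real" and z :: "real ^ 'n"
  assumes \<zeta>: "\<And>k. C_k k \<zeta>" "\<And>x. x \<notin> cball z r \<Longrightarrow> \<zeta> x = 0" and r: "r < r'" "r < r2"
    and u[measurable]: "u \<in> borel_measurable borel" "ux \<in> borel_measurable borel"
    and fin: "(\<integral>\<^sup>+x\<in>ball z r2. ennreal (\<bar>u x\<bar> ^ CARD('n)) \<partial>lborel) < \<infinity>"
      "(\<integral>\<^sup>+x\<in>ball z r2. ennreal (norm (ux x) ^ CARD('n)) \<partial>lborel) < \<infinity>"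
    and weak: "\<And>\<phi> i. test_function (ball z r2) \<phi> \<Longrightarrow>
      (\<integral>x. u x * partial_deriv i \<phi> x \<partial>lborel) = - (\<integral>x. ux x $ i * \<phi> x \<partial>lborel)"
  shows "H0 z r' (\<lambda>x. \<zeta> x * u x) (\<lambda>x. \<zeta> x *\<^sub>R ux x + u x *\<^sub>R gradient \<zeta> x)"
proof -
  let ?N = "CARD('n)"
  have C\<zeta>: "C1_grad \<zeta> (gradient \<zeta>)" by (rule C_k_1_C1_grad[OF \<zeta>(1)])
  have g0: "gradient \<zeta> x = 0" if "x \<notin> cball z r" for x by (rule gradient_zero_outside[OF C\<zeta> closed_cball \<zeta>(2) that])
  note [measurable] = C1_grad_borel[OF C\<zeta>]
  have mult_fin: "lpint ?N (\<lambda>x. h x *\<^sub>R f x) < \<infinity> \<and> integrable lborel (\<lambda>x. h x *\<^sub>R f x)"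
    if h: "continuous_on UNIV h" "\<And>x. x \<notin> cball z r \<Longrightarrow> h x = 0" and f[measurable]: "f \<in> borel_measurable borel"
      "(\<integral>\<^sup>+x\<in>ball z r2. ennreal (norm (f x) ^ ?N) \<partial>lborel) < \<infinity>"
    for h :: "real ^ 'n \<Rightarrow> real" and f :: "real ^ 'n \<Rightarrow> 'b::euclidean_space"
  proof
    have [measurable]: "h \<in> borel_measurable borel" using h borel_measurable_continuous_onI by blast
    obtain B where B: "B \<ge> 0" "\<And>x. norm (h x) \<le> B" using bounded_support_bound[OF h] by blast
    have "lpint ?N (\<lambda>x. h x *\<^sub>R f x) \<le> ennreal (B ^ ?N) * lpint ?N (\<lambda>x. indicator (ball z r2) x *\<^sub>R f x)"
    proof (rule lpint_mult_le[OF _ B(1)])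
      show "norm (h x *\<^sub>R f x) \<le> B * norm (indicator (ball z r2) x *\<^sub>R f x)" for x
        using B(2)[of x] h(2)[of x] r by (cases "x \<in> ball z r2") (auto intro!: mult_right_mono)
      show "(\<lambda>x. indicator (ball z r2) x *\<^sub>R f x) \<in> borel_measurable borel"
        by (intro borel_measurable_scaleR borel_measurable_indicator) (use f in auto)
    qed
    also have "\<dots> < \<infinity>" using f(2) by (subst lpint_indicator) (auto simp: ennreal_mult_less_top)
    finally show F: "lpint ?N (\<lambda>x. h x *\<^sub>R f x) < \<infinity>" .
    show "integrable lborel (\<lambda>x. h x *\<^sub>R f x)"
      by (rule integrable_Lp_bounded_support[OF _ _ _ F, of z r]) (use h f in auto)
  qed
  define v where "v x = \<zeta> x * u x" for x
  define g where "g x = \<zeta> x *\<^sub>R ux x + u x *\<^sub>R gradient \<zeta> x" for x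
  have [measurable]: "v \<in> borel_measurable borel" "g \<in> borel_measurable borel" unfolding v_def g_def by measurable
  have v: "lpint ?N v < \<infinity>" "integrable lborel v"
    using mult_fin[OF C1_grad_cont(1)[OF C\<zeta>] \<zeta>(2) u(1)] fin(1) by (auto simp: v_def[abs_def])
  have \<zeta>ux: "lpint ?N (\<lambda>x. \<zeta> x *\<^sub>R ux x) < \<infinity>" "integrable lborel (\<lambda>x. \<zeta> x *\<^sub>R ux x)"
    using mult_fin[OF C1_grad_cont(1)[OF C\<zeta>] \<zeta>(2) u(2) fin(2)] by auto
  have cgi: "continuous_on UNIV (\<lambda>x. gradient \<zeta> x $ i)" for i
    using C1_grad_cont(2)[OF C\<zeta>] by (intro continuous_intros)
  have gu: "integrable lborel (\<lambda>x. gradient \<zeta> x $ i * u x)" for i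
    using mult_fin[OF cgi _ u(1)] g0 fin(1) by auto
  obtain Bg where Bg: "Bg \<ge> 0" "\<And>x. norm (gradient \<zeta> x) \<le> Bg"
    using bounded_support_bound[OF C1_grad_cont(2)[OF C\<zeta>] g0] by blast
  have "lpint ?N (\<lambda>x. u x *\<^sub>R gradient \<zeta> x) \<le> ennreal (Bg ^ ?N) * lpint ?N (\<lambda>x. indicator (ball z r2) x *\<^sub>R u x)"
  proof (rule lpint_mult_le[OF _ Bg(1)])
    show "norm (u x *\<^sub>R gradient \<zeta> x) \<le> Bg * norm (indicator (ball z r2) x *\<^sub>R u x)" for x
      using Bg(2)[of x] g0[of x] r mult_right_mono[of "norm (gradient \<zeta> x)" Bg "\<bar>u x\<bar>"]
      by (cases "x \<in> ball z r2") (auto simp: mult.commute)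
  qed measurable
  also have "\<dots> < \<infinity>" using fin(1) by (subst lpint_indicator) (auto simp: ennreal_mult_less_top)
  finally have ug: "lpint ?N (\<lambda>x. u x *\<^sub>R gradient \<zeta> x) < \<infinity>" .
  have "lpint ?N g \<le> 2 ^ ?N * (lpint ?N (\<lambda>x. \<zeta> x *\<^sub>R ux x) + lpint ?N (\<lambda>x. u x *\<^sub>R gradient \<zeta> x))"
    unfolding g_def by (rule lpint_add_le) measurable
  also have "\<dots> < \<infinity>" using ug \<zeta>ux(1) by (auto simp: ennreal_mult_less_top power_less_top_ennreal)
  finally have gfin: "lpint ?N g < \<infinity>" .
  have gint: "integrable lborel g"
    by (rule integrable_Lp_bounded_support[OF _ _ _ gfin, of z r]) (auto simp: g_def g0 \<zeta>)
  have gi: "integrable lborel (\<lambda>x. g x $ i)" for i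
    using integrable_inner_left[OF gint, of "axis i 1"] by (simp add: inner_axis)
  show ?thesis
    unfolding v_def[symmetric] g_def[symmetric]
  proof (unfold H0_def, intro conjI allI impI)
    fix e :: ennreal assume e: "e > 0"
    then obtain e' where e': "e' > 0" "ennreal e' < e" using ennreal_ex_real_less by blast
    have e'': "ennreal e' > 0" using e' by simp
    obtain d1 where d1: "d1 > 0" "\<And>\<rho> \<epsilon>. \<epsilon> \<le> d1 \<Longrightarrow> mollifier \<epsilon> \<rho> \<Longrightarrow> lpint ?N (\<lambda>x. conv v \<rho> x - v x) \<le> ennreal e'"
      using Lp_mollify[OF _ v(2) v(1) e''] by auto
    obtain d2 where d2: "d2 > 0" "\<And>\<rho> \<epsilon>. \<epsilon> \<le> d2 \<Longrightarrow> mollifier \<epsilon> \<rho> \<Longrightarrow> lpint ?N (\<lambda>x. conv g \<rho> x - g x) \<le> ennreal e'"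
      using Lp_mollify[OF _ gint gfin e''] by auto
    define \<epsilon> where "\<epsilon> = min (r' - r) (min d1 d2)"
    have \<epsilon>d: "\<epsilon> \<le> d1" "\<epsilon> \<le> d2" by (auto simp: \<epsilon>_def)
    have "\<epsilon> > 0" using r d1 d2 by (simp add: \<epsilon>_def)
    then obtain \<rho> :: "real ^ 'n \<Rightarrow> real" where \<rho>: "mollifier \<epsilon> \<rho>" "smooth_bump \<rho>" using ex_smooth_mollifier by blast
    have C\<rho>: "C1_grad \<rho> (gradient \<rho>)" by (rule smooth_bump_C1_grad[OF \<rho>(2)])
    have \<rho>0: "\<rho> x = 0" if "norm x \<ge> \<epsilon>" for x using \<rho>(1) that by (auto simp: mollifier_def)
    have C\<rho>': "C1_grad (partial_deriv i \<rho>) (gradient (partial_deriv i \<rho>))" for i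
      by (rule smooth_bump_C1_grad[OF smooth_bump_partial_deriv[OF \<rho>(2)]])
    note [measurable] = C1_grad_borel[OF C\<rho>] C1_grad_borel(1)[OF C\<rho>']
    obtain M where M: "\<And>x. norm (\<rho> x) \<le> M"
      using bounded_support_uniformly_continuous(2)[OF C1_grad_cont(1)[OF C\<rho>] \<rho>0] by blast
    have "\<rho> x = 0" if "x \<notin> cball 0 \<epsilon>" for x using \<rho>0 that by auto
    then have g\<rho>0: "gradient \<rho> x = 0" if "x \<notin> cball 0 \<epsilon>" for x
      using gradient_zero_outside[OF C\<rho> closed_cball] that by blast
    obtain M' where M': "\<And>x. norm (gradient \<rho> x) \<le> M'"
      using bounded_support_bound[OF C1_grad_cont(2)[OF C\<rho>] g\<rho>0] by blast
    have M'i: "\<bar>partial_deriv i \<rho> x\<bar> \<le> M'" for i x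
      using M'[of x] component_le_norm_cart[of "gradient \<rho> x" i] by (simp add: C1_grad_partial_deriv[OF C\<rho>])
    have D: "C1_grad (conv v \<rho>) (\<lambda>x. \<integral>y. v y *\<^sub>R gradient \<rho> (x - y) \<partial>lborel)"
      by (rule conv_C1_grad[OF v(2) C\<rho> \<rho>0])
    have "(\<integral>y. v y *\<^sub>R gradient \<rho> (x - y) \<partial>lborel) = conv g \<rho> x" for x
    proof (subst vec_eq_iff, intro allI)
      fix i
      have i1: "integrable lborel (\<lambda>y. v y *\<^sub>R gradient \<rho> (x - y))"
        by (rule integrable_scaleR_bounded[OF v(2) _ M']) measurable
      have i1i: "integrable lborel (\<lambda>y. v y * partial_deriv i \<rho> (x - y))"
        using integrable_scaleR_bounded[OF v(2), of "\<lambda>y. partial_deriv i \<rho> (x - y)" M'] M'i by auto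
      have i2: "integrable lborel (\<lambda>y. \<rho> (x - y) *\<^sub>R g y)"
        by (rule conv_integrable[OF gint C1_grad_cont(1)[OF C\<rho>] M])
      have ib: "integrable lborel (\<lambda>y. f y * \<rho> (x - y))" if "integrable lborel f" for f :: "real ^ 'n \<Rightarrow> real"
        using conv_integrable[OF that C1_grad_cont(1)[OF C\<rho>] M, of x] by (simp add: mult.commute)
      have i3: "integrable lborel (\<lambda>y. (gradient \<zeta> y $ i * u y) * \<rho> (x - y))" by (rule ib[OF gu])
      have i4: "integrable lborel (\<lambda>y. (\<zeta> y * ux y $ i) * \<rho> (x - y))"
        using ib[OF integrable_inner_left[OF \<zeta>ux(2), of "axis i 1"]] by (simp add: inner_axis)
      have CR: "C1_grad (\<lambda>y. \<rho> (x - y)) (\<lambda>y. - gradient \<rho> (x - y))" by (rule C1_grad_reflect[OF C\<rho>])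
      \<comment> \<open>The weak gradient is tested with \<open>\<zeta>\<close> times the reflected
        kernel at \<open>x\<close>. The product rule yields the kernel derivative against
        \<open>v\<close> and the two summands of \<open>g\<close>, which is the identity between the
        two convolutions at \<open>x\<close>.\<close>
      have "test_function (ball z r2) (\<lambda>y. \<zeta> y * \<rho> (x - y))"
      proof (rule test_functionI[where K="cball z r"])
        show "C_k k (\<lambda>y. \<zeta> y * \<rho> (x - y))" for k
          using \<rho>(2) by (intro C_k_mult \<zeta> C_k_reflect) (auto simp: smooth_bump_def)
      qed (use r \<zeta> in auto)
      from weak[OF this, of i]
      have "(\<integral>y. u y * (\<zeta> y * (- partial_deriv i \<rho> (x - y)) + \<rho> (x - y) * gradient \<zeta> y $ i) \<partial>lborel)
          = - (\<integral>y. ux y $ i * (\<zeta> y * \<rho> (x - y)) \<partial>lborel)"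
        by (simp add: C1_grad_partial_deriv[OF C1_grad_mult[OF C\<zeta> CR]] C1_grad_partial_deriv[OF C\<rho>])
      also have "(\<integral>y. u y * (\<zeta> y * (- partial_deriv i \<rho> (x - y)) + \<rho> (x - y) * gradient \<zeta> y $ i) \<partial>lborel)
          = (\<integral>y. (gradient \<zeta> y $ i * u y) * \<rho> (x - y) - v y * partial_deriv i \<rho> (x - y) \<partial>lborel)"
        by (intro Bochner_Integration.integral_cong) (auto simp: v_def algebra_simps)
      also have "\<dots> = (\<integral>y. (gradient \<zeta> y $ i * u y) * \<rho> (x - y) \<partial>lborel) - (\<integral>y. v y * partial_deriv i \<rho> (x - y) \<partial>lborel)"
        by (rule Bochner_Integration.integral_diff[OF i3 i1i])
      finally have "(\<integral>y. v y * partial_deriv i \<rho> (x - y) \<partial>lborel)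
        = (\<integral>y. (gradient \<zeta> y $ i * u y) * \<rho> (x - y) \<partial>lborel) + (\<integral>y. (\<zeta> y * ux y $ i) * \<rho> (x - y) \<partial>lborel)"
        by (simp add: mult_ac)
      also have "\<dots> = (\<integral>y. (gradient \<zeta> y $ i * u y) * \<rho> (x - y) + (\<zeta> y * ux y $ i) * \<rho> (x - y) \<partial>lborel)"
        by (rule Bochner_Integration.integral_add[OF i3 i4, symmetric])
      also have "\<dots> = (\<integral>y. (\<rho> (x - y) *\<^sub>R g y) \<bullet> axis i 1 \<partial>lborel)"
        by (intro Bochner_Integration.integral_cong) (auto simp: g_def inner_axis algebra_simps)
      also have "\<dots> = conv g \<rho> x $ i"
        unfolding integral_inner_left[OF i2] by (simp add: conv_def inner_axis)
      finally have A: "(\<integral>y. v y * partial_deriv i \<rho> (x - y) \<partial>lborel) = conv g \<rho> x $ i" .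
      have "(\<integral>y. v y *\<^sub>R gradient \<rho> (x - y) \<partial>lborel) $ i = (\<integral>y. (v y *\<^sub>R gradient \<rho> (x - y)) \<bullet> axis i 1 \<partial>lborel)"
        unfolding integral_inner_left[OF i1] by (simp add: inner_axis)
      also have "\<dots> = (\<integral>y. v y * partial_deriv i \<rho> (x - y) \<partial>lborel)"
        by (simp add: inner_axis C1_grad_partial_deriv[OF C\<rho>])
      finally show "(\<integral>y. v y *\<^sub>R gradient \<rho> (x - y) \<partial>lborel) $ i = conv g \<rho> x $ i" using A by simp
    qed
    with D have D': "C1_grad (conv v \<rho>) (conv g \<rho>)" by simp
    show "\<exists>\<phi> \<psi>. C1_grad \<phi> \<psi> \<and> (\<forall>x. x \<notin> cball z r' \<longrightarrow> \<phi> x = 0) \<and>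
       lpint ?N (\<lambda>x. \<phi> x - v x) < e \<and> lpint ?N (\<lambda>x. \<psi> x - g x) < e"
    proof (intro exI conjI)
      show "C1_grad (conv v \<rho>) (conv g \<rho>)" by (rule D')
      show "\<forall>x. x \<notin> cball z r' \<longrightarrow> conv v \<rho> x = 0"
      proof (intro allI impI)
        fix x assume x: "x \<notin> cball z r'"
        show "conv v \<rho> x = 0"
          by (rule conv_outside_support[where z=z and r=r and \<epsilon>=\<epsilon>]) (use \<zeta> \<rho>0 x in \<open>auto simp: v_def \<epsilon>_def\<close>)
      qed
      show "lpint ?N (\<lambda>x. conv v \<rho> x - v x) < e"
        using d1(2)[OF \<epsilon>d(1) \<rho>(1)] e' by auto
      show "lpint ?N (\<lambda>x. conv g \<rho> x - g x) < e"
        using d2(2)[OF \<epsilon>d(2) \<rho>(1)] e' by auto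
    qed
  qed (use v gfin r \<zeta> g0 in \<open>auto simp: v_def g_def\<close>)
qed

lemma young_light2:
  fixes a b \<delta> :: real
  assumes "a \<ge> 0" "b \<ge> 0" "\<delta> > 0" "p > 0"
  shows "a * b ^ (p - 1) \<le> \<delta> * b ^ p + (1 / \<delta>) ^ (p - 1) * a ^ p"
proof (cases "a \<le> \<delta> * b")
  case True
  then have "a * b ^ (p - 1) \<le> (\<delta> * b) * b ^ (p - 1)" using assms by (intro mult_right_mono) auto
  also have "\<dots> = \<delta> * b ^ p" using assms(4) by (cases p) auto
  finally show ?thesis using assms by (simp add: add_increasing2)
next
  case False
  then have "b ^ (p - 1) \<le> (a / \<delta>) ^ (p - 1)" using assms by (intro power_mono) (auto simp: field_simps)
  then have "a * b ^ (p - 1) \<le> a * (a / \<delta>) ^ (p - 1)" using assms by (intro mult_left_mono) auto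
  also have "\<dots> = (1 / \<delta>) ^ (p - 1) * a ^ p" using assms(4) by (cases p) (auto simp: power_divide)
  finally show ?thesis using assms by (simp add: add_increasing)
qed

text \<open>For a fixed \<open>P\<close>, a small \<open>\<delta>\<close> makes the first term small
  and the second tends to 0 with \<open>f\<close>; this pairing carries limits of gradients through
  the flux term.\<close>

lemma nn_integral_holder_light:
  fixes f :: "'a::euclidean_space \<Rightarrow> 'b::euclidean_space" and P :: "'a \<Rightarrow> real"
  assumes p: "p > 0" and [measurable]: "f \<in> borel_measurable borel" "P \<in> borel_measurable borel"
    and P: "\<And>x. P x \<ge> 0" and \<delta>: "\<delta> > 0"
  shows "(\<integral>\<^sup>+x. ennreal (norm (f x) * P x ^ (p - 1)) \<partial>lborel)
     \<le> ennreal \<delta> * lpint p P + ennreal ((1 / \<delta>) ^ (p - 1)) * lpint p f"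
proof -
  have "(\<integral>\<^sup>+x. ennreal (norm (f x) * P x ^ (p - 1)) \<partial>lborel)
    \<le> (\<integral>\<^sup>+x. ennreal \<delta> * ennreal (norm (P x) ^ p) + ennreal ((1 / \<delta>) ^ (p - 1)) * ennreal (norm (f x) ^ p) \<partial>lborel)"
  proof (intro nn_integral_mono)
    fix x
    have "ennreal (norm (f x) * P x ^ (p - 1)) \<le> ennreal (\<delta> * P x ^ p + (1 / \<delta>) ^ (p - 1) * norm (f x) ^ p)"
      using young_light2[OF norm_ge_zero P \<delta> p] by (intro ennreal_leI)
    then show "ennreal (norm (f x) * P x ^ (p - 1)) \<le> ennreal \<delta> * ennreal (norm (P x) ^ p) + ennreal ((1 / \<delta>) ^ (p - 1)) * ennreal (norm (f x) ^ p)"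
      using \<delta> P[of x] by (simp add: ennreal_mult[symmetric])
  qed
  then show ?thesis by (simp add: nn_integral_add nn_integral_cmult lpint_def)
qed

lemma nn_integral_holder_light_tendsto_0:
  fixes f :: "nat \<Rightarrow> 'a::euclidean_space \<Rightarrow> 'b::euclidean_space" and P :: "'a \<Rightarrow> real"
  assumes p: "p > 0" and f: "\<And>k. f k \<in> borel_measurable borel" and P: "P \<in> borel_measurable borel" "\<And>x. P x \<ge> 0"
    and fin: "lpint p P < \<infinity>" and lim: "(\<lambda>k. lpint p (f k)) \<longlonglongrightarrow> 0"
  shows "(\<lambda>k. \<integral>\<^sup>+x. ennreal (norm (f k x) * P x ^ (p - 1)) \<partial>lborel) \<longlonglongrightarrow> 0"
proof (rule order_tendstoI)
  fix e :: ennreal assume "0 < e"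
  then obtain e0 where e0: "e0 > 0" "ennreal e0 < e" using ennreal_ex_real_less by blast
  define w where "w = enn2real (lpint p P) + 1"
  have w: "w > 0" by (simp add: w_def add_nonneg_pos)
  have "lpint p P = ennreal (enn2real (lpint p P))" using fin by simp
  also have "\<dots> \<le> ennreal w" unfolding w_def by (intro ennreal_leI) simp
  finally have ew: "lpint p P \<le> ennreal w" .
  define \<delta> where "\<delta> = e0 / 2 / w"
  have \<delta>: "\<delta> > 0" using e0 w by (simp add: \<delta>_def)
  have "(\<lambda>k. ennreal ((1 / \<delta>) ^ (p - 1)) * lpint p (f k)) \<longlonglongrightarrow> 0"
    by (rule tendsto_mult_0_ennreal[OF lim]) simp
  moreover have "ennreal (e0 / 2) > 0" using e0 by simp
  ultimately have "\<forall>\<^sub>F k in sequentially. ennreal ((1 / \<delta>) ^ (p - 1)) * lpint p (f k) < ennreal (e0 / 2)"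
    using order_tendstoD(2) by blast
  then show "\<forall>\<^sub>F k in sequentially. (\<integral>\<^sup>+x. ennreal (norm (f k x) * P x ^ (p - 1)) \<partial>lborel) < e"
  proof eventually_elim
    case (elim k)
    have "(\<integral>\<^sup>+x. ennreal (norm (f k x) * P x ^ (p - 1)) \<partial>lborel) \<le> ennreal \<delta> * lpint p P + ennreal ((1 / \<delta>) ^ (p - 1)) * lpint p (f k)"
      by (rule nn_integral_holder_light[OF p f P \<delta>])
    also have "\<dots> \<le> ennreal \<delta> * ennreal w + ennreal (e0 / 2)"
      using ew elim by (intro add_mono mult_left_mono) auto
    also have "\<dots> = ennreal e0" using \<delta> w e0 by (simp add: ennreal_mult[symmetric] \<delta>_def flip: ennreal_plus)
    finally show ?case using e0 by simp
  qed
qed simp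

text \<open>Extends the equation to bounded functions of the Sobolev class. The flux grows like the
  (n-1)-st power of an n-integrable \<open>P\<close> and pairs with gradients in L^n;
  \<open>Gs\<close> is only integrable, so it pairs with bounded functions.\<close>

lemma weak_equation_H0:
  fixes F :: "real ^ 'n::finite \<Rightarrow> real ^ 'n" and Gs P :: "real ^ 'n \<Rightarrow> real" and z :: "real ^ 'n"
  assumes r: "r < r'" and [measurable]: "F \<in> borel_measurable borel" "Gs \<in> borel_measurable borel" "P \<in> borel_measurable borel"
    and P: "\<And>x. P x \<ge> 0" "\<And>x. x \<notin> cball z r' \<Longrightarrow> P x = 0" "lpint CARD('n) P < \<infinity>"
    and A: "A \<ge> 0" and FP: "\<And>x. norm (F x) \<le> A * P x ^ (CARD('n) - 1)" and n2: "CARD('n) \<ge> 2"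
    and G: "integrable lborel Gs"
    and weak: "\<And>\<phi>. (\<And>k. C_k k \<phi>) \<Longrightarrow> (\<And>x. x \<notin> cball z r' \<Longrightarrow> \<phi> x = 0) \<Longrightarrow>
       (\<integral>x. gradient \<phi> x \<bullet> F x + \<phi> x * Gs x \<partial>lborel) = 0"
    and H: "H0 z r v g" and M: "\<And>x. \<bar>v x\<bar> \<le> M"
  shows "integrable lborel (\<lambda>x. g x \<bullet> F x)" "integrable lborel (\<lambda>x. v x * Gs x)"
    "(\<integral>x. g x \<bullet> F x \<partial>lborel) + (\<integral>x. v x * Gs x \<partial>lborel) = 0"
proof -
  let ?N = "CARD('n)"
  have M0: "M \<ge> 0" using M[of 0] by simp
  have pt: "norm (h x \<bullet> F x) \<le> A * (norm (h x) * P x ^ (?N - 1))" for h x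
  proof -
    have "norm (h x \<bullet> F x) \<le> norm (h x) * norm (F x)" using Cauchy_Schwarz_ineq2 by simp
    also have "\<dots> \<le> norm (h x) * (A * P x ^ (?N - 1))" by (intro mult_left_mono FP) auto
    finally show ?thesis by (simp add: mult_ac)
  qed
  have bd: "(\<integral>\<^sup>+x. ennreal (norm (h x \<bullet> F x)) \<partial>lborel) \<le> ennreal A * (\<integral>\<^sup>+x. ennreal (norm (h x) * P x ^ (?N - 1)) \<partial>lborel)"
    if [measurable]: "h \<in> borel_measurable borel" for h
  proof -
    have "(\<integral>\<^sup>+x. ennreal (norm (h x \<bullet> F x)) \<partial>lborel) \<le> (\<integral>\<^sup>+x. ennreal A * ennreal (norm (h x) * P x ^ (?N - 1)) \<partial>lborel)"
      using pt A P(1) by (intro nn_integral_mono) (simp add: ennreal_mult[symmetric] ennreal_leI)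
    then show ?thesis by (simp add: nn_integral_cmult)
  qed
  have iF: "integrable lborel (\<lambda>x. h x \<bullet> F x)" if [measurable]: "h \<in> borel_measurable borel" and fin: "lpint ?N h < \<infinity>" for h
  proof (rule integrableI_bounded)
    have "(\<integral>\<^sup>+x. ennreal (norm (h x \<bullet> F x)) \<partial>lborel) \<le> ennreal A * (\<integral>\<^sup>+x. ennreal (norm (h x) * P x ^ (?N - 1)) \<partial>lborel)"
      by (rule bd) measurable
    also have "\<dots> \<le> ennreal A * (ennreal 1 * lpint ?N P + ennreal ((1 / 1) ^ (?N - 1)) * lpint ?N h)"
      by (intro mult_left_mono nn_integral_holder_light P) auto
    also have "\<dots> < \<infinity>" using fin P(3) by (auto simp: ennreal_mult_less_top)
    finally show "(\<integral>\<^sup>+x. ennreal (norm (h x \<bullet> F x)) \<partial>lborel) < \<infinity>" .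
  qed measurable
  have F0: "F x = 0" if "x \<notin> cball z r'" for x
    using FP[of x] P(2)[OF that] n2 by (simp add: power_0_left)
  have intF: "integrable lborel F"
  proof (rule integrableI_bounded)
    have "(\<integral>\<^sup>+x. ennreal (norm (F x)) \<partial>lborel) \<le> (\<integral>\<^sup>+x. ennreal A * ennreal (norm (indicator (cball z r') x :: real) * P x ^ (?N - 1)) \<partial>lborel)"
    proof (intro nn_integral_mono)
      fix x show "ennreal (norm (F x)) \<le> ennreal A * ennreal (norm (indicator (cball z r') x :: real) * P x ^ (?N - 1))"
        using FP[of x] F0[of x] A P(1)[of x] by (cases "x \<in> cball z r'") (auto simp: ennreal_mult[symmetric] ennreal_leI)
    qed
    also have "\<dots> = ennreal A * (\<integral>\<^sup>+x. ennreal (norm (indicator (cball z r') x :: real) * P x ^ (?N - 1)) \<partial>lborel)"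
      by (rule nn_integral_cmult) measurable
    also have "\<dots> \<le> ennreal A * (ennreal 1 * lpint ?N P + ennreal ((1 / 1) ^ (?N - 1)) * lpint ?N (indicator (cball z r') :: _ \<Rightarrow> real))"
      by (intro mult_left_mono nn_integral_holder_light P) auto
    also have "\<dots> < \<infinity>"
    proof -
      have "lpint ?N (indicator (cball z r') :: real ^ 'n \<Rightarrow> real) = (\<integral>\<^sup>+x. indicator (cball z r') x \<partial>lborel)"
        unfolding lpint_def by (intro nn_integral_cong) (auto simp: indicator_def power_0_left)
      then show ?thesis using P(3) emeasure_lborel_cball_finite[of z r'] by (auto simp: ennreal_mult_less_top)
    qed
    finally show "(\<integral>\<^sup>+x. ennreal (norm (F x)) \<partial>lborel) < \<infinity>" .
  qed measurable
  have iG: "integrable lborel (\<lambda>x. h x * Gs x)" if "h \<in> borel_measurable borel" "\<And>x. \<bar>h x\<bar> \<le> B" for h B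
    using integrable_scaleR_bounded[OF G, of h B] that by (simp add: mult.commute)
  \<comment> \<open>For C1 functions, approximation uniform in value and gradient suffices, since
    \<open>F\<close> and \<open>Gs\<close> are integrable.\<close>
  have step1: "(\<integral>x. \<psi> x \<bullet> F x \<partial>lborel) + (\<integral>x. \<phi> x * Gs x \<partial>lborel) = 0"
    if C: "C1_grad \<phi> \<psi>" and s: "\<And>x. x \<notin> cball z r \<Longrightarrow> \<phi> x = 0" for \<phi> \<psi>
  proof -
    note [measurable] = C1_grad_borel[OF C]
    define I where "I = (\<integral>x. norm (F x) \<partial>lborel) + (\<integral>x. \<bar>Gs x\<bar> \<partial>lborel)"
    note HC = C1_grad_H0[OF C s]
    obtain B where B: "\<And>x. norm (\<phi> x) \<le> B" using bounded_support_bound[OF C1_grad_cont(1)[OF C] s] by blast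
    have i1: "integrable lborel (\<lambda>x. \<psi> x \<bullet> F x)" "integrable lborel (\<lambda>x. \<phi> x * Gs x)"
      using iF[of \<psi>] H0_finite[OF HC] iG[of \<phi> B] B by auto
    have key: "\<bar>(\<integral>x. \<psi> x \<bullet> F x \<partial>lborel) + (\<integral>x. \<phi> x * Gs x \<partial>lborel)\<bar> \<le> e * I" if e: "e > 0" for e
    proof -
      obtain \<phi>' where \<phi>': "\<And>k. C_k k \<phi>'" "\<And>x. x \<notin> cball z r' \<Longrightarrow> \<phi>' x = 0"
        "\<And>x. norm (\<phi>' x - \<phi> x) \<le> e" "\<And>x. norm (gradient \<phi>' x - \<psi> x) \<le> e"
        using C1_uniform_smooth_approx[OF C s r e] by blast
      have C': "C1_grad \<phi>' (gradient \<phi>')" by (rule C_k_1_C1_grad[OF \<phi>'(1)])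
      note [measurable] = C1_grad_borel[OF C']
      note HC' = C1_grad_H0[OF C' \<phi>'(2)]
      obtain B where B: "\<And>x. norm (\<phi>' x) \<le> B" using bounded_support_bound[OF C1_grad_cont(1)[OF C'] \<phi>'(2)] by blast
      have i2: "integrable lborel (\<lambda>x. gradient \<phi>' x \<bullet> F x)" "integrable lborel (\<lambda>x. \<phi>' x * Gs x)"
        using iF[of "gradient \<phi>'"] H0_finite[OF HC'] iG[of \<phi>' B] B by auto
      have "(\<integral>x. gradient \<phi>' x \<bullet> F x \<partial>lborel) + (\<integral>x. \<phi>' x * Gs x \<partial>lborel) = 0"
        using weak[OF \<phi>'(1,2)] i2 by simp
      then have "\<bar>(\<integral>x. \<psi> x \<bullet> F x \<partial>lborel) + (\<integral>x. \<phi> x * Gs x \<partial>lborel)\<bar>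
        = \<bar>((\<integral>x. gradient \<phi>' x \<bullet> F x \<partial>lborel) - (\<integral>x. \<psi> x \<bullet> F x \<partial>lborel)) + ((\<integral>x. \<phi>' x * Gs x \<partial>lborel) - (\<integral>x. \<phi> x * Gs x \<partial>lborel))\<bar>"
        by simp
      also have "\<dots> = \<bar>(\<integral>x. (gradient \<phi>' x - \<psi> x) \<bullet> F x \<partial>lborel) + (\<integral>x. (\<phi>' x - \<phi> x) * Gs x \<partial>lborel)\<bar>"
        using i1 i2 by (simp add: inner_diff_left left_diff_distrib)
      also have "\<dots> \<le> norm (\<integral>x. (gradient \<phi>' x - \<psi> x) \<bullet> F x \<partial>lborel) + norm (\<integral>x. (\<phi>' x - \<phi> x) * Gs x \<partial>lborel)"
        by simp
      also have "\<dots> \<le> (\<integral>x. e * norm (F x) \<partial>lborel) + (\<integral>x. e * \<bar>Gs x\<bar> \<partial>lborel)"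
      proof (intro add_mono Bochner_Integration.integral_norm_bound_integral)
        show "integrable lborel (\<lambda>x. (gradient \<phi>' x - \<psi> x) \<bullet> F x)" "integrable lborel (\<lambda>x. (\<phi>' x - \<phi> x) * Gs x)"
          using i1 i2 by (auto simp: inner_diff_left left_diff_distrib)
        show "integrable lborel (\<lambda>x. e * norm (F x))" "integrable lborel (\<lambda>x. e * \<bar>Gs x\<bar>)" using intF G by auto
        show "norm ((gradient \<phi>' x - \<psi> x) \<bullet> F x) \<le> e * norm (F x)" for x
          using Cauchy_Schwarz_ineq2[of "gradient \<phi>' x - \<psi> x" "F x"] mult_right_mono[OF \<phi>'(4)[of x], of "norm (F x)"] by simp
        show "norm ((\<phi>' x - \<phi> x) * Gs x) \<le> e * \<bar>Gs x\<bar>" for x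
          using mult_right_mono[OF \<phi>'(3)[of x], of "\<bar>Gs x\<bar>"] by (simp add: abs_mult)
      qed
      also have "\<dots> = e * I" by (simp add: I_def algebra_simps)
      finally show ?thesis .
    qed
    have I: "I \<ge> 0" unfolding I_def by (intro add_nonneg_nonneg Bochner_Integration.integral_nonneg) auto
    have "\<bar>(\<integral>x. \<psi> x \<bullet> F x \<partial>lborel) + (\<integral>x. \<phi> x * Gs x \<partial>lborel)\<bar> \<le> 0 + e" if "e > 0" for e
    proof -
      have "\<bar>(\<integral>x. \<psi> x \<bullet> F x \<partial>lborel) + (\<integral>x. \<phi> x * Gs x \<partial>lborel)\<bar> \<le> e / (I + 1) * I"
        using that I by (intro key) auto
      also have "\<dots> \<le> e" using that I by (simp add: divide_simps)
      finally show ?thesis by simp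
    qed
    then have "\<bar>(\<integral>x. \<psi> x \<bullet> F x \<partial>lborel) + (\<integral>x. \<phi> x * Gs x \<partial>lborel)\<bar> \<le> 0" by (rule field_le_epsilon)
    then show ?thesis by simp
  qed
  \<comment> \<open>A C1 truncation, equal to the identity on \<open>[-M, M]\<close> and bounded by
    \<open>M + 2\<close>. Composition leaves \<open>v\<close> unchanged but bounds the approximants
    uniformly, as dominated convergence against \<open>Gs\<close> demands.\<close>
  define T where "T t = t - soft_pos 1 (t - M) + soft_pos 1 (- t - M)" for t
  define \<tau> where "\<tau> t = 1 - soft_step 1 (t - M) - soft_step 1 (- t - M)" for t
  have dT: "(T has_real_derivative \<tau> t) (at t)" for t
  proof -
    have 1: "((\<lambda>t. soft_pos 1 (t - M)) has_real_derivative soft_step 1 (t - M)) (at t)"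
      using DERIV_shift[of "soft_pos 1" "soft_step 1 (t - M)" t "- M"] soft_pos_deriv[of 1 "t - M"] by simp
    have "((\<lambda>s. soft_pos 1 (s - M)) has_real_derivative soft_step 1 (- t - M)) (at (- t))"
      using DERIV_shift[of "soft_pos 1" "soft_step 1 (- t - M)" "- t" "- M"] soft_pos_deriv[of 1 "- t - M"] by simp
    then have 2: "((\<lambda>t. soft_pos 1 (- t - M)) has_real_derivative - soft_step 1 (- t - M)) (at t)"
      by (subst (asm) DERIV_mirror) simp
    show ?thesis unfolding T_def \<tau>_def
      using DERIV_add[OF DERIV_diff[OF DERIV_ident 1] 2] by simp
  qed
  have c\<tau>: "continuous_on UNIV \<tau>" unfolding \<tau>_def
    by (intro continuous_intros continuous_on_compose2[OF soft_step(5)[of 1]]) auto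
  have b\<tau>: "\<bar>\<tau> t\<bar> \<le> 2" for t
    using soft_step(1,2)[of 1 "t - M"] soft_step(1,2)[of 1 "- t - M"] by (auto simp: \<tau>_def)
  have T0: "T 0 = 0" using M0 by (simp add: T_def)
  have bT: "\<bar>T t\<bar> \<le> M + 2" for t
  proof -
    have a: "\<bar>soft_pos 1 (t - M) - max 0 (t - M)\<bar> \<le> 1" "\<bar>soft_pos 1 (- t - M) - max 0 (- t - M)\<bar> \<le> 1"
      using soft_pos(3)[of 1] by auto
    have b: "\<bar>t - max 0 (t - M) + max 0 (- t - M)\<bar> \<le> M" using M0 by (auto simp: max_def)
    show ?thesis using a b unfolding T_def by linarith
  qed
  have Tv: "T (v x) = v x" "\<tau> (v x) = 1" for x
    using M[of x] soft_pos(1)[of 1 "v x - M"] soft_pos(1)[of 1 "- v x - M"]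
      soft_step(3)[of 1 "v x - M"] soft_step(3)[of 1 "- v x - M"] by (auto simp: T_def \<tau>_def abs_le_iff)
  obtain \<phi> \<psi> where a: "\<And>k::nat. C1_grad (\<lambda>x. T (\<phi> k x)) (\<psi> k)" "\<And>k x. x \<notin> cball z r \<Longrightarrow> T (\<phi> k x) = 0"
    "(\<lambda>k. lpint CARD('n) (\<lambda>x. T (\<phi> k x) - T (v x))) \<longlonglongrightarrow> 0"
    "(\<lambda>k. lpint CARD('n) (\<lambda>x. \<psi> k x - \<tau> (v x) *\<^sub>R g x)) \<longlonglongrightarrow> 0"
    "AE x in lborel. (\<lambda>k. T (\<phi> k x)) \<longlonglongrightarrow> T (v x)"
    by (rule H0_compose_seq[OF H dT c\<tau> b\<tau> T0]) (rule that, assumption+)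
  note [measurable] = H0_borel[OF H] C1_grad_borel[OF a(1)]
  show ig: "integrable lborel (\<lambda>x. g x \<bullet> F x)" by (rule iF) (use H0_finite[OF H] in auto)
  show iv: "integrable lborel (\<lambda>x. v x * Gs x)" by (rule iG[of v M]) (use M in auto)
  have l1: "(\<lambda>k. \<integral>x. T (\<phi> k x) * Gs x \<partial>lborel) \<longlonglongrightarrow> (\<integral>x. v x * Gs x \<partial>lborel)"
  proof (rule integral_dominated_convergence[where w="\<lambda>x. (M + 2) * \<bar>Gs x\<bar>"])
    show "integrable lborel (\<lambda>x. (M + 2) * \<bar>Gs x\<bar>)" using G by auto
    show "AE x in lborel. (\<lambda>k. T (\<phi> k x) * Gs x) \<longlonglongrightarrow> v x * Gs x"
      using a(5) by eventually_elim (auto simp: Tv intro!: tendsto_intros)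
    show "AE x in lborel. norm (T (\<phi> k x) * Gs x) \<le> (M + 2) * \<bar>Gs x\<bar>" for k
      using bT by (auto simp: abs_mult intro!: mult_right_mono)
  qed measurable
  have i\<psi>: "integrable lborel (\<lambda>x. \<psi> k x \<bullet> F x)" for k
    by (rule iF) (use H0_finite(2)[OF C1_grad_H0[OF a(1,2)]] in auto)
  have l2: "(\<lambda>k. (\<integral>x. \<psi> k x \<bullet> F x \<partial>lborel) - (\<integral>x. g x \<bullet> F x \<partial>lborel)) \<longlonglongrightarrow> 0"
  proof -
    have l: "(\<lambda>k. ennreal A * (\<integral>\<^sup>+x. ennreal (norm (\<psi> k x - g x) * P x ^ (?N - 1)) \<partial>lborel)) \<longlonglongrightarrow> 0"
      by (rule tendsto_mult_0_ennreal[OF nn_integral_holder_light_tendsto_0]) (use P a(4) in \<open>auto simp: Tv\<close>)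
    have le: "ennreal \<bar>(\<integral>x. \<psi> k x \<bullet> F x \<partial>lborel) - (\<integral>x. g x \<bullet> F x \<partial>lborel)\<bar>
       \<le> ennreal A * (\<integral>\<^sup>+x. ennreal (norm (\<psi> k x - g x) * P x ^ (?N - 1)) \<partial>lborel)" for k
    proof -
      have i: "integrable lborel (\<lambda>x. (\<psi> k x - g x) \<bullet> F x)" using i\<psi>[of k] ig by (simp add: inner_diff_left)
      have "(\<integral>x. \<psi> k x \<bullet> F x \<partial>lborel) - (\<integral>x. g x \<bullet> F x \<partial>lborel) = (\<integral>x. (\<psi> k x - g x) \<bullet> F x \<partial>lborel)"
        using i\<psi>[of k] ig by (simp add: inner_diff_left)
      also have "ennreal \<bar>\<dots>\<bar> \<le> (\<integral>\<^sup>+x. ennreal (norm ((\<psi> k x - g x) \<bullet> F x)) \<partial>lborel)"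
        using integral_norm_bound_ennreal[OF i] by simp
      also have "\<dots> \<le> ennreal A * (\<integral>\<^sup>+x. ennreal (norm (\<psi> k x - g x) * P x ^ (?N - 1)) \<partial>lborel)" by (rule bd) measurable
      finally show ?thesis .
    qed
    have "(\<lambda>k. ennreal \<bar>(\<integral>x. \<psi> k x \<bullet> F x \<partial>lborel) - (\<integral>x. g x \<bullet> F x \<partial>lborel)\<bar>) \<longlonglongrightarrow> 0"
      by (rule tendsto_0_le_ennreal[OF l le])
    then have "(\<lambda>k. \<bar>(\<integral>x. \<psi> k x \<bullet> F x \<partial>lborel) - (\<integral>x. g x \<bullet> F x \<partial>lborel)\<bar>) \<longlonglongrightarrow> 0"
      by (subst (asm) ennreal_0[symmetric], subst (asm) tendsto_ennreal_iff) auto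
    then show ?thesis by (simp add: tendsto_rabs_zero_iff)
  qed
  have "(\<lambda>k. ((\<integral>x. \<psi> k x \<bullet> F x \<partial>lborel) - (\<integral>x. g x \<bullet> F x \<partial>lborel)) + (\<integral>x. T (\<phi> k x) * Gs x \<partial>lborel)) \<longlonglongrightarrow> 0 + (\<integral>x. v x * Gs x \<partial>lborel)"
    by (intro tendsto_add l1 l2)
  moreover have "((\<integral>x. \<psi> k x \<bullet> F x \<partial>lborel) - (\<integral>x. g x \<bullet> F x \<partial>lborel)) + (\<integral>x. T (\<phi> k x) * Gs x \<partial>lborel) = - (\<integral>x. g x \<bullet> F x \<partial>lborel)" for k
    using step1[OF a(1,2), of k] by linarith
  ultimately have "(\<lambda>k::nat. - (\<integral>x. g x \<bullet> F x \<partial>lborel)) \<longlonglongrightarrow> 0 + (\<integral>x. v x * Gs x \<partial>lborel)"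
    by (simp only:)
  from LIMSEQ_unique[OF tendsto_const this]
  have "- (\<integral>x. g x \<bullet> F x \<partial>lborel) = 0 + (\<integral>x. v x * Gs x \<partial>lborel)" .
  then show "(\<integral>x. g x \<bullet> F x \<partial>lborel) + (\<integral>x. v x * Gs x \<partial>lborel) = 0" by simp
qed

subsection \<open>Trudinger inequalities\<close>

text \<open>In dimension \<open>n\<close> a ball of radius \<open>ball_const n\<close> times the
  n-th root of \<open>a\<close> has measure \<open>2 a\<close>.\<close>

definition ball_const :: "nat \<Rightarrow> real"
  where "ball_const n = root n (2 / unit_ball_vol (real n))"

lemma ball_const_pos: "n > 0 \<Longrightarrow> ball_const n > 0"
  by (simp add: ball_const_def)

lemma H0_level_finite:
  fixes v :: "real ^ 'n::finite \<Rightarrow> real"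
  assumes H: "H0 z r v g" and t: "t \<ge> 0"
  shows "{x. v x > t} \<in> sets borel" "{x. v x > t} \<subseteq> cball z r" "emeasure lborel {x. v x > t} = ennreal (measure lborel {x. v x > t})"
proof -
  note [measurable] = H0_borel[OF H]
  show b: "{x. v x > t} \<in> sets borel" by measurable
  show s: "{x. v x > t} \<subseteq> cball z r"
  proof
    fix x assume "x \<in> {x. v x > t}"
    then have "v x \<noteq> 0" using t by auto
    then show "x \<in> cball z r" using H0_outside(1)[OF H] by blast
  qed
  have "emeasure lborel {x. v x > t} \<le> emeasure lborel (cball z r)" using s by (intro emeasure_mono) auto
  then show "emeasure lborel {x. v x > t} = ennreal (measure lborel {x. v x > t})"
    using emeasure_lborel_cball_finite[of z r] by (intro emeasure_eq_ennreal_measure) (auto simp: top_unique)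
qed

text \<open>
  Averaging \<open>\<bar>T (x + h) - T x\<bar>\<close> over the ball of measure \<open>2 |{T > 0}|\<close>: for at least half of
  the translations \<open>h\<close> the point \<open>x + h\<close> lies outside \<open>{T > 0}\<close>.
\<close>

lemma level_set_decay:
  fixes T :: "real ^ 'n::finite \<Rightarrow> real"
  assumes H: "H0 z r T g" and T: "\<And>x. T x \<ge> 0" and g0: "\<And>x. T x = 0 \<Longrightarrow> g x = 0"
    and J: "J \<ge> 0" "lpint CARD('n) g \<le> ennreal J" and \<Delta>: "\<Delta> > 0" and \<tau>: "\<tau> > 0"
  shows "measure lborel {x. T x \<ge> \<Delta>} * \<Delta>
    \<le> 2 * ball_const CARD('n) * measure lborel {x. T x > 0} * (\<tau> + (1 / \<tau>) ^ (CARD('n) - 1) * J)"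
proof -
  let ?N = "CARD('n)"
  note [measurable] = H0_borel[OF H]
  define a where "a = measure lborel {x. T x > 0}"
  note lev = H0_level_finite[OF H order_refl]
  have Pfin: "emeasure lborel {x. T x \<ge> \<Delta>} = ennreal (measure lborel {x. T x \<ge> \<Delta>})"
  proof -
    have "emeasure lborel {x. T x \<ge> \<Delta>} \<le> emeasure lborel {x. T x > 0}" using \<Delta> by (intro emeasure_mono) auto
    then show ?thesis using lev(3) by (intro emeasure_eq_ennreal_measure) (auto simp: top_unique)
  qed
  have Ple: "measure lborel {x. T x \<ge> \<Delta>} \<le> a"
  proof -
    have "emeasure lborel {x. T x \<ge> \<Delta>} \<le> emeasure lborel {x. T x > 0}" using \<Delta> by (intro emeasure_mono) auto
    then show ?thesis using lev(3) Pfin by (simp add: a_def)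
  qed
  show ?thesis
  proof (cases "a = 0")
    case True
    then have "measure lborel {x. T x \<ge> \<Delta>} = 0" using Ple by (simp add: antisym)
    then show ?thesis using True by (simp add: a_def)
  next
    case False
    then have a: "a > 0" by (simp add: a_def less_le)
    define b where "b = root ?N a"
    have b: "b > 0" "b ^ ?N = a" using a by (auto simp: b_def)
    define \<kappa> where "\<kappa> = ball_const ?N"
    have \<kappa>: "\<kappa> > 0" "\<kappa> ^ ?N = 2 / unit_ball_vol ?N" using ball_const_pos[of ?N] by (auto simp: \<kappa>_def ball_const_def)
    define \<rho> where "\<rho> = \<kappa> * b"
    have \<rho>: "\<rho> > 0" using \<kappa> b by (simp add: \<rho>_def)
    have ball: "emeasure lborel (ball (0::real ^ 'n) \<rho>) = ennreal (2 * a)"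
    proof -
      have "unit_ball_vol (real ?N) \<noteq> 0" using unit_ball_vol_pos[of "real ?N"] by linarith
      then have "unit_ball_vol (real ?N) * \<rho> ^ ?N = 2 * a"
        by (simp add: \<rho>_def power_mult_distrib \<kappa>(2) b(2))
      then show ?thesis using emeasure_ball[of \<rho> "0::real ^ 'n"] \<rho> by simp
    qed
    define I where "I = (\<integral>\<^sup>+x. ennreal (norm (g x)) \<partial>lborel)"
    \<comment> \<open>Young's parameter is \<open>\<tau> / b\<close> with \<open>b\<close> the n-th
      root of the measure \<open>a\<close>. After multiplication by the radius, itself proportional
      to \<open>b\<close>, the bound becomes linear in \<open>a\<close>.\<close>
    define I0 where "I0 = \<tau> / b * a + (1 / (\<tau> / b)) ^ (?N - 1) * J"
    have I0: "I0 \<ge> 0" using \<tau> b a J by (simp add: I0_def)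
    have "I \<le> ennreal (\<tau> / b) * emeasure lborel {x. T x > 0} + ennreal ((1 / (\<tau> / b)) ^ (?N - 1)) * lpint ?N g"
      unfolding I_def
    proof (rule L1_le_Lp_bounded_support)
      show "g x = 0" if "x \<notin> {x. T x > 0}" for x using that T[of x] g0 by auto
    qed (use \<tau> b in auto)
    also have "\<dots> \<le> ennreal (\<tau> / b) * ennreal a + ennreal ((1 / (\<tau> / b)) ^ (?N - 1)) * ennreal J"
      using lev(3) J by (intro add_mono mult_left_mono) (auto simp: a_def)
    also have "\<dots> = ennreal I0" using \<tau> b a J by (simp add: I0_def ennreal_mult[symmetric])
    finally have I: "I \<le> ennreal I0" .
    define X where "X = (\<integral>\<^sup>+h. (\<integral>\<^sup>+x. indicator (ball 0 \<rho>) h * ennreal \<bar>T (x + h) - T x\<bar> \<partial>lborel) \<partial>lborel)"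
    have "X \<le> (\<integral>\<^sup>+h. indicator (ball (0::real ^ 'n) \<rho>) h * (ennreal \<rho> * I) \<partial>lborel)"
      unfolding X_def
    proof (intro nn_integral_mono)
      fix h :: "real ^ 'n"
      have "(\<integral>\<^sup>+x. indicator (ball 0 \<rho>) h * ennreal \<bar>T (x + h) - T x\<bar> \<partial>lborel)
        = indicator (ball 0 \<rho>) h * (\<integral>\<^sup>+x. ennreal \<bar>T (x + h) - T x\<bar> \<partial>lborel)"
        by (rule nn_integral_cmult) measurable
      also have "\<dots> \<le> indicator (ball 0 \<rho>) h * (ennreal \<rho> * I)"
      proof (cases "h \<in> ball 0 \<rho>")
        case True
        have "(\<integral>\<^sup>+x. ennreal \<bar>T (x + h) - T x\<bar> \<partial>lborel) \<le> ennreal (norm h) * I"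
          unfolding I_def by (rule H0_translation_le[OF H])
        also have "\<dots> \<le> ennreal \<rho> * I" using True by (intro mult_right_mono ennreal_leI) auto
        finally show ?thesis using True by simp
      qed simp
      finally show "(\<integral>\<^sup>+x. indicator (ball 0 \<rho>) h * ennreal \<bar>T (x + h) - T x\<bar> \<partial>lborel) \<le> indicator (ball 0 \<rho>) h * (ennreal \<rho> * I)" .
    qed
    also have "\<dots> = ennreal (2 * a) * (ennreal \<rho> * I)" by (simp add: nn_integral_multc ball)
    also have "\<dots> \<le> ennreal (2 * a) * (ennreal \<rho> * ennreal I0)" by (intro mult_left_mono I) auto
    also have "\<dots> = ennreal (2 * a * (\<rho> * I0))" using a \<rho> I0 by (simp add: ennreal_mult)
    finally have up: "X \<le> ennreal (2 * a * (\<rho> * I0))" .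
    have "ennreal (measure lborel {x. T x \<ge> \<Delta>} * (\<Delta> * a)) = (\<integral>\<^sup>+x. ennreal (\<Delta> * a) * indicator {x. T x \<ge> \<Delta>} x \<partial>lborel)"
      using \<Delta> a by (subst nn_integral_cmult_indicator) (auto simp: Pfin ennreal_mult[symmetric] mult.commute)
    also have "\<dots> \<le> (\<integral>\<^sup>+x. \<integral>\<^sup>+h. indicator (ball 0 \<rho>) h * ennreal \<bar>T (x + h) - T x\<bar> \<partial>lborel \<partial>lborel)"
    proof (intro nn_integral_mono)
      fix x
      show "ennreal (\<Delta> * a) * indicator {x. T x \<ge> \<Delta>} x \<le> (\<integral>\<^sup>+h. indicator (ball 0 \<rho>) h * ennreal \<bar>T (x + h) - T x\<bar> \<partial>lborel)"
      proof (cases "T x \<ge> \<Delta>")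
        case True
        define S where "S = {h. T (x + h) > 0}"
        have S[measurable]: "S \<in> sets borel" unfolding S_def by measurable
        have eS: "emeasure lborel S = ennreal a"
        proof -
          have "emeasure lborel S = (\<integral>\<^sup>+h. indicator S h \<partial>lborel)" by simp
          also have "\<dots> = (\<integral>\<^sup>+h. indicator {x. T x > 0} (x + h) \<partial>lborel)"
            by (intro nn_integral_cong) (auto simp: S_def indicator_def)
          also have "\<dots> = emeasure lborel {x. T x > 0}"
            by (subst nn_integral_lborel_shift) auto
          finally show ?thesis using lev(3) by (simp add: a_def)
        qed
        have "ennreal (2 * a) \<le> emeasure lborel ((ball 0 \<rho> - S) \<union> S)"
          unfolding ball[symmetric] by (intro emeasure_mono) auto
        also have "\<dots> \<le> emeasure lborel (ball 0 \<rho> - S) + emeasure lborel S"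
          by (rule emeasure_subadditive) auto
        finally have "ennreal a + ennreal a \<le> emeasure lborel (ball 0 \<rho> - S) + ennreal a"
          using a by (simp add: eS flip: ennreal_plus)
        then have *: "ennreal a \<le> emeasure lborel (ball 0 \<rho> - S)"
          using ennreal_add_left_cancel_le[of "ennreal a" "ennreal a" "emeasure lborel (ball 0 \<rho> - S)"] by (simp add: add.commute)
        have "ennreal (\<Delta> * a) \<le> ennreal \<Delta> * emeasure lborel (ball 0 \<rho> - S)"
          using mult_left_mono[OF *, of "ennreal \<Delta>"] \<Delta> a by (simp add: ennreal_mult)
        also have "\<dots> = (\<integral>\<^sup>+h. ennreal \<Delta> * indicator (ball 0 \<rho> - S) h \<partial>lborel)"
          by (subst nn_integral_cmult_indicator) auto
        also have "\<dots> \<le> (\<integral>\<^sup>+h. indicator (ball 0 \<rho>) h * ennreal \<bar>T (x + h) - T x\<bar> \<partial>lborel)"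
        proof (intro nn_integral_mono)
          fix h
          show "ennreal \<Delta> * indicator (ball 0 \<rho> - S) h \<le> indicator (ball 0 \<rho>) h * ennreal \<bar>T (x + h) - T x\<bar>"
            using T[of "x + h"] True by (auto simp: indicator_def S_def intro!: ennreal_leI)
        qed
        finally show ?thesis using True by simp
      qed simp
    qed
    also have "\<dots> = X" unfolding X_def by (rule lborel_pair.Fubini') measurable
    finally have "ennreal (measure lborel {x. T x \<ge> \<Delta>} * (\<Delta> * a)) \<le> ennreal (2 * a * (\<rho> * I0))" using up by simp
    then have "measure lborel {x. T x \<ge> \<Delta>} * (\<Delta> * a) \<le> 2 * a * (\<rho> * I0)"
      using a \<rho> I0 by (subst (asm) ennreal_le_iff) auto
    then have "a * (measure lborel {x. T x \<ge> \<Delta>} * \<Delta>) \<le> a * (2 * (\<rho> * I0))" by (simp add: mult_ac)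
    then have "measure lborel {x. T x \<ge> \<Delta>} * \<Delta> \<le> 2 * (\<rho> * I0)" using a by simp
    also have "b * I0 = a * (\<tau> + (1 / \<tau>) ^ (?N - 1) * J)"
    proof -
      have "b * b ^ (?N - 1) = a" using b(2) by (simp add: power_Suc[symmetric] del: power_Suc)
      moreover have "(1 / (\<tau> / b)) ^ (?N - 1) = b ^ (?N - 1) * (1 / \<tau>) ^ (?N - 1)" by (simp add: power_divide)
      ultimately show ?thesis using b(1) by (simp add: I0_def algebra_simps)
    qed
    then have "2 * (\<rho> * I0) = 2 * \<kappa> * a * (\<tau> + (1 / \<tau>) ^ (?N - 1) * J)" by (simp add: \<rho>_def mult.assoc)
    finally show ?thesis by (simp add: a_def \<kappa>_def)
  qed
qed

text \<open>Makes the factor \<open>C\<close> per slice at most \<open>exp (-2)\<close>. Of the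
  total gain \<open>exp (-2 m)\<close> the slice energies consume \<open>exp m\<close>, which leaves
  \<open>exp (-m)\<close>.\<close>

definition trudinger_const :: "nat \<Rightarrow> real"
  where "trudinger_const n = 2 * ball_const n * exp 2"

lemma trudinger_const_pos: "n > 0 \<Longrightarrow> trudinger_const n > 0"
  by (simp add: trudinger_const_def ball_const_pos)

text \<open>
  Trudinger's inequality with the sharp exponent, by Maz'ya's truncation: \<open>m\<close> equal level
  slices are treated by \<open>level_set_decay\<close>, and the slice energies add up to at most \<open>J\<close>.
\<close>

lemma exponential_level_decay:
  fixes v :: "real ^ 'n::finite \<Rightarrow> real"
  assumes H: "H0 z r v g" and J: "J > 0" "lpint CARD('n) g \<le> ennreal J" and t: "t > 0"
    and m: "trudinger_const CARD('n) ^ CARD('n) * J * real m ^ (CARD('n) - 1) \<le> t ^ CARD('n)"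
  shows "measure lborel {x. v x > t} \<le> measure lborel {x. v x > 0} * exp (- real m)"
proof (cases "m = 0")
  case True
  have "emeasure lborel {x. v x > t} \<le> emeasure lborel {x. v x > 0}"
    using t H0_level_finite[OF H] by (intro emeasure_mono) auto
  then have "measure lborel {x. v x > t} \<le> measure lborel {x. v x > 0}"
    using t by (simp add: H0_level_finite(3)[OF H])
  then show ?thesis using True by simp
next
  case False
  let ?N = "CARD('n)"
  note [measurable] = H0_borel[OF H]
  have m0: "m > 0" using False by simp
  define \<Delta> where "\<Delta> = t / m"
  have \<Delta>: "\<Delta> > 0" using t m0 by (simp add: \<Delta>_def)
  define \<kappa> where "\<kappa> = ball_const ?N"
  have \<kappa>: "\<kappa> > 0" using ball_const_pos[of ?N] by (simp add: \<kappa>_def)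
  \<comment> \<open>\<open>J / m\<close> is the average energy available per slice. With this
    parameter a slice of energy \<open>Ji j\<close> contributes the factor
    \<open>1 + m Ji j / J\<close>.\<close>
  define \<tau> where "\<tau> = root ?N (J / m)"
  have \<tau>: "\<tau> > 0" "\<tau> ^ ?N = J / m" using J m0 by (auto simp: \<tau>_def)
  define C where "C = 2 * \<kappa> * \<tau> / \<Delta>"
  have C: "C > 0" using \<kappa> \<tau> \<Delta> by (simp add: C_def)
  define gi where "gi i x = (if real i * \<Delta> < v x \<and> v x \<le> real i * \<Delta> + \<Delta> then g x else 0)" for i :: nat and x
  \<comment> \<open>\<open>gs j\<close> collects the first \<open>j\<close> slices; its energy is
    the sum of the slice energies and at most \<open>J\<close>.\<close>
  define gs where "gs j x = (if 0 < v x \<and> v x \<le> real j * \<Delta> then g x else 0)" for j :: nat and x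
  have [measurable]: "gi i \<in> borel_measurable borel" "gs i \<in> borel_measurable borel" for i
    unfolding gi_def gs_def by measurable
  have gs_le: "lpint ?N (gs j) \<le> ennreal J" for j
  proof -
    have "lpint ?N (gs j) \<le> lpint ?N g"
      unfolding lpint_def by (intro nn_integral_mono) (auto simp: gs_def power_0_left intro!: ennreal_leI)
    then show ?thesis using J by simp
  qed
  have gs_Suc: "lpint ?N (gs (Suc j)) = lpint ?N (gs j) + lpint ?N (gi j)" for j
  proof -
    have "ennreal (norm (gs (Suc j) x) ^ ?N) = ennreal (norm (gs j x) ^ ?N) + ennreal (norm (gi j x) ^ ?N)" for x
    proof -
      have j: "real j * \<Delta> \<ge> 0" using \<Delta> by simp
      have S: "real (Suc j) * \<Delta> = real j * \<Delta> + \<Delta>" by (simp add: algebra_simps)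
      consider "v x \<le> 0" | "0 < v x" "v x \<le> real j * \<Delta>" | "real j * \<Delta> < v x" "v x \<le> real j * \<Delta> + \<Delta>" | "real j * \<Delta> + \<Delta> < v x"
        by linarith
      then show ?thesis
      proof cases
        case 1
        then have "\<not> real j * \<Delta> < v x" using j by linarith
        then show ?thesis using 1 by (simp add: gs_def gi_def power_0_left)
      next
        case 2
        then have "v x \<le> real (Suc j) * \<Delta>" unfolding S using \<Delta> by linarith
        then show ?thesis using 2 by (simp add: gs_def gi_def power_0_left)
      next
        case 3
        then have "v x \<le> real (Suc j) * \<Delta>" "0 < v x" unfolding S using j by linarith+
        then show ?thesis using 3 by (simp add: gs_def gi_def power_0_left)
      next
        case 4
        then have "\<not> v x \<le> real (Suc j) * \<Delta>" "\<not> v x \<le> real j * \<Delta>" unfolding S using \<Delta> by linarith+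
        then show ?thesis using 4 by (simp add: gs_def gi_def power_0_left)
      qed
    qed
    then show ?thesis unfolding lpint_def by (simp add: nn_integral_add)
  qed
  have gi_fin: "lpint ?N (gi i) < \<infinity>" for i
  proof -
    have "lpint ?N (gi i) \<le> lpint ?N (gs (Suc i))" unfolding gs_Suc by (simp add: add_increasing)
    also have "\<dots> \<le> ennreal J" by (rule gs_le)
    finally show ?thesis using le_less_trans[OF _ ennreal_less_top] by auto
  qed
  define Ji where "Ji i = enn2real (lpint ?N (gi i))" for i
  have Ji: "Ji i \<ge> 0" "lpint ?N (gi i) = ennreal (Ji i)" for i using gi_fin[of i] by (auto simp: Ji_def)
  have gs_sum: "lpint ?N (gs j) = ennreal (\<Sum>i<j. Ji i)" for j
  proof (induction j)
    case 0
    have "gs 0 = (\<lambda>x. 0)" by (auto simp: gs_def fun_eq_iff)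
    then show ?case by (simp add: lpint_def power_0_left)
  next
    case (Suc j)
    then show ?case unfolding gs_Suc Suc Ji(2) by (simp add: Ji(1) sum_nonneg flip: ennreal_plus)
  qed
  have sumJ: "(\<Sum>i<m. Ji i) \<le> J" using gs_le[of m] J unfolding gs_sum by (simp add: ennreal_le_iff)
  define A where "A j = measure lborel {x. v x > real j * \<Delta>}" for j :: nat
  have A0: "A j \<ge> 0" for j by (simp add: A_def)
  have step: "A (Suc j) \<le> A j * C * exp (m * Ji j / J)" for j
  proof -
    define T where "T x = min \<Delta> (max 0 (v x - real j * \<Delta>))" for x
    have HT: "H0 z r T (gi j)" unfolding T_def gi_def using \<Delta> by (intro H0_truncate[OF H]) auto
    note [measurable] = H0_borel[OF HT]
    have "measure lborel {x. T x \<ge> \<Delta>} * \<Delta> \<le> 2 * \<kappa> * measure lborel {x. T x > 0} * (\<tau> + (1 / \<tau>) ^ (?N - 1) * Ji j)"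
      unfolding \<kappa>_def
      by (rule level_set_decay[OF HT]) (use \<Delta> Ji \<tau> in \<open>auto simp: T_def gi_def min_def max_def split: if_splits\<close>)
    also have "{x. T x > 0} = {x. v x > real j * \<Delta>}" using \<Delta> by (auto simp: T_def min_def max_def)
    also have "(1 / \<tau>) ^ (?N - 1) = \<tau> / \<tau> ^ ?N"
      using \<tau>(1) by (simp add: power_divide divide_simps power_Suc[symmetric] del: power_Suc)
    also have "\<tau> + \<tau> / \<tau> ^ ?N * Ji j = \<tau> * (1 + m * Ji j / J)" using J m0 by (simp add: \<tau>(2) field_simps)
    \<comment> \<open>Replacing \<open>1 + t\<close> by \<open>exp t\<close> makes the product over
      all slices depend only on the sum of their energies.\<close>
    also have "2 * \<kappa> * measure lborel {x. v x > real j * \<Delta>} * (\<tau> * (1 + m * Ji j / J))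
       \<le> 2 * \<kappa> * measure lborel {x. v x > real j * \<Delta>} * (\<tau> * exp (m * Ji j / J))"
      using \<kappa> \<tau> by (intro mult_left_mono exp_ge_add_one_self) auto
    finally have "measure lborel {x. T x \<ge> \<Delta>} * \<Delta> \<le> 2 * \<kappa> * A j * (\<tau> * exp (m * Ji j / J))" by (simp add: A_def)
    then have "measure lborel {x. T x \<ge> \<Delta>} \<le> 2 * \<kappa> * A j * (\<tau> * exp (m * Ji j / J)) / \<Delta>"
      using \<Delta> by (simp add: field_simps)
    also have "\<dots> = A j * C * exp (m * Ji j / J)" by (simp add: C_def)
    finally have 1: "measure lborel {x. T x \<ge> \<Delta>} \<le> A j * C * exp (m * Ji j / J)" .
    have fin: "emeasure lborel {x. T x \<ge> \<Delta>} \<noteq> top"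
    proof -
      have "emeasure lborel {x. T x \<ge> \<Delta>} \<le> emeasure lborel {x. T x > 0}" using \<Delta> by (intro emeasure_mono) auto
      then show ?thesis using H0_level_finite(3)[OF HT order_refl] by (auto simp: top_unique)
    qed
    have "A (Suc j) \<le> measure lborel {x. T x \<ge> \<Delta>}"
      unfolding A_def using fin by (intro measure_mono_fmeasurable fmeasurableI) (auto simp: T_def algebra_simps less_top)
    with 1 show ?thesis by simp
  qed
  have claim: "A j \<le> A 0 * C ^ j * exp (\<Sum>i<j. m * Ji i / J)" for j
  proof (induction j)
    case (Suc j)
    have "A (Suc j) \<le> A j * C * exp (m * Ji j / J)" by (rule step)
    also have "\<dots> \<le> A 0 * C ^ j * exp (\<Sum>i<j. m * Ji i / J) * C * exp (m * Ji j / J)"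
      using Suc C by (intro mult_right_mono) auto
    finally show ?case by (simp add: exp_add mult_ac)
  qed simp
  have "(\<Sum>i<m. m * Ji i / J) = m * (\<Sum>i<m. Ji i) / J" by (simp add: sum_distrib_left sum_divide_distrib)
  also have "\<dots> \<le> m" using sumJ J m0 by (simp add: divide_simps mult_left_mono)
  finally have s: "(\<Sum>i<m. m * Ji i / J) \<le> m" .
  have "trudinger_const ?N * \<tau> \<le> \<Delta>"
  proof (rule power_le_imp_le_base)
    have "(trudinger_const ?N * \<tau>) ^ ?N = trudinger_const ?N ^ ?N * J / m"
      by (simp add: power_mult_distrib \<tau>)
    also have "\<dots> = trudinger_const ?N ^ ?N * J * real m ^ (?N - 1) / real m ^ ?N"
      using m0 by (simp add: field_simps power_Suc[symmetric] del: power_Suc)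
    also have "\<dots> \<le> t ^ ?N / real m ^ ?N" using m m0 by (intro divide_right_mono) auto
    finally have "(trudinger_const ?N * \<tau>) ^ ?N \<le> \<Delta> ^ ?N" by (simp add: \<Delta>_def power_divide)
    then show "(trudinger_const ?N * \<tau>) ^ Suc (?N - 1) \<le> \<Delta> ^ Suc (?N - 1)" by simp
  qed (use \<Delta> in simp)
  then have "C * exp 2 \<le> 1" using \<Delta> by (simp add: C_def trudinger_const_def \<kappa>_def divide_simps mult_ac)
  then have C2: "C \<le> exp (- 2)" by (simp add: exp_minus field_simps)
  have "A m \<le> A 0 * C ^ m * exp (\<Sum>i<m. m * Ji i / J)" by (rule claim)
  also have "\<dots> \<le> A 0 * exp (- 2) ^ m * exp m"
    using C C2 s A0 by (intro mult_mono power_mono) auto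
  also have "\<dots> = A 0 * exp (- real m)"
    by (simp add: exp_of_nat_mult[symmetric] mult.assoc exp_add[symmetric])
  finally show ?thesis using m0 by (simp add: A_def \<Delta>_def)
qed

definition small_set_decay :: "(real ^ 'n::finite) set \<Rightarrow> (real ^ 'n \<Rightarrow> real) \<Rightarrow> real \<Rightarrow> real \<Rightarrow> bool"
  where "small_set_decay B W s \<Gamma> \<longleftrightarrow> (\<forall>E L. E \<in> sets borel \<longrightarrow> E \<subseteq> B \<longrightarrow> L \<ge> 1 \<longrightarrow> emeasure lborel E \<le> ennreal (exp (- L)) \<longrightarrow>
     (\<integral>\<^sup>+x\<in>E. ennreal (W x) \<partial>lborel) \<le> ennreal (\<Gamma> * L powr (- s)))"

text \<open>The 1 accounts for values below the first level; the quotient sums the geometric series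
  over the higher layers. The factor \<open>2 ^ (n - 1)\<close> arises because each layer is
  estimated by its upper level.\<close>

definition weight_const :: "nat \<Rightarrow> real \<Rightarrow> real"
  where "weight_const n s = trudinger_const n ^ n *
    (1 + 2 ^ (n - 1) / (1 - 2 powr (real n - 1 - (s + (real n - 1)) / 2)))"

text \<open>Layers with \<open>t j ^ n\<close> proportional to \<open>2 ^ (j (n - 1))\<close>:
  Trudinger's inequality with \<open>m = 2 ^ j\<close> gives \<open>v x > t j\<close> measure at
  most \<open>exp (- (L + 2 ^ j))\<close>, hence weight at most
  \<open>\<Gamma> (L + 2 ^ j) powr (- s)\<close>.\<close>

lemma weighted_trudinger:
  fixes v :: "real ^ 'n::finite \<Rightarrow> real"
  assumes H: "H0 z r v g" and v: "\<And>x. v x \<ge> 0" and J: "J > 0" "lpint CARD('n) g \<le> ennreal J"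
    and s: "s > real CARD('n) - 1" and n: "CARD('n) \<ge> 2" and [measurable]: "W \<in> borel_measurable borel" and W: "\<And>x. W x \<ge> 0"
    and dec: "small_set_decay (cball z r) W s \<Gamma>" and \<Gamma>: "\<Gamma> \<ge> 0"
    and L: "L \<ge> 1" "measure lborel {x. v x > 0} \<le> exp (- L)"
  shows "(\<integral>\<^sup>+x. ennreal (W x * v x ^ CARD('n)) \<partial>lborel)
    \<le> ennreal (weight_const CARD('n) s * J * \<Gamma> * L powr (- ((s - (real CARD('n) - 1)) / 2)))"
proof -
  let ?N = "CARD('n)"
  note [measurable] = H0_borel[OF H]
  define c where "c = trudinger_const ?N ^ ?N * J"
  have c: "c > 0" using J trudinger_const_pos[of ?N] by (simp add: c_def)
  define t where "t j = root ?N (c * 2 ^ (j * (?N - 1)))" for j :: nat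
  have t: "t j > 0" "t j ^ ?N = c * 2 ^ (j * (?N - 1))" for j using c by (auto simp: t_def)
  \<comment> \<open>The exponent is split as \<open>s = \<theta> + p\<close>. The part
    \<open>\<theta> > 0\<close> gives the decay in \<open>L\<close>, and \<open>p > n - 1\<close>
    makes the sum over the layers converge.\<close>
  define \<theta> where "\<theta> = (s - (real ?N - 1)) / 2"
  define p where "p = (s + (real ?N - 1)) / 2"
  have ps: "s = \<theta> + p" by (simp add: \<theta>_def p_def field_simps)
  have p: "p > real ?N - 1" "p > 0" and \<theta>: "\<theta> > 0" using s n by (auto simp: \<theta>_def p_def)
  have lev: "measure lborel {x. v x > t j} \<le> exp (- (L + 2 ^ j))" for j
  proof -
    have "measure lborel {x. v x > t j} \<le> measure lborel {x. v x > 0} * exp (- real (2 ^ j))"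
    proof (rule exponential_level_decay[OF H J t(1)])
      show "trudinger_const ?N ^ ?N * J * real (2 ^ j) ^ (?N - 1) \<le> t j ^ ?N"
        by (simp add: t(2) c_def power_mult)
    qed
    also have "\<dots> \<le> exp (- L) * exp (- real (2 ^ j))" using L by (intro mult_right_mono) auto
    also have "\<dots> = exp (- (L + 2 ^ j))" by (simp add: exp_add[symmetric])
    finally show ?thesis .
  qed
  have Wlev: "(\<integral>\<^sup>+x\<in>{x. v x > \<sigma>}. ennreal (W x) \<partial>lborel) \<le> ennreal (\<Gamma> * K powr (- s))"
    if "\<sigma> \<ge> 0" "K \<ge> 1" "measure lborel {x. v x > \<sigma>} \<le> exp (- K)" for \<sigma> K
    using dec[unfolded small_set_decay_def, rule_format, of "{x. v x > \<sigma>}" K] H0_level_finite[OF H that(1)] that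
    by (simp add: ennreal_leI)
  have pw: "ennreal (W x * v x ^ ?N) \<le> ennreal (t 0 ^ ?N) * (ennreal (W x) * indicator {x. v x > 0} x)
     + (\<Sum>j. ennreal (t (Suc j) ^ ?N) * (ennreal (W x) * indicator {x. v x > t j} x))" for x
  proof (cases "v x \<le> t 0")
    case True
    have "W x * v x ^ ?N \<le> W x * t 0 ^ ?N" using True v[of x] W[of x] by (intro mult_left_mono power_mono) auto
    then have "ennreal (W x * v x ^ ?N) \<le> ennreal (t 0 ^ ?N) * (ennreal (W x) * indicator {x. v x > 0} x)"
      using v[of x] W[of x] t(1)[of 0] by (cases "v x = 0") (auto simp: power_0_left ennreal_mult[symmetric] mult.commute intro!: ennreal_leI)
    then show ?thesis by (rule add_increasing2[rotated]) simp
  next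
    case False
    have "\<exists>j. v x \<le> t j"
    proof -
      obtain j where j: "v x ^ ?N / c < 2 ^ j" using real_arch_pow[of 2] by auto
      have "(2::real) ^ j \<le> 2 ^ (j * (?N - 1))" using n by (intro power_increasing) auto
      have "v x ^ ?N \<le> c * 2 ^ j" using j c by (simp add: field_simps)
      also have "\<dots> \<le> t j ^ ?N" unfolding t(2) using c \<open>(2::real) ^ j \<le> 2 ^ (j * (?N - 1))\<close> by (intro mult_left_mono) auto
      finally have "v x ^ ?N \<le> t j ^ ?N" .
      then have "v x \<le> t j" using power_strict_mono[of "t j" "v x" ?N] t(1)[of j] by (meson less_imp_le not_le zero_less_card_finite)
      then show ?thesis by blast
    qed
    \<comment> \<open>The first level not exceeded by \<open>v x\<close>: the preceding level is
      exceeded, and its summand alone dominates the left side.\<close>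
    define j where "j = (LEAST j. v x \<le> t j)"
    have j: "v x \<le> t j" unfolding j_def by (rule LeastI_ex) fact
    have "j \<noteq> 0"
    proof
      assume "j = 0"
      then show False using j False by simp
    qed
    then obtain i where i: "j = Suc i" using not0_implies_Suc by blast
    have "i < j" using i by simp
    then have "v x > t i" unfolding j_def using not_less_Least[of i "\<lambda>j. v x \<le> t j"] by (simp add: not_le)
    have "ennreal (W x * v x ^ ?N) \<le> ennreal (t (Suc i) ^ ?N) * (ennreal (W x) * indicator {x. v x > t i} x)"
      using \<open>v x > t i\<close> j i v[of x] W[of x] t(1)[of "Suc i"]
      by (auto simp: ennreal_mult[symmetric] mult.commute[of _ "W x"] intro!: ennreal_leI mult_left_mono power_mono)
    also have "\<dots> = (\<Sum>j\<in>{i}. ennreal (t (Suc j) ^ ?N) * (ennreal (W x) * indicator {x. v x > t j} x))" by simp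
    also have "\<dots> \<le> (\<Sum>j. ennreal (t (Suc j) ^ ?N) * (ennreal (W x) * indicator {x. v x > t j} x))"
      by (rule sum_le_suminf) auto
    finally show ?thesis by (rule add_increasing[rotated]) simp
  qed
  define q where "q = 2 powr (real ?N - 1 - p)"
  have q: "0 < q" "q < 1" using p by (auto simp: q_def powr_less_one)
  have "(\<integral>\<^sup>+x. ennreal (W x * v x ^ ?N) \<partial>lborel)
    \<le> (\<integral>\<^sup>+x. ennreal (t 0 ^ ?N) * (ennreal (W x) * indicator {x. v x > 0} x)
     + (\<Sum>j. ennreal (t (Suc j) ^ ?N) * (ennreal (W x) * indicator {x. v x > t j} x)) \<partial>lborel)"
    by (intro nn_integral_mono pw)
  also have "\<dots> = ennreal (t 0 ^ ?N) * (\<integral>\<^sup>+x\<in>{x. v x > 0}. ennreal (W x) \<partial>lborel)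
     + (\<Sum>j. ennreal (t (Suc j) ^ ?N) * (\<integral>\<^sup>+x\<in>{x. v x > t j}. ennreal (W x) \<partial>lborel))"
    by (simp add: nn_integral_add nn_integral_cmult nn_integral_suminf)
  also have "\<dots> \<le> ennreal (c * \<Gamma> * L powr (- \<theta>)) + (\<Sum>j. ennreal (c * 2 ^ (?N - 1) * \<Gamma> * L powr (- \<theta>) * q ^ j))"
  proof (intro add_mono suminf_le)
    have "ennreal (t 0 ^ ?N) * (\<integral>\<^sup>+x\<in>{x. v x > 0}. ennreal (W x) \<partial>lborel) \<le> ennreal (t 0 ^ ?N) * ennreal (\<Gamma> * L powr (- s))"
      using L by (intro mult_left_mono Wlev) auto
    also have "\<dots> = ennreal (c * (\<Gamma> * L powr (- s)))" using \<Gamma> c by (simp add: t(2) ennreal_mult)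
    also have "\<dots> \<le> ennreal (c * \<Gamma> * L powr (- \<theta>))"
      using L \<Gamma> c p ps unfolding mult.assoc by (intro ennreal_leI mult_left_mono powr_mono) auto
    finally show "ennreal (t 0 ^ ?N) * (\<integral>\<^sup>+x\<in>{x. v x > 0}. ennreal (W x) \<partial>lborel) \<le> ennreal (c * \<Gamma> * L powr (- \<theta>))" .
    fix j
    have "ennreal (t (Suc j) ^ ?N) * (\<integral>\<^sup>+x\<in>{x. v x > t j}. ennreal (W x) \<partial>lborel)
      \<le> ennreal (t (Suc j) ^ ?N) * ennreal (\<Gamma> * (L + 2 ^ j) powr (- s))"
      using L lev[of j] t(1)[of j] by (intro mult_left_mono Wlev) (auto intro: add_increasing2)
    also have "\<dots> = ennreal (c * 2 ^ (Suc j * (?N - 1)) * (\<Gamma> * (L + 2 ^ j) powr (- s)))" using \<Gamma> c by (simp add: t(2) ennreal_mult)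
    also have "\<dots> \<le> ennreal (c * 2 ^ (Suc j * (?N - 1)) * (\<Gamma> * (L powr (- \<theta>) * (2 ^ j) powr (- p))))"
    proof (intro ennreal_leI mult_left_mono)
      have "(L + 2 ^ j) powr (- s) = (L + 2 ^ j) powr (- \<theta>) * (L + 2 ^ j) powr (- p)" by (simp add: ps powr_add[symmetric])
      also have "\<dots> \<le> L powr (- \<theta>) * (2 ^ j) powr (- p)"
        using L p \<theta> by (intro mult_mono powr_mono2') auto
      finally show "(L + 2 ^ j) powr (- s) \<le> L powr (- \<theta>) * (2 ^ j) powr (- p)" .
    qed (use \<Gamma> c in auto)
    also have "c * 2 ^ (Suc j * (?N - 1)) * (\<Gamma> * (L powr (- \<theta>) * (2 ^ j) powr (- p))) = c * 2 ^ (?N - 1) * \<Gamma> * L powr (- \<theta>) * q ^ j"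
    proof -
      have q_eq: "(2::real) ^ (j * (?N - 1)) * (2 ^ j) powr (- p) = q ^ j"
      proof -
        have "(2::real) ^ (j * (?N - 1)) = 2 powr (real j * (real ?N - 1))"
          using n by (subst powr_realpow[symmetric]) (auto simp: of_nat_diff)
        moreover have "((2::real) ^ j) powr (- p) = 2 powr (real j * (- p))"
          by (subst powr_realpow[symmetric]) (auto simp: powr_powr)
        moreover have "q ^ j = 2 powr (real j * (real ?N - 1 - p))"
          using q by (subst powr_realpow[symmetric]) (auto simp: q_def powr_powr mult.commute)
        ultimately show ?thesis by (simp add: powr_add[symmetric] algebra_simps)
      qed
      have S: "(2::real) ^ (Suc j * (?N - 1)) = 2 ^ (?N - 1) * 2 ^ (j * (?N - 1))" by (simp only: mult_Suc power_add)
      show ?thesis unfolding S q_eq[symmetric] by (simp only: mult_ac)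
    qed
    finally show "ennreal (t (Suc j) ^ ?N) * (\<integral>\<^sup>+x\<in>{x. v x > t j}. ennreal (W x) \<partial>lborel) \<le> ennreal (c * 2 ^ (?N - 1) * \<Gamma> * L powr (- \<theta>) * q ^ j)" .
  qed auto
  also have "(\<Sum>j. ennreal (c * 2 ^ (?N - 1) * \<Gamma> * L powr (- \<theta>) * q ^ j)) = ennreal (\<Sum>j. c * 2 ^ (?N - 1) * \<Gamma> * L powr (- \<theta>) * q ^ j)"
    using c \<Gamma> q by (intro suminf_ennreal2 summable_mult summable_geometric) auto
  also have "(\<Sum>j. c * 2 ^ (?N - 1) * \<Gamma> * L powr (- \<theta>) * q ^ j) = c * 2 ^ (?N - 1) * \<Gamma> * L powr (- \<theta>) * (1 / (1 - q))"
    using q by (subst suminf_mult) (auto intro!: summable_geometric simp: suminf_geometric)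
  also have "ennreal (c * \<Gamma> * L powr (- \<theta>)) + ennreal (c * 2 ^ (?N - 1) * \<Gamma> * L powr (- \<theta>) * (1 / (1 - q)))
     = ennreal (c * \<Gamma> * L powr (- \<theta>) + c * 2 ^ (?N - 1) * \<Gamma> * L powr (- \<theta>) * (1 / (1 - q)))"
    using c \<Gamma> q by (intro ennreal_plus[symmetric]) auto
  also have "c * \<Gamma> * L powr (- \<theta>) + c * 2 ^ (?N - 1) * \<Gamma> * L powr (- \<theta>) * (1 / (1 - q))
     = weight_const ?N s * J * \<Gamma> * L powr (- \<theta>)"
    by (simp add: weight_const_def c_def q_def p_def algebra_simps add_divide_distrib)
  finally show ?thesis by (simp add: \<theta>_def)
qed

subsection \<open>Energy estimates\<close>

text \<open>An explicit cutoff, because a gradient bound inversely proportional to the gap enters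
  the iteration. It is a C1 function of the squared distance and thus differentiable at the
  centre.\<close>

lemma ex_C1_cutoff:
  fixes z :: "real ^ 'n::finite"
  assumes r: "0 < r" "r < r'"
  shows "\<exists>\<eta> \<eta>'. C1_grad \<eta> \<eta>' \<and> (\<forall>x. 0 \<le> \<eta> x \<and> \<eta> x \<le> 1) \<and> (\<forall>x\<in>cball z r. \<eta> x = 1) \<and>
    (\<forall>x. x \<notin> cball z r' \<longrightarrow> \<eta> x = 0) \<and> (\<forall>x. norm (\<eta>' x) \<le> 8 / (r' - r))"
proof -
  define d where "d = r'\<^sup>2 - r\<^sup>2"
  have d: "d > 0" unfolding d_def using r by (simp add: power_strict_mono)
  define T where "T t = (max 0 (1 - (max 0 (t - r\<^sup>2))\<^sup>2 / d\<^sup>2))\<^sup>2" for t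
  define \<tau> where "\<tau> t = 2 * max 0 (1 - (max 0 (t - r\<^sup>2))\<^sup>2 / d\<^sup>2) * (- (2 * max 0 (t - r\<^sup>2)) / d\<^sup>2)" for t
  have dT: "(T has_real_derivative \<tau> t) (at t)" for t
  proof -
    have "((\<lambda>t. (max 0 (t - r\<^sup>2))\<^sup>2) has_real_derivative 2 * max 0 (t - r\<^sup>2)) (at t)"
      using DERIV_shift[of "\<lambda>t. (max 0 t)\<^sup>2" "2 * max 0 (t - r\<^sup>2)" t "- r\<^sup>2"] DERIV_max_0_sq[of "t - r\<^sup>2"] by simp
    from DERIV_diff[OF DERIV_const[of 1] DERIV_cdivide[OF this, of "d\<^sup>2"]]
    have "((\<lambda>t. 1 - (max 0 (t - r\<^sup>2))\<^sup>2 / d\<^sup>2) has_real_derivative - (2 * max 0 (t - r\<^sup>2)) / d\<^sup>2) (at t)"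
      by simp
    from DERIV_chain2[where f="\<lambda>t. (max 0 t)\<^sup>2", OF DERIV_max_0_sq this]
    show ?thesis unfolding T_def[abs_def] \<tau>_def .
  qed
  have c\<tau>: "continuous_on UNIV \<tau>" unfolding \<tau>_def using d by (intro continuous_intros) auto
  have "C1_grad (\<lambda>x. (x - z) \<bullet> (x - z)) (\<lambda>x. 2 *\<^sub>R (x - z))"
    unfolding C1_grad_def
  proof (intro conjI allI)
    fix x
    have D: "((\<lambda>x. (x - z) \<bullet> (x - z)) has_derivative (\<lambda>h. (x - z) \<bullet> h + h \<bullet> (x - z))) (at x)"
      by (auto intro!: derivative_eq_intros)
    show "((\<lambda>x. (x - z) \<bullet> (x - z)) has_derivative (\<bullet>) (2 *\<^sub>R (x - z))) (at x)"
      by (rule has_derivative_eq_rhs[OF D]) (auto simp: inner_commute)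
  qed (intro continuous_intros)
  from C1_grad_compose[OF this dT c\<tau>]
  have C: "C1_grad (\<lambda>x. T ((x - z) \<bullet> (x - z))) (\<lambda>x. \<tau> ((x - z) \<bullet> (x - z)) *\<^sub>R 2 *\<^sub>R (x - z))" .
  have nn: "(x - z) \<bullet> (x - z) = (norm (x - z))\<^sup>2" for x by (simp add: power2_norm_eq_inner)
  have T01: "0 \<le> T t \<and> T t \<le> 1" for t
  proof -
    have "0 \<le> max 0 (1 - (max 0 (t - r\<^sup>2))\<^sup>2 / d\<^sup>2)" "max 0 (1 - (max 0 (t - r\<^sup>2))\<^sup>2 / d\<^sup>2) \<le> 1" by auto
    then show ?thesis unfolding T_def by (auto simp: power_le_one)
  qed
  have T1: "T ((x - z) \<bullet> (x - z)) = 1" if "x \<in> cball z r" for x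
  proof -
    have "(norm (x - z))\<^sup>2 \<le> r\<^sup>2" using that by (intro power_mono) (auto simp: dist_norm norm_minus_commute)
    then show ?thesis by (simp add: T_def nn)
  qed
  have far: "max 0 (1 - (max 0 ((norm (x - z))\<^sup>2 - r\<^sup>2))\<^sup>2 / d\<^sup>2) = 0" if "x \<notin> ball z r'" for x
  proof -
    have "r'\<^sup>2 \<le> (norm (x - z))\<^sup>2" using that r by (intro power_mono) (auto simp: dist_norm norm_minus_commute)
    then have "d \<le> max 0 ((norm (x - z))\<^sup>2 - r\<^sup>2)" by (simp add: d_def)
    then have "d\<^sup>2 \<le> (max 0 ((norm (x - z))\<^sup>2 - r\<^sup>2))\<^sup>2" using d by (intro power_mono) auto
    then show ?thesis using d by simp
  qed
  have "norm (\<tau> ((x - z) \<bullet> (x - z)) *\<^sub>R 2 *\<^sub>R (x - z)) \<le> 8 / (r' - r)" for x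
  proof (cases "x \<in> ball z r'")
    case True
    then have x: "norm (x - z) \<le> r'" by (auto simp: dist_norm norm_minus_commute)
    then have "(norm (x - z))\<^sup>2 \<le> r'\<^sup>2" by (intro power_mono) auto
    then have m: "max 0 ((norm (x - z))\<^sup>2 - r\<^sup>2) \<le> d" using d by (simp add: d_def)
    have "\<bar>\<tau> ((norm (x - z))\<^sup>2)\<bar> = 2 * max 0 (1 - (max 0 ((norm (x - z))\<^sup>2 - r\<^sup>2))\<^sup>2 / d\<^sup>2) * (2 * max 0 ((norm (x - z))\<^sup>2 - r\<^sup>2) / d\<^sup>2)"
      unfolding \<tau>_def using d by (simp add: abs_mult)
    also have "\<dots> \<le> 2 * 1 * (2 * d / d\<^sup>2)"
      using m d by (intro mult_mono divide_right_mono) auto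
    also have "\<dots> = 4 / d" using d by (simp add: power2_eq_square)
    finally have "\<bar>\<tau> ((norm (x - z))\<^sup>2)\<bar> * (2 * norm (x - z)) \<le> 4 / d * (2 * r')"
      using x d r by (intro mult_mono) auto
    \<comment> \<open>\<open>d\<close> factors as \<open>(r' - r) (r' + r)\<close>, and
      \<open>r' / (r' + r)\<close> is at most 1.\<close>
    also have "\<dots> = 8 * r' / ((r' - r) * (r' + r))" by (simp add: d_def power2_eq_square algebra_simps)
    also have "\<dots> \<le> 8 / (r' - r)" using r by (simp add: divide_simps)
    finally show ?thesis by (simp add: nn)
  next
    case False
    then show ?thesis using far[OF False] r by (simp add: nn \<tau>_def)
  qed
  moreover have "T ((x - z) \<bullet> (x - z)) = 0" if "x \<notin> cball z r'" for x
    using far[of x] that by (auto simp: nn T_def)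
  ultimately show ?thesis using C T01 T1 by blast
qed

lemma lpint_mono:
  assumes "\<And>x. norm (f x) \<le> norm (g x)" shows "lpint p f \<le> lpint p g"
  unfolding lpint_def using assms by (intro nn_integral_mono ennreal_leI power_mono) auto

text \<open>Both constants come from Young's inequality with parameter 1/4 for the two terms that
  contain the gradient, so that together they cost half of it. The 3 in \<open>cacc2\<close> counts
  the lower order terms of the coercivity condition, of the flux and of the zero order term.\<close>

definition cacc1 :: "nat \<Rightarrow> real \<Rightarrow> real"
  where "cacc1 n a = 4 ^ (n - 1) * (real n * a) ^ n + real n ^ n"

definition cacc2 :: "nat \<Rightarrow> real"
  where "cacc2 n = 4 ^ (n - 1) + 3"

lemma cacc_nonneg: "a \<ge> 0 \<Longrightarrow> cacc1 n a \<ge> 0" "cacc2 n \<ge> 0"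
  by (auto simp: cacc1_def cacc2_def)

text \<open>
  The data of the equation after rescaling, as Borel functions extended by zero outside the
  ball, so that all integrals are over the whole space: \<open>F\<close> stands for \<open>\<A>(x,u,u\<^sub>x)\<close> and \<open>Gs\<close> for \<open>\<B>(x,u,u\<^sub>x)\<close>.
\<close>

locale local_solution =
  fixes z :: "real ^ 'n::finite" and R a s \<Gamma> M0 M1 :: real
    and u :: "real ^ 'n \<Rightarrow> real" and ux F :: "real ^ 'n \<Rightarrow> real ^ 'n" and Gs \<sigma> :: "real ^ 'n \<Rightarrow> real"
  assumes n2: "CARD('n) \<ge> 2" and R: "R > 0" and a: "a > 0" and s: "s > real CARD('n) - 1" and \<Gamma>: "\<Gamma> \<ge> 0" and M0: "M0 \<ge> 0" and M1: "M1 \<ge> 0"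
    and borel [measurable]: "u \<in> borel_measurable borel" "ux \<in> borel_measurable borel" "F \<in> borel_measurable borel"
      "Gs \<in> borel_measurable borel" "\<sigma> \<in> borel_measurable borel"
    and \<sigma>: "\<And>x. \<sigma> x \<ge> 0"
    and F_le: "\<And>x. norm (F x) \<le> a * norm (ux x) ^ (CARD('n) - 1) + (\<sigma> x * (1 + \<bar>u x\<bar>)) ^ (CARD('n) - 1)"
    and G_le: "\<And>x. \<bar>Gs x\<bar> \<le> \<sigma> x * norm (ux x) ^ (CARD('n) - 1) + \<sigma> x ^ CARD('n) * (1 + \<bar>u x\<bar>) ^ (CARD('n) - 1)"
    and coercive: "\<And>x. ux x \<bullet> F x \<ge> norm (ux x) ^ CARD('n) - (\<sigma> x * (1 + \<bar>u x\<bar>)) ^ CARD('n)"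
    and outside: "\<And>x. x \<notin> ball z (2 * R) \<Longrightarrow> u x = 0" "\<And>x. x \<notin> ball z (2 * R) \<Longrightarrow> ux x = 0" "\<And>x. x \<notin> ball z (2 * R) \<Longrightarrow> F x = 0"
      "\<And>x. x \<notin> ball z (2 * R) \<Longrightarrow> Gs x = 0" "\<And>x. x \<notin> ball z (2 * R) \<Longrightarrow> \<sigma> x = 0"
    and u_int: "lpint (2 * CARD('n)) u \<le> ennreal M0"
    and ux_int: "lpint CARD('n) ux < \<infinity>"
    and decay: "small_set_decay (ball z (2 * R)) (\<lambda>x. \<sigma> x ^ CARD('n)) s \<Gamma>"
    and \<sigma>_int: "lpint CARD('n) \<sigma> \<le> ennreal M1"
    and weak_grad: "\<And>\<phi> i. test_function (ball z (2 * R)) \<phi> \<Longrightarrow>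
      (\<integral>x. u x * partial_deriv i \<phi> x \<partial>lborel) = - (\<integral>x. ux x $ i * \<phi> x \<partial>lborel)"
    and weak_eq: "\<And>\<phi>. test_function (ball z (2 * R)) \<phi> \<Longrightarrow>
      (\<integral>x. gradient \<phi> x \<bullet> F x + \<phi> x * Gs x \<partial>lborel) = 0"
begin

lemma \<sigma>_fin: "lpint CARD('n) \<sigma> < \<infinity>"
  using \<sigma>_int by (auto intro: le_less_trans)

lemma u_fin: "lpint CARD('n) u < \<infinity>"
proof -
  have "lpint CARD('n) u \<le> (\<integral>\<^sup>+x. indicator (ball z (2 * R)) x + ennreal (norm (u x) ^ (2 * CARD('n))) \<partial>lborel)"
    unfolding lpint_def
  proof (intro nn_integral_mono)
    fix x
    have "norm (u x) ^ CARD('n) \<le> 1 + (norm (u x) ^ CARD('n))\<^sup>2"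
    proof (cases "norm (u x) ^ CARD('n) \<le> 1")
      case False
      then have "norm (u x) ^ CARD('n) * 1 \<le> norm (u x) ^ CARD('n) * norm (u x) ^ CARD('n)" by (intro mult_left_mono) auto
      then show ?thesis by (simp add: power2_eq_square)
    qed (simp add: add_increasing2)
    then have "ennreal (norm (u x) ^ CARD('n)) \<le> 1 + ennreal (norm (u x) ^ (2 * CARD('n)))"
      by (simp add: power_mult power_mult[of _ "CARD('n)" 2] mult.commute[of 2 "CARD('n)"] ennreal_leI flip: ennreal_plus ennreal_1)
    then show "ennreal (norm (u x) ^ CARD('n)) \<le> indicator (ball z (2 * R)) x + ennreal (norm (u x) ^ (2 * CARD('n)))"
      using outside(1)[of x] by (cases "x \<in> ball z (2 * R)") (auto simp: power_0_left)
  qed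
  also have "\<dots> = emeasure lborel (ball z (2 * R)) + lpint (2 * CARD('n)) u"
    by (simp add: nn_integral_add lpint_def)
  also have "\<dots> < \<infinity>"
    using u_int emeasure_lborel_ball_finite[of z "2 * R"] by (auto intro: le_less_trans)
  finally show ?thesis .
qed

text \<open>Cut off between \<open>13/8 R\<close> and \<open>7/4 R\<close>, and with room up to
  \<open>15/8 R\<close> for mollification, \<open>u\<close> becomes a Sobolev function on the whole
  space. The estimates are localised to the ball of radius \<open>3/2 R\<close>, where nothing has
  changed.\<close>

lemma ex_cutoff_solution:
  "\<exists>U GU. H0 z (15 / 8 * R) U GU \<and> (\<forall>x\<in>cball z (3 / 2 * R). U x = u x \<and> GU x = ux x)"
proof -
  have "13 / 8 * R < 7 / 4 * R" using R by simp
  from ex_smooth_cutoff[OF this, of z] obtain \<zeta> where \<zeta>: "\<And>k. C_k k \<zeta>" "\<And>x. x \<in> cball z (13 / 8 * R) \<Longrightarrow> \<zeta> x = 1"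
    "\<And>x. x \<notin> cball z (7 / 4 * R) \<Longrightarrow> \<zeta> x = 0" by blast
  have C: "C1_grad \<zeta> (gradient \<zeta>)" by (rule C_k_1_C1_grad[OF \<zeta>(1)])
  have "H0 z (15 / 8 * R) (\<lambda>x. \<zeta> x * u x) (\<lambda>x. \<zeta> x *\<^sub>R ux x + u x *\<^sub>R gradient \<zeta> x)"
  proof (rule weak_gradient_cutoff_H0[where r="7 / 4 * R" and ?r2.0="2 * R"])
    have "(\<integral>\<^sup>+x\<in>ball z (2 * R). ennreal (\<bar>u x\<bar> ^ CARD('n)) \<partial>lborel) \<le> lpint CARD('n) u"
      unfolding lpint_def by (intro nn_integral_mono) (auto simp: indicator_def)
    then show "(\<integral>\<^sup>+x\<in>ball z (2 * R). ennreal (\<bar>u x\<bar> ^ CARD('n)) \<partial>lborel) < \<infinity>" using u_fin by (rule le_less_trans)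
    have "(\<integral>\<^sup>+x\<in>ball z (2 * R). ennreal (norm (ux x) ^ CARD('n)) \<partial>lborel) \<le> lpint CARD('n) ux"
      unfolding lpint_def by (intro nn_integral_mono) (auto simp: indicator_def)
    then show "(\<integral>\<^sup>+x\<in>ball z (2 * R). ennreal (norm (ux x) ^ CARD('n)) \<partial>lborel) < \<infinity>" using ux_int by (rule le_less_trans)
  qed (use R weak_grad \<zeta> in auto)
  moreover have "\<zeta> x * u x = u x \<and> \<zeta> x *\<^sub>R ux x + u x *\<^sub>R gradient \<zeta> x = ux x" if x: "x \<in> cball z (3 / 2 * R)" for x
  proof -
    have xb: "x \<in> ball z (13 / 8 * R)" using x R by auto
    have "(\<zeta> has_derivative (\<lambda>h. gradient \<zeta> x \<bullet> h)) (at x)" using C by (auto simp: C1_grad_def)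
    moreover have "((\<lambda>_. 1) has_derivative (\<lambda>h. 0)) (at x)" by simp
    then have "(\<zeta> has_derivative (\<lambda>h. 0)) (at x)"
      by (rule has_derivative_transform_within_open[where s="ball z (13 / 8 * R)"]) (use xb \<zeta>(2) in auto)
    ultimately have "(\<lambda>h. gradient \<zeta> x \<bullet> h) = (\<lambda>h. 0)" by (rule has_derivative_unique)
    then have "gradient \<zeta> x \<bullet> gradient \<zeta> x = 0" by meson
    then have "gradient \<zeta> x = 0" by simp
    moreover have "\<zeta> x = 1" using \<zeta>(2) xb by auto
    ultimately show ?thesis by simp
  qed
  ultimately show ?thesis by blast
qed

lemma decay_cball: "r < 2 * R \<Longrightarrow> small_set_decay (cball z r) (\<lambda>x. \<sigma> x ^ CARD('n)) s \<Gamma>"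
proof -
  assume "r < 2 * R"
  then have "cball z r \<subseteq> ball z (2 * R)" by auto
  then show ?thesis using decay unfolding small_set_decay_def by blast
qed

text \<open>Purely qualitative. Above a level \<open>h\<close> so high that \<open>v x > h\<close>
  has measure at most \<open>exp (-1)\<close>, the weighted inequality applies with
  \<open>L = 1\<close>; below it integrability of \<open>\<sigma> ^ n\<close> suffices. This makes
  the equation testable with functions of \<open>u\<close>.\<close>

lemma weighted_pos_finite:
  assumes H: "H0 z r v g" and r: "r < 2 * R"
  shows "(\<integral>\<^sup>+x. ennreal ((\<sigma> x * max 0 (v x)) ^ CARD('n)) \<partial>lborel) < \<infinity>"
proof -
  note [measurable] = H0_borel[OF H]
  define m where "m = enn2real (lpint CARD('n) v)"
  have m: "m \<ge> 0" "lpint CARD('n) v = ennreal m" using H0_finite(1)[OF H] by (auto simp: m_def)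
  \<comment> \<open>Chebyshev: since \<open>h \<ge> 1\<close>, the set where \<open>v\<close>
    exceeds \<open>h\<close> has measure at most \<open>m / h\<close>, which this choice keeps below
    \<open>exp (- 1)\<close>.\<close>
  define h where "h = 1 + m * exp 1"
  have h: "h \<ge> 1" using m by (simp add: h_def)
  have "ennreal (h ^ CARD('n)) * emeasure lborel {x. v x > h} = (\<integral>\<^sup>+x. ennreal (h ^ CARD('n)) * indicator {x. v x > h} x \<partial>lborel)"
    by (subst nn_integral_cmult_indicator) auto
  also have "\<dots> \<le> lpint CARD('n) v"
    unfolding lpint_def
  proof (intro nn_integral_mono)
    fix x show "ennreal (h ^ CARD('n)) * indicator {x. v x > h} x \<le> ennreal (norm (v x) ^ CARD('n))"
      using h by (cases "v x > h") (auto intro!: ennreal_leI power_mono)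
  qed
  finally have "ennreal (h ^ CARD('n) * measure lborel {x. v x > h}) \<le> ennreal m"
    using h m by (simp add: H0_level_finite(3)[OF H] ennreal_mult)
  then have "h ^ CARD('n) * measure lborel {x. v x > h} \<le> m" using m by (simp add: ennreal_le_iff)
  moreover have "h ^ 1 \<le> h ^ CARD('n)" using h by (intro power_increasing) auto
  then have "h * measure lborel {x. v x > h} \<le> h ^ CARD('n) * measure lborel {x. v x > h}" by (intro mult_right_mono) auto
  ultimately have "h * measure lborel {x. v x > h} \<le> m" by linarith
  also have "m \<le> h * exp (- 1)" by (simp add: h_def exp_minus field_simps)
  finally have small: "measure lborel {x. v x > h} \<le> exp (- 1)" using h by simp
  define w where "w x = max 0 (v x - h)" for x
  have Hw: "H0 z r w (\<lambda>x. if v x > h then g x else 0)" unfolding w_def using h by (intro H0_pos_part[OF H]) auto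
  note [measurable] = H0_borel[OF Hw]
  define J where "J = enn2real (lpint CARD('n) (\<lambda>x. if v x > h then g x else 0)) + 1"
  have Jeq: "lpint CARD('n) (\<lambda>x. if v x > h then g x else 0) = ennreal (enn2real (lpint CARD('n) (\<lambda>x. if v x > h then g x else 0)))"
    using H0_finite(2)[OF Hw] by simp
  have "\<dots> \<le> ennreal J" unfolding J_def by (intro ennreal_leI) simp
  with Jeq have J: "lpint CARD('n) (\<lambda>x. if v x > h then g x else 0) \<le> ennreal J" by simp
  have J0: "J > 0" by (simp add: J_def add_nonneg_pos)
  have "{x. w x > 0} = {x. v x > h}" by (auto simp: w_def max_def)
  then have "(\<integral>\<^sup>+x. ennreal (\<sigma> x ^ CARD('n) * w x ^ CARD('n)) \<partial>lborel) \<le> ennreal (weight_const CARD('n) s * J * \<Gamma> * 1 powr (- ((s - (real CARD('n) - 1)) / 2)))"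
    using small by (intro weighted_trudinger[OF Hw _ J0 J s n2 _ _ decay_cball[OF r] \<Gamma>]) (auto simp: w_def \<sigma>)
  then have fw: "(\<integral>\<^sup>+x. ennreal (\<sigma> x ^ CARD('n) * w x ^ CARD('n)) \<partial>lborel) < \<infinity>" by (rule le_less_trans) simp
  have "(\<integral>\<^sup>+x. ennreal ((\<sigma> x * max 0 (v x)) ^ CARD('n)) \<partial>lborel)
    \<le> (\<integral>\<^sup>+x. ennreal (2 ^ CARD('n) * h ^ CARD('n)) * ennreal (norm (\<sigma> x) ^ CARD('n)) + ennreal (2 ^ CARD('n)) * ennreal (\<sigma> x ^ CARD('n) * w x ^ CARD('n)) \<partial>lborel)"
  proof (intro nn_integral_mono)
    fix x
    have "max 0 (v x) \<le> norm (h + w x)" using h by (auto simp: w_def max_def)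
    then have "max 0 (v x) ^ CARD('n) \<le> norm (h + w x) ^ CARD('n)" by (intro power_mono) auto
    also have "\<dots> \<le> 2 ^ CARD('n) * (norm h ^ CARD('n) + norm (w x) ^ CARD('n))" by (rule norm_add_power_le)
    finally have "\<sigma> x ^ CARD('n) * max 0 (v x) ^ CARD('n) \<le> \<sigma> x ^ CARD('n) * (2 ^ CARD('n) * (norm h ^ CARD('n) + norm (w x) ^ CARD('n)))"
      using \<sigma> by (intro mult_left_mono) auto
    also have "\<dots> = 2 ^ CARD('n) * h ^ CARD('n) * norm (\<sigma> x) ^ CARD('n) + 2 ^ CARD('n) * (\<sigma> x ^ CARD('n) * w x ^ CARD('n))"
      using h \<sigma>[of x] by (simp add: w_def algebra_simps)
    finally have "ennreal ((\<sigma> x * max 0 (v x)) ^ CARD('n)) \<le> ennreal (2 ^ CARD('n) * h ^ CARD('n) * norm (\<sigma> x) ^ CARD('n) + 2 ^ CARD('n) * (\<sigma> x ^ CARD('n) * w x ^ CARD('n)))"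
      by (intro ennreal_leI) (simp add: power_mult_distrib)
    also have "\<dots> = ennreal (2 ^ CARD('n) * h ^ CARD('n)) * ennreal (norm (\<sigma> x) ^ CARD('n)) + ennreal (2 ^ CARD('n)) * ennreal (\<sigma> x ^ CARD('n) * w x ^ CARD('n))"
      using h \<sigma>[of x] by (simp add: w_def ennreal_mult[symmetric] ennreal_plus[symmetric] del: ennreal_plus)
    finally show "ennreal ((\<sigma> x * max 0 (v x)) ^ CARD('n)) \<le> ennreal (2 ^ CARD('n) * h ^ CARD('n)) * ennreal (norm (\<sigma> x) ^ CARD('n)) + ennreal (2 ^ CARD('n)) * ennreal (\<sigma> x ^ CARD('n) * w x ^ CARD('n))" .
  qed
  also have "\<dots> = ennreal (2 ^ CARD('n) * h ^ CARD('n)) * lpint CARD('n) \<sigma> + ennreal (2 ^ CARD('n)) * (\<integral>\<^sup>+x. ennreal (\<sigma> x ^ CARD('n) * w x ^ CARD('n)) \<partial>lborel)"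
    by (simp add: nn_integral_add nn_integral_cmult lpint_def)
  also have "\<dots> < \<infinity>" using fw \<sigma>_fin by (auto simp: ennreal_mult_less_top)
  finally show ?thesis .
qed

text \<open>A common majorant of \<open>norm (ux x)\<close> and
  \<open>\<sigma> x (1 + |u x|)\<close>: inside the ball the flux is at most
  \<open>(a + 1) P ^ (n - 1)\<close> and the zero order term at most \<open>2 P ^ n\<close>, as the
  extension of the equation to Sobolev functions requires.\<close>

definition P :: "real ^ 'n \<Rightarrow> real"
  where "P x = indicator (cball z (3 / 2 * R)) x * (norm (ux x) + \<sigma> x * (1 + \<bar>u x\<bar>))"

lemma P_borel [measurable]: "P \<in> borel_measurable borel"
  unfolding P_def[abs_def] by measurable

lemma P_nonneg: "P x \<ge> 0"
  using \<sigma> by (auto simp: P_def)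

text \<open>The weighted finiteness is one-sided, so it is applied to the cut-off solution and to
  its negative, and the positive parts are added.\<close>

lemma P_fin: "lpint CARD('n) P < \<infinity>"
proof -
  let ?S = "cball z (3 / 2 * R)"
  obtain U GU where U: "H0 z (15 / 8 * R) U GU" "\<And>x. x \<in> ?S \<Longrightarrow> U x = u x" using ex_cutoff_solution by blast
  note [measurable] = H0_borel[OF U(1)]
  have "15 / 8 * R < 2 * R" using R by simp
  note fin = weighted_pos_finite[OF U(1) this] weighted_pos_finite[OF H0_uminus[OF U(1)] this]
  have 1: "lpint CARD('n) (\<lambda>x. \<sigma> x * (max 0 (U x) + max 0 (- U x))) < \<infinity>"
  proof -
    have "lpint CARD('n) (\<lambda>x. \<sigma> x * max 0 (U x) + \<sigma> x * max 0 (- U x)) \<le> 2 ^ CARD('n) * (lpint CARD('n) (\<lambda>x. \<sigma> x * max 0 (U x)) + lpint CARD('n) (\<lambda>x. \<sigma> x * max 0 (- U x)))"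
      by (rule lpint_add_le) measurable
    also have "\<dots> < \<infinity>"
      using fin \<sigma> by (auto simp: lpint_def abs_mult ennreal_mult_less_top power_less_top_ennreal)
    finally show ?thesis by (simp add: distrib_left)
  qed
  have 2: "lpint CARD('n) (\<lambda>x. norm (ux x) + \<sigma> x) < \<infinity>"
  proof -
    have "lpint CARD('n) (\<lambda>x. norm (ux x) + \<sigma> x) \<le> 2 ^ CARD('n) * (lpint CARD('n) (\<lambda>x. norm (ux x)) + lpint CARD('n) \<sigma>)"
      by (rule lpint_add_le) measurable
    also have "\<dots> < \<infinity>"
      using ux_int \<sigma>_fin by (auto simp: lpint_def ennreal_mult_less_top power_less_top_ennreal)
    finally show ?thesis .
  qed
  have "lpint CARD('n) P \<le> lpint CARD('n) (\<lambda>x. (norm (ux x) + \<sigma> x) + \<sigma> x * (max 0 (U x) + max 0 (- U x)))"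
  proof (rule lpint_mono)
    fix x
    have e: "max 0 (U x) + max 0 (- U x) = \<bar>U x\<bar>" by (simp add: max_def)
    show "norm (P x) \<le> norm ((norm (ux x) + \<sigma> x) + \<sigma> x * (max 0 (U x) + max 0 (- U x)))"
      unfolding e using U(2)[of x] \<sigma>[of x] by (cases "x \<in> ?S") (auto simp: P_def algebra_simps)
  qed
  also have "\<dots> \<le> 2 ^ CARD('n) * (lpint CARD('n) (\<lambda>x. norm (ux x) + \<sigma> x) + lpint CARD('n) (\<lambda>x. \<sigma> x * (max 0 (U x) + max 0 (- U x))))"
    by (rule lpint_add_le) measurable
  also have "\<dots> < \<infinity>" using 1 2 by (auto simp: ennreal_mult_less_top power_less_top_ennreal)
  finally show ?thesis .
qed

text \<open>The integrand of the equation tested with \<open>\<eta> ^ n t\<close>, where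
  \<open>t\<close> is a truncation with derivative \<open>\<chi>1\<close>. Half of the full gradient
  term is subtracted, not half of its part with \<open>\<chi>1\<close>, because the error terms live
  wherever \<open>t\<close> is nonzero; the difference disappears in the limit of the
  truncations.\<close>

lemma pointwise_caccioppoli:
  fixes t \<chi>1 w \<eta> :: real and \<eta>' :: "real ^ 'n"
  assumes t: "\<bar>t\<bar> \<le> w" "w \<le> 1 + \<bar>u x\<bar>" and \<chi>1: "0 \<le> \<chi>1" "\<chi>1 \<le> 1" and \<eta>: "0 \<le> \<eta>" "\<eta> \<le> 1"
  shows "\<eta> ^ CARD('n) * \<chi>1 * norm (ux x) ^ CARD('n) - 1 / 2 * (\<eta> ^ CARD('n) * norm (ux x) ^ CARD('n))
      - (cacc1 CARD('n) a * (w * norm \<eta>') ^ CARD('n) + cacc2 CARD('n) * (\<eta> * (\<sigma> x * (1 + \<bar>u x\<bar>))) ^ CARD('n))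
    \<le> (\<eta> ^ CARD('n) *\<^sub>R (\<chi>1 *\<^sub>R ux x) + t *\<^sub>R ((real CARD('n) * \<eta> ^ (CARD('n) - 1)) *\<^sub>R \<eta>')) \<bullet> F x + (\<eta> ^ CARD('n) * t) * Gs x"
proof -
  define p where "p = norm (ux x)"
  define q where "q = \<sigma> x * (1 + \<bar>u x\<bar>)"
  define e where "e = norm \<eta>'"
  have p: "p \<ge> 0" and q: "q \<ge> 0" and e: "e \<ge> 0" using \<sigma>[of x] by (auto simp: p_def q_def e_def)
  have w: "w \<ge> 0" using t by linarith
  have N0: "CARD('n) > 0" using n2 by simp
  have I1: "\<eta> ^ CARD('n) * \<chi>1 * (ux x \<bullet> F x) \<ge> \<eta> ^ CARD('n) * \<chi>1 * p ^ CARD('n) - (\<eta> * q) ^ CARD('n)"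
  proof -
    have "\<eta> ^ CARD('n) * \<chi>1 * (p ^ CARD('n) - q ^ CARD('n)) \<le> \<eta> ^ CARD('n) * \<chi>1 * (ux x \<bullet> F x)"
      using coercive[of x] \<chi>1 \<eta> by (intro mult_left_mono) (auto simp: p_def q_def)
    moreover have "\<eta> ^ CARD('n) * \<chi>1 * q ^ CARD('n) \<le> \<eta> ^ CARD('n) * 1 * q ^ CARD('n)"
      using \<chi>1 \<eta> q by (intro mult_right_mono mult_left_mono) auto
    ultimately show ?thesis by (simp add: algebra_simps power_mult_distrib)
  qed
  have I2: "\<bar>t * (real CARD('n) * \<eta> ^ (CARD('n) - 1)) * (\<eta>' \<bullet> F x)\<bar> \<le> (1 / 4 * (\<eta> * p) ^ CARD('n) + 4 ^ (CARD('n) - 1) * (real CARD('n) * a * (w * e)) ^ CARD('n)) + ((\<eta> * q) ^ CARD('n) + (real CARD('n) * (w * e)) ^ CARD('n))"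
  proof -
    have "\<bar>t * (real CARD('n) * \<eta> ^ (CARD('n) - 1)) * (\<eta>' \<bullet> F x)\<bar> = \<bar>t\<bar> * (real CARD('n) * \<eta> ^ (CARD('n) - 1)) * \<bar>\<eta>' \<bullet> F x\<bar>"
      using \<eta> by (simp add: abs_mult)
    also have "\<dots> \<le> w * (real CARD('n) * \<eta> ^ (CARD('n) - 1)) * (e * (a * p ^ (CARD('n) - 1) + q ^ (CARD('n) - 1)))"
    proof (intro mult_mono)
      have "\<bar>\<eta>' \<bullet> F x\<bar> \<le> e * norm (F x)" unfolding e_def by (rule Cauchy_Schwarz_ineq2)
      also have "\<dots> \<le> e * (a * p ^ (CARD('n) - 1) + q ^ (CARD('n) - 1))"
        using F_le[of x] e by (intro mult_left_mono) (auto simp: p_def q_def)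
      finally show "\<bar>\<eta>' \<bullet> F x\<bar> \<le> e * (a * p ^ (CARD('n) - 1) + q ^ (CARD('n) - 1))" .
    qed (use t \<eta> w in auto)
    also have "\<dots> = (real CARD('n) * a * (w * e)) * (\<eta> * p) ^ (CARD('n) - 1) + (real CARD('n) * (w * e)) * (\<eta> * q) ^ (CARD('n) - 1)"
      by (simp add: algebra_simps power_mult_distrib)
    also have "\<dots> \<le> (1 / 4 * (\<eta> * p) ^ CARD('n) + (1 / (1 / 4)) ^ (CARD('n) - 1) * (real CARD('n) * a * (w * e)) ^ CARD('n))
       + (1 * (\<eta> * q) ^ CARD('n) + (1 / 1) ^ (CARD('n) - 1) * (real CARD('n) * (w * e)) ^ CARD('n))"
      using a w e \<eta> p q N0 by (intro add_mono young_light2) auto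
    finally show ?thesis by simp
  qed
  \<comment> \<open>Here \<open>|t| \<le> 1 + |u x|\<close> enters: the missing power of
    \<open>1 + |u x|\<close> is supplied by \<open>t\<close>, and only powers of
    \<open>\<eta> q\<close> and \<open>\<eta> p\<close> remain.\<close>
  have I3: "\<bar>(\<eta> ^ CARD('n) * t) * Gs x\<bar> \<le> (1 / 4 * (\<eta> * p) ^ CARD('n) + 4 ^ (CARD('n) - 1) * (\<eta> * q) ^ CARD('n)) + (\<eta> * q) ^ CARD('n)"
  proof -
    have SN: "y ^ CARD('n) = y * y ^ (CARD('n) - 1)" for y :: real using N0 by (simp add: power_eq_if)
    have "\<bar>(\<eta> ^ CARD('n) * t) * Gs x\<bar> = \<eta> ^ CARD('n) * \<bar>t\<bar> * \<bar>Gs x\<bar>" using \<eta> by (simp add: abs_mult)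
    also have "\<dots> \<le> \<eta> ^ CARD('n) * (1 + \<bar>u x\<bar>) * (\<sigma> x * p ^ (CARD('n) - 1) + \<sigma> x ^ CARD('n) * (1 + \<bar>u x\<bar>) ^ (CARD('n) - 1))"
      using G_le[of x] t \<eta> by (intro mult_mono) (auto simp: p_def)
    also have "\<dots> = (\<eta> * q) * (\<eta> * p) ^ (CARD('n) - 1) + (\<eta> * q) ^ CARD('n)"
      unfolding q_def power_mult_distrib SN by (simp add: algebra_simps)
    also have "\<dots> \<le> (1 / 4 * (\<eta> * p) ^ CARD('n) + (1 / (1 / 4)) ^ (CARD('n) - 1) * (\<eta> * q) ^ CARD('n)) + (\<eta> * q) ^ CARD('n)"
      using \<eta> p q N0 by (intro add_right_mono young_light2) auto
    finally show ?thesis by simp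
  qed
  have eq: "(\<eta> ^ CARD('n) *\<^sub>R (\<chi>1 *\<^sub>R ux x) + t *\<^sub>R ((real CARD('n) * \<eta> ^ (CARD('n) - 1)) *\<^sub>R \<eta>')) \<bullet> F x + (\<eta> ^ CARD('n) * t) * Gs x
    = \<eta> ^ CARD('n) * \<chi>1 * (ux x \<bullet> F x) + t * (real CARD('n) * \<eta> ^ (CARD('n) - 1)) * (\<eta>' \<bullet> F x) + (\<eta> ^ CARD('n) * t) * Gs x"
    by (simp add: inner_add_left)
  have c1: "cacc1 CARD('n) a * (w * e) ^ CARD('n) = 4 ^ (CARD('n) - 1) * (real CARD('n) * a * (w * e)) ^ CARD('n) + (real CARD('n) * (w * e)) ^ CARD('n)"
    by (simp add: cacc1_def power_mult_distrib algebra_simps)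
  have c2: "cacc2 CARD('n) * (\<eta> * q) ^ CARD('n) = 4 ^ (CARD('n) - 1) * (\<eta> * q) ^ CARD('n) + 3 * (\<eta> * q) ^ CARD('n)" by (simp add: cacc2_def algebra_simps)
  show ?thesis
    unfolding eq p_def[symmetric] q_def[symmetric] e_def[symmetric] c1 c2
    using I1 I2 I3 unfolding power_mult_distrib[of \<eta> p] by linarith
qed

end

context local_solution
begin

text \<open>
  The test functions are \<open>\<eta>\<^sup>n t\<^sub>M\<close> with bounded truncations \<open>t\<^sub>M\<close> of \<open>u\<close> (or of its positive part
  above a level), since only bounded test functions are admissible; then \<open>M\<close> tends to infinity.
\<close>

lemma caccioppoli:
  assumes \<rho>: "\<rho> < 3 / 2 * R"
    and U: "\<And>x. x \<in> cball z (3 / 2 * R) \<Longrightarrow> GU x = ux x"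
    and Ht: "\<And>M::nat. H0 z (15 / 8 * R) (t M) (\<lambda>x. \<chi>1 M x *\<^sub>R GU x)"
    and tb: "\<And>M. \<exists>B. \<forall>x. \<bar>t M x\<bar> \<le> B"
    and tw: "\<And>M x. x \<in> cball z (3 / 2 * R) \<Longrightarrow> \<bar>t M x\<bar> \<le> w x" "\<And>x. x \<in> cball z (3 / 2 * R) \<Longrightarrow> w x \<le> 1 + \<bar>u x\<bar>"
    and [measurable]: "w \<in> borel_measurable borel" "\<And>M. \<chi>1 M \<in> borel_measurable borel" "A \<in> sets borel"
    and \<chi>1: "\<And>M x. 0 \<le> \<chi>1 M x" "\<And>M x. \<chi>1 M x \<le> 1"
    and lim: "\<And>x. x \<in> cball z (3 / 2 * R) \<Longrightarrow> (\<lambda>M. \<chi>1 M x) \<longlonglongrightarrow> indicator A x"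
    and offA: "\<And>M x. x \<in> cball z (3 / 2 * R) \<Longrightarrow> x \<notin> A \<Longrightarrow> t M x = 0 \<and> \<chi>1 M x = 0 \<and> w x = 0"
    and \<eta>: "C1_grad \<eta> \<eta>'" "\<And>x. 0 \<le> \<eta> x" "\<And>x. \<eta> x \<le> 1" "\<And>x. x \<notin> cball z \<rho> \<Longrightarrow> \<eta> x = 0" "\<And>x. norm (\<eta>' x) \<le> B"
  shows "(\<integral>\<^sup>+x\<in>A. ennreal ((\<eta> x * norm (ux x)) ^ CARD('n)) \<partial>lborel)
    \<le> 2 * (ennreal (cacc1 CARD('n) a) * lpint CARD('n) (\<lambda>x. w x *\<^sub>R \<eta>' x)
      + ennreal (cacc2 CARD('n)) * (\<integral>\<^sup>+x\<in>A. ennreal ((\<eta> x * (\<sigma> x * (1 + \<bar>u x\<bar>))) ^ CARD('n)) \<partial>lborel))"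
proof -
  let ?S = "cball z (3 / 2 * R)"
  let ?N = "CARD('n)"
  have N0: "?N > 0" using n2 by simp
  note [measurable] = C1_grad_borel[OF \<eta>(1)]
  have cc: "cacc1 ?N a \<ge> 0" "cacc2 ?N \<ge> 0" using a cacc_nonneg(1)[of a ?N] cacc_nonneg(2)[of ?N] by auto
  have B: "B \<ge> 0" using \<eta>(5)[of z] norm_ge_zero order_trans by blast
  have S\<rho>: "x \<in> ?S" if "x \<in> cball z \<rho>" for x using that \<rho> by auto
  have \<eta>'0: "\<eta>' x = 0" if "x \<notin> cball z \<rho>" for x by (rule gradient_zero_outside[OF \<eta>(1) closed_cball \<eta>(4) that])
  \<comment> \<open>\<open>P\<close> vanishes outside \<open>?S\<close>, so flux and zero order term
    are cut there as well; test functions supported in \<open>?S\<close> do not see the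
    change.\<close>
  define F' where "F' x = indicator ?S x *\<^sub>R F x" for x
  define G' where "G' x = indicator ?S x * Gs x" for x
  have FG' [measurable]: "F' \<in> borel_measurable borel" "G' \<in> borel_measurable borel" unfolding F'_def G'_def by measurable
  have PS: "norm (ux x) \<le> P x" "\<sigma> x * (1 + \<bar>u x\<bar>) \<le> P x" "\<sigma> x \<le> P x" if "x \<in> ?S" for x
  proof -
    have "\<sigma> x * 1 \<le> \<sigma> x * (1 + \<bar>u x\<bar>)" using \<sigma>[of x] by (intro mult_left_mono) auto
    then show "norm (ux x) \<le> P x" "\<sigma> x * (1 + \<bar>u x\<bar>) \<le> P x" "\<sigma> x \<le> P x" using that \<sigma>[of x] norm_ge_zero[of "ux x"] by (auto simp: P_def simp del: norm_ge_zero)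
  qed
  have iPN: "integrable lborel (\<lambda>x. P x ^ ?N)"
    using P_fin P_nonneg by (intro integrableI_nonneg) (auto simp: lpint_def)
  have F'P: "norm (F' x) \<le> (a + 1) * P x ^ (?N - 1)" for x
  proof (cases "x \<in> ?S")
    case True
    have "norm (F x) \<le> a * norm (ux x) ^ (?N - 1) + (\<sigma> x * (1 + \<bar>u x\<bar>)) ^ (?N - 1)" by (rule F_le)
    also have "\<dots> \<le> a * P x ^ (?N - 1) + P x ^ (?N - 1)"
      using PS[OF True] a \<sigma>[of x] by (intro add_mono mult_left_mono power_mono) auto
    finally show ?thesis using True by (simp add: F'_def algebra_simps)
  qed (use a P_nonneg in \<open>simp add: F'_def\<close>)
  have iG: "integrable lborel G'"
  proof (rule Bochner_Integration.integrable_bound)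
    show "integrable lborel (\<lambda>x. 2 * P x ^ ?N)" using iPN by simp
    have SN: "y ^ ?N = y * y ^ (?N - 1)" for y :: real using N0 by (simp add: power_eq_if)
    have "norm (G' x) \<le> norm (2 * P x ^ ?N)" for x
    proof (cases "x \<in> ?S")
      case True
      have "\<bar>Gs x\<bar> \<le> \<sigma> x * norm (ux x) ^ (?N - 1) + \<sigma> x ^ ?N * (1 + \<bar>u x\<bar>) ^ (?N - 1)" by (rule G_le)
      also have "\<sigma> x * norm (ux x) ^ (?N - 1) \<le> P x * P x ^ (?N - 1)"
        using PS[OF True] \<sigma>[of x] P_nonneg[of x] by (intro mult_mono power_mono) auto
      also have "\<sigma> x ^ ?N * (1 + \<bar>u x\<bar>) ^ (?N - 1) \<le> \<sigma> x ^ ?N * (1 + \<bar>u x\<bar>) ^ ?N"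
        using \<sigma>[of x] by (intro mult_left_mono power_increasing) auto
      also have "\<dots> \<le> P x ^ ?N"
        using PS[OF True] \<sigma>[of x] unfolding power_mult_distrib[symmetric] by (intro power_mono) auto
      finally have "\<bar>Gs x\<bar> \<le> 2 * P x ^ ?N" using SN[of "P x"] by linarith
      then show ?thesis using True P_nonneg[of x] by (simp add: G'_def)
    qed (simp add: G'_def)
    then show "AE x in lborel. norm (G' x) \<le> norm (2 * P x ^ ?N)" by simp
  qed measurable
  have weak: "(\<integral>x. gradient \<phi> x \<bullet> F' x + \<phi> x * G' x \<partial>lborel) = 0"
    if "\<And>k. C_k k \<phi>" "\<And>x. x \<notin> ?S \<Longrightarrow> \<phi> x = 0" for \<phi>
  proof -
    have "?S \<subseteq> ball z (2 * R)" using R by auto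
    then have "test_function (ball z (2 * R)) \<phi>" by (intro test_functionI[OF that(1) compact_cball _ that(2)])
    from weak_eq[OF this] have "(\<integral>x. gradient \<phi> x \<bullet> F x + \<phi> x * Gs x \<partial>lborel) = 0" .
    moreover have "gradient \<phi> x = 0" if "x \<notin> ?S" for x
      by (rule gradient_zero_outside[OF C_k_1_C1_grad closed_cball _ that]) (use \<open>\<And>k. C_k k \<phi>\<close> \<open>\<And>x. x \<notin> ?S \<Longrightarrow> \<phi> x = 0\<close> in auto)
    then have "gradient \<phi> x \<bullet> F' x + \<phi> x * G' x = gradient \<phi> x \<bullet> F x + \<phi> x * Gs x" for x
      using that(2)[of x] by (cases "x \<in> ?S") (auto simp: F'_def G'_def)
    ultimately show ?thesis by simp
  qed
  define Y where "Y x = indicator A x * (\<eta> x * norm (ux x)) ^ ?N" for x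
  define Z where "Z x = cacc1 ?N a * norm (w x *\<^sub>R \<eta>' x) ^ ?N + cacc2 ?N * (indicator A x * (\<eta> x * (\<sigma> x * (1 + \<bar>u x\<bar>))) ^ ?N)" for x
  define X where "X M x = \<eta> x ^ ?N * \<chi>1 M x * norm (ux x) ^ ?N" for M x
  have [measurable]: "Y \<in> borel_measurable borel" "Z \<in> borel_measurable borel" "\<And>M. X M \<in> borel_measurable borel"
    unfolding Y_def Z_def X_def by measurable
  have iux: "integrable lborel (\<lambda>x. norm (ux x) ^ ?N)"
    using ux_int by (intro integrableI_nonneg) (auto simp: lpint_def)
  have Yle: "0 \<le> Y x" "Y x \<le> norm (ux x) ^ ?N" for x
  proof -
    have "(\<eta> x * norm (ux x)) ^ ?N \<le> (1 * norm (ux x)) ^ ?N" using \<eta> by (intro power_mono mult_right_mono) auto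
    then show "Y x \<le> norm (ux x) ^ ?N" by (auto simp: Y_def indicator_def)
    show "0 \<le> Y x" using \<eta>(2)[of x] by (simp add: Y_def)
  qed
  have iY: "integrable lborel Y" by (rule Bochner_Integration.integrable_bound[OF iux]) (use Yle in auto)
  have wfin: "lpint ?N (\<lambda>x. w x *\<^sub>R \<eta>' x) < \<infinity>"
  proof -
    have "lpint ?N (\<lambda>x. w x *\<^sub>R \<eta>' x) \<le> ennreal (B ^ ?N) * lpint ?N (\<lambda>x. indicator ?S x + norm (u x))"
    proof (rule lpint_mult_le[OF _ B])
      fix x
      show "norm (w x *\<^sub>R \<eta>' x) \<le> B * norm (indicator ?S x + norm (u x))"
      proof (cases "x \<in> cball z \<rho>")
        case True
        then have x: "x \<in> ?S" by (rule S\<rho>)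
        have "0 \<le> w x" using tw(1)[OF x, of 0] by simp
        then have "norm (w x *\<^sub>R \<eta>' x) \<le> (1 + \<bar>u x\<bar>) * B" using tw(2)[OF x] \<eta>(5)[of x] by (auto intro!: mult_mono)
        then show ?thesis using x by (simp add: mult.commute)
      qed (use \<eta>'0 B in auto)
    qed measurable
    also have "lpint ?N (\<lambda>x. indicator ?S x + norm (u x)) \<le> 2 ^ ?N * (lpint ?N (indicator ?S :: _ \<Rightarrow> real) + lpint ?N (\<lambda>x. norm (u x)))"
      by (rule lpint_add_le) measurable
    also have "lpint ?N (indicator ?S :: _ \<Rightarrow> real) = emeasure lborel ?S"
    proof -
      have "lpint ?N (indicator ?S :: real ^ 'n \<Rightarrow> real) = (\<integral>\<^sup>+x. indicator ?S x \<partial>lborel)"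
        unfolding lpint_def by (intro nn_integral_cong) (auto simp: indicator_def power_0_left)
      then show ?thesis by simp
    qed
    also have "ennreal (B ^ ?N) * (2 ^ ?N * (emeasure lborel ?S + lpint ?N (\<lambda>x. norm (u x)))) < \<infinity>"
      using u_fin emeasure_lborel_cball_finite[of z "3/2*R"] by (auto simp: ennreal_mult_less_top power_less_top_ennreal lpint_def)
    finally show ?thesis by (simp add: mult_left_mono)
  qed
  have iw: "integrable lborel (\<lambda>x. norm (w x *\<^sub>R \<eta>' x) ^ ?N)"
    using wfin by (intro integrableI_nonneg) (auto simp: lpint_def)
  have i\<sigma>: "integrable lborel (\<lambda>x. indicator A x * (\<eta> x * (\<sigma> x * (1 + \<bar>u x\<bar>))) ^ ?N)"
  proof (rule Bochner_Integration.integrable_bound[OF iPN])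
    have "norm (indicator A x * (\<eta> x * (\<sigma> x * (1 + \<bar>u x\<bar>))) ^ ?N) \<le> norm (P x ^ ?N)" for x
    proof (cases "x \<in> cball z \<rho>")
      case True
      have "\<eta> x * (\<sigma> x * (1 + \<bar>u x\<bar>)) \<le> 1 * P x"
        using PS(2)[OF S\<rho>[OF True]] \<eta>(2,3)[of x] \<sigma>[of x] by (intro mult_mono) auto
      then have "(\<eta> x * (\<sigma> x * (1 + \<bar>u x\<bar>))) ^ ?N \<le> P x ^ ?N"
        using \<eta>(2)[of x] \<sigma>[of x] by (intro power_mono) auto
      then show ?thesis using \<eta>(2)[of x] \<sigma>[of x] P_nonneg[of x] by (auto simp: indicator_def abs_mult)
    qed (use \<eta>(4) P_nonneg in \<open>auto simp: power_0_left\<close>)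
    then show "AE x in lborel. norm (indicator A x * (\<eta> x * (\<sigma> x * (1 + \<bar>u x\<bar>))) ^ ?N) \<le> norm (P x ^ ?N)" by simp
  qed measurable
  have iZ: "integrable lborel Z" unfolding Z_def using iw i\<sigma> by auto
  have Z0: "Z x \<ge> 0" for x using cc \<eta>(2)[of x] \<sigma>[of x] by (simp add: Z_def)
  have XY: "0 \<le> X M x" "X M x \<le> Y x" for M x
  proof -
    show "0 \<le> X M x" using \<eta>(2)[of x] \<chi>1 by (simp add: X_def)
    show "X M x \<le> Y x"
    proof (cases "x \<in> cball z \<rho>")
      case True
      show ?thesis
      proof (cases "x \<in> A")
        case True
        have "\<eta> x ^ ?N * \<chi>1 M x * norm (ux x) ^ ?N \<le> \<eta> x ^ ?N * 1 * norm (ux x) ^ ?N"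
          using \<chi>1 \<eta>(2)[of x] by (intro mult_right_mono mult_left_mono) auto
        then show ?thesis using True by (simp add: X_def Y_def power_mult_distrib)
      qed (use offA[OF S\<rho>[OF True]] in \<open>simp add: X_def Y_def\<close>)
    qed (use \<eta>(4) in \<open>simp add: X_def Y_def power_0_left\<close>)
  qed
  have iX: "integrable lborel (X M)" for M
    by (rule Bochner_Integration.integrable_bound[OF iY]) (use XY Yle in auto)
  have key: "(\<integral>x. X M x \<partial>lborel) \<le> 1 / 2 * (\<integral>x. Y x \<partial>lborel) + (\<integral>x. Z x \<partial>lborel)" for M
  proof -
    obtain Bt where Bt: "\<And>x. \<bar>t M x\<bar> \<le> Bt" using tb by blast
    have C\<eta>: "C1_grad (\<lambda>x. \<eta> x ^ ?N) (\<lambda>x. (real ?N * \<eta> x ^ (?N - 1)) *\<^sub>R \<eta>' x)"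
      by (rule C1_grad_compose[OF \<eta>(1), where T="\<lambda>t. t ^ ?N" and \<tau>="\<lambda>t. real ?N * t ^ (?N - 1)"])
         (auto intro!: derivative_eq_intros continuous_intros)
    have \<eta>N: "\<bar>\<eta> x ^ ?N\<bar> \<le> real ?N * (1 + B)" "norm ((real ?N * \<eta> x ^ (?N - 1)) *\<^sub>R \<eta>' x) \<le> real ?N * (1 + B)" for x
    proof -
      have "1 * 1 \<le> real ?N * (1 + B)" using N0 B by (intro mult_mono) auto
      moreover have "\<eta> x ^ ?N \<le> 1" using \<eta>(2,3)[of x] by (intro power_le_one) auto
      ultimately show "\<bar>\<eta> x ^ ?N\<bar> \<le> real ?N * (1 + B)" using \<eta>(2)[of x] by simp
      have "\<eta> x ^ (?N - 1) \<le> 1" using \<eta>(2,3)[of x] by (intro power_le_one) auto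
      then have "real ?N * \<eta> x ^ (?N - 1) * norm (\<eta>' x) \<le> real ?N * 1 * (1 + B)"
        using \<eta>(5)[of x] B \<eta>(2)[of x] by (intro mult_mono) auto
      then show "norm ((real ?N * \<eta> x ^ (?N - 1)) *\<^sub>R \<eta>' x) \<le> real ?N * (1 + B)" using \<eta>(2)[of x] by simp
    qed
    have \<eta>N0: "\<eta> x ^ ?N = 0" if "x \<notin> cball z \<rho>" for x using \<eta>(4)[OF that] by (simp add: power_0_left)
    note HM = H0_mult[OF Ht[of M] C\<eta> \<eta>N \<eta>N0]
    define vM where "vM x = \<eta> x ^ ?N * t M x" for x
    define gM where "gM x = \<eta> x ^ ?N *\<^sub>R (\<chi>1 M x *\<^sub>R GU x) + t M x *\<^sub>R ((real ?N * \<eta> x ^ (?N - 1)) *\<^sub>R \<eta>' x)" for x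
    have HM': "H0 z \<rho> vM gM" using HM by (simp add: vM_def[abs_def] gM_def[abs_def])
    have vMb: "\<bar>vM x\<bar> \<le> Bt" for x
    proof -
      have "\<bar>vM x\<bar> \<le> 1 * Bt" unfolding vM_def abs_mult using Bt[of x] \<eta>(2,3)[of x]
        by (intro mult_mono) (auto simp: power_le_one)
      then show ?thesis by simp
    qed
    have a1: "a + 1 \<ge> 0" using a by simp
    have P0: "P x = 0" if "x \<notin> ?S" for x using that by (simp add: P_def)
    note weq = weak_equation_H0[OF \<rho> FG' P_borel P_nonneg P0 P_fin a1 F'P n2 iG weak HM' vMb]
    note w1 = weq(1) and w2 = weq(2) and w3 = weq(3)
    have pt: "X M x - (1 / 2 * Y x + Z x) \<le> gM x \<bullet> F' x + vM x * G' x" for x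
    proof (cases "x \<in> cball z \<rho>")
      case True
      then have x: "x \<in> ?S" by (rule S\<rho>)
      show ?thesis
      proof (cases "x \<in> A")
        case A: True
        have "0 \<le> w x" using tw(1)[OF x, of 0] by simp
        then have "\<bar>w x\<bar> = w x" by simp
        then show ?thesis
          using pointwise_caccioppoli[OF tw(1)[OF x, of M] tw(2)[OF x] \<chi>1(1)[of M x] \<chi>1(2)[of M x] \<eta>(2)[of x] \<eta>(3)[of x], where \<eta>'="\<eta>' x"] x A U[OF x]
          by (simp add: X_def Y_def Z_def gM_def vM_def F'_def G'_def power_mult_distrib)
      next
        case A: False
        then show ?thesis using offA[OF x A, of M] x Z0[of x] by (simp add: X_def Y_def gM_def vM_def)
      qed
    next
      case False
      then show ?thesis using \<eta>(4)[OF False] \<eta>'0[OF False] Z0[of x] by (simp add: X_def Y_def gM_def vM_def power_0_left)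
    qed
    have "(\<integral>x. X M x - (1 / 2 * Y x + Z x) \<partial>lborel) \<le> (\<integral>x. gM x \<bullet> F' x + vM x * G' x \<partial>lborel)"
    proof (rule Bochner_Integration.integral_mono[OF _ _ pt])
      show "integrable lborel (\<lambda>x. X M x - (1 / 2 * Y x + Z x))"
        by (intro Bochner_Integration.integrable_diff Bochner_Integration.integrable_add integrable_mult_right iX iY iZ)
      show "integrable lborel (\<lambda>x. gM x \<bullet> F' x + vM x * G' x)"
        by (rule Bochner_Integration.integrable_add[OF w1 w2])
    qed
    also have "\<dots> = 0" by (rule trans[OF Bochner_Integration.integral_add[OF w1 w2] w3])
    finally have "(\<integral>x. X M x - (1 / 2 * Y x + Z x) \<partial>lborel) \<le> 0" .
    moreover have iY2: "integrable lborel (\<lambda>x. 1 / 2 * Y x)" by (rule integrable_mult_right[OF iY])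
    have "(\<integral>x. X M x - (1 / 2 * Y x + Z x) \<partial>lborel) = (\<integral>x. X M x \<partial>lborel) - ((\<integral>x. 1 / 2 * Y x \<partial>lborel) + (\<integral>x. Z x \<partial>lborel))"
      unfolding Bochner_Integration.integral_diff[OF iX Bochner_Integration.integrable_add[OF iY2 iZ]]
        Bochner_Integration.integral_add[OF iY2 iZ] ..
    moreover have "(\<integral>x. 1 / 2 * Y x \<partial>lborel) = 1 / 2 * (\<integral>x. Y x \<partial>lborel)" by simp
    ultimately show ?thesis by linarith
  qed
  have "(\<lambda>M. \<integral>x. X M x \<partial>lborel) \<longlonglongrightarrow> (\<integral>x. Y x \<partial>lborel)"
  proof (rule integral_dominated_convergence[where w=Y])
    show "AE x in lborel. (\<lambda>M. X M x) \<longlonglongrightarrow> Y x"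
    proof (intro AE_I2)
      fix x
      show "(\<lambda>M. X M x) \<longlonglongrightarrow> Y x"
      proof (cases "x \<in> cball z \<rho>")
        case True
        have "(\<lambda>M. \<eta> x ^ ?N * \<chi>1 M x * norm (ux x) ^ ?N) \<longlonglongrightarrow> \<eta> x ^ ?N * indicator A x * norm (ux x) ^ ?N"
          by (intro tendsto_intros lim S\<rho>[OF True])
        then show ?thesis by (simp add: X_def Y_def power_mult_distrib mult_ac)
      qed (use \<eta>(4) in \<open>simp add: X_def Y_def power_0_left\<close>)
    qed
  qed (use iY XY in auto)
  from LIMSEQ_le_const2[OF this] key
  have "(\<integral>x. Y x \<partial>lborel) \<le> 1 / 2 * (\<integral>x. Y x \<partial>lborel) + (\<integral>x. Z x \<partial>lborel)" by blast
  \<comment> \<open>\<open>Y\<close> is dominated by the integrable n-th power of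
    \<open>norm (ux x)\<close>, so its integral is finite and half of it may be moved to the
    left.\<close>
  then have fin: "(\<integral>x. Y x \<partial>lborel) \<le> 2 * (\<integral>x. Z x \<partial>lborel)" by simp
  have "(\<integral>\<^sup>+x\<in>A. ennreal ((\<eta> x * norm (ux x)) ^ ?N) \<partial>lborel) = (\<integral>\<^sup>+x. ennreal (Y x) \<partial>lborel)"
    by (intro nn_integral_cong) (auto simp: Y_def indicator_def)
  also have "\<dots> = ennreal (\<integral>x. Y x \<partial>lborel)" by (rule nn_integral_eq_integral[OF iY]) (use Yle in auto)
  also have "\<dots> \<le> ennreal (2 * (\<integral>x. Z x \<partial>lborel))" by (intro ennreal_leI fin)
  also have "\<dots> = 2 * ennreal (\<integral>x. Z x \<partial>lborel)" by (simp add: ennreal_mult')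
  also have "ennreal (\<integral>x. Z x \<partial>lborel) = (\<integral>\<^sup>+x. ennreal (Z x) \<partial>lborel)" by (rule nn_integral_eq_integral[OF iZ, symmetric]) (use Z0 in auto)
  also have "\<dots> = (\<integral>\<^sup>+x. ennreal (cacc1 ?N a) * ennreal (norm (w x *\<^sub>R \<eta>' x) ^ ?N)
      + ennreal (cacc2 ?N) * (ennreal ((\<eta> x * (\<sigma> x * (1 + \<bar>u x\<bar>))) ^ ?N) * indicator A x) \<partial>lborel)"
  proof (intro nn_integral_cong)
    fix x
    have "(\<eta> x * (\<sigma> x * (1 + \<bar>u x\<bar>))) ^ ?N \<ge> 0" using \<eta>(2)[of x] \<sigma>[of x] by simp
    then show "ennreal (Z x) = ennreal (cacc1 ?N a) * ennreal (norm (w x *\<^sub>R \<eta>' x) ^ ?N)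
      + ennreal (cacc2 ?N) * (ennreal ((\<eta> x * (\<sigma> x * (1 + \<bar>u x\<bar>))) ^ ?N) * indicator A x)"
      using cc unfolding Z_def by (cases "x \<in> A") (auto simp: ennreal_mult[symmetric] ennreal_plus[symmetric] simp del: ennreal_plus norm_scaleR)
  qed
  also have "\<dots> = ennreal (cacc1 ?N a) * lpint ?N (\<lambda>x. w x *\<^sub>R \<eta>' x)
      + ennreal (cacc2 ?N) * (\<integral>\<^sup>+x\<in>A. ennreal ((\<eta> x * (\<sigma> x * (1 + \<bar>u x\<bar>))) ^ ?N) \<partial>lborel)"
    by (simp add: nn_integral_add nn_integral_cmult lpint_def del: norm_scaleR)
  finally show ?thesis .
qed

end

text \<open>The powers of 2 are costs of the triangle inequality for n-th powers: once for the
  product rule, and a second time in \<open>energy2\<close> for splitting \<open>1 + |u|\<close>.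
  The factors 2 are that of Caccioppoli's inequality; the 1 comes from the derivative falling on the
  cutoff.\<close>

definition energy1 :: "nat \<Rightarrow> real \<Rightarrow> real"
  where "energy1 n a = 2 ^ n * (2 * cacc1 n a + 1)"

definition energy2 :: "nat \<Rightarrow> real"
  where "energy2 n = 4 ^ n * (2 * cacc2 n)"

lemma energy_pos: "a \<ge> 0 \<Longrightarrow> energy1 n a > 0" "energy2 n > 0"
  using cacc_nonneg(1)[of a n] by (auto simp: energy1_def energy2_def cacc2_def intro!: mult_pos_pos add_nonneg_pos add_pos_pos)

lemma half_absorb:
  fixes G p q y :: real
  assumes "G \<le> p + (y + q)" "y \<le> 1 / 2 * G" shows "G \<le> 2 * (p + q)"
  using assms by argo

lemma square_light:
  fixes y e :: real assumes "y \<ge> 0" "e > 0" shows "y \<le> e * y\<^sup>2 + 1 / e"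
proof (cases "y \<le> 1 / e")
  case False
  then have "1 \<le> e * y" using assms by (simp add: field_simps)
  then have "y * 1 \<le> y * (e * y)" using assms by (intro mult_left_mono) auto
  then show ?thesis using assms by (simp add: power2_eq_square mult_ac add_increasing2)
qed (use assms in \<open>simp add: add_increasing\<close>)

context local_solution
begin

text \<open>The first summand is the cutoff term on a set of measure \<open>exp (-L)\<close>, the
  second the part of the weighted term belonging to the constant \<open>1 + h\<close>. The outer 2
  is the price of absorbing half of the energy.\<close>

definition energy_bound :: "real \<Rightarrow> real \<Rightarrow> real \<Rightarrow> real"
  where "energy_bound B h L = 2 * (energy1 CARD('n) a * B ^ CARD('n) * (M0 + 1) * exp (- L / 2)
     + energy2 CARD('n) * (1 + h) ^ CARD('n) * \<Gamma> * L powr (- s))"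

lemma energy_bound_pos: "B > 0 \<Longrightarrow> h \<ge> 0 \<Longrightarrow> energy_bound B h L > 0"
proof -
  assume B: "B > 0" and h: "h \<ge> 0"
  have "M0 + 1 > 0" using M0 by simp
  then have A1: "energy1 CARD('n) a * B ^ CARD('n) * (M0 + 1) * exp (- L / 2) > 0"
    using energy_pos(1)[of a "CARD('n)"] a B by simp
  have A2: "energy2 CARD('n) * (1 + h) ^ CARD('n) * \<Gamma> * L powr (- s) \<ge> 0"
    using energy_pos(2)[of "CARD('n)"] h \<Gamma> by simp
  show ?thesis unfolding energy_bound_def by (rule mult_pos_pos[OF zero_less_numeral add_pos_nonneg[OF A1 A2]])
qed

text \<open>Caccioppoli's inequality above the level \<open>h\<close> leaves a cutoff term and a
  weighted term. Up to a contribution of \<open>1 + h\<close>, the weighted term is at most half of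
  the energy of the same \<open>v\<close>, by the weighted Trudinger inequality and
  \<open>absorb\<close>.\<close>

lemma energy_estimate:
  assumes \<rho>: "\<rho> < 3 / 2 * R" and h: "h \<ge> 0" and L: "L \<ge> 1"
    and small: "measure lborel {x \<in> cball z \<rho>. u x > h} \<le> exp (- L)"
    and absorb: "energy2 CARD('n) * weight_const CARD('n) s * \<Gamma> * L powr (- ((s - (real CARD('n) - 1)) / 2)) \<le> 1 / 2"
    and \<eta>: "C1_grad \<eta> \<eta>'" "\<And>x. 0 \<le> \<eta> x" "\<And>x. \<eta> x \<le> 1" "\<And>x. x \<notin> cball z \<rho> \<Longrightarrow> \<eta> x = 0" "\<And>x. norm (\<eta>' x) \<le> B"
  obtains v gv where "H0 z \<rho> v gv" "\<And>x. x \<in> cball z (3 / 2 * R) \<Longrightarrow> v x = \<eta> x * max 0 (u x - h)"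
    "lpint CARD('n) gv \<le> ennreal (energy_bound B h L)" "measure lborel {x. v x > 0} \<le> exp (- L)"
proof -
  let ?S = "cball z (3 / 2 * R)"
  let ?N = "CARD('n)"
  let ?\<theta> = "(s - (real ?N - 1)) / 2"
  have N0: "?N > 0" using n2 by simp
  have cc: "cacc1 ?N a \<ge> 0" "cacc2 ?N \<ge> 0" using a cacc_nonneg(1)[of a ?N] cacc_nonneg(2)[of ?N] by auto
  note [measurable] = C1_grad_borel[OF \<eta>(1)]
  obtain U GU where U: "H0 z (15 / 8 * R) U GU" "\<And>x. x \<in> ?S \<Longrightarrow> U x = u x" "\<And>x. x \<in> ?S \<Longrightarrow> GU x = ux x"
    using ex_cutoff_solution by blast
  note [measurable] = H0_borel[OF U(1)]
  have B: "B \<ge> 0" using \<eta>(5)[of z] norm_ge_zero order_trans by blast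
  have S\<rho>: "x \<in> ?S" if "x \<in> cball z \<rho>" for x using that \<rho> by auto
  have \<eta>'0: "\<eta>' x = 0" if "x \<notin> cball z \<rho>" for x by (rule gradient_zero_outside[OF \<eta>(1) closed_cball \<eta>(4) that])
  define A where "A = {x. U x > h}"
  have [measurable]: "A \<in> sets borel" unfolding A_def by measurable
  define w where "w x = max 0 (U x - h)" for x
  have [measurable]: "w \<in> borel_measurable borel" unfolding w_def by measurable
  have w0: "w x \<ge> 0" for x by (simp add: w_def)
  define v where "v x = \<eta> x * w x" for x
  define gv where "gv x = \<eta> x *\<^sub>R (if U x > h then GU x else 0) + w x *\<^sub>R \<eta>' x" for x
  have Hw: "H0 z (15 / 8 * R) w (\<lambda>x. if U x > h then GU x else 0)"
    unfolding w_def by (rule H0_pos_part[OF U(1) h])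
  have Hv: "H0 z \<rho> v gv"
    unfolding v_def gv_def
    by (rule H0_mult[OF Hw \<eta>(1), of "1 + B"]) (use \<eta> B in \<open>auto intro: order_trans add_increasing add_increasing2\<close>)
  note [measurable] = H0_borel[OF Hv]
  have vU: "v x = \<eta> x * max 0 (u x - h)" if "x \<in> ?S" for x using U(2)[OF that] by (simp add: v_def w_def)
  define A' where "A' = {x \<in> cball z \<rho>. u x > h}"
  have [measurable]: "A' \<in> sets borel" unfolding A'_def by measurable
  have A'fin: "emeasure lborel A' = ennreal (measure lborel A')"
  proof -
    have "emeasure lborel A' \<le> emeasure lborel (cball z \<rho>)" by (intro emeasure_mono) (auto simp: A'_def)
    then show ?thesis using emeasure_lborel_cball_finite[of z \<rho>] by (intro emeasure_eq_ennreal_measure) (auto simp: top_unique)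
  qed
  have smallv: "measure lborel {x. v x > 0} \<le> exp (- L)"
  proof -
    have "{x. v x > 0} \<subseteq> A'"
    proof
      fix x assume "x \<in> {x. v x > 0}"
      then have "\<eta> x \<noteq> 0" "w x \<noteq> 0" by (auto simp: v_def)
      then have "x \<in> cball z \<rho>" using \<eta>(4) by blast
      then show "x \<in> A'" using \<open>w x \<noteq> 0\<close> U(2)[OF S\<rho>] by (auto simp: A'_def w_def max_def split: if_splits)
    qed
    then have "emeasure lborel {x. v x > 0} \<le> emeasure lborel A'" by (intro emeasure_mono) auto
    then have "measure lborel {x. v x > 0} \<le> measure lborel A'"
      unfolding A'fin H0_level_finite(3)[OF Hv order_refl] by simp
    then show ?thesis using small by (simp add: A'_def)
  qed
  define X where "X = lpint ?N (\<lambda>x. w x *\<^sub>R \<eta>' x)"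
  have X: "X \<le> ennreal (B ^ ?N * (M0 + 1) * exp (- L / 2))"
  proof -
    have "X \<le> ennreal (B ^ ?N) * lpint ?N (\<lambda>x. indicator A' x * u x)"
      unfolding X_def
    proof (rule lpint_mult_le[OF _ B])
      fix x
      show "norm (w x *\<^sub>R \<eta>' x) \<le> B * norm (indicator A' x * u x)"
      proof (cases "x \<in> A'")
        case True
        then have x: "x \<in> ?S" "u x > h" using S\<rho> by (auto simp: A'_def)
        have "norm (w x *\<^sub>R \<eta>' x) \<le> \<bar>u x\<bar> * B"
          using \<eta>(5)[of x] x h U(2)[OF x(1)] w0[of x] by (auto simp: w_def intro!: mult_mono)
        then show ?thesis using True by (simp add: mult.commute)
      next
        case False
        then have "w x = 0 \<or> \<eta>' x = 0" using \<eta>'0[of x] U(2)[OF S\<rho>, of x]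
          by (cases "x \<in> cball z \<rho>") (auto simp: A'_def w_def)
        then show ?thesis using B by auto
      qed
    qed measurable
    \<comment> \<open>The inequality \<open>y \<le> e y^2 + 1/e\<close> with
      \<open>e = exp (- L / 2)\<close> is balanced: the integral of the \<open>2 n\<close>-th power
      and the measure of \<open>A'\<close> both contribute multiples of
      \<open>exp (- L / 2)\<close>.\<close>
    also have "lpint ?N (\<lambda>x. indicator A' x * u x) \<le> (\<integral>\<^sup>+x. ennreal (exp (- L / 2)) * ennreal (norm (u x) ^ (2 * ?N)) + ennreal (exp (L / 2)) * indicator A' x \<partial>lborel)"
      unfolding lpint_def
    proof (intro nn_integral_mono)
      fix x
      have "norm (u x) ^ ?N \<le> exp (- L / 2) * (norm (u x) ^ ?N)\<^sup>2 + 1 / exp (- L / 2)"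
        by (rule square_light) auto
      also have "\<dots> = exp (- L / 2) * norm (u x) ^ (2 * ?N) + exp (L / 2)"
      proof -
        have "exp (L / 2) * exp (- L / 2) = 1" unfolding exp_add[symmetric] by simp
        then have "1 / exp (- L / 2) = exp (L / 2)" using nonzero_eq_divide_eq[of "exp (- L / 2)" "exp (L / 2)" 1] by simp
        then show ?thesis by (simp only: power_even_eq)
      qed
      finally have "ennreal (norm (u x) ^ ?N) \<le> ennreal (exp (- L / 2) * norm (u x) ^ (2 * ?N) + exp (L / 2))"
        by (rule ennreal_leI)
      also have "\<dots> = ennreal (exp (- L / 2)) * ennreal (norm (u x) ^ (2 * ?N)) + ennreal (exp (L / 2))"
        by (simp add: ennreal_mult)
      finally show "ennreal (norm (indicator A' x * u x) ^ ?N) \<le> ennreal (exp (- L / 2)) * ennreal (norm (u x) ^ (2 * ?N)) + ennreal (exp (L / 2)) * indicator A' x"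
        using N0 by (cases "x \<in> A'") (auto simp: power_0_left)
    qed
    also have "\<dots> = ennreal (exp (- L / 2)) * lpint (2 * ?N) u + ennreal (exp (L / 2)) * emeasure lborel A'"
      by (simp add: nn_integral_add nn_integral_cmult lpint_def nn_integral_cmult_indicator)
    also have "\<dots> \<le> ennreal (exp (- L / 2)) * ennreal M0 + ennreal (exp (L / 2)) * ennreal (exp (- L))"
      using u_int small unfolding A'fin by (intro add_mono mult_left_mono ennreal_leI) (auto simp: A'_def)
    also have "\<dots> = ennreal (exp (- L / 2) * M0 + exp (L / 2) * exp (- L))" using M0 by (simp add: ennreal_mult)
    also have "exp (L / 2) * exp (- L) = exp (- L / 2)" by (simp add: exp_add[symmetric])
    also have "ennreal (B ^ ?N) * ennreal (exp (- L / 2) * M0 + exp (- L / 2)) = ennreal (B ^ ?N * (M0 + 1) * exp (- L / 2))"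
      using B M0 by (simp add: ennreal_mult[symmetric] algebra_simps)
    finally show ?thesis by (simp add: mult_left_mono)
  qed
  define E1 where "E1 = (\<integral>\<^sup>+x\<in>A. ennreal ((\<eta> x * norm (ux x)) ^ ?N) \<partial>lborel)"
  define Q where "Q = (\<integral>\<^sup>+x\<in>A. ennreal ((\<eta> x * (\<sigma> x * (1 + \<bar>u x\<bar>))) ^ ?N) \<partial>lborel)"
  have E1: "E1 \<le> 2 * (ennreal (cacc1 ?N a) * X + ennreal (cacc2 ?N) * Q)"
    unfolding E1_def X_def Q_def
  \<comment> \<open>The test functions are the positive part above \<open>h\<close>, truncated at
    height \<open>M\<close>; its derivative is the indicator of a bounded range of values of
    \<open>U\<close>, increasing to that of \<open>A\<close>.\<close>
  proof (rule caccioppoli[OF \<rho> U(3), where t="\<lambda>M x. min (real M) (max 0 (U x - h))" and ?\<chi>1.0="\<lambda>M x. if h < U x \<and> U x \<le> h + real M then 1 else 0"])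
    show "H0 z (15 / 8 * R) (\<lambda>x. min (real M) (max 0 (U x - h))) (\<lambda>x. (if h < U x \<and> U x \<le> h + real M then 1 else 0) *\<^sub>R GU x)" for M
    proof -
      have "(\<lambda>x. (if h < U x \<and> U x \<le> h + real M then 1 else 0) *\<^sub>R GU x) = (\<lambda>x. if h < U x \<and> U x \<le> h + real M then GU x else 0)"
        by auto
      then show ?thesis using H0_truncate[OF U(1) h, of "real M"] by simp
    qed
    show "\<exists>B. \<forall>x. \<bar>min (real M) (max 0 (U x - h))\<bar> \<le> B" for M by (intro exI[of _ "real M"]) auto
    show "\<bar>min (real M) (max 0 (U x - h))\<bar> \<le> w x" for M x by (auto simp: w_def)
    show "w x \<le> 1 + \<bar>u x\<bar>" if "x \<in> ?S" for x using U(2)[OF that] h by (auto simp: w_def)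
    show "(\<lambda>M. if h < U x \<and> U x \<le> h + real M then 1 else 0) \<longlonglongrightarrow> (indicator A x :: real)" for x
    proof -
      obtain M0 :: nat where "U x \<le> h + real M0" using real_arch_simple[of "U x - h"] by (auto simp: algebra_simps)
      then show ?thesis
        by (intro tendsto_eventually eventually_sequentiallyI[of M0]) (auto simp: A_def indicator_def)
    qed
    show "min (real M) (max 0 (U x - h)) = 0 \<and> (if h < U x \<and> U x \<le> h + real M then 1 else 0) = (0::real) \<and> w x = 0" if "x \<notin> A" for M x
      using that by (auto simp: A_def w_def)
  qed (use \<eta> in auto)
  define Wv where "Wv = (\<integral>\<^sup>+x. ennreal (\<sigma> x ^ ?N * v x ^ ?N) \<partial>lborel)"
  \<comment> \<open>Writing \<open>1 + |u|\<close> as \<open>(u - h) + (1 + h)\<close> separates the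
    weighted integral of \<open>v\<close> from a multiple of the weight of its support.\<close>
  have Q: "Q \<le> ennreal (2 ^ ?N) * (Wv + ennreal ((1 + h) ^ ?N * (\<Gamma> * L powr (- s))))"
  proof -
    have "Q \<le> (\<integral>\<^sup>+x. ennreal (2 ^ ?N) * (ennreal (\<sigma> x ^ ?N * v x ^ ?N) + ennreal ((1 + h) ^ ?N) * (ennreal (\<sigma> x ^ ?N) * indicator {x. v x > 0} x)) \<partial>lborel)"
      unfolding Q_def
    proof (intro nn_integral_mono)
      fix x
      show "ennreal ((\<eta> x * (\<sigma> x * (1 + \<bar>u x\<bar>))) ^ ?N) * indicator A x \<le> ennreal (2 ^ ?N) * (ennreal (\<sigma> x ^ ?N * v x ^ ?N) + ennreal ((1 + h) ^ ?N) * (ennreal (\<sigma> x ^ ?N) * indicator {x. v x > 0} x))"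
      proof (cases "x \<in> A \<and> \<eta> x \<noteq> 0")
        case True
        then have x: "x \<in> ?S" "U x > h" "\<eta> x > 0" using \<eta>(4)[of x] S\<rho> \<eta>(2)[of x] by (auto simp: A_def less_le)
        have ux: "u x > h" using x U(2) by simp
        have v: "v x = \<eta> x * (u x - h)" "v x > 0" using x vU[OF x(1)] ux by auto
        have "\<eta> x * (\<sigma> x * (1 + \<bar>u x\<bar>)) = \<sigma> x * v x + \<sigma> x * (\<eta> x * (1 + h))"
        proof -
          have "\<bar>u x\<bar> = u x" using ux h by simp
          then show ?thesis unfolding v(1) by (simp add: algebra_simps)
        qed
        also have "\<dots> \<le> \<sigma> x * v x + \<sigma> x * (1 * (1 + h))" using \<sigma>[of x] \<eta>(3)[of x] h by (intro add_left_mono mult_left_mono mult_right_mono) auto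
        finally have "(\<eta> x * (\<sigma> x * (1 + \<bar>u x\<bar>))) ^ ?N \<le> norm (\<sigma> x * v x + \<sigma> x * (1 + h)) ^ ?N"
          using \<eta>(2)[of x] \<sigma>[of x] by (intro power_mono) auto
        also have "\<dots> \<le> 2 ^ ?N * (norm (\<sigma> x * v x) ^ ?N + norm (\<sigma> x * (1 + h)) ^ ?N)" by (rule norm_add_power_le)
        also have "\<dots> = 2 ^ ?N * (\<sigma> x ^ ?N * v x ^ ?N + (1 + h) ^ ?N * \<sigma> x ^ ?N)"
          using v(2) \<sigma>[of x] h by (simp add: power_mult_distrib abs_mult mult.commute)
        finally have "ennreal ((\<eta> x * (\<sigma> x * (1 + \<bar>u x\<bar>))) ^ ?N) \<le> ennreal (2 ^ ?N * (\<sigma> x ^ ?N * v x ^ ?N + (1 + h) ^ ?N * \<sigma> x ^ ?N))"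
          by (rule ennreal_leI)
        also have "\<dots> = ennreal (2 ^ ?N) * (ennreal (\<sigma> x ^ ?N * v x ^ ?N) + ennreal ((1 + h) ^ ?N) * ennreal (\<sigma> x ^ ?N))"
          using v(2) \<sigma>[of x] h by (simp add: ennreal_mult[symmetric] ennreal_plus[symmetric] del: ennreal_plus)
        finally show ?thesis using True v(2) by simp
      next
        case False
        then show ?thesis using N0 by (auto simp: power_0_left)
      qed
    qed
    also have "\<dots> = ennreal (2 ^ ?N) * (Wv + ennreal ((1 + h) ^ ?N) * (\<integral>\<^sup>+x\<in>{x. v x > 0}. ennreal (\<sigma> x ^ ?N) \<partial>lborel))"
      by (simp add: nn_integral_add nn_integral_cmult Wv_def)
    also have "\<dots> \<le> ennreal (2 ^ ?N) * (Wv + ennreal ((1 + h) ^ ?N) * ennreal (\<Gamma> * L powr (- s)))"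
    proof (intro mult_left_mono add_left_mono)
      have "{x. v x > 0} \<subseteq> ball z (2 * R)" using H0_level_finite(2)[OF Hv order_refl] \<rho> R by fastforce
      then show "(\<integral>\<^sup>+x\<in>{x. v x > 0}. ennreal (\<sigma> x ^ ?N) \<partial>lborel) \<le> ennreal (\<Gamma> * L powr (- s))"
        using decay[unfolded small_set_decay_def, rule_format, of "{x. v x > 0}" L] L smallv H0_level_finite[OF Hv order_refl]
        by (simp add: ennreal_leI)
    qed auto
    finally show ?thesis using h \<Gamma> by (simp add: ennreal_mult)
  qed
  define G where "G = enn2real (lpint ?N gv)"
  have G: "G \<ge> 0" "lpint ?N gv = ennreal G" using H0_finite(2)[OF Hv] by (auto simp: G_def)
  have "lpint ?N gv \<le> 2 ^ ?N * (lpint ?N (\<lambda>x. \<eta> x *\<^sub>R (if U x > h then GU x else 0)) + X)"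
    unfolding gv_def X_def by (rule lpint_add_le) measurable
  also have "lpint ?N (\<lambda>x. \<eta> x *\<^sub>R (if U x > h then GU x else 0)) = E1"
    unfolding lpint_def E1_def
  proof (intro nn_integral_cong)
    fix x
    show "ennreal (norm (\<eta> x *\<^sub>R (if U x > h then GU x else 0)) ^ ?N) = ennreal ((\<eta> x * norm (ux x)) ^ ?N) * indicator A x"
      using N0 \<eta>(2)[of x] \<eta>(4)[of x] U(3)[OF S\<rho>, of x] by (cases "x \<in> cball z \<rho>") (auto simp: A_def power_0_left)
  qed
  finally have g1: "lpint ?N gv \<le> 2 ^ ?N * (E1 + X)" .
  have "energy_bound B h L \<ge> 0"
    unfolding energy_bound_def using energy_pos(1)[of a ?N] energy_pos(2)[of ?N] a M0 \<Gamma> B h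
    by (intro mult_nonneg_nonneg add_nonneg_nonneg) auto
  \<comment> \<open>The energy \<open>G\<close>, finite because \<open>v\<close> is a Sobolev
    function, itself serves as \<open>J\<close>; the weighted term is then a small multiple of
    \<open>G\<close>. Since \<open>J\<close> has to be positive, \<open>G = 0\<close> is treated
    apart.\<close>
  have "G \<le> energy_bound B h L"
  proof (cases "G = 0")
    case False
    then have G0: "G > 0" using G by simp
    have "Wv \<le> ennreal (weight_const ?N s * G * \<Gamma> * L powr (- ?\<theta>))"
      unfolding Wv_def
      by (rule weighted_trudinger[OF Hv _ G0 _ s n2 _ _ _ \<Gamma> L smallv])
         (use decay_cball[of \<rho>] \<rho> R \<eta>(2) w0 \<sigma> G in \<open>auto simp: v_def\<close>)
    then have Q': "Q \<le> ennreal (2 ^ ?N) * (ennreal (weight_const ?N s * G * \<Gamma> * L powr (- ?\<theta>)) + ennreal ((1 + h) ^ ?N * (\<Gamma> * L powr (- s))))"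
      by (intro order_trans[OF Q] mult_left_mono add_right_mono) auto
    have wc: "weight_const ?N s \<ge> 0"
      using s trudinger_const_pos[of ?N] unfolding weight_const_def
      by (intro mult_nonneg_nonneg add_nonneg_nonneg divide_nonneg_nonneg) (auto simp: powr_le_one_le powr_le1 intro!: less_imp_le[OF powr_less_one])
    define x1 where "x1 = B ^ ?N * (M0 + 1) * exp (- L / 2)"
    define q1 where "q1 = 2 ^ ?N * (weight_const ?N s * G * \<Gamma> * L powr (- ?\<theta>) + (1 + h) ^ ?N * (\<Gamma> * L powr (- s)))"
    have q1: "q1 \<ge> 0" "Q \<le> ennreal q1" using Q' wc G \<Gamma> h
      by (auto simp: q1_def ennreal_mult[symmetric] ennreal_plus[symmetric] simp del: ennreal_plus)
    have x1: "x1 \<ge> 0" "X \<le> ennreal x1" using X B M0 by (auto simp: x1_def)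
    have "lpint ?N gv \<le> 2 ^ ?N * (2 * (ennreal (cacc1 ?N a) * X + ennreal (cacc2 ?N) * Q) + X)"
      by (rule order_trans[OF g1]) (intro mult_left_mono add_right_mono E1, auto)
    also have "\<dots> \<le> 2 ^ ?N * (2 * (ennreal (cacc1 ?N a) * ennreal x1 + ennreal (cacc2 ?N) * ennreal q1) + ennreal x1)"
      by (intro mult_left_mono add_mono x1 q1) auto
    also have "\<dots> = ennreal (2 ^ ?N * (2 * (cacc1 ?N a * x1 + cacc2 ?N * q1) + x1))"
    proof -
      have "(2::ennreal) ^ ?N = ennreal (2 ^ ?N)" using ennreal_power[of 2 ?N] by simp
      then show ?thesis using x1 q1 cc by (simp add: ennreal_mult)
    qed
    finally have "G \<le> 2 ^ ?N * (2 * (cacc1 ?N a * x1 + cacc2 ?N * q1) + x1)"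
      unfolding G(2) using x1 q1 cc by (subst (asm) ennreal_le_iff) auto
    also have "\<dots> = energy1 ?N a * x1 + 2 ^ ?N * (2 * cacc2 ?N) * q1" by (simp add: energy1_def algebra_simps)
    also have "2 ^ ?N * (2 * cacc2 ?N) * q1 = energy2 ?N * weight_const ?N s * \<Gamma> * L powr (- ?\<theta>) * G + energy2 ?N * (1 + h) ^ ?N * \<Gamma> * L powr (- s)"
    proof -
      have "(4::real) ^ ?N = 2 ^ ?N * 2 ^ ?N" by (simp add: power_mult_distrib[symmetric])
      then show ?thesis by (simp add: q1_def energy2_def algebra_simps)
    qed
    finally have g3: "G \<le> energy1 ?N a * x1 + (energy2 ?N * weight_const ?N s * \<Gamma> * L powr (- ?\<theta>) * G
      + energy2 ?N * (1 + h) ^ ?N * \<Gamma> * L powr (- s))" .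
    have g4: "energy2 ?N * weight_const ?N s * \<Gamma> * L powr (- ?\<theta>) * G \<le> 1 / 2 * G" using absorb G by (intro mult_right_mono) auto
    have "G \<le> 2 * (energy1 ?N a * x1 + energy2 ?N * (1 + h) ^ ?N * \<Gamma> * L powr (- s))"
    proof -
      show ?thesis by (rule half_absorb[OF g3 g4])
    qed
    then show ?thesis by (simp add: energy_bound_def x1_def mult.assoc)
  qed (use \<open>energy_bound B h L \<ge> 0\<close> in simp)
  then have "lpint ?N gv \<le> ennreal (energy_bound B h L)" unfolding G(2) by (rule ennreal_leI)
  then show ?thesis using that[OF Hv vU _ smallv] by blast
qed

text \<open>Where the cutoff is 1, \<open>u x > h'\<close> forces \<open>v x > h' - h\<close>, and
  Trudinger's inequality applies to \<open>v\<close> with the new energy bound. The input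
  \<open>exp (-L)\<close> only makes the energy small; the output exponent \<open>m\<close> comes
  from slicing the gap \<open>h' - h\<close>.\<close>

lemma level_iteration_step:
  assumes r: "0 < \<rho>'" "\<rho>' < \<rho>" "\<rho> < 3 / 2 * R" and h: "0 \<le> h" "h < h'" and L: "L \<ge> 1"
    and small: "measure lborel {x \<in> cball z \<rho>. u x > h} \<le> exp (- L)"
    and absorb: "energy2 CARD('n) * weight_const CARD('n) s * \<Gamma> * L powr (- ((s - (real CARD('n) - 1)) / 2)) \<le> 1 / 2"
    and m: "trudinger_const CARD('n) ^ CARD('n) * energy_bound (8 / (\<rho> - \<rho>')) h L * real m ^ (CARD('n) - 1) \<le> (h' - h) ^ CARD('n)"
  shows "measure lborel {x \<in> cball z \<rho>'. u x > h'} \<le> exp (- real m)"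
proof -
  obtain \<eta> \<eta>' where \<eta>: "C1_grad \<eta> \<eta>'" "\<And>x. 0 \<le> \<eta> x" "\<And>x. \<eta> x \<le> 1" "\<And>x. x \<in> cball z \<rho>' \<Longrightarrow> \<eta> x = 1"
    "\<And>x. x \<notin> cball z \<rho> \<Longrightarrow> \<eta> x = 0" "\<And>x. norm (\<eta>' x) \<le> 8 / (\<rho> - \<rho>')"
    using ex_C1_cutoff[OF r(1,2), of z] by blast
  obtain v gv where v: "H0 z \<rho> v gv" "\<And>x. x \<in> cball z (3 / 2 * R) \<Longrightarrow> v x = \<eta> x * max 0 (u x - h)"
    "lpint CARD('n) gv \<le> ennreal (energy_bound (8 / (\<rho> - \<rho>')) h L)" "measure lborel {x. v x > 0} \<le> exp (- L)"
    by (rule energy_estimate[OF r(3) h(1) L small absorb \<eta>(1,2,3) _ \<eta>(6)]) (rule \<eta>(5), assumption, rule that, assumption+)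
  note [measurable] = H0_borel[OF v(1)]
  have E: "energy_bound (8 / (\<rho> - \<rho>')) h L > 0" using r h by (intro energy_bound_pos) auto
  have "{x \<in> cball z \<rho>'. u x > h'} \<subseteq> {x. v x > h' - h}"
  proof
    fix x assume x: "x \<in> {x \<in> cball z \<rho>'. u x > h'}"
    then have "x \<in> cball z (3 / 2 * R)" using r by auto
    then show "x \<in> {x. v x > h' - h}" using x v(2)[of x] \<eta>(4)[of x] h by auto
  qed
  then have "emeasure lborel {x \<in> cball z \<rho>'. u x > h'} \<le> emeasure lborel {x. v x > h' - h}"
    by (intro emeasure_mono) auto
  also have "\<dots> = ennreal (measure lborel {x. v x > h' - h})" using H0_level_finite(3)[OF v(1), of "h' - h"] h by simp
  finally have "measure lborel {x \<in> cball z \<rho>'. u x > h'} \<le> measure lborel {x. v x > h' - h}"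
    unfolding measure_def by (simp add: enn2real_leI measure_def)
  also have "\<dots> \<le> measure lborel {x. v x > 0} * exp (- real m)"
    by (rule exponential_level_decay[OF v(1) E v(3) _ m]) (use h in simp)
  also have "\<dots> \<le> 1 * exp (- real m)"
  proof (intro mult_right_mono)
    have "exp (- L) \<le> 1" using L by simp
    then show "measure lborel {x. v x > 0} \<le> 1" using v(4) by linarith
  qed simp
  finally show ?thesis by simp
qed

text \<open>Caccioppoli's inequality with \<open>A\<close> the whole space and two-sided
  truncations. With \<open>u\<close> already bounded, the cutoff term and the weighted term are
  estimated directly and nothing has to be absorbed.\<close>

lemma gradient_estimate:
  assumes H: "H \<ge> 0" and bound: "AE x in lborel. x \<in> cball z (5 / 4 * R) \<longrightarrow> \<bar>u x\<bar> \<le> H"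
  shows "(\<integral>\<^sup>+x\<in>ball z R. ennreal (norm (ux x) ^ CARD('n)) \<partial>lborel)
    \<le> ennreal (2 * (cacc1 CARD('n) a * ((32 / R) ^ CARD('n) * H ^ CARD('n) * measure lborel (cball z (5 / 4 * R)))
        + cacc2 CARD('n) * ((1 + H) ^ CARD('n) * M1)))"
proof -
  let ?N = "CARD('n)"
  let ?S = "cball z (3 / 2 * R)" and ?T = "cball z (5 / 4 * R)"
  have N0: "?N > 0" using n2 by simp
  have cc: "cacc1 ?N a \<ge> 0" "cacc2 ?N \<ge> 0" using a cacc_nonneg(1)[of a ?N] cacc_nonneg(2)[of ?N] by auto
  obtain U GU where U: "H0 z (15 / 8 * R) U GU" "\<And>x. x \<in> ?S \<Longrightarrow> U x = u x" "\<And>x. x \<in> ?S \<Longrightarrow> GU x = ux x"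
    using ex_cutoff_solution by blast
  note [measurable] = H0_borel[OF U(1)]
  have "R < 5 / 4 * R" using R by simp
  from ex_C1_cutoff[OF R this, of z] obtain \<eta> \<eta>' where \<eta>: "C1_grad \<eta> \<eta>'" "\<And>x. 0 \<le> \<eta> x" "\<And>x. \<eta> x \<le> 1" "\<And>x. x \<in> cball z R \<Longrightarrow> \<eta> x = 1"
    "\<And>x. x \<notin> ?T \<Longrightarrow> \<eta> x = 0" "\<And>x. norm (\<eta>' x) \<le> 8 / (5 / 4 * R - R)"
    by blast
  have B: "8 / (5 / 4 * R - R) = 32 / R" using R by (simp add: field_simps)
  note [measurable] = C1_grad_borel[OF \<eta>(1)]
  have \<eta>'0: "\<eta>' x = 0" if "x \<notin> ?T" for x by (rule gradient_zero_outside[OF \<eta>(1) closed_cball \<eta>(5) that])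
  \<comment> \<open>A two-sided C1 truncation whose derivative lies between 0 and 1 for
    \<open>M \<ge> 0\<close> and is 1 on \<open>[-M, M]\<close>; both facts are demanded of
    \<open>\<chi>1\<close>.\<close>
  define T where "T M t = t - soft_pos 1 (t - M) + soft_pos 1 (- t - M)" for M t :: real
  define \<tau> where "\<tau> M t = 1 - soft_step 1 (t - M) - soft_step 1 (- t - M)" for M t :: real
  have dT: "(T M has_real_derivative \<tau> M t) (at t)" for t M
  proof -
    have 1: "((\<lambda>t. soft_pos 1 (t - M)) has_real_derivative soft_step 1 (t - M)) (at t)"
      using DERIV_shift[of "soft_pos 1" "soft_step 1 (t - M)" t "- M"] soft_pos_deriv[of 1 "t - M"] by simp
    have "((\<lambda>s. soft_pos 1 (s - M)) has_real_derivative soft_step 1 (- t - M)) (at (- t))"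
      using DERIV_shift[of "soft_pos 1" "soft_step 1 (- t - M)" "- t" "- M"] soft_pos_deriv[of 1 "- t - M"] by simp
    then have 2: "((\<lambda>t. soft_pos 1 (- t - M)) has_real_derivative - soft_step 1 (- t - M)) (at t)"
      by (subst (asm) DERIV_mirror) simp
    show ?thesis unfolding T_def[abs_def] \<tau>_def
      using DERIV_add[OF DERIV_diff[OF DERIV_ident 1] 2] by simp
  qed
  have c\<tau>: "continuous_on UNIV (\<tau> M)" for M unfolding \<tau>_def[abs_def]
    by (intro continuous_intros continuous_on_compose2[OF soft_step(5)[of 1]]) auto
  have b\<tau>: "0 \<le> \<tau> M t \<and> \<tau> M t \<le> 1" if "M \<ge> 0" for t M
    using soft_step(1,2,3)[of 1 "t - M"] soft_step(1,2,3)[of 1 "- t - M"] that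
    by (cases "t \<ge> 0") (auto simp: \<tau>_def)
  have T0: "T M 0 = 0" if "M \<ge> 0" for M using that by (simp add: T_def)
  have Tle: "\<bar>T M t\<bar> \<le> \<bar>t\<bar>" if "M \<ge> 0" for M t
    using real_derivative_bounded_lipschitz[OF dT, of M 1 t 0] b\<tau>[OF that] T0[OF that] by (auto simp: abs_le_iff)
  have bT: "\<bar>T M t\<bar> \<le> M + 2" if "M \<ge> 0" for M t
  proof -
    have a: "\<bar>soft_pos 1 (t - M) - max 0 (t - M)\<bar> \<le> 1" "\<bar>soft_pos 1 (- t - M) - max 0 (- t - M)\<bar> \<le> 1"
      using soft_pos(3)[of 1] by auto
    have b: "\<bar>t - max 0 (t - M) + max 0 (- t - M)\<bar> \<le> M" using that by (auto simp: max_def)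
    show ?thesis using a b unfolding T_def by linarith
  qed
  have [measurable]: "\<tau> M \<in> borel_measurable borel" for M using c\<tau> borel_measurable_continuous_onI by blast
  have main: "(\<integral>\<^sup>+x\<in>UNIV. ennreal ((\<eta> x * norm (ux x)) ^ ?N) \<partial>lborel)
    \<le> 2 * (ennreal (cacc1 ?N a) * lpint ?N (\<lambda>x. \<bar>U x\<bar> *\<^sub>R \<eta>' x)
      + ennreal (cacc2 ?N) * (\<integral>\<^sup>+x\<in>UNIV. ennreal ((\<eta> x * (\<sigma> x * (1 + \<bar>u x\<bar>))) ^ ?N) \<partial>lborel))"
  proof (rule caccioppoli[where \<rho>="5 / 4 * R" and GU=GU and t="\<lambda>M x. T (real M) (U x)" and ?\<chi>1.0="\<lambda>M x. \<tau> (real M) (U x)"])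
    show "H0 z (15 / 8 * R) (\<lambda>x. T (real M) (U x)) (\<lambda>x. \<tau> (real M) (U x) *\<^sub>R GU x)" for M
      by (rule H0_compose[OF U(1) dT c\<tau>, where B=1]) (use b\<tau>[of "real M"] T0[of "real M"] in \<open>auto simp: abs_le_iff intro: order_trans\<close>)
    show "\<exists>B. \<forall>x. \<bar>T (real M) (U x)\<bar> \<le> B" for M using bT[of "real M"] by auto
    show "(\<lambda>M. \<tau> (real M) (U x)) \<longlonglongrightarrow> indicator UNIV x" for x
    proof -
      obtain M0 :: nat where "\<bar>U x\<bar> \<le> real M0" using real_arch_simple by blast
      then have "\<tau> (real M) (U x) = 1" if "M \<ge> M0" for M
        using that soft_step(3)[of 1 "U x - real M"] soft_step(3)[of 1 "- U x - real M"] by (auto simp: \<tau>_def)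
      then show ?thesis by (intro tendsto_eventually eventually_sequentiallyI[of M0]) auto
    qed
  qed (use \<eta> R U Tle b\<tau> in auto)
  have "(\<integral>\<^sup>+x\<in>ball z R. ennreal (norm (ux x) ^ ?N) \<partial>lborel) \<le> (\<integral>\<^sup>+x\<in>UNIV. ennreal ((\<eta> x * norm (ux x)) ^ ?N) \<partial>lborel)"
    by (intro nn_integral_mono) (use \<eta>(4) in \<open>auto simp: indicator_def\<close>)
  also note main
  also have "lpint ?N (\<lambda>x. \<bar>U x\<bar> *\<^sub>R \<eta>' x) \<le> ennreal ((32 / R) ^ ?N * H ^ ?N * measure lborel ?T)"
  proof -
    have "lpint ?N (\<lambda>x. \<bar>U x\<bar> *\<^sub>R \<eta>' x) \<le> (\<integral>\<^sup>+x. ennreal ((32 / R) ^ ?N * H ^ ?N) * indicator ?T x \<partial>lborel)"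
      unfolding lpint_def
    proof (intro nn_integral_mono_AE)
      show "AE x in lborel. ennreal (norm (\<bar>U x\<bar> *\<^sub>R \<eta>' x) ^ ?N) \<le> ennreal ((32 / R) ^ ?N * H ^ ?N) * indicator ?T x"
        using bound
      proof eventually_elim
        case (elim x)
        show ?case
        proof (cases "x \<in> ?T")
          case True
          then have "\<bar>U x\<bar> \<le> H" using elim U(2)[of x] R by auto
          then have "\<bar>U x\<bar> * norm (\<eta>' x) \<le> H * (32 / R)"
            using \<eta>(6)[of x] H unfolding B by (intro mult_mono) auto
          then have "norm (\<bar>U x\<bar> *\<^sub>R \<eta>' x) ^ ?N \<le> (H * (32 / R)) ^ ?N"
            by (intro power_mono) auto
          also have "\<dots> = (32 / R) ^ ?N * H ^ ?N" by (simp only: power_mult_distrib mult.commute)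
          finally show ?thesis using True by (simp add: ennreal_leI del: norm_scaleR)
        qed (use \<eta>'0 N0 in \<open>auto simp: power_0_left\<close>)
      qed
    qed
    also have "\<dots> = ennreal ((32 / R) ^ ?N * H ^ ?N) * emeasure lborel ?T" by (simp add: nn_integral_cmult_indicator)
    also have "emeasure lborel ?T = ennreal (measure lborel ?T)"
      using emeasure_lborel_cball_finite[of z "5/4*R"] by (intro emeasure_eq_ennreal_measure) auto
    also have "ennreal ((32 / R) ^ ?N * H ^ ?N) * ennreal (measure lborel ?T) = ennreal ((32 / R) ^ ?N * H ^ ?N * measure lborel ?T)"
      using R H by (intro ennreal_mult[symmetric]) auto
    finally show ?thesis .
  qed
  also have "(\<integral>\<^sup>+x\<in>UNIV. ennreal ((\<eta> x * (\<sigma> x * (1 + \<bar>u x\<bar>))) ^ ?N) \<partial>lborel) \<le> ennreal ((1 + H) ^ ?N * M1)"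
  proof -
    have "(\<integral>\<^sup>+x\<in>UNIV. ennreal ((\<eta> x * (\<sigma> x * (1 + \<bar>u x\<bar>))) ^ ?N) \<partial>lborel) \<le> (\<integral>\<^sup>+x. ennreal ((1 + H) ^ ?N) * ennreal (norm (\<sigma> x) ^ ?N) \<partial>lborel)"
    proof (intro nn_integral_mono_AE)
      show "AE x in lborel. ennreal ((\<eta> x * (\<sigma> x * (1 + \<bar>u x\<bar>))) ^ ?N) * indicator UNIV x \<le> ennreal ((1 + H) ^ ?N) * ennreal (norm (\<sigma> x) ^ ?N)"
        using bound
      proof eventually_elim
        case (elim x)
        show ?case
        proof (cases "x \<in> ?T")
          case True
          have "\<eta> x * (\<sigma> x * (1 + \<bar>u x\<bar>)) \<le> 1 * (\<sigma> x * (1 + H))"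
            using elim True \<eta>(2,3)[of x] \<sigma>[of x] by (intro mult_mono) auto
          then have "(\<eta> x * (\<sigma> x * (1 + \<bar>u x\<bar>))) ^ ?N \<le> (1 * (\<sigma> x * (1 + H))) ^ ?N"
            using \<eta>(2)[of x] \<sigma>[of x] by (intro power_mono) auto
          then show ?thesis using \<sigma>[of x] H by (simp add: power_mult_distrib mult.commute ennreal_leI ennreal_mult[symmetric])
        qed (use \<eta>(5) N0 in \<open>auto simp: power_0_left\<close>)
      qed
    qed
    also have "\<dots> = ennreal ((1 + H) ^ ?N) * lpint ?N \<sigma>" by (simp add: nn_integral_cmult lpint_def)
    also have "\<dots> \<le> ennreal ((1 + H) ^ ?N) * ennreal M1" by (intro mult_left_mono \<sigma>_int) auto
    also have "\<dots> = ennreal ((1 + H) ^ ?N * M1)" using H M1 by (simp add: ennreal_mult)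
    finally show ?thesis .
  qed
  also have "2 * (ennreal (cacc1 ?N a) * ennreal ((32 / R) ^ ?N * H ^ ?N * measure lborel ?T) + ennreal (cacc2 ?N) * ennreal ((1 + H) ^ ?N * M1))
     = ennreal (2 * (cacc1 ?N a * ((32 / R) ^ ?N * H ^ ?N * measure lborel ?T) + cacc2 ?N * ((1 + H) ^ ?N * M1)))"
    using cc R H M1 by (simp add: ennreal_mult)
  finally show ?thesis by (simp add: mult_left_mono add_mono)
qed

end

subsection \<open>The level iteration\<close>

context local_solution
begin

text \<open>For \<open>H \<ge> 1\<close> the energy bound and the n-th power of the level gap both
  scale like \<open>H ^ n\<close>, so \<open>H\<close> cancels from the induction step:
  \<open>E\<close> and \<open>\<kappa>'\<close> are free of it. It is constrained by
  \<open>start\<close> alone and can be chosen after \<open>L0\<close>.\<close>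

lemma sup_bound:
  fixes L0 \<kappa> :: nat and H cs :: real
  assumes H: "H \<ge> 1" and L0: "L0 \<ge> 1" and \<kappa>: "\<kappa> \<ge> 2"
    and cs: "cs \<ge> 0" "\<And>L. L \<ge> 1 \<Longrightarrow> exp (- L / 2) \<le> cs * L powr (- s)"
    and absorb: "energy2 CARD('n) * weight_const CARD('n) s * \<Gamma> * real L0 powr (- ((s - (real CARD('n) - 1)) / 2)) \<le> 1 / 2"
    and E: "trudinger_const CARD('n) ^ CARD('n) * (2 * (energy1 CARD('n) a * (128 / R) ^ CARD('n) * (M0 + 1) * cs + energy2 CARD('n) * 3 ^ CARD('n) * \<Gamma>))
      * 2 ^ CARD('n) * real \<kappa> ^ (CARD('n) - 1) \<le> real L0 powr (s - (real CARD('n) - 1))"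
    and \<kappa>': "4 ^ CARD('n) \<le> real \<kappa> powr (s - (real CARD('n) - 1))"
    and start: "M0 * exp (real L0) \<le> H ^ (2 * CARD('n))"
  shows "AE x in lborel. x \<in> cball z (5 / 4 * R) \<longrightarrow> u x \<le> 2 * H"
proof -
  let ?N = "CARD('n)"
  have N0: "?N > 0" using n2 by simp
  define \<theta> where "\<theta> = (s - (real ?N - 1)) / 2"
  define \<delta> where "\<delta> = s - (real ?N - 1)"
  have \<theta>: "\<theta> > 0" "\<delta> > 0" using s by (auto simp: \<theta>_def \<delta>_def)
  \<comment> \<open>Radii decrease from \<open>11/8 R\<close> to \<open>5/4 R\<close> and levels
    increase from \<open>H\<close> to \<open>2 H\<close>, with gaps halved at each step.
    \<open>L\<close> is a natural number because it also serves as the number of slices.\<close>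
  define \<rho> where "\<rho> j = R * (5 / 4 + (1 / 2) ^ j / 8)" for j :: nat
  define h where "h j = H * (2 - (1 / 2) ^ j)" for j :: nat
  define L where "L j = L0 * \<kappa> ^ j" for j :: nat
  have L1: "real (L j) \<ge> real L0" "real (L j) \<ge> 1" for j
  proof -
    have "1 \<le> \<kappa> ^ j" using \<kappa> by simp
    then have "L0 * 1 \<le> L0 * \<kappa> ^ j" by (intro mult_left_mono) auto
    then have "L0 \<le> L j" by (simp add: L_def)
    then show "real (L j) \<ge> real L0" by (rule of_nat_mono)
    then show "real (L j) \<ge> 1" using L0 by linarith
  qed
  define c1 where "c1 = energy1 ?N a * (128 / R) ^ ?N * (M0 + 1) * cs"
  define c2 where "c2 = energy2 ?N * 3 ^ ?N * \<Gamma>"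
  have c: "c1 \<ge> 0" "c2 \<ge> 0" using energy_pos(1)[of a ?N] energy_pos(2)[of ?N] a R M0 cs \<Gamma> by (auto simp: c1_def c2_def)
  define tc where "tc = trudinger_const ?N ^ ?N"
  have tc: "tc > 0" using trudinger_const_pos[of ?N] by (simp add: tc_def)
  have claim: "measure lborel {x \<in> cball z (\<rho> j). u x > h j} \<le> exp (- real (L j))" for j
  proof (induction j)
    case 0
    \<comment> \<open>Chebyshev's inequality for the \<open>2 n\<close>-th power of \<open>u\<close>
      at the level \<open>h 0 = H\<close> starts the induction.\<close>
    have "ennreal (H ^ (2 * ?N)) * emeasure lborel {x \<in> cball z (\<rho> 0). u x > h 0}
      = (\<integral>\<^sup>+x. ennreal (H ^ (2 * ?N)) * indicator {x \<in> cball z (\<rho> 0). u x > h 0} x \<partial>lborel)"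
      by (subst nn_integral_cmult_indicator) auto
    also have "\<dots> \<le> lpint (2 * ?N) u"
      unfolding lpint_def
    proof (intro nn_integral_mono)
      fix x
      show "ennreal (H ^ (2 * ?N)) * indicator {x \<in> cball z (\<rho> 0). u x > h 0} x \<le> ennreal (norm (u x) ^ (2 * ?N))"
      proof (cases "u x > H")
        case True
        then have "H ^ (2 * ?N) \<le> norm (u x) ^ (2 * ?N)" using H by (intro power_mono) auto
        then show ?thesis by (auto simp: indicator_def intro!: ennreal_leI)
      qed (simp add: h_def)
    qed
    also have "\<dots> \<le> ennreal M0" by (rule u_int)
    finally have 1: "ennreal (H ^ (2 * ?N)) * emeasure lborel {x \<in> cball z (\<rho> 0). u x > h 0} \<le> ennreal M0" .
    have "emeasure lborel {x \<in> cball z (\<rho> 0). u x > h 0} \<le> emeasure lborel (cball z (\<rho> 0))" by (intro emeasure_mono) auto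
    then have "emeasure lborel {x \<in> cball z (\<rho> 0). u x > h 0} = ennreal (measure lborel {x \<in> cball z (\<rho> 0). u x > h 0})"
      using emeasure_lborel_cball_finite[of z "\<rho> 0"] by (intro emeasure_eq_ennreal_measure) (auto simp: top_unique)
    then have "ennreal (H ^ (2 * ?N) * measure lborel {x \<in> cball z (\<rho> 0). u x > h 0}) \<le> ennreal M0"
      using 1 H by (simp add: ennreal_mult)
    then have "H ^ (2 * ?N) * measure lborel {x \<in> cball z (\<rho> 0). u x > h 0} \<le> M0" using M0 by (simp add: ennreal_le_iff)
    also have "M0 = M0 * exp (real L0) * exp (- real L0)" by (simp add: mult.assoc exp_add[symmetric])
    also have "\<dots> \<le> H ^ (2 * ?N) * exp (- real L0)" using start by (intro mult_right_mono) auto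
    finally have "measure lborel {x \<in> cball z (\<rho> 0). u x > h 0} \<le> exp (- real L0)" using H by simp
    then show ?case by (simp add: L_def)
  next
    case (Suc j)
    define e where "e = (1 / 2 :: real) ^ j"
    have e: "e > 0" "e \<le> 1" by (auto simp: e_def power_le_one)
    have eS: "(1 / 2 :: real) ^ Suc j = e / 2" by (simp add: e_def)
    have r1: "0 < \<rho> (Suc j)" unfolding \<rho>_def eS using R e by (intro mult_pos_pos) auto
    have diff: "\<rho> j - \<rho> (Suc j) = R * e / 16" unfolding \<rho>_def eS e_def[symmetric] by (simp add: algebra_simps)
    have r2: "\<rho> (Suc j) < \<rho> j" using diff R e by (smt (verit) divide_pos_pos mult_pos_pos)
    have r3: "\<rho> j < 3 / 2 * R"
    proof -
      have "R * (5 / 4 + e / 8) < R * (3 / 2)" using R e by (intro mult_strict_left_mono) auto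
      then show ?thesis by (simp add: \<rho>_def e_def mult.commute)
    qed
    have h1: "0 \<le> h j" "h j \<le> 2 * H" "h j \<ge> 0"
      using H e unfolding h_def e_def[symmetric] by (auto simp: algebra_simps intro!: mult_nonneg_nonneg)
    have hd: "h (Suc j) - h j = H * e / 2" unfolding h_def eS e_def[symmetric] by (simp add: algebra_simps)
    have h2: "h j < h (Suc j)" using hd H e by (smt (verit) divide_pos_pos mult_pos_pos)
    have ab: "energy2 ?N * weight_const ?N s * \<Gamma> * real (L j) powr (- ((s - (real ?N - 1)) / 2)) \<le> 1 / 2"
    proof -
      have "weight_const ?N s \<ge> 0"
        using s trudinger_const_pos[of ?N] unfolding weight_const_def
        by (intro mult_nonneg_nonneg add_nonneg_nonneg divide_nonneg_nonneg) (auto simp: powr_le_one_le powr_le1 intro!: less_imp_le[OF powr_less_one])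
      moreover have "real (L j) powr (- \<theta>) \<le> real L0 powr (- \<theta>)"
        using L1[of j] L0 \<theta> by (intro powr_mono2') auto
      ultimately have "energy2 ?N * weight_const ?N s * \<Gamma> * real (L j) powr (- \<theta>) \<le> energy2 ?N * weight_const ?N s * \<Gamma> * real L0 powr (- \<theta>)"
        using energy_pos(2)[of ?N] \<Gamma> by (intro mult_left_mono mult_nonneg_nonneg) auto
      then show ?thesis using absorb by (simp add: \<theta>_def)
    qed
    have B: "8 / (\<rho> j - \<rho> (Suc j)) = 128 / R * (1 / e)" unfolding diff using R e by (simp add: field_simps)
    have Hn: "H ^ ?N \<ge> 1" using H by simp
    have en: "(1 / e) ^ ?N \<ge> 1" using e by (simp add: one_le_power)
    have lp: "real (L j) powr (- s) \<ge> 0" by simp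
    have EB: "energy_bound (8 / (\<rho> j - \<rho> (Suc j))) (h j) (real (L j)) \<le> 2 * (c1 + c2) * ((1 / e) ^ ?N * H ^ ?N * real (L j) powr (- s))"
    proof -
      have "energy1 ?N a * (8 / (\<rho> j - \<rho> (Suc j))) ^ ?N * (M0 + 1) * exp (- real (L j) / 2)
        \<le> energy1 ?N a * (8 / (\<rho> j - \<rho> (Suc j))) ^ ?N * (M0 + 1) * (cs * real (L j) powr (- s))"
        using cs(2)[OF L1(2)[of j]] energy_pos(1)[of a ?N] a M0 R e unfolding B by (intro mult_left_mono) auto
      also have "\<dots> = c1 * ((1 / e) ^ ?N * 1 * real (L j) powr (- s))" unfolding B c1_def power_mult_distrib by (simp only: mult_ac)
      also have "\<dots> \<le> c1 * ((1 / e) ^ ?N * H ^ ?N * real (L j) powr (- s))"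
        using c Hn e by (intro mult_left_mono mult_right_mono) auto
      finally have 1: "energy1 ?N a * (8 / (\<rho> j - \<rho> (Suc j))) ^ ?N * (M0 + 1) * exp (- real (L j) / 2) \<le> c1 * ((1 / e) ^ ?N * H ^ ?N * real (L j) powr (- s))" .
      have "(1 + h j) ^ ?N \<le> (3 * H) ^ ?N" using h1 H by (intro power_mono) auto
      then have "energy2 ?N * (1 + h j) ^ ?N * \<Gamma> * real (L j) powr (- s) \<le> energy2 ?N * (3 * H) ^ ?N * \<Gamma> * real (L j) powr (- s)"
        using energy_pos(2)[of ?N] \<Gamma> by (intro mult_right_mono mult_left_mono) auto
      also have "\<dots> = c2 * (1 * H ^ ?N * real (L j) powr (- s))" unfolding c2_def power_mult_distrib by (simp only: mult_ac mult_1_left)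
      also have "\<dots> \<le> c2 * ((1 / e) ^ ?N * H ^ ?N * real (L j) powr (- s))"
        using c Hn en by (intro mult_left_mono mult_right_mono) auto
      finally have 2: "energy2 ?N * (1 + h j) ^ ?N * \<Gamma> * real (L j) powr (- s) \<le> c2 * ((1 / e) ^ ?N * H ^ ?N * real (L j) powr (- s))" .
      show ?thesis unfolding energy_bound_def using add_mono[OF 1 2] by (simp add: algebra_simps)
    qed
    have m: "tc * energy_bound (8 / (\<rho> j - \<rho> (Suc j))) (h j) (real (L j)) * real (L (Suc j)) ^ (?N - 1) \<le> (h (Suc j) - h j) ^ ?N"
    proof -
      have Lp: "real (L j) > 0" using L1(2)[of j] by linarith
      have LS: "real (L (Suc j)) = real \<kappa> * real (L j)" by (simp add: L_def)
      \<comment> \<open>The cutoff gradient and the level gap each lose \<open>2 ^ (j n)\<close>.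
        Their product \<open>4 ^ (n j)\<close> is compensated by the power \<open>\<delta>\<close>
        of the factor \<open>\<kappa> ^ j\<close> in \<open>L j\<close>.\<close>
      have e4: "(1 / e) ^ ?N * (1 / e) ^ ?N = (4 ^ ?N) ^ j"
      proof -
        have "1 / e = 2 ^ j" by (simp add: e_def power_one_over)
        then have "(1 / e) ^ ?N * (1 / e) ^ ?N = ((2 * 2) ^ j) ^ ?N" by (simp only: power_mult_distrib[symmetric])
        also have "\<dots> = (4 ^ ?N) ^ j" by (simp add: power_mult[symmetric] mult.commute)
        finally show ?thesis .
      qed
      have "tc * (2 * (c1 + c2)) * 2 ^ ?N * real \<kappa> ^ (?N - 1) * (4 ^ ?N) ^ j \<le> real L0 powr \<delta> * (real \<kappa> powr \<delta>) ^ j"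
        using E \<kappa>' by (intro mult_mono power_mono) (auto simp: tc_def c1_def c2_def \<delta>_def)
      also have "\<dots> = real (L j) powr \<delta>"
        using \<kappa> by (simp add: L_def powr_mult powr_powr powr_realpow[symmetric] mult.commute)
      finally have k1: "tc * (2 * (c1 + c2)) * 2 ^ ?N * real \<kappa> ^ (?N - 1) * ((1 / e) ^ ?N * (1 / e) ^ ?N) \<le> real (L j) powr \<delta>" unfolding e4 .
      \<comment> \<open>Exact balance of exponents: \<open>\<delta>\<close> from the choice of
        \<open>L0\<close> and \<open>\<kappa>\<close>, \<open>- s\<close> from the energy and
        \<open>n - 1\<close> from the number of slices.\<close>
      have Lpow: "real (L j) powr \<delta> * real (L j) powr (- s) * real (L j) ^ (?N - 1) = 1"
      proof -
        have "real (L j) ^ (?N - 1) = real (L j) powr (real ?N - 1)" using Lp N0 by (subst powr_realpow[symmetric]) (auto simp: of_nat_diff)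
        then show ?thesis using Lp by (simp add: powr_add[symmetric] \<delta>_def)
      qed
      have "tc * energy_bound (8 / (\<rho> j - \<rho> (Suc j))) (h j) (real (L j)) * real (L (Suc j)) ^ (?N - 1)
        \<le> tc * (2 * (c1 + c2) * ((1 / e) ^ ?N * H ^ ?N * real (L j) powr (- s))) * real (L (Suc j)) ^ (?N - 1)"
        using tc EB by (intro mult_right_mono mult_left_mono) auto
      also have "\<dots> = (H * e / 2) ^ ?N * ((tc * (2 * (c1 + c2)) * 2 ^ ?N * real \<kappa> ^ (?N - 1) * ((1 / e) ^ ?N * (1 / e) ^ ?N)) * real (L j) powr (- s) * real (L j) ^ (?N - 1))"
        using e(1) unfolding LS power_mult_distrib power_divide by (simp add: field_simps)
      also have "\<dots> \<le> (H * e / 2) ^ ?N * (real (L j) powr \<delta> * real (L j) powr (- s) * real (L j) ^ (?N - 1))"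
        using k1 H e by (intro mult_left_mono mult_right_mono) auto
      also have "\<dots> = (h (Suc j) - h j) ^ ?N" by (simp only: Lpow hd mult_1_right)
      finally show ?thesis .
    qed
    show ?case
      by (rule level_iteration_step[OF r1 r2 r3 h1(1) h2 L1(2) Suc.IH ab m[unfolded tc_def]])
  qed
  define B where "B = {x \<in> cball z (5 / 4 * R). u x > 2 * H}"
  have Bb[measurable]: "B \<in> sets borel" unfolding B_def by measurable
  have "measure lborel B \<le> exp (- real j)" for j
  proof -
    have sub: "B \<subseteq> {x \<in> cball z (\<rho> j). u x > h j}"
    proof
      fix x assume "x \<in> B"
      moreover have "5 / 4 * R \<le> \<rho> j" using R by (simp add: \<rho>_def algebra_simps)
      moreover have "h j \<le> 2 * H" using H by (simp add: h_def)
      ultimately show "x \<in> {x \<in> cball z (\<rho> j). u x > h j}" by (auto simp: B_def)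
    qed
    have "emeasure lborel {x \<in> cball z (\<rho> j). u x > h j} \<le> emeasure lborel (cball z (\<rho> j))" by (intro emeasure_mono) auto
    then have "{x \<in> cball z (\<rho> j). u x > h j} \<in> fmeasurable lborel"
      using emeasure_lborel_cball_finite[of z "\<rho> j"] by (intro fmeasurableI) (auto intro: le_less_trans)
    then have "measure lborel B \<le> measure lborel {x \<in> cball z (\<rho> j). u x > h j}"
      using sub Bb by (intro measure_mono_fmeasurable) auto
    also have "\<dots> \<le> exp (- real (L j))" by (rule claim)
    also have "\<dots> \<le> exp (- real j)"
    proof -
      have "j \<le> 2 ^ j" by (rule less_imp_le[OF less_exp])
      also have "(2::nat) ^ j \<le> \<kappa> ^ j" using \<kappa> by (intro power_mono) auto
      also have "\<dots> \<le> L j" using L0 by (simp add: L_def)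
      finally show ?thesis by simp
    qed
    finally show ?thesis .
  qed
  moreover have "(\<lambda>j. exp (- real j)) \<longlonglongrightarrow> 0"
    by (rule filterlim_compose[OF exp_at_bot]) (simp add: filterlim_uminus_at_bot filterlim_real_sequentially)
  ultimately have "measure lborel B \<le> 0" by (intro LIMSEQ_le_const) auto
  then have "measure lborel B = 0" by (simp add: antisym)
  moreover have "emeasure lborel B \<le> emeasure lborel (cball z (5 / 4 * R))" by (intro emeasure_mono) (auto simp: B_def)
  then have "emeasure lborel B = ennreal (measure lborel B)"
    using emeasure_lborel_cball_finite[of z "5 / 4 * R"] by (intro emeasure_eq_ennreal_measure) (auto simp: top_unique)
  ultimately have "B \<in> null_sets lborel" using Bb by (intro null_setsI) auto
  then have "AE x in lborel. x \<notin> B" by (rule AE_not_in)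
  then show ?thesis by eventually_elim (auto simp: B_def)
qed

text \<open>The structure inequalities involve only absolute values and products of two
  sign-changing factors, so the bound from above also gives the one from below.\<close>

lemma local_solution_uminus: "local_solution z R a s \<Gamma> M0 M1 (\<lambda>x. - u x) (\<lambda>x. - ux x) (\<lambda>x. - F x) (\<lambda>x. - Gs x) \<sigma>"
proof
  show "(\<integral>x. - u x * partial_deriv i \<phi> x \<partial>lborel) = - (\<integral>x. (- ux x) $ i * \<phi> x \<partial>lborel)"
    if "test_function (ball z (2 * R)) \<phi>" for \<phi> i
    using weak_grad[OF that, of i] by simp
  show "(\<integral>x. gradient \<phi> x \<bullet> - F x + \<phi> x * - Gs x \<partial>lborel) = 0" if "test_function (ball z (2 * R)) \<phi>" for \<phi>
  proof -
    have "(\<lambda>x. gradient \<phi> x \<bullet> - F x + \<phi> x * - Gs x) = (\<lambda>x. - (gradient \<phi> x \<bullet> F x + \<phi> x * Gs x))" by auto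
    then show ?thesis using weak_eq[OF that] by (simp only: Bochner_Integration.integral_minus minus_zero)
  qed
  show "lpint (2 * CARD('n)) (\<lambda>x. - u x) \<le> ennreal M0" using u_int by (simp add: lpint_minus)
  show "lpint CARD('n) (\<lambda>x. - ux x) < \<infinity>" using ux_int by (simp add: lpint_minus)
qed (use n2 R a s \<Gamma> M0 M1 \<sigma> F_le G_le coercive outside decay \<sigma>_int in auto)

end

section \<open>Choice of the parameters of the iteration\<close>

lemma exp_minus_half_le_powr:
  fixes s :: real
  assumes "s > 0"
  shows "\<exists>cs\<ge>0. \<forall>L\<ge>1. exp (- L / 2) \<le> cs * L powr (- s)"
proof -
  \<comment> \<open>With an integer \<open>k \<ge> s\<close>, the inequality
    \<open>t \<le> exp t\<close> at \<open>t = L / (2 k)\<close>, raised to the power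
    \<open>k\<close>, compares \<open>L ^ k\<close> with \<open>exp (L / 2)\<close>.\<close>
  define k where "k = nat \<lceil>s\<rceil>"
  have k: "k > 0" "s \<le> real k" using assms by (auto simp: k_def)
  have "exp (- L / 2) \<le> (2 * real k) ^ k * L powr (- s)" if L: "L \<ge> 1" for L
  proof -
    have "(L / (2 * k)) ^ k \<le> exp (L / (2 * k)) ^ k"
      using L k exp_ge_add_one_self[of "L / (2 * k)"] by (intro power_mono) (auto simp del: exp_ge_add_one_self intro: order_trans[rotated])
    also have "\<dots> = exp (L / 2)" using k by (simp add: exp_of_nat_mult[symmetric])
    finally have "L ^ k \<le> (2 * real k) ^ k * exp (L / 2)" using k by (simp add: power_divide field_simps)
    moreover have "L powr s \<le> L ^ k" using L k powr_mono[of s "real k" L] by (simp add: powr_realpow)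
    ultimately have "L powr s \<le> (2 * real k) ^ k * exp (L / 2)" by linarith
    then show ?thesis using L by (simp add: powr_minus exp_minus field_simps)
  qed
  then show ?thesis by (intro exI[of _ "(2 * real k) ^ k"]) auto
qed

lemma ex_nat_powr_ge:
  assumes "\<delta> > 0" shows "\<exists>n::nat. n \<ge> 2 \<and> real n powr \<delta> \<ge> X"
proof -
  obtain n :: nat where n: "max X 1 powr (1 / \<delta>) \<le> real n" using real_arch_simple by blast
  have "X \<le> max X 1" by simp
  also have "\<dots> = (max X 1 powr (1 / \<delta>)) powr \<delta>" using assms by (simp add: powr_powr)
  also have "\<dots> \<le> real (max n 2) powr \<delta>" using n assms by (intro powr_mono2) auto
  finally show ?thesis by (intro exI[of _ "max n 2"]) auto
qed

text \<open>Order of the choices: \<open>\<kappa>\<close> from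
  \<open>\<delta> = s - (n - 1)\<close>, then \<open>L0\<close> from \<open>\<kappa>\<close> and the
  structural constants, then \<open>H\<close> from \<open>L0\<close>. None depends on the solution
  or on the centre. \<open>K\<close> is made at least 1 so that \<open>K ^ n\<close> dominates the
  gradient bound.\<close>

lemma local_bound_exists:
  assumes n: "CARD('n::finite) \<ge> 2" and R: "R > 0" and a: "a > 0" and s: "s > real CARD('n) - 1" and \<Gamma>: "\<Gamma> \<ge> 0" and M0: "M0 \<ge> 0" and M1: "M1 \<ge> 0"
  shows "\<exists>K>0. \<forall>(z :: real ^ 'n) u ux F Gs \<sigma>. local_solution z R a s \<Gamma> M0 M1 u ux F Gs \<sigma> \<longrightarrow>
    (AE x in lborel. x \<in> ball z R \<longrightarrow> \<bar>u x\<bar> \<le> K) \<and> (\<integral>\<^sup>+x\<in>ball z R. ennreal (norm (ux x) ^ CARD('n)) \<partial>lborel) \<le> ennreal (K ^ CARD('n))"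
proof -
  let ?N = "CARD('n)"
  define \<delta> where "\<delta> = s - (real ?N - 1)"
  have \<delta>: "\<delta> > 0" "\<delta> / 2 > 0" using s by (auto simp: \<delta>_def)
  have s0: "s > 0" using s n by linarith
  obtain cs where cs: "cs \<ge> 0" "\<And>L. L \<ge> 1 \<Longrightarrow> exp (- L / 2) \<le> cs * L powr (- s)" using exp_minus_half_le_powr[OF s0] by blast
  obtain \<kappa> :: nat where \<kappa>: "\<kappa> \<ge> 2" "real \<kappa> powr \<delta> \<ge> 4 ^ ?N" using ex_nat_powr_ge[OF \<delta>(1)] by blast
  define X1 where "X1 = 2 * (energy2 ?N * weight_const ?N s * \<Gamma>)"
  define X2 where "X2 = trudinger_const ?N ^ ?N * (2 * (energy1 ?N a * (128 / R) ^ ?N * (M0 + 1) * cs + energy2 ?N * 3 ^ ?N * \<Gamma>)) * 2 ^ ?N * real \<kappa> ^ (?N - 1)"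
  obtain L0 :: nat where L0: "L0 \<ge> 2" "real L0 powr (\<delta> / 2) \<ge> max X1 X2" using ex_nat_powr_ge[OF \<delta>(2)] by blast
  have L0': "real L0 powr \<delta> \<ge> X2"
  proof -
    have "X2 \<le> real L0 powr (\<delta> / 2)" using L0 by simp
    also have "\<dots> \<le> real L0 powr \<delta>" using L0 \<delta> by (intro powr_mono) auto
    finally show ?thesis .
  qed
  have absorb: "energy2 ?N * weight_const ?N s * \<Gamma> * real L0 powr (- (\<delta> / 2)) \<le> 1 / 2"
  proof -
    have "X1 * real L0 powr (- (\<delta> / 2)) \<le> real L0 powr (\<delta> / 2) * real L0 powr (- (\<delta> / 2))"
      using L0 by (intro mult_right_mono) auto
    also have "\<dots> = 1" using L0 by (simp add: powr_add[symmetric])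
    finally show ?thesis by (simp add: X1_def)
  qed
  define H where "H = 1 + M0 * exp (real L0)"
  have H: "H \<ge> 1" using M0 by (simp add: H_def)
  have start: "M0 * exp (real L0) \<le> H ^ (2 * ?N)"
  proof -
    have "M0 * exp (real L0) \<le> H ^ 1" by (simp add: H_def)
    also have "\<dots> \<le> H ^ (2 * ?N)" using H by (intro power_increasing) auto
    finally show ?thesis .
  qed
  define vol where "vol = unit_ball_vol (real ?N) * (5 / 4 * R) ^ ?N"
  define I where "I = 2 * (cacc1 ?N a * ((32 / R) ^ ?N * (2 * H) ^ ?N * vol) + cacc2 ?N * ((1 + 2 * H) ^ ?N * M1))"
  define K where "K = 2 * H + I + 1"
  have "vol \<ge> 0" using R by (simp add: vol_def)
  then have I: "I \<ge> 0" unfolding I_def using cacc_nonneg(1)[of a ?N] cacc_nonneg(2)[of ?N] a R H M1 by simp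
  have K: "K \<ge> 1" "K > 0" "K \<ge> 2 * H" using I H by (auto simp: K_def)
  have IK: "I \<le> K ^ ?N"
  proof -
    have "I \<le> K ^ 1" using H by (simp add: K_def)
    also have "\<dots> \<le> K ^ ?N" using K by (intro power_increasing) auto
    finally show ?thesis .
  qed
  have "(AE x in lborel. x \<in> ball z R \<longrightarrow> \<bar>u x\<bar> \<le> K) \<and> (\<integral>\<^sup>+x\<in>ball z R. ennreal (norm (ux x) ^ ?N) \<partial>lborel) \<le> ennreal (K ^ ?N)"
    if sol: "local_solution z R a s \<Gamma> M0 M1 u ux F Gs \<sigma>" for z :: "real ^ 'n" and u ux F Gs \<sigma>
  proof -
    interpret local_solution z R a s \<Gamma> M0 M1 u ux F Gs \<sigma> by fact
    interpret m: local_solution z R a s \<Gamma> M0 M1 "\<lambda>x. - u x" "\<lambda>x. - ux x" "\<lambda>x. - F x" "\<lambda>x. - Gs x" \<sigma> by (rule local_solution_uminus)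
    have L01: "1 \<le> L0" using L0 by simp
    have up: "AE x in lborel. x \<in> cball z (5 / 4 * R) \<longrightarrow> u x \<le> 2 * H"
      by (rule sup_bound[OF H L01 \<kappa>(1) cs absorb[unfolded \<delta>_def] L0'[unfolded X2_def \<delta>_def] \<kappa>(2)[unfolded \<delta>_def] start])
    have lo: "AE x in lborel. x \<in> cball z (5 / 4 * R) \<longrightarrow> - u x \<le> 2 * H"
      by (rule m.sup_bound[OF H L01 \<kappa>(1) cs absorb[unfolded \<delta>_def] L0'[unfolded X2_def \<delta>_def] \<kappa>(2)[unfolded \<delta>_def] start])
    have b: "AE x in lborel. x \<in> cball z (5 / 4 * R) \<longrightarrow> \<bar>u x\<bar> \<le> 2 * H"
      using up lo by eventually_elim auto
    have "AE x in lborel. x \<in> ball z R \<longrightarrow> \<bar>u x\<bar> \<le> K"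
      using b by eventually_elim (use K R in auto)
    moreover have "measure lborel (cball z (5 / 4 * R)) = vol" using R by (simp add: vol_def content_cball)
    then have "(\<integral>\<^sup>+x\<in>ball z R. ennreal (norm (ux x) ^ ?N) \<partial>lborel) \<le> ennreal I"
      using gradient_estimate[OF _ b] H by (simp add: I_def)
    then have "(\<integral>\<^sup>+x\<in>ball z R. ennreal (norm (ux x) ^ ?N) \<partial>lborel) \<le> ennreal (K ^ ?N)"
      by (rule order_trans) (rule ennreal_leI[OF IK])
    ultimately show ?thesis by blast
  qed
  then show ?thesis using K by blast
qed

subsection \<open>Orlicz norms\<close>

lemma nn_integral_lebesgue_on_borel:
  fixes D :: "'a::euclidean_space set"
  assumes D: "D \<in> sets borel" and eq: "AE x in lborel. x \<in> D \<longrightarrow> h x = g x"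
  shows "(\<integral>\<^sup>+x. h x \<partial>lebesgue_on D) = (\<integral>\<^sup>+x\<in>D. g x \<partial>lborel)"
proof -
  have "(\<integral>\<^sup>+x. h x \<partial>lebesgue_on D) = (\<integral>\<^sup>+x. h x * indicator D x \<partial>lebesgue)"
    using D by (subst nn_integral_restrict_space) auto
  also have "\<dots> = (\<integral>\<^sup>+x. g x * indicator D x \<partial>lebesgue)"
  proof (rule nn_integral_cong_AE)
    have "AE x in lebesgue. x \<in> D \<longrightarrow> h x = g x" using eq by (rule AE_completion)
    then show "AE x in lebesgue. h x * indicator D x = g x * indicator D x" by eventually_elim (auto simp: indicator_def)
  qed
  finally show ?thesis by (simp add: nn_integral_completion)
qed

lemma integral_lebesgue_on_borel:
  fixes D :: "'a::euclidean_space set" and h g :: "'a \<Rightarrow> real"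
  assumes D: "D \<in> sets borel" and h: "h \<in> borel_measurable (lebesgue_on D)" and g: "g \<in> borel_measurable borel"
    and eq: "AE x in lborel. x \<in> D \<longrightarrow> h x = g x" and g0: "\<And>x. x \<notin> D \<Longrightarrow> g x = 0"
  shows "(\<integral>x. h x \<partial>lebesgue_on D) = (\<integral>x. g x \<partial>lborel)"
proof -
  have "(\<integral>x. h x \<partial>lebesgue_on D) = (\<integral>x. indicator D x *\<^sub>R h x \<partial>lebesgue)"
    using D by (intro integral_restrict_space) auto
  also have "\<dots> = (\<integral>x. g x \<partial>lebesgue)"
  proof (rule integral_cong_AE)
    show "(\<lambda>x. indicator D x *\<^sub>R h x) \<in> borel_measurable lebesgue"
      using h D by (subst (asm) borel_measurable_restrict_space_iff) auto
    show "g \<in> borel_measurable lebesgue" using g by (auto intro: measurable_completion)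
    have "AE x in lebesgue. x \<in> D \<longrightarrow> h x = g x" using eq by (rule AE_completion)
    then show "AE x in lebesgue. indicator D x *\<^sub>R h x = g x" by eventually_elim (use g0 in \<open>auto simp: indicator_def\<close>)
  qed
  also have "\<dots> = (\<integral>x. g x \<partial>lborel)" using g by (intro integral_completion) auto
  finally show ?thesis .
qed

lemma lebesgue_on_ex_borel_real:
  fixes h :: "'a::euclidean_space \<Rightarrow> real"
  assumes D: "D \<in> sets borel" and h: "h \<in> borel_measurable (lebesgue_on D)"
  obtains g where "g \<in> borel_measurable borel" "AE x in lborel. x \<in> D \<longrightarrow> h x = g x"
proof -
  have "(\<lambda>x. indicator D x *\<^sub>R h x) \<in> borel_measurable lebesgue"
    using h D by (subst (asm) borel_measurable_restrict_space_iff) auto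
  from completion_ex_borel_measurable_real[OF this]
  obtain g where g: "g \<in> borel_measurable lborel" "AE x in lborel. indicator D x *\<^sub>R h x = g x" by blast
  from g(2) have "AE x in lborel. x \<in> D \<longrightarrow> h x = g x" by eventually_elim auto
  then show ?thesis using that g(1) by auto
qed

lemma lebesgue_on_ex_borel_vec:
  fixes h :: "'a::euclidean_space \<Rightarrow> real ^ 'n::finite"
  assumes D: "D \<in> sets borel" and h: "h \<in> borel_measurable (lebesgue_on D)"
  obtains g where "g \<in> borel_measurable borel" "AE x in lborel. x \<in> D \<longrightarrow> h x = g x"
proof -
  have "\<exists>g. g \<in> borel_measurable borel \<and> (AE x in lborel. x \<in> D \<longrightarrow> h x $ i = g x)" for i
  proof -
    have "(\<lambda>x. h x \<bullet> axis i 1) \<in> borel_measurable (lebesgue_on D)" using h by measurable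
    then have "(\<lambda>x. h x $ i) \<in> borel_measurable (lebesgue_on D)" by (simp add: inner_axis)
    from lebesgue_on_ex_borel_real[OF D this] show ?thesis by blast
  qed
  then obtain g where g: "\<And>i. g i \<in> borel_measurable borel" "\<And>i. AE x in lborel. x \<in> D \<longrightarrow> h x $ i = g i x" by metis
  have "(\<lambda>x. \<chi> i. g i x) \<in> borel_measurable borel"
    using g(1) by (subst borel_measurable_euclidean_space) (auto simp: Basis_vec_def inner_axis)
  moreover have "AE x in lborel. \<forall>i. x \<in> D \<longrightarrow> h x $ i = g i x" using g(2) by (subst AE_all_countable) auto
  then have "AE x in lborel. x \<in> D \<longrightarrow> h x = (\<chi> i. g i x)" by eventually_elim (auto simp: vec_eq_iff)
  ultimately show ?thesis using that by blast
qed

text \<open>The integrand increases. The right half of \<open>[0, 2 y]\<close> gives the lower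
  bound, the value at the right end of \<open>[0, y]\<close> the upper one; so \<open>N_s\<close> is
  comparable to \<open>y ln (1 + y) powr s\<close> up to doubling the argument.\<close>

lemma young_fun_bounds:
  fixes s :: real
  assumes s: "s > 0" and y: "y \<ge> 0"
  shows "y * ln (1 + y) powr s \<le> integral {0..2 * y} (\<lambda>\<tau>. ln (\<tau> + 1) powr s)"
    "integral {0..y} (\<lambda>\<tau>. ln (\<tau> + 1) powr s) \<le> y * ln (1 + y) powr s"
proof -
  have "continuous_on {0..t} (\<lambda>\<tau>. ln (\<tau> + 1) powr s)" for t
    using s by (intro continuous_on_powr' continuous_intros) auto
  then have i: "(\<lambda>\<tau>. ln (\<tau> + 1) powr s) integrable_on {0..t}" for t by (rule integrable_continuous_real)
  have i': "(\<lambda>\<tau>. ln (\<tau> + 1) powr s) integrable_on {y..2 * y}"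
    by (rule integrable_subinterval_real[OF i[of "2 * y"]]) (use y in auto)
  have "y * ln (1 + y) powr s = integral {y..2 * y} (\<lambda>\<tau>. ln (1 + y) powr s)" using y by simp
  also have "\<dots> \<le> integral {y..2 * y} (\<lambda>\<tau>. ln (\<tau> + 1) powr s)"
    using y s by (intro integral_le i' powr_mono2) auto
  also have "\<dots> \<le> integral {0..2 * y} (\<lambda>\<tau>. ln (\<tau> + 1) powr s)"
    using y by (intro integral_subset_le i i') auto
  finally show "y * ln (1 + y) powr s \<le> integral {0..2 * y} (\<lambda>\<tau>. ln (\<tau> + 1) powr s)" .
  have "integral {0..y} (\<lambda>\<tau>. ln (\<tau> + 1) powr s) \<le> integral {0..y} (\<lambda>\<tau>. ln (1 + y) powr s)"
    using y s by (intro integral_le i powr_mono2) auto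
  also have "\<dots> = y * ln (1 + y) powr s" using y by simp
  finally show "integral {0..y} (\<lambda>\<tau>. ln (\<tau> + 1) powr s) \<le> y * ln (1 + y) powr s" .
qed

text \<open>Division by \<open>l \<ge> 1\<close> does not increase the logarithm, so with
  \<open>I\<close> the given integral the modular at \<open>l = I + 1\<close> is at most
  \<open>I / l < 1\<close>.\<close>

lemma N_norm_finite:
  fixes D :: "(real ^ 'n::finite) set"
  assumes s: "s > 0" "s = (real CARD('n) - 1) / r" and W: "LlogL s D W"
  shows "N_norm r D W < \<infinity>"
proof -
  have i: "integrable (lebesgue_on D) (\<lambda>x. \<bar>W x\<bar> * ln (\<bar>W x\<bar> + 1) powr s)" using W by (simp add: LlogL_def)
  define I where "I = (\<integral>x. \<bar>W x\<bar> * ln (\<bar>W x\<bar> + 1) powr s \<partial>lebesgue_on D)"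
  have I: "I \<ge> 0" unfolding I_def by (intro Bochner_Integration.integral_nonneg) auto
  define l where "l = I + 1"
  have l: "l \<ge> 1" "l > 0" using I by (auto simp: l_def)
  have "(\<integral>\<^sup>+x. ennreal (integral {0..\<bar>W x\<bar> / l} (\<lambda>\<tau>. ln (\<tau> + 1) powr s)) \<partial>lebesgue_on D)
    \<le> (\<integral>\<^sup>+x. ennreal (1 / l * (\<bar>W x\<bar> * ln (\<bar>W x\<bar> + 1) powr s)) \<partial>lebesgue_on D)"
  proof (intro nn_integral_mono ennreal_leI)
    fix x
    have "integral {0..\<bar>W x\<bar> / l} (\<lambda>\<tau>. ln (\<tau> + 1) powr s) \<le> \<bar>W x\<bar> / l * ln (1 + \<bar>W x\<bar> / l) powr s"
      using l s by (intro young_fun_bounds) auto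
    also have "\<dots> \<le> \<bar>W x\<bar> / l * ln (\<bar>W x\<bar> + 1) powr s"
    proof (intro mult_left_mono powr_mono2)
      have "\<bar>W x\<bar> / l \<le> \<bar>W x\<bar>" using l mult_left_mono[of 1 l "\<bar>W x\<bar>"] by (simp add: divide_simps)
      then show "ln (1 + \<bar>W x\<bar> / l) \<le> ln (\<bar>W x\<bar> + 1)" using l by (subst ln_le_cancel_iff) (auto intro: add_pos_nonneg)
    qed (use l s in auto)
    finally show "integral {0..\<bar>W x\<bar> / l} (\<lambda>\<tau>. ln (\<tau> + 1) powr s) \<le> 1 / l * (\<bar>W x\<bar> * ln (\<bar>W x\<bar> + 1) powr s)" by simp
  qed
  also have "\<dots> = ennreal (\<integral>x. 1 / l * (\<bar>W x\<bar> * ln (\<bar>W x\<bar> + 1) powr s) \<partial>lebesgue_on D)"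
    using i l by (intro nn_integral_eq_integral integrable_mult_right) auto
  also have "\<dots> = ennreal (I / l)" by (simp add: I_def)
  also have "\<dots> \<le> 1" using I by (simp add: l_def)
  finally have "N_norm r D W \<le> ennreal l"
    unfolding N_norm_def luxemburg_norm_def s(2)[symmetric] using l by (intro Inf_lower) auto
  then show ?thesis by (rule le_less_trans) simp
qed

text \<open>A strict bound on an infimum yields an admissible \<open>l'\<close> below
  \<open>l\<close>. The factor 2 is the doubled argument in the comparison of \<open>N_s\<close>
  with \<open>y ln (1 + y) powr s\<close>.\<close>

lemma orlicz_modular:
  fixes D :: "(real ^ 'n::finite) set"
  assumes D: "D \<in> sets borel" and s: "s > 0" "s = (real CARD('n) - 1) / r"
    and V[measurable]: "V \<in> borel_measurable borel" "\<And>x. V x \<ge> 0" "AE x in lborel. x \<in> D \<longrightarrow> W x = V x"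
    and l: "N_norm r D W < ennreal l"
  obtains l' where "l' > 0" "l' \<le> l" "(\<integral>\<^sup>+x\<in>D. ennreal (V x / (2 * l') * ln (1 + V x / (2 * l')) powr s) \<partial>lborel) \<le> 1"
proof -
  obtain l' where l': "l' > 0" "ennreal l' < ennreal l"
    "(\<integral>\<^sup>+x. ennreal (integral {0..\<bar>W x\<bar> / l'} (\<lambda>\<tau>. ln (\<tau> + 1) powr s)) \<partial>lebesgue_on D) \<le> 1"
    using l unfolding N_norm_def luxemburg_norm_def s(2)[symmetric] Inf_less_iff by auto
  have "(\<integral>\<^sup>+x\<in>D. ennreal (V x / (2 * l') * ln (1 + V x / (2 * l')) powr s) \<partial>lborel)
    \<le> (\<integral>\<^sup>+x\<in>D. ennreal (integral {0..V x / l'} (\<lambda>\<tau>. ln (\<tau> + 1) powr s)) \<partial>lborel)"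
  proof (intro nn_integral_mono mult_right_mono ennreal_leI)
    fix x
    show "V x / (2 * l') * ln (1 + V x / (2 * l')) powr s \<le> integral {0..V x / l'} (\<lambda>\<tau>. ln (\<tau> + 1) powr s)"
      using young_fun_bounds(1)[OF s(1), of "V x / (2 * l')"] V(2)[of x] l'(1) by simp
  qed simp
  also have "\<dots> = (\<integral>\<^sup>+x. ennreal (integral {0..\<bar>W x\<bar> / l'} (\<lambda>\<tau>. ln (\<tau> + 1) powr s)) \<partial>lebesgue_on D)"
  proof (rule nn_integral_lebesgue_on_borel[OF D, symmetric])
    show "AE x in lborel. x \<in> D \<longrightarrow> ennreal (integral {0..\<bar>W x\<bar> / l'} (\<lambda>\<tau>. ln (\<tau> + 1) powr s)) = ennreal (integral {0..V x / l'} (\<lambda>\<tau>. ln (\<tau> + 1) powr s))"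
      using V(3) by eventually_elim (use V(2) in auto)
  qed
  also note l'(3)
  finally show ?thesis using that[of l'] l' by (auto simp: ennreal_less_iff)
qed

text \<open>Split at \<open>y x = exp (L / 2)\<close>. Below, the integral is at most
  \<open>exp (L / 2)\<close> times the measure, that is \<open>exp (- L / 2)\<close>. Above, the
  logarithm is at least \<open>L / 2\<close>, so \<open>y\<close> is at most
  \<open>(2 / L) powr s\<close> times the integrand of the modular.\<close>

lemma orlicz_small_sets:
  fixes D :: "(real ^ 'n::finite) set"
  assumes D: "D \<in> sets borel" and s: "s > 0" "s = (real CARD('n) - 1) / r"
    and V[measurable]: "V \<in> borel_measurable borel" "\<And>x. V x \<ge> 0" "AE x in lborel. x \<in> D \<longrightarrow> W x = V x"
    and l: "N_norm r D W < ennreal l" and cs: "cs \<ge> 0" "\<And>L. L \<ge> 1 \<Longrightarrow> exp (- L / 2) \<le> cs * L powr (- s)"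
    and E[measurable]: "E \<in> sets borel" "E \<subseteq> D" and L: "L \<ge> 1" "emeasure lborel E \<le> ennreal (exp (- L))"
  shows "(\<integral>\<^sup>+x\<in>E. ennreal (V x) \<partial>lborel) \<le> ennreal (2 * l * ((cs + 2 powr s) * L powr (- s)))"
proof -
  obtain l' where l': "l' > 0" "l' \<le> l" "(\<integral>\<^sup>+x\<in>D. ennreal (V x / (2 * l') * ln (1 + V x / (2 * l')) powr s) \<partial>lborel) \<le> 1"
    using orlicz_modular[OF D s V l] .
  define y where "y x = V x / (2 * l')" for x
  have [measurable]: "y \<in> borel_measurable borel" unfolding y_def by measurable
  have y: "y x \<ge> 0" "V x = 2 * l' * y x" for x using l' V(2)[of x] by (auto simp: y_def)
  have pt: "ennreal (V x) * indicator E x \<le> ennreal (2 * l' * exp (L / 2)) * indicator E x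
      + ennreal (2 * l' * (2 / L) powr s) * (ennreal (y x * ln (1 + y x) powr s) * indicator D x)" for x
  proof (cases "x \<in> E")
    case True
    have "y x \<le> exp (L / 2) + (2 / L) powr s * (y x * ln (1 + y x) powr s)"
    proof (cases "y x \<le> exp (L / 2)")
      case False
      then have "ln (exp (L / 2)) \<le> ln (1 + y x)" by (intro ln_mono) auto
      then have "(L / 2) powr s \<le> ln (1 + y x) powr s" using L s by (intro powr_mono2) auto
      then have "(2 / L) powr s * (y x * (L / 2) powr s) \<le> (2 / L) powr s * (y x * ln (1 + y x) powr s)"
        using y(1)[of x] by (intro mult_left_mono) auto
      moreover have "(2 / L) powr s * (L / 2) powr s = 1" using L by (simp add: powr_mult[symmetric])
      then have "(2 / L) powr s * (y x * (L / 2) powr s) = y x" by (simp add: mult.left_commute)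
      ultimately show ?thesis by (simp add: add_increasing)
    qed (use y(1)[of x] L in \<open>simp add: add_increasing2\<close>)
    then have "V x \<le> 2 * l' * (exp (L / 2) + (2 / L) powr s * (y x * ln (1 + y x) powr s))"
      unfolding y(2) using l' by (intro mult_left_mono) auto
    also have "\<dots> = 2 * l' * exp (L / 2) + 2 * l' * (2 / L) powr s * (y x * ln (1 + y x) powr s)" by (simp add: algebra_simps)
    finally have "ennreal (V x) \<le> ennreal (2 * l' * exp (L / 2) + 2 * l' * (2 / L) powr s * (y x * ln (1 + y x) powr s))"
      by (rule ennreal_leI)
    also have "\<dots> = ennreal (2 * l' * exp (L / 2)) + ennreal (2 * l' * (2 / L) powr s) * ennreal (y x * ln (1 + y x) powr s)"
      using l' y(1)[of x] by (simp add: ennreal_mult[symmetric] ennreal_plus[symmetric] del: ennreal_plus)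
    finally show ?thesis using True E(2) by auto
  qed simp
  have "(\<integral>\<^sup>+x\<in>E. ennreal (V x) \<partial>lborel) \<le> (\<integral>\<^sup>+x. ennreal (2 * l' * exp (L / 2)) * indicator E x
      + ennreal (2 * l' * (2 / L) powr s) * (ennreal (y x * ln (1 + y x) powr s) * indicator D x) \<partial>lborel)"
    by (intro nn_integral_mono pt)
  also have "\<dots> = ennreal (2 * l' * exp (L / 2)) * emeasure lborel E
      + ennreal (2 * l' * (2 / L) powr s) * (\<integral>\<^sup>+x\<in>D. ennreal (y x * ln (1 + y x) powr s) \<partial>lborel)"
    using D by (simp add: nn_integral_add nn_integral_cmult)
  also have "\<dots> \<le> ennreal (2 * l' * exp (L / 2)) * ennreal (exp (- L)) + ennreal (2 * l' * (2 / L) powr s) * 1"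
    using l'(3) L by (intro add_mono mult_left_mono) (auto simp: y_def)
  also have "\<dots> = ennreal (2 * l' * (exp (L / 2) * exp (- L) + (2 / L) powr s))"
    using l' by (simp add: ennreal_mult[symmetric] ennreal_plus[symmetric] algebra_simps del: ennreal_plus)
  also have "exp (L / 2) * exp (- L) = exp (- L / 2)" by (simp add: exp_add[symmetric])
  also have "(2 / L) powr s = 2 powr s * L powr (- s)" using powr_divide[of 2 L s] L by (simp add: powr_minus_divide)
  also have "ennreal (2 * l' * (exp (- L / 2) + 2 powr s * L powr (- s))) \<le> ennreal (2 * l * (cs * L powr (- s) + 2 powr s * L powr (- s)))"
    using l' cs L by (intro ennreal_leI mult_mono add_right_mono) auto
  finally show ?thesis by (simp add: distrib_right)
qed

text \<open>The same splitting at the fixed threshold \<open>exp 1\<close>, above which the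
  logarithm is at least 1.\<close>

lemma orlicz_total:
  fixes D :: "(real ^ 'n::finite) set"
  assumes D: "D \<in> sets borel" and s: "s > 0" "s = (real CARD('n) - 1) / r"
    and V[measurable]: "V \<in> borel_measurable borel" "\<And>x. V x \<ge> 0" "AE x in lborel. x \<in> D \<longrightarrow> W x = V x"
    and l: "N_norm r D W < ennreal l"
    and E[measurable]: "E \<in> sets borel" "E \<subseteq> D" and w: "w \<ge> 0" "emeasure lborel E \<le> ennreal w"
  shows "(\<integral>\<^sup>+x\<in>E. ennreal (V x) \<partial>lborel) \<le> ennreal (2 * l * (exp 1 * w + 1))"
proof -
  obtain l' where l': "l' > 0" "l' \<le> l" "(\<integral>\<^sup>+x\<in>D. ennreal (V x / (2 * l') * ln (1 + V x / (2 * l')) powr s) \<partial>lborel) \<le> 1"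
    using orlicz_modular[OF D s V l] .
  define y where "y x = V x / (2 * l')" for x
  have [measurable]: "y \<in> borel_measurable borel" unfolding y_def by measurable
  have y: "y x \<ge> 0" "V x = 2 * l' * y x" for x using l' V(2)[of x] by (auto simp: y_def)
  have pt: "ennreal (V x) * indicator E x \<le> ennreal (2 * l' * exp 1) * indicator E x
      + ennreal (2 * l') * (ennreal (y x * ln (1 + y x) powr s) * indicator D x)" for x
  proof (cases "x \<in> E")
    case True
    have "y x \<le> exp 1 + y x * ln (1 + y x) powr s"
    proof (cases "y x \<le> exp 1")
      case False
      then have "ln (exp 1) \<le> ln (1 + y x)" by (intro ln_mono) auto
      then have "1 powr s \<le> ln (1 + y x) powr s" using s by (intro powr_mono2) auto
      then have "y x * 1 \<le> y x * ln (1 + y x) powr s" using y(1)[of x] by (intro mult_left_mono) auto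
      then show ?thesis by (simp add: add_increasing)
    qed (use y(1)[of x] in \<open>simp add: add_increasing2\<close>)
    then have "V x \<le> 2 * l' * (exp 1 + y x * ln (1 + y x) powr s)"
      unfolding y(2) using l' by (intro mult_left_mono) auto
    also have "\<dots> = 2 * l' * exp 1 + 2 * l' * (y x * ln (1 + y x) powr s)" by (simp add: algebra_simps)
    finally have "ennreal (V x) \<le> ennreal (2 * l' * exp 1 + 2 * l' * (y x * ln (1 + y x) powr s))"
      by (rule ennreal_leI)
    also have "\<dots> = ennreal (2 * l' * exp 1) + ennreal (2 * l') * ennreal (y x * ln (1 + y x) powr s)"
      using l' y(1)[of x] by (simp add: ennreal_mult[symmetric] ennreal_plus[symmetric] del: ennreal_plus)
    finally show ?thesis using True E(2) by auto
  qed simp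
  have "(\<integral>\<^sup>+x\<in>E. ennreal (V x) \<partial>lborel) \<le> (\<integral>\<^sup>+x. ennreal (2 * l' * exp 1) * indicator E x
      + ennreal (2 * l') * (ennreal (y x * ln (1 + y x) powr s) * indicator D x) \<partial>lborel)"
    by (intro nn_integral_mono pt)
  also have "\<dots> = ennreal (2 * l' * exp 1) * emeasure lborel E
      + ennreal (2 * l') * (\<integral>\<^sup>+x\<in>D. ennreal (y x * ln (1 + y x) powr s) \<partial>lborel)"
    using D by (simp add: nn_integral_add nn_integral_cmult)
  also have "\<dots> \<le> ennreal (2 * l' * exp 1) * ennreal w + ennreal (2 * l') * 1"
    using l'(3) w by (intro add_mono mult_left_mono) (auto simp: y_def)
  also have "\<dots> = ennreal (2 * l' * (exp 1 * w + 1))"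
    using l' w by (simp add: ennreal_mult[symmetric] ennreal_plus[symmetric] algebra_simps del: ennreal_plus)
  also have "\<dots> \<le> ennreal (2 * l * (exp 1 * w + 1))"
    using l' w by (intro ennreal_leI mult_right_mono) auto
  finally show ?thesis .
qed

text \<open>For \<open>t > 1\<close> one has \<open>t \<le> t powr q\<close> with
  \<open>q \<ge> 1\<close>, so \<open>t ^ k \<le> k ^ k exp t\<close> is dominated by the
  exponential in the norm. The bound after division by \<open>lam\<close> does not depend on
  \<open>u\<close>.\<close>

lemma E_norm_power_bound:
  fixes z :: "real ^ 'n::finite" and u v :: "real ^ 'n \<Rightarrow> real"
  assumes q: "1 \<le> real CARD('n) * r / (real CARD('n) - 1)"
    and v[measurable]: "v \<in> borel_measurable borel" "AE x in lborel. x \<in> ball z \<rho> \<longrightarrow> u x = v x"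
    and lam: "E_norm (real CARD('n) * r) (ball z \<rho>) u < ennreal lam"
    and k: "k > 0" and w: "w \<ge> 0" "emeasure lborel (ball z \<rho>) \<le> ennreal w"
  shows "(\<integral>\<^sup>+x\<in>ball z \<rho>. ennreal (\<bar>v x / lam\<bar> ^ k) \<partial>lborel) \<le> ennreal (real k ^ k * (w + 1))"
proof -
  define q where "q = real CARD('n) * r / (real CARD('n) - 1)"
  obtain l where l: "l > 0" "ennreal l < ennreal lam" "(\<integral>\<^sup>+x. ennreal (exp ((\<bar>u x\<bar> / l) powr q) - 1) \<partial>lebesgue_on (ball z \<rho>)) \<le> 1"
    using lam unfolding E_norm_def luxemburg_norm_def q_def[symmetric] Inf_less_iff by auto
  have llam: "l \<le> lam" using l by (simp add: ennreal_less_iff)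
  have "(\<integral>\<^sup>+x. ennreal (exp ((\<bar>u x\<bar> / l) powr q) - 1) \<partial>lebesgue_on (ball z \<rho>)) = (\<integral>\<^sup>+x\<in>ball z \<rho>. ennreal (exp ((\<bar>v x\<bar> / l) powr q) - 1) \<partial>lborel)"
  proof (rule nn_integral_lebesgue_on_borel)
    show "AE x in lborel. x \<in> ball z \<rho> \<longrightarrow> ennreal (exp ((\<bar>u x\<bar> / l) powr q) - 1) = ennreal (exp ((\<bar>v x\<bar> / l) powr q) - 1)"
      using v(2) by eventually_elim auto
  qed simp
  with l(3) have m: "(\<integral>\<^sup>+x\<in>ball z \<rho>. ennreal (exp ((\<bar>v x\<bar> / l) powr q) - 1) \<partial>lborel) \<le> 1" by simp
  have pt: "ennreal (\<bar>v x / lam\<bar> ^ k) * indicator (ball z \<rho>) x \<le> ennreal (real k ^ k) * indicator (ball z \<rho>) x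
     + ennreal (real k ^ k) * (ennreal (exp ((\<bar>v x\<bar> / l) powr q) - 1) * indicator (ball z \<rho>) x)" for x
  proof -
    define t where "t = \<bar>v x\<bar> / l"
    have t: "t \<ge> 0" using l by (simp add: t_def)
    have "\<bar>v x / lam\<bar> \<le> t" using l llam by (auto simp: t_def intro!: divide_left_mono)
    then have "\<bar>v x / lam\<bar> ^ k \<le> t ^ k" by (intro power_mono) auto
    also have "t ^ k \<le> real k ^ k * exp (t powr q)"
    proof (cases "t \<le> 1")
      case True
      have "t ^ k \<le> 1 * 1" using True t by (simp add: power_le_one)
      also have "\<dots> \<le> real k ^ k * exp (t powr q)" using k by (intro mult_mono) auto
      finally show ?thesis .
    next
      case False
      then have "t powr 1 \<le> t powr q" using q by (intro powr_mono) (auto simp: q_def)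
      then have "t \<le> t powr q" using t by simp
      have "(t / k) ^ k \<le> exp (t / k) ^ k"
        using t exp_ge_add_one_self[of "t / k"] by (intro power_mono) (auto simp del: exp_ge_add_one_self)
      also have "\<dots> = exp t" using k by (simp add: exp_of_nat_mult[symmetric])
      finally have "t ^ k \<le> real k ^ k * exp t" using k by (simp add: power_divide field_simps)
      also have "\<dots> \<le> real k ^ k * exp (t powr q)" using \<open>t \<le> t powr q\<close> by (intro mult_left_mono) auto
      finally show ?thesis .
    qed
    also have "\<dots> = real k ^ k + real k ^ k * (exp (t powr q) - 1)" by (simp add: algebra_simps)
    finally have "ennreal (\<bar>v x / lam\<bar> ^ k) \<le> ennreal (real k ^ k + real k ^ k * (exp (t powr q) - 1))" by (rule ennreal_leI)
    also have "\<dots> = ennreal (real k ^ k) + ennreal (real k ^ k) * ennreal (exp (t powr q) - 1)"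
      by (simp add: ennreal_mult[symmetric] ennreal_plus[symmetric] del: ennreal_plus)
    finally show ?thesis by (auto simp: t_def indicator_def)
  qed
  have "(\<integral>\<^sup>+x\<in>ball z \<rho>. ennreal (\<bar>v x / lam\<bar> ^ k) \<partial>lborel) \<le> (\<integral>\<^sup>+x. ennreal (real k ^ k) * indicator (ball z \<rho>) x
     + ennreal (real k ^ k) * (ennreal (exp ((\<bar>v x\<bar> / l) powr q) - 1) * indicator (ball z \<rho>) x) \<partial>lborel)"
    by (intro nn_integral_mono pt)
  also have "\<dots> = ennreal (real k ^ k) * emeasure lborel (ball z \<rho>)
     + ennreal (real k ^ k) * (\<integral>\<^sup>+x\<in>ball z \<rho>. ennreal (exp ((\<bar>v x\<bar> / l) powr q) - 1) \<partial>lborel)"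
    by (simp add: nn_integral_add nn_integral_cmult)
  also have "\<dots> \<le> ennreal (real k ^ k) * ennreal w + ennreal (real k ^ k) * 1"
    using m w by (intro add_mono mult_left_mono) auto
  also have "\<dots> = ennreal (real k ^ k * (w + 1))"
    using w by (simp add: ennreal_mult[symmetric] ennreal_plus[symmetric] algebra_simps del: ennreal_plus)
  finally show ?thesis .
qed

text \<open>The exponents in \<open>k_const\<close> give each of the three coefficients the
  homogeneity of \<open>u\<close>. Undoing the roots shows that, divided by the right power of
  \<open>lam\<close>, each has Orlicz norm below 1.\<close>

lemma k_const_less:
  fixes D :: "(real ^ 'n::finite) set"
  assumes n: "CARD('n) \<ge> 2" and k: "k_const D r e f g < lam"
  shows "lam > 0" "N_real r D (\<lambda>x. e x powr (real CARD('n) / (real CARD('n) - 1))) < lam ^ CARD('n)"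
    "N_real r D f < lam ^ (CARD('n) - 1)" "N_real r D g < lam ^ CARD('n)"
proof -
  define n' where "n' = real CARD('n)"
  define a where "a = N_real r D (\<lambda>x. e x powr (n' / (n' - 1)))"
  define b where "b = N_real r D f"
  define c where "c = N_real r D g"
  have nn: "a \<ge> 0" "b \<ge> 0" "c \<ge> 0" by (auto simp: a_def b_def c_def N_real_def)
  have n': "n' > 1" using n by (simp add: n'_def)
  define X where "X = a powr ((n' - 1) / n') + b"
  have k': "X powr (1 / (n' - 1)) + c powr (1 / n') < lam"
    using k unfolding k_const_def X_def a_def b_def c_def n'_def Let_def .
  have X: "X \<ge> 0" using nn by (simp add: X_def)
  show lam: "lam > 0" using k' by (smt (verit) powr_ge_zero)
  have p1: "X powr (1 / (n' - 1)) < lam" and p2: "c powr (1 / n') < lam" using k' by (smt (verit) powr_ge_zero)+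
  have N1: "lam powr (n' - 1) = lam ^ (CARD('n) - 1)"
    using lam n by (subst powr_realpow[symmetric]) (auto simp: n'_def of_nat_diff)
  have N2: "lam powr n' = lam ^ CARD('n)" using lam by (simp add: powr_realpow n'_def)
  have "X = (X powr (1 / (n' - 1))) powr (n' - 1)" using X n' by (simp add: powr_powr)
  also have "\<dots> < lam powr (n' - 1)" using p1 n' by (intro powr_less_mono2) auto
  finally have Xlam: "X < lam powr (n' - 1)" .
  have "b \<le> X" by (simp add: X_def)
  then show "N_real r D f < lam ^ (CARD('n) - 1)" using Xlam by (simp add: N1 b_def)
  have "a powr ((n' - 1) / n') \<le> X" using nn by (simp add: X_def)
  then have aX: "a powr ((n' - 1) / n') < lam powr (n' - 1)" using Xlam by linarith
  have "a = (a powr ((n' - 1) / n')) powr (n' / (n' - 1))" using nn n' by (simp add: powr_powr)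
  also have "\<dots> < (lam powr (n' - 1)) powr (n' / (n' - 1))" using aX n' by (intro powr_less_mono2) auto
  also have "\<dots> = lam powr n'" using n' by (simp add: powr_powr)
  finally have "a < lam ^ CARD('n)" unfolding N2 .
  then show "N_real r D (\<lambda>x. e x powr (real CARD('n) / (real CARD('n) - 1))) < lam ^ CARD('n)"
    by (simp only: a_def n'_def)
  have "c = (c powr (1 / n')) powr n'" using nn n' by (simp add: powr_powr)
  also have "\<dots> < lam powr n'" using p2 n' by (intro powr_less_mono2) auto
  finally show "N_real r D g < lam ^ CARD('n)" unfolding N2 c_def .
qed

subsection \<open>Rescaling and the final estimates\<close>

lemma test_function_facts:
  assumes "test_function B \<phi>"
  shows "\<phi> \<in> borel_measurable borel" "gradient \<phi> \<in> borel_measurable borel" "partial_deriv i \<phi> \<in> borel_measurable borel"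
    "x \<notin> B \<Longrightarrow> \<phi> x = 0" "x \<notin> B \<Longrightarrow> gradient \<phi> x = 0" "x \<notin> B \<Longrightarrow> partial_deriv i \<phi> x = 0"
proof -
  have C: "C_k 0 \<phi>" "C_k (Suc 0) \<phi>" using assms unfolding test_function_def by blast+
  have sub: "closure (support_on UNIV \<phi>) \<subseteq> B" using assms by (simp add: test_function_def)
  have out: "\<phi> x = 0" if "x \<notin> closure (support_on UNIV \<phi>)" for x
    using that closure_subset[of "support_on UNIV \<phi>"] by (auto simp: support_on_def)
  have G: "C1_grad \<phi> (gradient \<phi>)" by (rule C_k_1_C1_grad[OF C(2)])
  show "\<phi> \<in> borel_measurable borel" using C(1) by (simp add: borel_measurable_continuous_onI)
  show gm: "gradient \<phi> \<in> borel_measurable borel" using G by (simp add: C1_grad_def borel_measurable_continuous_onI)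
  have p: "partial_deriv i \<phi> = (\<lambda>x. gradient \<phi> x $ i)" by (simp add: gradient_def fun_eq_iff)
  have "partial_deriv i \<phi> = (\<lambda>x. gradient \<phi> x \<bullet> axis i 1)" by (simp add: p inner_axis fun_eq_iff)
  then show "partial_deriv i \<phi> \<in> borel_measurable borel" using gm by simp
  show "\<phi> x = 0" if "x \<notin> B" using that sub out by blast
  show g0: "gradient \<phi> x = 0" if "x \<notin> B"
    by (rule gradient_zero_outside[OF G, of "closure (support_on UNIV \<phi>)"]) (use that sub out in auto)
  show "partial_deriv i \<phi> x = 0" if "x \<notin> B" using g0[OF that] by (simp add: p)
qed

lemma le_power_from_conjugate:
  fixes x y :: real
  assumes n: "N \<ge> 2" and x: "x \<ge> 0" and y: "y \<ge> 0" and le: "x powr (real N / (real N - 1)) \<le> y ^ N"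
  shows "x \<le> y ^ (N - 1)"
proof (rule ccontr)
  assume "\<not> ?thesis"
  then have lt: "y ^ (N - 1) < x" by simp
  then have "(y ^ (N - 1)) powr (real N / (real N - 1)) < x powr (real N / (real N - 1))"
    using n y by (intro powr_less_mono2) auto
  moreover have "(y ^ (N - 1)) powr (real N / (real N - 1)) = y ^ N"
    using y n by (cases "y = 0") (auto simp: powr_realpow[symmetric] powr_powr of_nat_diff power_0_left)
  ultimately show False using le by simp
qed

text \<open>Merges the power of \<open>|u|\<close> and the constant term of a structure condition
  into one power of \<open>1 + |u|\<close>.\<close>

lemma one_plus_power_ge:
  fixes x :: real
  assumes "x \<ge> 0" "m \<ge> 1" shows "x ^ m + 1 \<le> (1 + x) ^ m"
  using assms(2)
proof (induction m rule: dec_induct)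
  case (step m)
  have "x ^ Suc m + 1 \<le> (1 + x) * (x ^ m + 1)" using assms(1) by (simp add: algebra_simps)
  also have "\<dots> \<le> (1 + x) * (1 + x) ^ m" using step assms(1) by (intro mult_left_mono) auto
  finally show ?case by simp
qed simp

text \<open>A sum of nonnegative terms dominates each of them: \<open>b\<close> and the scaled
  \<open>e\<close> are compared with \<open>\<sigma> ^ (N - 1)\<close> through the conjugate
  exponent, \<open>c\<close> with \<open>\<sigma>\<close>, and \<open>d\<close> and the scaled
  \<open>f\<close>, \<open>g\<close> with \<open>\<sigma> ^ N\<close>.\<close>

lemma scaled_structure_bounds:
  fixes lam a b c d e f g P U \<sigma> :: real
  assumes n: "N \<ge> 2" and lam: "lam > 0" and nn: "b \<ge> 0" "c \<ge> 0" "d \<ge> 0" "e \<ge> 0" "f \<ge> 0" "g \<ge> 0" "P \<ge> 0" "U \<ge> 0" "\<sigma> \<ge> 0"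
    and \<sigma>: "\<sigma> ^ N = b powr (real N / (real N - 1)) + c ^ N + d + e powr (real N / (real N - 1)) / lam ^ N + f / lam ^ (N - 1) + g / lam ^ N"
  shows "(a * P ^ (N - 1) + b * U ^ (N - 1) + e) / lam ^ (N - 1) \<le> a * (P / lam) ^ (N - 1) + (\<sigma> * (1 + U / lam)) ^ (N - 1)"
    "(c * P ^ (N - 1) + d * U ^ (N - 1) + f) / lam ^ (N - 1) \<le> \<sigma> * (P / lam) ^ (N - 1) + \<sigma> ^ N * (1 + U / lam) ^ (N - 1)"
    "(P / lam) ^ N - (\<sigma> * (1 + U / lam)) ^ N \<le> (P ^ N - d * U ^ N - g) / lam ^ N"
proof -
  have m: "N - 1 \<ge> 1" "N \<ge> 1" using n by auto
  have lp: "lam ^ m > 0" for m using lam by simp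
  define B where "B = b powr (real N / (real N - 1))"
  define E where "E = e powr (real N / (real N - 1)) / lam ^ N"
  have t0: "B \<ge> 0" "c ^ N \<ge> 0" "E \<ge> 0" "f / lam ^ (N - 1) \<ge> 0" "g / lam ^ N \<ge> 0"
    using nn lp lam by (auto simp: B_def E_def)
  have \<sigma>': "\<sigma> ^ N = B + c ^ N + d + E + f / lam ^ (N - 1) + g / lam ^ N" using \<sigma> by (simp add: B_def E_def)
  define T where "T = 1 + U / lam"
  define Q where "Q = U / lam"
  have Q0: "Q \<ge> 0" "T = 1 + Q" using nn lam by (auto simp: Q_def T_def)
  have T: "Q ^ (N - 1) + 1 \<le> T ^ (N - 1)" "Q ^ N + 1 \<le> T ^ N" "T \<ge> 1"
    using one_plus_power_ge[OF Q0(1) m(1)] one_plus_power_ge[OF Q0(1) m(2)] Q0 by auto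
  have e': "(e / lam ^ (N - 1)) powr (real N / (real N - 1)) = E"
  proof -
    have "(lam ^ (N - 1)) powr (real N / (real N - 1)) = lam ^ N"
      using lam n by (auto simp: powr_realpow[symmetric] powr_powr of_nat_diff)
    then show ?thesis using lam nn by (simp add: powr_divide E_def)
  qed
  have be: "(b powr (real N / (real N - 1))) + (e / lam ^ (N - 1)) powr (real N / (real N - 1)) \<le> \<sigma> ^ N"
    unfolding e' B_def[symmetric] using \<sigma>' t0 nn by linarith
  have b: "b \<le> \<sigma> ^ (N - 1)" by (rule le_power_from_conjugate[OF n]) (use be nn in \<open>auto intro: order_trans[rotated]\<close>)
  have e: "e / lam ^ (N - 1) \<le> \<sigma> ^ (N - 1)" by (rule le_power_from_conjugate[OF n]) (use be nn lp[of "N - 1"] in \<open>auto intro: order_trans[rotated]\<close>)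
  have c: "c \<le> \<sigma>" by (rule power_le_imp_le_base[of c "N - 1"]) (use \<sigma>' t0 nn m in auto)
  have "(a * P ^ (N - 1) + b * U ^ (N - 1) + e) / lam ^ (N - 1) = a * (P / lam) ^ (N - 1) + (b * Q ^ (N - 1) + e / lam ^ (N - 1))"
    by (simp add: add_divide_distrib power_divide Q_def)
  also have "b * Q ^ (N - 1) + e / lam ^ (N - 1) \<le> \<sigma> ^ (N - 1) * Q ^ (N - 1) + \<sigma> ^ (N - 1)"
    using b e Q0 by (intro add_mono mult_right_mono) auto
  also have "\<dots> = \<sigma> ^ (N - 1) * (Q ^ (N - 1) + 1)" by (simp add: algebra_simps)
  also have "\<dots> \<le> \<sigma> ^ (N - 1) * T ^ (N - 1)" using T nn by (intro mult_left_mono) auto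
  finally show "(a * P ^ (N - 1) + b * U ^ (N - 1) + e) / lam ^ (N - 1) \<le> a * (P / lam) ^ (N - 1) + (\<sigma> * (1 + U / lam)) ^ (N - 1)"
    by (simp add: T_def power_mult_distrib)
  have "(c * P ^ (N - 1) + d * U ^ (N - 1) + f) / lam ^ (N - 1) = c * (P / lam) ^ (N - 1) + (d * Q ^ (N - 1) + f / lam ^ (N - 1))"
    by (simp add: add_divide_distrib power_divide Q_def)
  also have "c * (P / lam) ^ (N - 1) \<le> \<sigma> * (P / lam) ^ (N - 1)" using c nn lam by (intro mult_right_mono) auto
  also have "d * Q ^ (N - 1) + f / lam ^ (N - 1) \<le> \<sigma> ^ N * Q ^ (N - 1) + \<sigma> ^ N"
    using \<sigma>' t0 nn Q0 by (intro add_mono mult_right_mono) auto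
  also have "\<dots> = \<sigma> ^ N * (Q ^ (N - 1) + 1)" by (simp add: algebra_simps)
  also have "\<dots> \<le> \<sigma> ^ N * T ^ (N - 1)" using T nn by (intro mult_left_mono) auto
  finally show "(c * P ^ (N - 1) + d * U ^ (N - 1) + f) / lam ^ (N - 1) \<le> \<sigma> * (P / lam) ^ (N - 1) + \<sigma> ^ N * (1 + U / lam) ^ (N - 1)"
    by (simp add: T_def)
  have "d * Q ^ N + g / lam ^ N \<le> \<sigma> ^ N * Q ^ N + \<sigma> ^ N"
    using \<sigma>' t0 nn Q0 by (intro add_mono mult_right_mono) auto
  also have "\<dots> = \<sigma> ^ N * (Q ^ N + 1)" by (simp add: algebra_simps)
  also have "\<dots> \<le> \<sigma> ^ N * T ^ N" using T nn by (intro mult_left_mono) auto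
  finally show "(P / lam) ^ N - (\<sigma> * (1 + U / lam)) ^ N \<le> (P ^ N - d * U ^ N - g) / lam ^ N"
    by (simp add: T_def power_mult_distrib diff_divide_distrib power_divide Q_def)
qed

lemma set_nn_integral_add_le:
  fixes x y :: real
  assumes "f \<in> borel_measurable M" "g \<in> borel_measurable M" "E \<in> sets M" "\<And>x. f x \<ge> 0" "\<And>x. g x \<ge> 0" "x \<ge> 0" "y \<ge> 0"
    "(\<integral>\<^sup>+t\<in>E. ennreal (f t) \<partial>M) \<le> ennreal x" "(\<integral>\<^sup>+t\<in>E. ennreal (g t) \<partial>M) \<le> ennreal y"
  shows "(\<integral>\<^sup>+t\<in>E. ennreal (f t + g t) \<partial>M) \<le> ennreal (x + y)"
proof -
  note [measurable] = assms(1-3)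
  have "(\<integral>\<^sup>+t\<in>E. ennreal (f t + g t) \<partial>M) = (\<integral>\<^sup>+t. ennreal (f t) * indicator E t + ennreal (g t) * indicator E t \<partial>M)"
    using assms by (intro nn_integral_cong) (auto simp: ennreal_plus distrib_right)
  also have "\<dots> = (\<integral>\<^sup>+t\<in>E. ennreal (f t) \<partial>M) + (\<integral>\<^sup>+t\<in>E. ennreal (g t) \<partial>M)" by (intro nn_integral_add) auto
  also have "\<dots> \<le> ennreal x + ennreal y" by (intro add_mono assms)
  finally show ?thesis using assms by (simp add: ennreal_plus)
qed

lemma set_nn_integral_divide_le:
  fixes x l :: real
  assumes "f \<in> borel_measurable M" "E \<in> sets M" "\<And>x. f x \<ge> 0" "l > 0" "(\<integral>\<^sup>+t\<in>E. ennreal (f t) \<partial>M) \<le> ennreal (2 * l * x)" "x \<ge> 0"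
  shows "(\<integral>\<^sup>+t\<in>E. ennreal (f t / l) \<partial>M) \<le> ennreal (2 * x)"
proof -
  note [measurable] = assms(1-2)
  have "(\<integral>\<^sup>+t\<in>E. ennreal (f t / l) \<partial>M) = (\<integral>\<^sup>+t. ennreal (1 / l) * (ennreal (f t) * indicator E t) \<partial>M)"
    using assms by (intro nn_integral_cong) (auto simp: ennreal_mult[symmetric] indicator_def)
  also have "\<dots> = ennreal (1 / l) * (\<integral>\<^sup>+t\<in>E. ennreal (f t) \<partial>M)" by (rule nn_integral_cmult) simp
  also have "\<dots> \<le> ennreal (1 / l) * ennreal (2 * l * x)" by (intro mult_left_mono assms) simp
  also have "\<dots> = ennreal (2 * x)" using assms by (subst ennreal_mult[symmetric]) auto
  finally show ?thesis .
qed

lemma LlogL_ex_borel: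
  fixes D :: "(real ^ 'n::finite) set"
  assumes D: "D \<in> sets borel" and W: "LlogL s D W" "\<And>x. x \<in> D \<Longrightarrow> W x \<ge> 0"
  obtains V where "V \<in> borel_measurable borel" "\<And>x. V x \<ge> 0" "AE x in lborel. x \<in> D \<longrightarrow> W x = V x"
proof -
  have "W \<in> borel_measurable (lebesgue_on D)" using W(1) by (simp add: LlogL_def)
  from lebesgue_on_ex_borel_real[OF D this] obtain g where [measurable]: "g \<in> borel_measurable borel" and g: "AE x in lborel. x \<in> D \<longrightarrow> W x = g x" by blast
  have "(\<lambda>x. max 0 (g x)) \<in> borel_measurable borel" by measurable
  moreover have "AE x in lborel. x \<in> D \<longrightarrow> W x = max 0 (g x)" using g by eventually_elim (use W(2) in fastforce)
  ultimately show ?thesis using that[of "\<lambda>x. max 0 (g x)"] by auto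
qed

text \<open>\<open>u\<close> and its gradient are divided by \<open>lam\<close>, the flux and the
  zero order term by \<open>lam ^ (n - 1)\<close>, in keeping with their homogeneity. The number
  \<open>k + 6\<close> collects six Orlicz bounds: three norms increased by 1 each, for
  \<open>b\<close>, \<open>c\<close> and \<open>d\<close>, and 1 for each of the normalised
  \<open>e\<close>, \<open>f\<close> and \<open>g\<close>.\<close>

lemma scaled_local_solution:
  fixes D :: "(real ^ 'n::finite) set" and R r lam k cs :: real
  defines "\<omega> \<equiv> unit_ball_vol (real CARD('n)) * (2 * R) ^ CARD('n)"
    and "s \<equiv> (real CARD('n) - 1) / r"
  assumes n: "CARD('n) \<ge> 2" and r: "(real CARD('n) - 1) / real CARD('n) < r" "r < 1" and R: "R > 0" and oD: "open D"
    and sc: "structure_conditions D A B a b c d e f g" and ic: "integrability_conditions D r b c d e f g"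
    and ws: "weak_solution D A B u ux" and sub: "ball z (2 * R) \<subseteq> D"
    and cs: "cs \<ge> 0" "\<And>L. L \<ge> 1 \<Longrightarrow> exp (- L / 2) \<le> cs * L powr (- s)"
    and lamE: "E_norm (real CARD('n) * r) (ball z (2 * R)) u < ennreal lam" and lamk: "k_const D r e f g < lam"
    and k: "N_real r D (\<lambda>x. b x powr (real CARD('n) / (real CARD('n) - 1))) + N_real r D (\<lambda>x. c x ^ CARD('n)) + N_real r D d \<le> k"
  obtains v w F Gs \<sigma> where
    "local_solution z R a s (2 * ((k + 6) * (cs + 2 powr s))) (real (2 * CARD('n)) ^ (2 * CARD('n)) * (\<omega> + 1)) (2 * ((k + 6) * (exp 1 * \<omega> + 1))) v w F Gs \<sigma>"
    "AE x in lborel. x \<in> ball z (2 * R) \<longrightarrow> u x = lam * v x \<and> ux x = lam *\<^sub>R w x"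
proof -
  let ?N = "CARD('n)"
  define Q where "Q = ball z (2 * R)"
  define n' where "n' = real ?N / (real ?N - 1)"
  have D[measurable]: "D \<in> sets borel" using oD by simp
  have Qb[measurable]: "Q \<in> sets borel" by (simp add: Q_def)
  have QD: "Q \<subseteq> D" using sub by (simp add: Q_def)
  have r0: "r > 0" using r n by (auto intro: le_less_trans[rotated])
  have "(real ?N - 1) * r < (real ?N - 1) * 1" using n r by (intro mult_strict_left_mono) auto
  then have s: "s > 0" "s = (real ?N - 1) / r" "s > real ?N - 1" using r0 n by (auto simp: s_def less_divide_eq)
  have q: "1 \<le> real ?N * r / (real ?N - 1)" using r n by (auto simp: field_simps)
  have \<omega>: "\<omega> \<ge> 0" "emeasure lborel Q \<le> ennreal \<omega>" using R by (auto simp: \<omega>_def Q_def emeasure_ball)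
  have lam: "lam > 0" and le: "N_real r D (\<lambda>x. e x powr n') < lam ^ ?N" and lf: "N_real r D f < lam ^ (?N - 1)" and lg: "N_real r D g < lam ^ ?N"
    using k_const_less[OF n lamk] by (simp_all add: n'_def)
  have lp: "lam ^ m > 0" for m using lam by simp
  have L: "LlogL s D (\<lambda>x. b x powr n')" "LlogL s D (\<lambda>x. c x ^ ?N)" "LlogL s D d" "LlogL s D (\<lambda>x. e x powr n')" "LlogL s D f" "LlogL s D g"
    using ic by (auto simp: integrability_conditions_def Let_def s_def n'_def)
  have nn: "0 \<le> b x" "0 \<le> c x" "0 \<le> d x" "0 \<le> e x" "0 \<le> f x" "0 \<le> g x" if "x \<in> D" for x
    using sc that by (auto simp: structure_conditions_def)
  have a: "a > 0" using sc by (simp add: structure_conditions_def)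
  have N_lt: "N_norm r D W < ennreal l" if "LlogL s D W" "N_real r D W < l" for W l
    using N_norm_finite[OF s(1,2) that(1)] that(2) by (cases "N_norm r D W") (auto simp: N_real_def ennreal_lessI)
  have N0: "N_real r D W \<ge> 0" for W by (simp add: N_real_def)
  define kb where "kb = N_real r D (\<lambda>x. b x powr n')"
  define kc where "kc = N_real r D (\<lambda>x. c x ^ ?N)"
  define kd where "kd = N_real r D d"
  have kk: "kb \<ge> 0" "kc \<ge> 0" "kd \<ge> 0" "kb + kc + kd \<le> k" using k N0 by (auto simp: kb_def kc_def kd_def n'_def)
  \<comment> \<open>Selecting a Luxemburg constant needs strict bounds. The norms of
    \<open>b\<close>, \<open>c\<close>, \<open>d\<close> are increased by 1; those of
    \<open>e\<close>, \<open>f\<close>, \<open>g\<close> lie strictly below the powers of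
    \<open>lam\<close> by which they are divided.\<close>
  have NN: "N_norm r D (\<lambda>x. b x powr n') < ennreal (kb + 1)" "N_norm r D (\<lambda>x. c x ^ ?N) < ennreal (kc + 1)" "N_norm r D d < ennreal (kd + 1)"
    "N_norm r D (\<lambda>x. e x powr n') < ennreal (lam ^ ?N)" "N_norm r D f < ennreal (lam ^ (?N - 1))" "N_norm r D g < ennreal (lam ^ ?N)"
    using lf by (auto intro!: N_lt L le lg simp: kb_def kc_def kd_def)
  have W: "u \<in> borel_measurable (lebesgue_on D)" "ux \<in> borel_measurable (lebesgue_on D)"
    "integrable (lebesgue_on D) (\<lambda>x. norm (ux x) ^ ?N)"
    "(\<lambda>x. A x (u x) (ux x)) \<in> borel_measurable (lebesgue_on D)" "(\<lambda>x. B x (u x) (ux x)) \<in> borel_measurable (lebesgue_on D)"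
    using ws by (auto simp: weak_solution_def W1n_def Ln_def)
  obtain u0 where u0[measurable]: "u0 \<in> borel_measurable borel" "AE x in lborel. x \<in> D \<longrightarrow> u x = u0 x" by (rule lebesgue_on_ex_borel_real[OF D W(1)])
  obtain w0 where w0[measurable]: "w0 \<in> borel_measurable borel" "AE x in lborel. x \<in> D \<longrightarrow> ux x = w0 x" by (rule lebesgue_on_ex_borel_vec[OF D W(2)])
  obtain A0 where A0[measurable]: "A0 \<in> borel_measurable borel" "AE x in lborel. x \<in> D \<longrightarrow> A x (u x) (ux x) = A0 x" by (rule lebesgue_on_ex_borel_vec[OF D W(4)])
  obtain B0 where B0[measurable]: "B0 \<in> borel_measurable borel" "AE x in lborel. x \<in> D \<longrightarrow> B x (u x) (ux x) = B0 x" by (rule lebesgue_on_ex_borel_real[OF D W(5)])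
  obtain Vb where Vb[measurable]: "Vb \<in> borel_measurable borel" "\<And>x. Vb x \<ge> 0" "AE x in lborel. x \<in> D \<longrightarrow> b x powr n' = Vb x" by (rule LlogL_ex_borel[OF D L(1)]) auto
  obtain Vc where Vc[measurable]: "Vc \<in> borel_measurable borel" "\<And>x. Vc x \<ge> 0" "AE x in lborel. x \<in> D \<longrightarrow> c x ^ ?N = Vc x" by (rule LlogL_ex_borel[OF D L(2)]) (use nn in auto)
  obtain Vd where Vd[measurable]: "Vd \<in> borel_measurable borel" "\<And>x. Vd x \<ge> 0" "AE x in lborel. x \<in> D \<longrightarrow> d x = Vd x" by (rule LlogL_ex_borel[OF D L(3)]) (use nn in auto)
  obtain Ve where Ve[measurable]: "Ve \<in> borel_measurable borel" "\<And>x. Ve x \<ge> 0" "AE x in lborel. x \<in> D \<longrightarrow> e x powr n' = Ve x" by (rule LlogL_ex_borel[OF D L(4)]) auto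
  obtain Vf where Vf[measurable]: "Vf \<in> borel_measurable borel" "\<And>x. Vf x \<ge> 0" "AE x in lborel. x \<in> D \<longrightarrow> f x = Vf x" by (rule LlogL_ex_borel[OF D L(5)]) (use nn in auto)
  obtain Vg where Vg[measurable]: "Vg \<in> borel_measurable borel" "\<And>x. Vg x \<ge> 0" "AE x in lborel. x \<in> D \<longrightarrow> g x = Vg x" by (rule LlogL_ex_borel[OF D L(6)]) (use nn in auto)
  have "AE x in lborel. x \<in> D \<longrightarrow> u x = u0 x \<and> ux x = w0 x \<and> A x (u x) (ux x) = A0 x \<and> B x (u x) (ux x) = B0 x \<and>
      b x powr n' = Vb x \<and> c x ^ ?N = Vc x \<and> d x = Vd x \<and> e x powr n' = Ve x \<and> f x = Vf x \<and> g x = Vg x"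
    using u0(2) w0(2) A0(2) B0(2) Vb(3) Vc(3) Vd(3) Ve(3) Vf(3) Vg(3) by eventually_elim simp
  then obtain Z where Z: "{x \<in> space lborel. \<not> (x \<in> D \<longrightarrow> u x = u0 x \<and> ux x = w0 x \<and> A x (u x) (ux x) = A0 x \<and> B x (u x) (ux x) = B0 x \<and>
      b x powr n' = Vb x \<and> c x ^ ?N = Vc x \<and> d x = Vd x \<and> e x powr n' = Ve x \<and> f x = Vf x \<and> g x = Vg x)} \<subseteq> Z"
      "emeasure lborel Z = 0" "Z \<in> sets lborel"
    by (rule AE_E)
  \<comment> \<open>All data are set to 0 on the exceptional null set \<open>Z\<close>. The
    inequalities then hold at every point, as the locale demands, being trivial where everything
    vanishes.\<close>
  define G where "G = Q - Z"
  have Gm[measurable]: "G \<in> sets borel" using Z(3) by (simp add: G_def)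
  have GQ: "x \<in> Q" "x \<in> D" if "x \<in> G" for x using that QD by (auto simp: G_def)
  have AEZ: "AE x in lborel. x \<notin> Z" using Z by (intro AE_not_in) auto
  have AEG: "AE x in lborel. x \<in> Q \<longrightarrow> x \<in> G" using AEZ by eventually_elim (simp add: G_def)
  have eq: "u x = u0 x" "ux x = w0 x" "A x (u x) (ux x) = A0 x" "B x (u x) (ux x) = B0 x"
      "b x powr n' = Vb x" "c x ^ ?N = Vc x" "d x = Vd x" "e x powr n' = Ve x" "f x = Vf x" "g x = Vg x" if "x \<in> G" for x
    using that Z(1) GQ[OF that] by (auto simp: G_def)
  define v where "v x = (if x \<in> G then u0 x / lam else 0)" for x
  define w where "w x = (if x \<in> G then (1 / lam) *\<^sub>R w0 x else 0)" for x
  define F where "F x = (if x \<in> G then (1 / lam ^ (?N - 1)) *\<^sub>R A0 x else 0)" for x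
  define Gs where "Gs x = (if x \<in> G then B0 x / lam ^ (?N - 1) else 0)" for x
  define S where "S x = Vb x + (Vc x + (Vd x + (Ve x / lam ^ ?N + (Vf x / lam ^ (?N - 1) + Vg x / lam ^ ?N))))" for x
  define \<sigma> where "\<sigma> x = (if x \<in> G then root ?N (S x) else 0)" for x
  have mS[measurable]: "S \<in> borel_measurable borel" unfolding S_def[abs_def] by measurable
  have m[measurable]: "v \<in> borel_measurable borel" "w \<in> borel_measurable borel" "F \<in> borel_measurable borel"
    "Gs \<in> borel_measurable borel" "\<sigma> \<in> borel_measurable borel"
    unfolding v_def[abs_def] w_def[abs_def] F_def[abs_def] Gs_def[abs_def] \<sigma>_def[abs_def] by measurable
  have S0: "S x \<ge> 0" for x using Vb(2) Vc(2) Vd(2) Ve(2) Vf(2) Vg(2) lam by (simp add: S_def)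
  have \<sigma>0: "\<sigma> x \<ge> 0" for x using S0 by (simp add: \<sigma>_def)
  have \<sigma>N: "\<sigma> x ^ ?N \<le> S x" for x using S0 n by (simp add: \<sigma>_def power_0_left)
  have \<sigma>G: "\<sigma> x ^ ?N = S x" if "x \<in> G" for x using S0 n that by (simp add: \<sigma>_def)
  have key: "norm (F x) \<le> a * norm (w x) ^ (?N - 1) + (\<sigma> x * (1 + \<bar>v x\<bar>)) ^ (?N - 1) \<and>
      \<bar>Gs x\<bar> \<le> \<sigma> x * norm (w x) ^ (?N - 1) + \<sigma> x ^ ?N * (1 + \<bar>v x\<bar>) ^ (?N - 1) \<and>
      norm (w x) ^ ?N - (\<sigma> x * (1 + \<bar>v x\<bar>)) ^ ?N \<le> w x \<bullet> F x" for x
  proof (cases "x \<in> G")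
    case True
    note E = eq[OF True] and nx = nn[OF GQ(2)[OF True]]
    have "\<sigma> x ^ ?N = b x powr (real ?N / (real ?N - 1)) + c x ^ ?N + d x + e x powr (real ?N / (real ?N - 1)) / lam ^ ?N + f x / lam ^ (?N - 1) + g x / lam ^ ?N"
      using \<sigma>G[OF True] E(5-10) by (simp add: S_def n'_def)
    note bd = scaled_structure_bounds[OF n lam nx norm_ge_zero[of "ux x"] abs_ge_zero[of "u x"] \<sigma>0[of x] this]
    have scx: "norm (A x (u x) (ux x)) \<le> a * norm (ux x) ^ (?N - 1) + b x * \<bar>u x\<bar> ^ (?N - 1) + e x"
      "\<bar>B x (u x) (ux x)\<bar> \<le> c x * norm (ux x) ^ (?N - 1) + d x * \<bar>u x\<bar> ^ (?N - 1) + f x"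
      "norm (ux x) ^ ?N - d x * \<bar>u x\<bar> ^ ?N - g x \<le> ux x \<bullet> A x (u x) (ux x)"
      using sc GQ(2)[OF True] unfolding structure_conditions_def by blast+
    have vw: "\<bar>v x\<bar> = \<bar>u x\<bar> / lam" "norm (w x) = norm (ux x) / lam" using True lam E(1,2) by (auto simp: v_def w_def)
    have 1: "norm (F x) = norm (A x (u x) (ux x)) / lam ^ (?N - 1)" "\<bar>Gs x\<bar> = \<bar>B x (u x) (ux x)\<bar> / lam ^ (?N - 1)"
      using True lam E(3,4) by (auto simp: F_def Gs_def)
    have "lam ^ (?N - 1) * lam = lam ^ ?N" using n by (simp add: power_eq_if)
    then have 2: "w x \<bullet> F x = (ux x \<bullet> A x (u x) (ux x)) / lam ^ ?N"
      using True E(2,3) by (simp add: F_def w_def)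
    have "norm (F x) \<le> (a * norm (ux x) ^ (?N - 1) + b x * \<bar>u x\<bar> ^ (?N - 1) + e x) / lam ^ (?N - 1)"
      unfolding 1 using scx lam by (intro divide_right_mono) auto
    moreover have "\<bar>Gs x\<bar> \<le> (c x * norm (ux x) ^ (?N - 1) + d x * \<bar>u x\<bar> ^ (?N - 1) + f x) / lam ^ (?N - 1)"
      unfolding 1 using scx lam by (intro divide_right_mono) auto
    moreover have "(norm (ux x) ^ ?N - d x * \<bar>u x\<bar> ^ ?N - g x) / lam ^ ?N \<le> w x \<bullet> F x"
      unfolding 2 using scx lam by (intro divide_right_mono) auto
    ultimately show ?thesis unfolding vw using bd(1)[of a] bd(2) bd(3) by (intro conjI) (erule order_trans order_trans[rotated], assumption)+
  next
    case False
    then show ?thesis using n by (auto simp: F_def w_def v_def Gs_def \<sigma>_def power_0_left)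
  qed
  have out: "v x = 0" "w x = 0" "F x = 0" "Gs x = 0" "\<sigma> x = 0" if "x \<notin> Q" for x
    using that GQ by (auto simp: v_def w_def F_def Gs_def \<sigma>_def)
  \<comment> \<open>One summation serves two purposes: \<open>y\<close> is the bound per unit of
    Orlicz norm, for small sets in \<open>dec\<close> and for the whole ball in
    \<open>tot\<close>.\<close>
  have Ssum: "(\<integral>\<^sup>+x\<in>E. ennreal (\<sigma> x ^ ?N) \<partial>lborel) \<le> ennreal (2 * ((k + 6) * y))"
    if E: "E \<in> sets borel" and y: "y \<ge> 0"
      and V: "\<And>W V l. V \<in> borel_measurable borel \<Longrightarrow> (\<And>x. V x \<ge> 0) \<Longrightarrow> AE x in lborel. x \<in> D \<longrightarrow> W x = V x \<Longrightarrow> N_norm r D W < ennreal l \<Longrightarrow>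
        (\<integral>\<^sup>+x\<in>E. ennreal (V x) \<partial>lborel) \<le> ennreal (2 * l * y)" for E y
  proof -
    have "(\<integral>\<^sup>+x\<in>E. ennreal (\<sigma> x ^ ?N) \<partial>lborel) \<le> (\<integral>\<^sup>+x\<in>E. ennreal (S x) \<partial>lborel)"
      using \<sigma>N by (intro nn_integral_mono mult_right_mono ennreal_leI) auto
    also have "\<dots> \<le> ennreal (2 * (kb + 1) * y + (2 * (kc + 1) * y + (2 * (kd + 1) * y + (2 * y + (2 * y + 2 * y)))))"
      unfolding S_def
      by (intro set_nn_integral_add_le V[OF Vb NN(1)] V[OF Vc NN(2)] V[OF Vd NN(3)]
          set_nn_integral_divide_le[OF _ _ Ve(2) lp V[OF Ve NN(4)] y] set_nn_integral_divide_le[OF _ _ Vf(2) lp V[OF Vf NN(5)] y]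
          set_nn_integral_divide_le[OF _ _ Vg(2) lp V[OF Vg NN(6)] y])
        (use E y kk Vb(1,2) Vc(1,2) Vd(1,2) Ve(1,2) Vf(1,2) Vg(1,2) lam in auto)
    also have "\<dots> = ennreal (2 * ((kb + kc + kd + 6) * y))" by (simp add: algebra_simps)
    also have "\<dots> \<le> ennreal (2 * ((k + 6) * y))" using kk y by (intro ennreal_leI mult_left_mono mult_right_mono) auto
    finally show ?thesis .
  qed
  have dec: "small_set_decay Q (\<lambda>x. \<sigma> x ^ ?N) s (2 * ((k + 6) * (cs + 2 powr s)))"
    unfolding small_set_decay_def
  proof (intro allI impI)
    fix E :: "(real ^ 'n) set" and L :: real
    assume E: "E \<in> sets borel" "E \<subseteq> Q" and L1: "1 \<le> L" "emeasure lborel E \<le> ennreal (exp (- L))"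
    have ED: "E \<subseteq> D" using E(2) QD by blast
    have "(\<integral>\<^sup>+x\<in>E. ennreal (\<sigma> x ^ ?N) \<partial>lborel) \<le> ennreal (2 * ((k + 6) * ((cs + 2 powr s) * L powr - s)))"
      by (rule Ssum[OF E(1)]) (use cs(1) in simp, rule orlicz_small_sets[OF D s(1,2) _ _ _ _ cs E(1) ED L1], assumption+)
    then show "(\<integral>\<^sup>+x\<in>E. ennreal (\<sigma> x ^ ?N) \<partial>lborel) \<le> ennreal (2 * ((k + 6) * (cs + 2 powr s)) * L powr - s)"
      by (simp only: mult.assoc)
  qed
  have tot: "lpint ?N \<sigma> \<le> ennreal (2 * ((k + 6) * (exp 1 * \<omega> + 1)))"
  proof -
    have "lpint ?N \<sigma> = (\<integral>\<^sup>+x\<in>Q. ennreal (\<sigma> x ^ ?N) \<partial>lborel)" unfolding lpint_def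
      using \<sigma>0 out(5) n by (intro nn_integral_cong) (auto simp: indicator_def power_0_left)
    also have "\<dots> \<le> ennreal (2 * ((k + 6) * (exp 1 * \<omega> + 1)))"
      by (rule Ssum[OF Qb]) (use \<omega>(1) in simp, rule orlicz_total[OF D s(1,2) _ _ _ _ Qb QD \<omega>], assumption+)
    finally show ?thesis .
  qed
  have uint: "lpint (2 * ?N) v \<le> ennreal (real (2 * ?N) ^ (2 * ?N) * (\<omega> + 1))"
  proof -
    have AE0: "AE x in lborel. x \<in> ball z (2 * R) \<longrightarrow> u x = u0 x" using AEG by eventually_elim (use eq(1) in \<open>auto simp: Q_def\<close>)
    have "lpint (2 * ?N) v \<le> (\<integral>\<^sup>+x\<in>Q. ennreal (\<bar>u0 x / lam\<bar> ^ (2 * ?N)) \<partial>lborel)" unfolding lpint_def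
      by (intro nn_integral_mono) (use GQ n in \<open>auto simp: v_def power_0_left\<close>)
    also have "\<dots> \<le> ennreal (real (2 * ?N) ^ (2 * ?N) * (\<omega> + 1))"
      unfolding Q_def by (rule E_norm_power_bound[OF q u0(1) AE0 lamE]) (use n \<omega> in \<open>auto simp: Q_def\<close>)
    finally show ?thesis .
  qed
  have wint: "lpint ?N w < \<infinity>"
  proof -
    have i: "integrable (lebesgue_on D) (\<lambda>x. norm (ux x) ^ ?N / lam ^ ?N)" using W(3) by simp
    have "lpint ?N w \<le> (\<integral>\<^sup>+x\<in>D. ennreal (norm (w0 x) ^ ?N / lam ^ ?N) \<partial>lborel)" unfolding lpint_def
      by (intro nn_integral_mono) (use GQ n lam in \<open>auto simp: w_def power_0_left power_divide\<close>)
    also have "\<dots> = (\<integral>\<^sup>+x. ennreal (norm (ux x) ^ ?N / lam ^ ?N) \<partial>lebesgue_on D)"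
      by (rule nn_integral_lebesgue_on_borel[symmetric, OF D]) (use w0(2) in eventually_elim, simp)
    also have "\<dots> < \<infinity>" using nn_integral_eq_integral[OF i] lam by (simp add: AE_I2)
    finally show ?thesis .
  qed
  have tf: "test_function D \<phi>" if "test_function Q \<phi>" for \<phi> using that QD by (auto simp: test_function_def)
  have lm: "h \<in> borel_measurable (lebesgue_on D)" if "h \<in> borel_measurable borel" for h :: "real ^ 'n \<Rightarrow> 'c::topological_space"
    using that by (intro measurable_restrict_space1) (simp add: measurable_completion)
  have wg: "(\<integral>x. v x * partial_deriv i \<phi> x \<partial>lborel) = - (\<integral>x. w x $ i * \<phi> x \<partial>lborel)" if t: "test_function Q \<phi>" for \<phi> i
  proof -
    note T = test_function_facts[OF t]
    note [measurable] = T(1,2) T(3)[of i] lm[OF T(1)] lm[OF T(3)[of i]] W(1,2)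
    have ci: "(\<lambda>y :: real ^ 'n. y $ i) \<in> borel_measurable borel" by (intro borel_measurable_continuous_onI continuous_intros)
    have "(\<integral>x. u x * partial_deriv i \<phi> x \<partial>lebesgue_on D) = (\<integral>x. lam * (v x * partial_deriv i \<phi> x) \<partial>lborel)"
    proof (rule integral_lebesgue_on_borel[OF D])
      show "AE x in lborel. x \<in> D \<longrightarrow> u x * partial_deriv i \<phi> x = lam * (v x * partial_deriv i \<phi> x)"
        using AEG by eventually_elim (use T(6)[where i = i] eq(1) lam in \<open>auto simp: v_def\<close>)
      show "lam * (v x * partial_deriv i \<phi> x) = 0" if "x \<notin> D" for x using that GQ(2) by (auto simp: v_def)
    qed measurable
    moreover have "(\<integral>x. ux x $ i * \<phi> x \<partial>lebesgue_on D) = (\<integral>x. lam * (w x $ i * \<phi> x) \<partial>lborel)"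
    proof (rule integral_lebesgue_on_borel[OF D])
      show "AE x in lborel. x \<in> D \<longrightarrow> ux x $ i * \<phi> x = lam * (w x $ i * \<phi> x)"
        using AEG by eventually_elim (use T(4) eq(2) lam in \<open>auto simp: w_def\<close>)
      show "lam * (w x $ i * \<phi> x) = 0" if "x \<notin> D" for x using that GQ(2) by (auto simp: w_def)
      show "(\<lambda>x. ux x $ i * \<phi> x) \<in> borel_measurable (lebesgue_on D)"
        by (intro borel_measurable_times lm T(1) measurable_compose[OF W(2) ci])
      show "(\<lambda>x. lam * (w x $ i * \<phi> x)) \<in> borel_measurable borel"
        by (intro borel_measurable_times borel_measurable_const T(1) measurable_compose[OF m(2) ci])
    qed
    moreover have "(\<integral>x. u x * partial_deriv i \<phi> x \<partial>lebesgue_on D) = - (\<integral>x. ux x $ i * \<phi> x \<partial>lebesgue_on D)"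
      using ws tf[OF t] by (simp add: weak_solution_def W1n_def)
    ultimately have "lam * (\<integral>x. v x * partial_deriv i \<phi> x \<partial>lborel) = lam * (- (\<integral>x. w x $ i * \<phi> x \<partial>lborel))" by simp
    then show ?thesis by (rule mult_left_cancel[THEN iffD1, rotated]) (use lam in simp)
  qed
  have we: "(\<integral>x. gradient \<phi> x \<bullet> F x + \<phi> x * Gs x \<partial>lborel) = 0" if t: "test_function Q \<phi>" for \<phi>
  proof -
    note T = test_function_facts[OF t]
    note [measurable] = T(1,2) lm[OF T(1)] lm[OF T(2)] W(4,5)
    have "(\<integral>x. gradient \<phi> x \<bullet> A x (u x) (ux x) + \<phi> x * B x (u x) (ux x) \<partial>lebesgue_on D) = (\<integral>x. lam ^ (?N - 1) * (gradient \<phi> x \<bullet> F x + \<phi> x * Gs x) \<partial>lborel)"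
    proof (rule integral_lebesgue_on_borel[OF D])
      show "AE x in lborel. x \<in> D \<longrightarrow> gradient \<phi> x \<bullet> A x (u x) (ux x) + \<phi> x * B x (u x) (ux x) = lam ^ (?N - 1) * (gradient \<phi> x \<bullet> F x + \<phi> x * Gs x)"
        using AEG by eventually_elim (use T(4,5) eq(3,4) lam in \<open>auto simp: F_def Gs_def field_simps\<close>)
      show "lam ^ (?N - 1) * (gradient \<phi> x \<bullet> F x + \<phi> x * Gs x) = 0" if "x \<notin> D" for x using that GQ(2) by (auto simp: F_def Gs_def)
    qed measurable
    moreover have "(\<integral>x. gradient \<phi> x \<bullet> A x (u x) (ux x) + \<phi> x * B x (u x) (ux x) \<partial>lebesgue_on D) = 0"
      using ws tf[OF t] by (simp add: weak_solution_def)
    ultimately show ?thesis using lam by simp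
  qed
  have "local_solution z R a s (2 * ((k + 6) * (cs + 2 powr s))) (real (2 * ?N) ^ (2 * ?N) * (\<omega> + 1)) (2 * ((k + 6) * (exp 1 * \<omega> + 1))) v w F Gs \<sigma>"
  proof (unfold_locales, unfold Q_def[symmetric])
    show "0 \<le> 2 * ((k + 6) * (cs + 2 powr s))" "0 \<le> 2 * ((k + 6) * (exp 1 * \<omega> + 1))" "0 \<le> real (2 * ?N) ^ (2 * ?N) * (\<omega> + 1)"
      using kk cs \<omega> by auto
  qed (fact n R a s(3) m \<sigma>0 out dec tot uint wint wg we key[THEN conjunct1] key[THEN conjunct2, THEN conjunct1] key[THEN conjunct2, THEN conjunct2])+
  moreover have "AE x in lborel. x \<in> ball z (2 * R) \<longrightarrow> u x = lam * v x \<and> ux x = lam *\<^sub>R w x"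
    using AEG by eventually_elim (use eq(1,2) lam in \<open>auto simp: v_def w_def Q_def[symmetric]\<close>)
  ultimately show ?thesis by (rule that)
qed

text \<open>The constants handed to the local estimate are computed from the dimension,
  \<open>r\<close>, \<open>R\<close> and \<open>k\<close>. The coefficients \<open>e\<close>,
  \<open>f\<close>, \<open>g\<close> are already normalised by \<open>lam\<close>, and undoing the
  division multiplies both bounds by \<open>lam\<close>.\<close>

lemma scaled_bound_exists:
  fixes r a R k :: real
  assumes n: "CARD('n::finite) \<ge> 2" and r: "(real CARD('n) - 1) / real CARD('n) < r" "r < 1" and R: "R > 0" and a: "a > 0" and k: "k \<ge> 0"
  shows "\<exists>K>0. \<forall>(D :: (real ^ 'n) set) A B b c d e f g u ux z lam.
    open D \<longrightarrow> structure_conditions D A B a b c d e f g \<longrightarrow> integrability_conditions D r b c d e f g \<longrightarrow>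
    weak_solution D A B u ux \<longrightarrow> ball z (2 * R) \<subseteq> D \<longrightarrow>
    E_norm (real CARD('n) * r) (ball z (2 * R)) u < ennreal lam \<longrightarrow> k_const D r e f g < lam \<longrightarrow>
    N_real r D (\<lambda>x. b x powr (real CARD('n) / (real CARD('n) - 1))) + N_real r D (\<lambda>x. c x ^ CARD('n)) + N_real r D d \<le> k \<longrightarrow>
    (AE x in lborel. x \<in> ball z R \<longrightarrow> \<bar>u x\<bar> \<le> K * lam) \<and>
    (\<integral>\<^sup>+x. ennreal (norm (ux x) ^ CARD('n)) \<partial>lebesgue_on (ball z R)) \<le> ennreal ((K * lam) ^ CARD('n))"
proof -
  let ?N = "CARD('n)"
  define s where "s = (real ?N - 1) / r"
  have r0: "r > 0" using r n by (auto intro: le_less_trans[rotated])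
  have "(real ?N - 1) * r < (real ?N - 1) * 1" using n r by (intro mult_strict_left_mono) auto
  then have s: "s > 0" "s > real ?N - 1" using r0 n by (auto simp: s_def less_divide_eq)
  obtain cs where cs: "cs \<ge> 0" "\<And>L. L \<ge> 1 \<Longrightarrow> exp (- L / 2) \<le> cs * L powr (- s)" using exp_minus_half_le_powr[OF s(1)] by blast
  define \<omega> where "\<omega> = unit_ball_vol (real ?N) * (2 * R) ^ ?N"
  have \<omega>: "\<omega> \<ge> 0" using R by (simp add: \<omega>_def)
  define \<Gamma> where "\<Gamma> = 2 * ((k + 6) * (cs + 2 powr s))"
  define M0 where "M0 = real (2 * ?N) ^ (2 * ?N) * (\<omega> + 1)"
  define M1 where "M1 = 2 * ((k + 6) * (exp 1 * \<omega> + 1))"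
  have nonneg: "\<Gamma> \<ge> 0" "M0 \<ge> 0" "M1 \<ge> 0" using k cs \<omega> by (auto simp: \<Gamma>_def M0_def M1_def)
  obtain K where K: "K > 0" "\<And>(z :: real ^ 'n) u ux F Gs \<sigma>. local_solution z R a s \<Gamma> M0 M1 u ux F Gs \<sigma> \<Longrightarrow>
    (AE x in lborel. x \<in> ball z R \<longrightarrow> \<bar>u x\<bar> \<le> K) \<and> (\<integral>\<^sup>+x\<in>ball z R. ennreal (norm (ux x) ^ ?N) \<partial>lborel) \<le> ennreal (K ^ ?N)"
    using local_bound_exists[OF n R a s(2) nonneg] by blast
  show ?thesis
  proof (intro exI[of _ K] conjI[OF K(1)] allI impI)
    fix D :: "(real ^ 'n) set" and A B b c d e f g u ux z lam
    assume H: "open D" "structure_conditions D A B a b c d e f g" "integrability_conditions D r b c d e f g"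
      "weak_solution D A B u ux" "ball z (2 * R) \<subseteq> D" "E_norm (real ?N * r) (ball z (2 * R)) u < ennreal lam" "k_const D r e f g < lam"
      "N_real r D (\<lambda>x. b x powr (real ?N / (real ?N - 1))) + N_real r D (\<lambda>x. c x ^ ?N) + N_real r D d \<le> k"
    have lam: "lam > 0" by (rule k_const_less(1)[OF n H(7)])
    obtain v w F Gs \<sigma> where sol: "local_solution z R a s \<Gamma> M0 M1 v w F Gs \<sigma>"
      and uv: "AE x in lborel. x \<in> ball z (2 * R) \<longrightarrow> u x = lam * v x \<and> ux x = lam *\<^sub>R w x"
      using scaled_local_solution[OF n r R H(1-5) cs(1) cs(2)[unfolded s_def] H(6-8)]
      unfolding \<Gamma>_def M0_def M1_def \<omega>_def s_def by blast
    interpret local_solution z R a s \<Gamma> M0 M1 v w F Gs \<sigma> by (fact sol)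
    have sub: "ball z R \<subseteq> ball z (2 * R)" using R by auto
    note b = K(2)[OF sol]
    have "AE x in lborel. x \<in> ball z R \<longrightarrow> \<bar>u x\<bar> \<le> K * lam"
      using conjunct1[OF b] uv
    proof eventually_elim
      case (elim x)
      show ?case using elim sub lam mult_right_mono[of "\<bar>v x\<bar>" K lam] by (auto simp: abs_mult mult.commute)
    qed
    moreover have "(\<integral>\<^sup>+x. ennreal (norm (ux x) ^ ?N) \<partial>lebesgue_on (ball z R)) \<le> ennreal ((K * lam) ^ ?N)"
    proof -
      have "(\<integral>\<^sup>+x. ennreal (norm (ux x) ^ ?N) \<partial>lebesgue_on (ball z R)) = (\<integral>\<^sup>+x\<in>ball z R. (ennreal (lam ^ ?N) * ennreal (norm (w x) ^ ?N)) \<partial>lborel)"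
      proof (rule nn_integral_lebesgue_on_borel)
        show "AE x in lborel. x \<in> ball z R \<longrightarrow> ennreal (norm (ux x) ^ ?N) = ennreal (lam ^ ?N) * ennreal (norm (w x) ^ ?N)"
          using uv by eventually_elim (use sub lam in \<open>auto simp: power_mult_distrib ennreal_mult\<close>)
      qed simp
      also have "\<dots> = ennreal (lam ^ ?N) * (\<integral>\<^sup>+x\<in>ball z R. ennreal (norm (w x) ^ ?N) \<partial>lborel)"
        by (subst nn_integral_cmult[symmetric]) (auto simp: mult.assoc)
      also have "\<dots> \<le> ennreal (lam ^ ?N) * ennreal (K ^ ?N)" by (intro mult_left_mono conjunct2[OF b]) simp
      also have "\<dots> = ennreal ((K * lam) ^ ?N)" using K(1) lam by (simp add: ennreal_mult[symmetric] power_mult_distrib mult.commute)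
      finally show ?thesis .
    qed
    ultimately show "(AE x in lborel. x \<in> ball z R \<longrightarrow> \<bar>u x\<bar> \<le> K * lam) \<and>
      (\<integral>\<^sup>+x. ennreal (norm (ux x) ^ ?N) \<partial>lebesgue_on (ball z R)) \<le> ennreal ((K * lam) ^ ?N)" ..
  qed
qed

section \<open>From bounds on the ball to the norms of the statement\<close>

lemma Linf_norm_le:
  assumes D: "D \<in> sets borel" and u: "u \<in> borel_measurable (lebesgue_on D)" and le: "AE x in lborel. x \<in> D \<longrightarrow> \<bar>u x\<bar> \<le> M"
  shows "Linf_norm D u \<le> ennreal M"
  unfolding Linf_norm_def
proof (rule esssup_I)
  show "(\<lambda>x. ennreal \<bar>u x\<bar>) \<in> borel_measurable (lebesgue_on D)" using u by measurable
  have "AE x in lebesgue. x \<in> D \<longrightarrow> \<bar>u x\<bar> \<le> M" using le by (rule AE_completion)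
  then show "AE x in lebesgue_on D. ennreal \<bar>u x\<bar> \<le> ennreal M"
    using D by (subst AE_restrict_space_iff) (auto intro: ennreal_leI elim!: eventually_mono)
qed

lemma Ln_norm_le:
  fixes f :: "real ^ 'n::finite \<Rightarrow> 'b::euclidean_space"
  assumes f: "f \<in> borel_measurable (lebesgue_on D)" and M: "M \<ge> 0"
    and le: "(\<integral>\<^sup>+x. ennreal (norm (f x) ^ CARD('n)) \<partial>lebesgue_on D) \<le> ennreal (M ^ CARD('n))"
  shows "Ln_norm D f \<le> M"
proof -
  have "(\<integral>x. norm (f x) ^ CARD('n) \<partial>lebesgue_on D) = enn2real (\<integral>\<^sup>+x. ennreal (norm (f x) ^ CARD('n)) \<partial>lebesgue_on D)"
    using f by (intro integral_eq_nn_integral) auto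
  also have "\<dots> \<le> M ^ CARD('n)" using le M by (intro enn2real_leI) auto
  finally have "Ln_norm D f \<le> (M ^ CARD('n)) powr (1 / CARD('n))"
    unfolding Ln_norm_def by (intro powr_mono2) (auto intro!: Bochner_Integration.integral_nonneg)
  also have "\<dots> = M" using M by (cases "M = 0") (auto simp: powr_realpow[symmetric] powr_powr power_0_left)
  finally show ?thesis .
qed

text \<open>Applied with \<open>lam\<close> slightly above \<open>E + k\<close>, which exceeds both
  lower bounds even if one of them is 0. For infinite \<open>E\<close> the right side is infinite
  because \<open>K > 0\<close>.\<close>

lemma le_ennreal_mult_add:
  fixes E X :: ennreal and K k :: real
  assumes K: "K > 0" and k: "k \<ge> 0" and le: "\<And>lam. E < ennreal lam \<Longrightarrow> k < lam \<Longrightarrow> X \<le> ennreal (K * lam)"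
  shows "X \<le> ennreal K * (E + ennreal k)"
proof (cases E)
  case (real t)
  have "X \<le> ennreal (K * (t + k)) + ennreal \<epsilon>" if "\<epsilon> > 0" for \<epsilon> :: real
  proof -
    have p: "\<epsilon> / K > 0" using that K by simp
    have "X \<le> ennreal (K * (t + k + \<epsilon> / K))" by (rule le) (use real p k in \<open>auto intro!: ennreal_lessI add_nonneg_pos\<close>)
    also have "K * (t + k + \<epsilon> / K) = K * (t + k) + \<epsilon>" using K by (simp add: field_simps)
    finally show ?thesis using K k real that by (simp add: ennreal_plus)
  qed
  then have "X \<le> ennreal (K * (t + k))" by (rule ennreal_le_epsilon)
  then show ?thesis using real K k by (simp add: ennreal_mult ennreal_plus)
next
  case top
  then show ?thesis using K by (simp add: ennreal_mult_top)
qed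

theorem theorem1p1:
  assumes "CARD('n::finite) \<ge> 2"
  shows "\<exists>C :: real \<Rightarrow> real \<Rightarrow> real \<Rightarrow> real \<Rightarrow> real \<Rightarrow> real \<Rightarrow> real \<Rightarrow> real \<Rightarrow> real \<Rightarrow> real.
    (\<forall>r a R. nondecreasing6 (C r a R)) \<and>
    (\<forall>r a R (D :: (real ^ 'n) set) A B b c d e f g u ux z K.
      (real CARD('n) - 1) / real CARD('n) < r \<longrightarrow> r < 1 \<longrightarrow> 0 < R \<longrightarrow> R \<le> 1 \<longrightarrow>
      bounded D \<longrightarrow> connected D \<longrightarrow> open D \<longrightarrow>
      structure_conditions D A B a b c d e f g \<longrightarrow>
      integrability_conditions D r b c d e f g \<longrightarrow>
      weak_solution D A B u ux \<longrightarrow>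
      z \<in> D \<longrightarrow> closure (ball z (2 * R)) \<subseteq> D \<longrightarrow>
      K = C r a R
            (N_real r D (\<lambda>x. b x powr (real CARD('n) / (real CARD('n) - 1))))
            (N_real r D (\<lambda>x. c x ^ CARD('n)))
            (N_real r D d)
            (N_real r D (\<lambda>x. e x powr (real CARD('n) / (real CARD('n) - 1))))
            (N_real r D f)
            (N_real r D g) \<longrightarrow>
      0 < K \<and>
      Linf_norm (ball z R) u
        \<le> ennreal K * (E_norm (real CARD('n) * r) (ball z (2 * R)) u + ennreal (k_const D r e f g)) \<and>
      ennreal (Ln_norm (ball z R) ux)
        \<le> ennreal K * (E_norm (real CARD('n) * r) (ball z (2 * R)) u + ennreal (k_const D r e f g)))"
proof -
  let ?N = "CARD('n)"
  define valid where "valid r a R \<longleftrightarrow> (real ?N - 1) / real ?N < r \<and> r < 1 \<and> R > 0 \<and> a > 0" for r a R :: real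
  define P where "P r a R k K \<longleftrightarrow> (\<forall>(D :: (real ^ 'n) set) A B b c d e f g u ux z lam.
    open D \<longrightarrow> structure_conditions D A B a b c d e f g \<longrightarrow> integrability_conditions D r b c d e f g \<longrightarrow>
    weak_solution D A B u ux \<longrightarrow> ball z (2 * R) \<subseteq> D \<longrightarrow>
    E_norm (real ?N * r) (ball z (2 * R)) u < ennreal lam \<longrightarrow> k_const D r e f g < lam \<longrightarrow>
    N_real r D (\<lambda>x. b x powr (real ?N / (real ?N - 1))) + N_real r D (\<lambda>x. c x ^ ?N) + N_real r D d \<le> k \<longrightarrow>
    (AE x in lborel. x \<in> ball z R \<longrightarrow> \<bar>u x\<bar> \<le> K * lam) \<and>
    (\<integral>\<^sup>+x. ennreal (norm (ux x) ^ ?N) \<partial>lebesgue_on (ball z R)) \<le> ennreal ((K * lam) ^ ?N))" for r a R k K :: real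
  \<comment> \<open>\<open>C r a R\<close> must be nondecreasing for all real parameters; outside
    the admissible range any positive number serves.\<close>
  have "\<exists>K>0. valid r a R \<longrightarrow> P r a R (real i) K" for r a R i
  proof (cases "valid r a R")
    case True
    then have v: "(real ?N - 1) / real ?N < r" "r < 1" "R > 0" "a > 0" by (auto simp: valid_def)
    show ?thesis using scaled_bound_exists[where 'n = 'n, OF assms v of_nat_0_le_iff[of i]] unfolding P_def by blast
  qed (auto intro: exI[of _ 1])
  then obtain \<kappa> where \<kappa>: "\<And>r a R i. \<kappa> r a R i > 0" "\<And>r a R i. valid r a R \<Longrightarrow> P r a R (real i) (\<kappa> r a R i)" by metis
  \<comment> \<open>Summing the positive constants for integer bounds up to the first integer not
    below \<open>p1 + p2 + p3\<close> dominates the one that applies and is monotone however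
    \<open>\<kappa>\<close> was chosen. The norms of \<open>e\<close>, \<open>f\<close>,
    \<open>g\<close> have been absorbed by the rescaling.\<close>
  define C where "C r a R p1 p2 p3 p4 p5 p6 = (\<Sum>i\<le>nat \<lceil>p1 + p2 + p3\<rceil>. \<kappa> r a R i)" for r a R p1 p2 p3 p4 p5 p6 :: real
  have mono: "nondecreasing6 (C r a R)" for r a R
    unfolding nondecreasing6_def C_def
  proof (intro allI impI sum_mono2)
    fix p1 p2 p3 p4 p5 p6 q1 q2 q3 q4 q5 q6 :: real
    assume "0 \<le> p1 \<and> p1 \<le> q1 \<and> 0 \<le> p2 \<and> p2 \<le> q2 \<and> 0 \<le> p3 \<and> p3 \<le> q3 \<and> 0 \<le> p4 \<and> p4 \<le> q4 \<and> 0 \<le> p5 \<and> p5 \<le> q5 \<and> 0 \<le> p6 \<and> p6 \<le> q6"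
    then have "nat \<lceil>p1 + p2 + p3\<rceil> \<le> nat \<lceil>q1 + q2 + q3\<rceil>" by (intro nat_mono ceiling_mono) linarith
    then show "{..nat \<lceil>p1 + p2 + p3\<rceil>} \<subseteq> {..nat \<lceil>q1 + q2 + q3\<rceil>}" by simp
  qed (auto intro: less_imp_le[OF \<kappa>(1)])
  show ?thesis
  proof (intro exI[of _ C] conjI[OF allI] allI mono impI)
    fix r a R :: real and D :: "(real ^ 'n) set" and A B b c d e f g u ux z K
    assume r: "(real ?N - 1) / real ?N < r" "r < 1" and R: "0 < R" "R \<le> 1" and oD: "open D"
      and sc: "structure_conditions D A B a b c d e f g" and ic: "integrability_conditions D r b c d e f g"
      and ws: "weak_solution D A B u ux" and cl: "closure (ball z (2 * R)) \<subseteq> D"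
      and K: "K = C r a R (N_real r D (\<lambda>x. b x powr (real ?N / (real ?N - 1)))) (N_real r D (\<lambda>x. c x ^ ?N)) (N_real r D d)
          (N_real r D (\<lambda>x. e x powr (real ?N / (real ?N - 1)))) (N_real r D f) (N_real r D g)"
    define p where "p = N_real r D (\<lambda>x. b x powr (real ?N / (real ?N - 1))) + N_real r D (\<lambda>x. c x ^ ?N) + N_real r D d"
    define i where "i = nat \<lceil>p\<rceil>"
    have Ki: "K = (\<Sum>j\<le>i. \<kappa> r a R j)" by (simp add: K C_def i_def p_def)
    have K0: "K > 0" unfolding Ki by (intro sum_pos \<kappa>(1)) auto
    have le: "\<kappa> r a R i \<le> K" unfolding Ki by (intro member_le_sum) (auto intro: less_imp_le[OF \<kappa>(1)])
    have sub: "ball z (2 * R) \<subseteq> D" using cl closure_subset by blast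
    have subR: "ball z R \<subseteq> D" using sub R by auto
    have v: "valid r a R" using r R sc by (auto simp: valid_def structure_conditions_def)
    have pi: "p \<le> real i" by (simp add: i_def real_nat_ceiling_ge)
    have um: "u \<in> borel_measurable (lebesgue_on (ball z R))" "ux \<in> borel_measurable (lebesgue_on (ball z R))"
      using ws subR by (auto simp: weak_solution_def W1n_def Ln_def intro!: measurable_restrict_mono[OF _ subR])
    have k0: "k_const D r e f g \<ge> 0" by (simp add: k_const_def Let_def N_real_def)
    have bd: "Linf_norm (ball z R) u \<le> ennreal (K * lam)" "Ln_norm (ball z R) ux \<le> K * lam"
      if lam: "E_norm (real ?N * r) (ball z (2 * R)) u < ennreal lam" "k_const D r e f g < lam" for lam
    proof -
      have l0: "lam > 0" using lam(2) k0 by linarith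
      have Pb: "(AE x in lborel. x \<in> ball z R \<longrightarrow> \<bar>u x\<bar> \<le> \<kappa> r a R i * lam) \<and>
          (\<integral>\<^sup>+x. ennreal (norm (ux x) ^ ?N) \<partial>lebesgue_on (ball z R)) \<le> ennreal ((\<kappa> r a R i * lam) ^ ?N)"
        using \<kappa>(2)[OF v, of i, unfolded P_def, rule_format, OF oD sc ic ws sub lam pi[unfolded p_def]] .
      have kl: "\<kappa> r a R i * lam \<le> K * lam" "\<kappa> r a R i * lam \<ge> 0" using le l0 less_imp_le[OF \<kappa>(1)[of r a R i]] by (auto intro: mult_right_mono)
      have "Linf_norm (ball z R) u \<le> ennreal (\<kappa> r a R i * lam)" by (rule Linf_norm_le[OF _ um(1) conjunct1[OF Pb]]) simp
      also have "\<dots> \<le> ennreal (K * lam)" by (rule ennreal_leI[OF kl(1)])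
      finally show "Linf_norm (ball z R) u \<le> ennreal (K * lam)" .
      show "Ln_norm (ball z R) ux \<le> K * lam" using Ln_norm_le[OF um(2) kl(2) conjunct2[OF Pb]] kl(1) by linarith
    qed
    show "0 < K \<and>
      Linf_norm (ball z R) u \<le> ennreal K * (E_norm (real ?N * r) (ball z (2 * R)) u + ennreal (k_const D r e f g)) \<and>
      ennreal (Ln_norm (ball z R) ux) \<le> ennreal K * (E_norm (real ?N * r) (ball z (2 * R)) u + ennreal (k_const D r e f g))"
      by (intro conjI K0 le_ennreal_mult_add[OF K0 k0] bd ennreal_leI) 
  qed
qed

end
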